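(* Let $(B,g_B,J_B)$ be an almost product non-degenerate semi-Riemannian manifold, let $(F_j,g_{F_j},J_{F_j})$, $1\le j\le m$, be almost product semi-regular semi-Riemannian manifolds, and let $b_j\in C^\infty(B)$. Let $\widetilde R$ be the almost product curvature of $(B\times_{b_1}F_1\times\cdots\times_{b_m}F_m,\,J)$, $J=(J_B,J_{F_1},\dots,J_{F_m})$. For all $X,Y,Z,T\in\Gamma(TB)$ and all $U_k\in\Gamma(TF_k)$, $V_i\in\Gamma(TF_i)$, $W_j\in\Gamma(TF_j)$, $Q_s\in\Gamma(TF_s)$: (1) $\widetilde R(X,Y,Z,T)=\widetilde R_B(X,Y,Z,T)$; (2) $\widetilde R(X,Y,Z,W_j)=\widetilde R(Z,W_j,X,Y)=0$; (3) $\widetilde R(X,Y,V_i,W_j)=\widetilde R(V_i,W_j,X,Y)=0$; (4) if $i=j$: $\widetilde R(X,V_i,Y,W_j)=\frac12b_jXY(b_j)g_{F_j}(V_j,W_j)-\frac12b_jg_B^*(\widetilde\nabla^\flat_XY,db_j)g_{F_j}(V_j,W_j)+\frac12b_jXJ_BY(b_j)g_{F_j}(V_j,J_{F_j}W_j)-\frac12b_jg_B^*(\widetilde\nabla^\flat_XY,db_j\circ J_B)g_{F_j}(V_j,J_{F_j}W_j)$; (5) if $i\ne j$: $\widetilde R(X,V_i,Y,W_j)=0$; (6) $\widetilde R(X,V_i,W_j,U_k)=0$; (7) if $i=j=k$: $\widetilde R(U_k,V_i,X,W_j)=\frac14b_jX(b_j)\big(-\mathcal K_{F_j}(V_j,W_j,U_j)+\mathcal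 K_{F_j}(U_j,W_j,V_j)+\mathcal K_{F_j}(V_j,J_{F_j}W_j,J_{F_j}U_j)-\mathcal K_{F_j}(U_j,J_{F_j}W_j,J_{F_j}V_j)\big)-\frac14b_jJ_BX(b_j)\big(-\mathcal K_{F_j}(V_j,W_j,J_{F_j}U_j)+\mathcal K_{F_j}(U_j,W_j,J_{F_j}V_j)+\mathcal K_{F_j}(V_j,J_{F_j}W_j,U_j)-\mathcal K_{F_j}(U_j,J_{F_j}W_j,V_j)\big)$; (8) $\widetilde R(U_k,V_i,X,W_j)=0$ in all other cases; (9) if $i=j=k=s$: $\widetilde R(U_k,V_i,W_j,Q_s)=b_j^2\widetilde R_{F_j}(U_j,V_j,W_j,Q_j)+\frac14b_j^2\big[g_B^*(db_j,db_j)\big(g_{F_j}(U_j,W_j)g_{F_j}(V_j,Q_j)-g_{F_j}(V_j,W_j)g_{F_j}(U_j,Q_j)\big)+g_B^*(db_j\circ J_B,db_j)\big(g_{F_j}(U_j,J_{F_j}W_j)g_{F_j}(V_j,Q_j)-g_{F_j}(V_j,J_{F_j}W_j)g_{F_j}(U_j,Q_j)+g_{F_j}(U_j,W_j)g_{F_j}(V_j,J_{F_j}Q_j)-g_{F_j}(V_j,W_j)g_{F_j}(U_j,J_{F_j}Q_j)\big)+g_B^*(db_j\circ J_B,db_j\circ J_B)\big(g_{F_j}(U_j,J_{F_j}W_j)g_{F_j}(V_j,J_{F_j}Q_j)-g_{F_j}(V_j,J_{F_j}W_j)g_{F_j}(U_j,J_{F_j}Q_j)\big)\big]$; (10) if $j=k\ne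 i=s$: $\widetilde R(U_k,V_i,W_j,Q_s)=\frac14b_ib_j\big(g_B^*(db_i,db_j)g_{F_i}(V_i,Q_i)g_{F_j}(U_j,W_j)+g_B^*(db_i\circ J_B,db_j)g_{F_i}(V_i,J_{F_i}Q_i)g_{F_j}(U_j,W_j)+g_B^*(db_i,db_j\circ J_B)g_{F_i}(V_i,Q_i)g_{F_j}(U_j,J_{F_j}W_j)+g_B^*(db_i\circ J_B,db_j\circ J_B)g_{F_i}(V_i,J_{F_i}Q_i)g_{F_j}(U_j,J_{F_j}W_j)\big)$; (11) $\widetilde R(U_k,V_i,W_j,Q_s)=0$ in all other cases, except the pattern $k=s\ne i=j$ (which is obtained from (10) by the antisymmetry $\widetilde R(X,Y,Z,T)=-\widetilde R(X,Y,T,Z)$).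
   Context: A singular semi-Riemannian manifold $(M,g)$ is a smooth manifold with a smooth symmetric bilinear form $g$ on $TM$, possibly degenerate and of variable signature; it is non-degenerate if $g$ is non-degenerate everywhere. Its Koszul form is $\mathcal K(X,Y,Z)=\frac12\{X(g(Y,Z))+Y(g(Z,X))-Z(g(X,Y))-g(X,[Y,Z])+g(Y,[Z,X])+g(Z,[X,Y])\}$. It is almost product if equipped with a bundle endomorphism $J:TM\to TM$ with $J^2=\mathrm{id}$ and $g(JX,JY)=g(X,Y)$. The almost product Koszul form is $\widetilde{\mathcal K}(X,Y,Z)=\frac12[\mathcal K(X,Y,Z)+\mathcal K(X,JY,JZ)]$, and $(\widetilde\nabla^\flat_XY)(Z)=\widetilde{\mathcal K}(X,Y,Z)$. Contraction: let $T_p^\bullet M=\{g_p(v,\cdot):v\in T_pM\}\subset T_p^*M$ with inner product $g_p^\bullet(g_p(v,\cdot),g_p(w,\cdot))=g_p(v,w)$. For 1-forms $\omega,\tau$ with values in $T^\bullet M$, $\omega(\bullet)\tau(\bullet)$ is the function $p\mapsto g^\bullet_p(\omega_p,\tau_p)$ on the dense open set where the rank of $g$ is locally constant; it is called smooth if it extends (uniquely) to a smooth function on $M$, and then the same symbol denotes the extension. $(M,g,J)$ is almost product radical-stationary if $\widetilde{\mathcal K}(X,Y,\cdot)$ takes values in $T^\bullet M$ for all vector fields $X,Y$, and almost product semi-regular if moreover all $\widetilde{\mathcal K}(X,Y,\bullet)\widetilde{\mathcal K}(Z,T,\bullet)$ are smooth. On an almost product semi-regular manifold the almost product curvature is $\widetilde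 R(X,Y,Z,T)=X(\widetilde{\mathcal K}(Y,Z,T))-Y(\widetilde{\mathcal K}(X,Z,T))-\widetilde{\mathcal K}([X,Y],Z,T)+\widetilde{\mathcal K}(X,Z,\bullet)\widetilde{\mathcal K}(Y,T,\bullet)-\widetilde{\mathcal K}(Y,Z,\bullet)\widetilde{\mathcal K}(X,T,\bullet)$. The multiply warped product $B\times_{b_1}F_1\times\cdots\times_{b_m}F_m$ is $B\times F_1\times\cdots\times F_m$ with $g=\pi_B^*(g_B)+\sum_j(b_j\circ\pi_B)^2\pi_{F_j}^*(g_{F_j})$, where the $\pi$'s are the canonical projections; the $b_j$ may vanish. $J$ acts as $J_B$ on $TB$ and as $J_{F_j}$ on $TF_j$. Under the hypotheses of the claim the product is almost product semi-regular. Vector fields in $\Gamma(TB)$, $\Gamma(TF_j)$ are identified with their lifts to the product, and functions and tensors on the factors with their pullbacks. Subscripts $B$, $F_j$ denote objects of that factor. When indices coincide, e.g. $i=j$, $V_i$ is also written $V_j$. $g_B^*$ is the inverse metric of $g_B$ on 1-forms of $B$; in $g_B^*(\widetilde\nabla^\flat_XY,\cdot)$, $\widetilde\nabla^\flat_XY=\widetilde{\mathcal K}_B(X,Y,\cdot)$. $XY(f)=X(Y(f))$, $J_BX(f)=(J_BX)(f)$, $XJ_BY(f)=X((J_BY)(f))$, $(db\circ J_B)(X)=(J_BX)(b)$. *)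

theory Defs
  imports "HOL-Analysis.Analysis" "HOL-Library.Function_Algebras"
begin

section \<open>Smooth manifolds\<close>

text \<open>
  Charts take values in \<open>\<real>\<^sup>I\<close>, the functions \<open>'i \<Rightarrow> real\<close> that are extensional on a finite index
  set \<open>I\<close>. Using \<open>I\<close> instead of \<open>{1..n}\<close> lets a product of manifolds be modelled on the
  disjoint union of the index sets.
\<close>

primrec Ck_on :: "nat \<Rightarrow> 'i set \<Rightarrow> ('i \<Rightarrow> real) set \<Rightarrow> (('i \<Rightarrow> real) \<Rightarrow> real) \<Rightarrow> bool" where
  "Ck_on 0 I U f \<longleftrightarrow>
     continuous_map (subtopology (powertop_real I) U) euclideanreal f"
| "Ck_on (Suc k) I U f \<longleftrightarrow>
     continuous_map (subtopology (powertop_real I) U) euclideanreal f \<and>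
     (\<exists>f'. \<forall>i\<in>I. (\<forall>x\<in>U. ((\<lambda>t. f (x(i := t))) has_real_derivative f' i x) (at (x i))) \<and>
                 Ck_on k I U (f' i))"

definition smooth_on :: "'i set \<Rightarrow> ('i \<Rightarrow> real) set \<Rightarrow> (('i \<Rightarrow> real) \<Rightarrow> real) \<Rightarrow> bool" where
  "smooth_on I U f \<longleftrightarrow> (\<forall>k. Ck_on k I U f)"

record ('a, 'i) manifold =
  mtop :: "'a topology"
  coords :: "'i set"
  atlas :: "('a set \<times> ('a \<Rightarrow> 'i \<Rightarrow> real)) set"

abbreviation points :: "('a, 'i, 'z) manifold_scheme \<Rightarrow> 'a set" where
  "points M \<equiv> topspace (mtop M)"

text \<open>The atlas is not required to be maximal.\<close>

definition smooth_manifold :: "('a, 'i, 'z) manifold_scheme \<Rightarrow> bool" where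
  "smooth_manifold M \<longleftrightarrow>
     Hausdorff_space (mtop M) \<and> second_countable (mtop M) \<and> finite (coords M) \<and>
     (\<Union>(U, \<phi>)\<in>atlas M. U) = points M \<and>
     (\<forall>(U, \<phi>)\<in>atlas M.
        openin (mtop M) U \<and> openin (powertop_real (coords M)) (\<phi> ` U) \<and>
        homeomorphic_map (subtopology (mtop M) U)
          (subtopology (powertop_real (coords M)) (\<phi> ` U)) \<phi>) \<and>
     (\<forall>(U, \<phi>)\<in>atlas M. \<forall>(V, \<psi>)\<in>atlas M. \<forall>i\<in>coords M.
        smooth_on (coords M) (\<phi> ` (U \<inter> V)) (\<lambda>x. \<psi> (inv_into U \<phi> x) i))"

text \<open>
  Only the values on \<open>points M\<close> matter for membership in \<open>C_inf M\<close>; a member is unconstrained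
  elsewhere. A derivation of the algebra \<open>C_inf M\<close> does not depend on the values
  outside \<open>points M\<close> either: a function vanishing on \<open>points M\<close> is the product of itself with the
  indicator of the complement, so the Leibniz rule at a point of \<open>M\<close> sends it to \<open>0\<close>.
\<close>

definition C_inf :: "('a, 'i, 'z) manifold_scheme \<Rightarrow> ('a \<Rightarrow> real) set" where
  "C_inf M = {f. \<forall>(U, \<phi>)\<in>atlas M. smooth_on (coords M) (\<phi> ` U) (\<lambda>x. f (inv_into U \<phi> x))}"


section \<open>Tangent vectors and vector fields\<close>

text \<open>
  Tangent vectors at \<open>p\<close> are the derivations at \<open>p\<close> of \<open>C_inf M\<close>, extended by \<open>0\<close> to functions
  outside \<open>C_inf M\<close> so that they are determined by their action on smooth functions.
\<close>

type_synonym 'a tangent = "('a \<Rightarrow> real) \<Rightarrow> real"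
type_synonym 'a covector = "'a tangent \<Rightarrow> real"
type_synonym 'a vfield = "'a \<Rightarrow> 'a tangent"

definition tangent_space :: "('a, 'i, 'z) manifold_scheme \<Rightarrow> 'a \<Rightarrow> 'a tangent set" where
  "tangent_space M p = {v.
     (\<forall>f\<in>C_inf M. \<forall>h\<in>C_inf M. \<forall>a c. v (\<lambda>x. a * f x + c * h x) = a * v f + c * v h) \<and>
     (\<forall>f\<in>C_inf M. \<forall>h\<in>C_inf M. v (\<lambda>x. f x * h x) = f p * v h + h p * v f) \<and>
     (\<forall>f. f \<notin> C_inf M \<longrightarrow> v f = 0)}"

definition vfield_app :: "'a vfield \<Rightarrow> ('a \<Rightarrow> real) \<Rightarrow> 'a \<Rightarrow> real"  (infixr "\<rhd>" 80) where
  "X \<rhd> f = (\<lambda>p. X p f)"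

definition vfields :: "('a, 'i, 'z) manifold_scheme \<Rightarrow> 'a vfield set"  ("\<Gamma>") where
  "\<Gamma> M = {X. (\<forall>p\<in>points M. X p \<in> tangent_space M p) \<and> (\<forall>f\<in>C_inf M. X \<rhd> f \<in> C_inf M)}"

definition bracket :: "'a vfield \<Rightarrow> 'a vfield \<Rightarrow> 'a vfield" where
  "bracket X Y = (\<lambda>p f. X p (Y \<rhd> f) - Y p (X \<rhd> f))"

definition pushforward ::
  "('b, 'j, 'z) manifold_scheme \<Rightarrow> ('a \<Rightarrow> 'b) \<Rightarrow> 'a tangent \<Rightarrow> 'b tangent" where
  "pushforward N h v = (\<lambda>f. if f \<in> C_inf N then v (f \<circ> h) else 0)"


section \<open>Singular semi-Riemannian and almost product structures\<close>

record ('a, 'i) almost_product = "('a, 'i) manifold" +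
  metric :: "'a \<Rightarrow> 'a tangent \<Rightarrow> 'a tangent \<Rightarrow> real"
  endo :: "'a \<Rightarrow> 'a tangent \<Rightarrow> 'a tangent"

definition inner_vf ::
  "('a, 'i) almost_product \<Rightarrow> 'a vfield \<Rightarrow> 'a vfield \<Rightarrow> 'a \<Rightarrow> real" where
  "inner_vf M X Y = (\<lambda>p. metric M p (X p) (Y p))"

definition endo_vf :: "('a, 'i) almost_product \<Rightarrow> 'a vfield \<Rightarrow> 'a vfield" where
  "endo_vf M X = (\<lambda>p. endo M p (X p))"

definition singular_semi_riemannian :: "('a, 'i) almost_product \<Rightarrow> bool" where
  "singular_semi_riemannian M \<longleftrightarrow>
     smooth_manifold M \<and>
     (\<forall>p\<in>points M. \<forall>u\<in>tangent_space M p. \<forall>v\<in>tangent_space M p.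
        metric M p u v = metric M p v u) \<and>
     (\<forall>p\<in>points M. \<forall>u\<in>tangent_space M p. \<forall>v\<in>tangent_space M p. \<forall>w\<in>tangent_space M p. \<forall>a c.
        metric M p (\<lambda>f. a * u f + c * v f) w = a * metric M p u w + c * metric M p v w) \<and>
     (\<forall>X\<in>\<Gamma> M. \<forall>Y\<in>\<Gamma> M. inner_vf M X Y \<in> C_inf M)"

definition nondegenerate :: "('a, 'i) almost_product \<Rightarrow> bool" where
  "nondegenerate M \<longleftrightarrow>
     (\<forall>p\<in>points M. \<forall>v\<in>tangent_space M p.
        (\<forall>w\<in>tangent_space M p. metric M p v w = 0) \<longrightarrow> v = (\<lambda>f. 0))"

definition almost_product_manifold :: "('a, 'i) almost_product \<Rightarrow> bool" where
  "almost_product_manifold M \<longleftrightarrow>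
     singular_semi_riemannian M \<and>
     (\<forall>p\<in>points M. \<forall>v\<in>tangent_space M p.
        endo M p v \<in> tangent_space M p \<and> endo M p (endo M p v) = v) \<and>
     (\<forall>p\<in>points M. \<forall>u\<in>tangent_space M p. \<forall>v\<in>tangent_space M p. \<forall>a c.
        endo M p (\<lambda>f. a * u f + c * v f) = (\<lambda>f. a * endo M p u f + c * endo M p v f)) \<and>
     (\<forall>p\<in>points M. \<forall>u\<in>tangent_space M p. \<forall>v\<in>tangent_space M p.
        metric M p (endo M p u) (endo M p v) = metric M p u v) \<and>
     (\<forall>X\<in>\<Gamma> M. endo_vf M X \<in> \<Gamma> M)"

definition koszul ::
  "('a, 'i) almost_product \<Rightarrow> 'a vfield \<Rightarrow> 'a vfield \<Rightarrow> 'a vfield \<Rightarrow> 'a \<Rightarrow> real" where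
  "koszul M X Y Z = (\<lambda>p. 1/2 *
     ((X \<rhd> inner_vf M Y Z) p + (Y \<rhd> inner_vf M Z X) p - (Z \<rhd> inner_vf M X Y) p
      - inner_vf M X (bracket Y Z) p + inner_vf M Y (bracket Z X) p
      + inner_vf M Z (bracket X Y) p))"

definition ap_koszul ::
  "('a, 'i) almost_product \<Rightarrow> 'a vfield \<Rightarrow> 'a vfield \<Rightarrow> 'a vfield \<Rightarrow> 'a \<Rightarrow> real" where
  "ap_koszul M X Y Z =
     (\<lambda>p. 1/2 * (koszul M X Y Z p + koszul M X (endo_vf M Y) (endo_vf M Z) p))"


section \<open>1-forms and the contraction\<close>

text \<open>
  A covector at \<open>p\<close> is a function on \<open>tangent_space M p\<close>, extended by \<open>0\<close>; a 1-form assigns a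
  covector to each point. The 1-form \<open>nabla_flat M X Y\<close> is \<open>ap_koszul M X Y\<close> read as
  a 1-form: its value on a tangent vector \<open>v\<close> at \<open>p\<close> is the common value at \<open>p\<close> of
  \<open>ap_koszul M X Y Z\<close> for all vector fields \<open>Z\<close> extending \<open>v\<close>, the expression being tensorial
  in \<open>Z\<close>.
\<close>

definition nabla_flat ::
  "('a, 'i) almost_product \<Rightarrow> 'a vfield \<Rightarrow> 'a vfield \<Rightarrow> 'a \<Rightarrow> 'a covector" where
  "nabla_flat M X Y = (\<lambda>p v.
     if v \<in> tangent_space M p
     then (THE r. \<exists>Z\<in>\<Gamma> M. Z p = v \<and> r = ap_koszul M X Y Z p) else 0)"

definition differential ::
  "('a, 'i) almost_product \<Rightarrow> ('a \<Rightarrow> real) \<Rightarrow> 'a \<Rightarrow> 'a covector" where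
  "differential M f = (\<lambda>p v. if v \<in> tangent_space M p then v f else 0)"

definition form_endo ::
  "('a, 'i) almost_product \<Rightarrow> ('a \<Rightarrow> 'a covector) \<Rightarrow> 'a \<Rightarrow> 'a covector" where
  "form_endo M \<omega> = (\<lambda>p v. if v \<in> tangent_space M p then \<omega> p (endo M p v) else 0)"

definition flat :: "('a, 'i) almost_product \<Rightarrow> 'a \<Rightarrow> 'a tangent \<Rightarrow> 'a covector" where
  "flat M p v = (\<lambda>w. if w \<in> tangent_space M p then metric M p v w else 0)"

definition radical_annihilator :: "('a, 'i) almost_product \<Rightarrow> 'a \<Rightarrow> 'a covector set" where
  "radical_annihilator M p = flat M p ` tangent_space M p"

definition bullet_inner ::
  "('a, 'i) almost_product \<Rightarrow> 'a \<Rightarrow> 'a covector \<Rightarrow> 'a covector \<Rightarrow> real" where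
  "bullet_inner M p \<omega> \<tau> =
     (THE r. \<exists>v\<in>tangent_space M p. \<exists>w\<in>tangent_space M p.
        \<omega> = flat M p v \<and> \<tau> = flat M p w \<and> r = metric M p v w)"

text \<open>The rank of \<open>g\<^sub>p\<close> is the dimension of the image of \<open>v \<mapsto> g\<^sub>p(v, \<cdot>)\<close>.\<close>

definition metric_rank :: "('a, 'i) almost_product \<Rightarrow> 'a \<Rightarrow> nat" where
  "metric_rank M p =
     vector_space.dim (\<lambda>(c::real) (\<omega>::'a covector). (\<lambda>v. c * \<omega> v)) (radical_annihilator M p)"

definition regular_points :: "('a, 'i) almost_product \<Rightarrow> 'a set" where
  "regular_points M =
     {p \<in> points M. \<exists>U. openin (mtop M) U \<and> p \<in> U \<and> (\<forall>q\<in>U. metric_rank M q = metric_rank M p)}"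

definition is_contraction ::
  "('a, 'i) almost_product \<Rightarrow> ('a \<Rightarrow> 'a covector) \<Rightarrow> ('a \<Rightarrow> 'a covector) \<Rightarrow> ('a \<Rightarrow> real) \<Rightarrow> bool" where
  "is_contraction M \<omega> \<tau> h \<longleftrightarrow>
     h \<in> C_inf M \<and> (\<forall>p\<in>regular_points M. h p = bullet_inner M p (\<omega> p) (\<tau> p))"

text \<open>
  On \<open>points M\<close> the smooth extension is unique because the regular points are dense, so the choice
  below only concerns the irrelevant values outside \<open>points M\<close>.
\<close>

definition contraction ::
  "('a, 'i) almost_product \<Rightarrow> ('a \<Rightarrow> 'a covector) \<Rightarrow> ('a \<Rightarrow> 'a covector) \<Rightarrow> 'a \<Rightarrow> real" where
  "contraction M \<omega> \<tau> = (SOME h. is_contraction M \<omega> \<tau> h)"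

definition ap_radical_stationary :: "('a, 'i) almost_product \<Rightarrow> bool" where
  "ap_radical_stationary M \<longleftrightarrow>
     almost_product_manifold M \<and>
     (\<forall>X\<in>\<Gamma> M. \<forall>Y\<in>\<Gamma> M. \<forall>p\<in>points M. nabla_flat M X Y p \<in> radical_annihilator M p)"

definition ap_semi_regular :: "('a, 'i) almost_product \<Rightarrow> bool" where
  "ap_semi_regular M \<longleftrightarrow>
     ap_radical_stationary M \<and>
     (\<forall>X\<in>\<Gamma> M. \<forall>Y\<in>\<Gamma> M. \<forall>Z\<in>\<Gamma> M. \<forall>T\<in>\<Gamma> M.
        \<exists>h. is_contraction M (nabla_flat M X Y) (nabla_flat M Z T) h)"

definition ap_curvature ::
  "('a, 'i) almost_product \<Rightarrow> 'a vfield \<Rightarrow> 'a vfield \<Rightarrow> 'a vfield \<Rightarrow> 'a vfield \<Rightarrow> 'a \<Rightarrow> real" where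
  "ap_curvature M X Y Z T = (\<lambda>p.
     (X \<rhd> ap_koszul M Y Z T) p - (Y \<rhd> ap_koszul M X Z T) p - ap_koszul M (bracket X Y) Z T p
     + contraction M (nabla_flat M X Z) (nabla_flat M Y T) p
     - contraction M (nabla_flat M Y Z) (nabla_flat M X T) p)"

text \<open>\<open>cometric M\<close> is the inverse metric on 1-forms; it is meaningful for non-degenerate \<open>M\<close>.\<close>

definition sharp :: "('a, 'i) almost_product \<Rightarrow> 'a \<Rightarrow> 'a covector \<Rightarrow> 'a tangent" where
  "sharp M p \<omega> = (THE v. v \<in> tangent_space M p \<and> flat M p v = \<omega>)"

definition cometric ::
  "('a, 'i) almost_product \<Rightarrow> ('a \<Rightarrow> 'a covector) \<Rightarrow> ('a \<Rightarrow> 'a covector) \<Rightarrow> 'a \<Rightarrow> real" where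
  "cometric M \<omega> \<tau> = (\<lambda>p. metric M p (sharp M p (\<omega> p)) (sharp M p (\<tau> p)))"


section \<open>Multiply warped products\<close>

text \<open>
  Points are pairs \<open>(p, q)\<close> with \<open>p\<close> in \<open>B\<close> and \<open>q\<close> an extensional family with \<open>q j\<close> in \<open>F j\<close> for
  \<open>1 \<le> j \<le> m\<close>. Although all \<open>F j\<close> have their points and coordinate indices in the same two types,
  they may have different carriers, topologies and dimensions.
\<close>

definition product_manifold ::
  "nat \<Rightarrow> ('b, 'i, 'y) manifold_scheme \<Rightarrow> (nat \<Rightarrow> ('f, 'j, 'z) manifold_scheme)
    \<Rightarrow> ('b \<times> (nat \<Rightarrow> 'f), 'i + nat \<times> 'j) manifold" where
  "product_manifold m B F =
     \<lparr> mtop = prod_topology (mtop B) (product_topology (\<lambda>j. mtop (F j)) {1..m}),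
       coords = coords B <+> (SIGMA j:{1..m}. coords (F j)),
       atlas = {(U \<times> (\<Pi>\<^sub>E j\<in>{1..m}. V j),
                 \<lambda>(p, q). restrict (case_sum (\<phi> p) (\<lambda>(j, k). \<psi> j (q j) k))
                           (coords B <+> (SIGMA j:{1..m}. coords (F j)))) | U \<phi> V \<psi>.
                (U, \<phi>) \<in> atlas B \<and> (\<forall>j\<in>{1..m}. (V j, \<psi> j) \<in> atlas (F j))} \<rparr>"

text \<open>
  The endomorphism of the product sends \<open>v\<close> to the sum of \<open>J\<^sub>B (d\<pi>\<^sub>B v)\<close> and the
  \<open>J\<^sub>F\<^sub>j (d\<pi>\<^sub>F\<^sub>j v)\<close>, embedded into the tangent space of the product at \<open>(p, q)\<close> along the slices
  through \<open>(p, q)\<close>.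
\<close>

definition multiply_warped_product ::
  "nat \<Rightarrow> ('b, 'i) almost_product \<Rightarrow> (nat \<Rightarrow> 'b \<Rightarrow> real) \<Rightarrow> (nat \<Rightarrow> ('f, 'j) almost_product)
    \<Rightarrow> ('b \<times> (nat \<Rightarrow> 'f), 'i + nat \<times> 'j) almost_product" where
  "multiply_warped_product m B b F =
     manifold.extend (product_manifold m B F)
       \<lparr> metric = (\<lambda>(p, q) v w.
           metric B p (pushforward B fst v) (pushforward B fst w) +
           (\<Sum>j\<in>{1..m}. (b j p)\<^sup>2 *
              metric (F j) (q j) (pushforward (F j) (\<lambda>(p', q'). q' j) v)
                                 (pushforward (F j) (\<lambda>(p', q'). q' j) w))),
         endo = (\<lambda>(p, q) v f.
           pushforward (product_manifold m B F) (\<lambda>p'. (p', q))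
             (endo B p (pushforward B fst v)) f +
           (\<Sum>j\<in>{1..m}. pushforward (product_manifold m B F) (\<lambda>y. (p, q(j := y)))
             (endo (F j) (q j) (pushforward (F j) (\<lambda>(p', q'). q' j) v)) f)) \<rparr>"

text \<open>Lifts of vector fields on the factors to the product manifold \<open>M\<close>.\<close>

definition lift_base ::
  "('b \<times> (nat \<Rightarrow> 'f), 'k) almost_product \<Rightarrow> 'b vfield \<Rightarrow> ('b \<times> (nat \<Rightarrow> 'f)) vfield" where
  "lift_base M X = (\<lambda>(p, q). pushforward M (\<lambda>p'. (p', q)) (X p))"

definition lift_fibre ::
  "('b \<times> (nat \<Rightarrow> 'f), 'k) almost_product \<Rightarrow> nat \<Rightarrow> 'f vfield \<Rightarrow> ('b \<times> (nat \<Rightarrow> 'f)) vfield" where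
  "lift_fibre M j V = (\<lambda>(p, q). pushforward M (\<lambda>y. (p, q(j := y))) (V (q j)))"

end

theory Submission
  imports Defs "HOL-Computational_Algebra.Polynomial"
begin

text \<open>
  A 1-form is tested on lifts of vector fields, because these span every tangent space of the
  product. The Koszul form of lifts is a short table, and it exhibits each \<open>nabla_flat M A C\<close>, for
  lifts \<open>A\<close> and \<open>C\<close>, as the flat of an explicit vector: the sharp of a 1-form of \<open>B\<close> plus a vertical
  vector in one fibre direction, namely \<open>(X b\<^sub>j / b\<^sub>j) V\<close> for \<open>(X, V)\<close> and
  \<open>(X b\<^sub>j V + J X b\<^sub>j J V) / (2 b\<^sub>j)\<close> for \<open>(V, X)\<close>. Contractions are then inner products of these
  vectors, and the curvature formulas follow from compatibility and torsion-freeness of the Koszul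
  form.

  The vanishing of \<open>b\<^sub>j\<close> is harmless at regular points. Where \<open>b\<^sub>j \<noteq> 0\<close>, a regular point of the
  product projects to a regular point of \<open>F\<^sub>j\<close>. Where \<open>b\<^sub>j = 0\<close> but \<open>db\<^sub>j \<noteq> 0\<close>, there are nearby
  points with \<open>b\<^sub>j \<noteq> 0\<close>, where the fibre contributes to the rank; local constancy of the rank
  forces the fibre metric to vanish, so \<open>X b\<^sub>j g\<^sub>F\<^sub>j = 0\<close> in either case.
\<close>

section \<open>Calculus on coordinate spaces\<close>

text \<open>The formulas must hold also at zeros of \<open>b j\<close>. There a vector with
  denominator \<open>b j\<close> does not exist, and products of representing vectors are
  \<open>0\<close> although the claimed contraction, such as \<open>X b * Y b * g(V, W)\<close>,
  need not be. But a contraction is only a smooth function with prescribed values at regular points.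
  So each one is guessed as a smooth expression and checked at those points, and their density fixes
  it everywhere. Density comes from the rank: it is bounded and lower semicontinuous, hence locally
  constant where it is maximal on an open set. The rank is counted by pairs of families dual under
  the metric, as such pairs extend to neighbourhoods and can be joined over the factors of a
  product. Tangent vectors are derivations of global functions, so local arguments need cut-offs.
  Bump functions and a first-order expansion with smooth coefficients are built from iterated
  partial derivatives alone, on the coordinate spaces of the charts. They yield frames, tensoriality
  of the Koszul form in its last argument, and the fact that pulled-back functions determine a
  tangent vector of the product.\<close>

lemma continuous_on_coord: "continuous_on S (\<lambda>x. x i :: real)"
  by (rule continuous_on_subset[OF continuous_on_product_coordinates subset_UNIV])

text \<open>Off \<open>I\<close> an extensional function is constantly \<open>undefined\<close>, so
  those coordinates are trivially continuous and the identity is a homeomorphism. Rewriting with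
  this equation makes \<open>continuous_on\<close>, \<open>at _ within _\<close> and relative
  openness available for chart images.\<close>

lemma powertop_real_eq: "powertop_real I = top_of_set (extensional I :: ('i \<Rightarrow> real) set)"
proof -
  have 1: "continuous_map (top_of_set (extensional I)) (powertop_real I) (id::('i \<Rightarrow> real) \<Rightarrow> _)"
    unfolding continuous_map_componentwise id_apply continuous_map_iff_continuous
    by (intro conjI ballI continuous_on_coord) simp
  have 2: "continuous_map (powertop_real I) (top_of_set (extensional I)) (id::('i \<Rightarrow> real) \<Rightarrow> _)"
    unfolding continuous_map_in_subtopology euclidean_product_topology[symmetric]
  proof
    show "continuous_map (powertop_real I) (powertop_real UNIV) (id::('i \<Rightarrow> real) \<Rightarrow> _)"
      unfolding continuous_map_componentwise
    proof (intro conjI ballI)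
      fix k :: 'i
      show "continuous_map (powertop_real I) euclideanreal (\<lambda>x. id x k)"
      proof (cases "k \<in> I")
        case True
        then show ?thesis unfolding id_apply by (rule continuous_map_product_projection)
      next
        case False
        show ?thesis
          by (rule continuous_map_eq[where f="\<lambda>x. undefined"])
             (use False in \<open>simp_all add: PiE_def extensional_def\<close>)
      qed
    qed simp
  qed (simp add: PiE_def)
  from 1 2 have "homeomorphic_map (top_of_set (extensional I)) (powertop_real I) (id::('i \<Rightarrow> real) \<Rightarrow> _)"
    by (intro homeomorphic_maps_imp_map[where g=id]) (auto simp: homeomorphic_maps_def)
  then show ?thesis by simp
qed

section \<open>Open sets and boxes in coordinate space\<close>

abbreviation open_ext :: "'i set \<Rightarrow> ('i \<Rightarrow> real) set \<Rightarrow> bool" where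
  "open_ext I U \<equiv> openin (top_of_set (extensional I)) U"

lemma open_ext_subset: "open_ext I U \<Longrightarrow> U \<subseteq> extensional I"
  by (simp add: openin_imp_subset)

lemma continuous_map_ext:
  "U \<subseteq> extensional I \<Longrightarrow>
    continuous_map (subtopology (powertop_real I) U) euclideanreal f \<longleftrightarrow> continuous_on U f"
  by (simp add: powertop_real_eq subtopology_subtopology inf_absorb2)

definition ext_box :: "'i set \<Rightarrow> ('i \<Rightarrow> real) \<Rightarrow> real \<Rightarrow> ('i \<Rightarrow> real) set" where
  "ext_box I a \<epsilon> = {x \<in> extensional I. \<forall>i\<in>I. \<bar>x i - a i\<bar> < \<epsilon>}"

lemma open_ext_box:
  fixes I :: "'i set" shows "finite I \<Longrightarrow> open_ext I (ext_box I a \<epsilon>)"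
proof -
  assume I: "finite I"
  have "open {x::'i \<Rightarrow> real. \<forall>i\<in>I. \<bar>x i - a i\<bar> < \<epsilon>}"
  proof -
    have "{x::'i \<Rightarrow> real. \<forall>i\<in>I. \<bar>x i - a i\<bar> < \<epsilon>} = (\<Inter>i\<in>I. {x. \<bar>x i - a i\<bar> < \<epsilon>})" by auto
    also have "open \<dots>"
      using I by (intro open_INT ballI open_Collect_less continuous_intros) auto
    finally show ?thesis .
  qed
  moreover have "ext_box I a \<epsilon> = extensional I \<inter> {x. \<forall>i\<in>I. \<bar>x i - a i\<bar> < \<epsilon>}"
    by (auto simp: ext_box_def)
  ultimately show ?thesis by (simp add: openin_open_Int)
qed

text \<open>A basic open set of the product restricts only finitely many coordinates, so one radius
  serves for all of them. Boxes are the neighbourhoods that contain the segments from their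
  centre.\<close>

lemma ext_box_within:
  assumes "open_ext I U" "a \<in> U"
  obtains \<epsilon> where "\<epsilon> > 0" "ext_box I a \<epsilon> \<subseteq> U"
proof -
  have "openin (powertop_real I) U" using assms by (simp add: powertop_real_eq)
  then obtain W where W: "finite {i \<in> I. W i \<noteq> UNIV}" "\<And>i. i \<in> I \<Longrightarrow> open (W i)"
      "a \<in> Pi\<^sub>E I W" "Pi\<^sub>E I W \<subseteq> U"
    using assms(2) unfolding openin_product_topology_alt by fastforce
  have "\<exists>e>0. \<forall>t. \<bar>t - a i\<bar> < e \<longrightarrow> t \<in> W i" if "i \<in> I" for i
    using W(2)[OF that] W(3) that by (auto simp: open_dist dist_real_def PiE_def Pi_def)
  then obtain e where e: "\<And>i. i \<in> I \<Longrightarrow> e i > 0 \<and> (\<forall>t. \<bar>t - a i\<bar> < e i \<longrightarrow> t \<in> W i)"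
    by metis
  \<comment> \<open>The entry \<open>1\<close> keeps the minimum defined and positive when no
    coordinate is restricted.\<close>
  let ?d = "Min (insert 1 (e ` {i \<in> I. W i \<noteq> UNIV}))"
  have "?d > 0" using W(1) e by (subst Min_gr_iff) auto
  moreover have "ext_box I a ?d \<subseteq> U"
  proof (rule subset_trans[OF _ W(4)], rule subsetI)
    fix x assume x: "x \<in> ext_box I a ?d"
    show "x \<in> Pi\<^sub>E I W"
    proof (rule PiE_I)
      fix i assume i: "i \<in> I"
      show "x i \<in> W i"
      proof (cases "W i = UNIV")
        case False
        then have "?d \<le> e i" using i W(1) by (intro Min_le) auto
        then show ?thesis using e[OF i] x i by (force simp: ext_box_def)
      qed auto
    qed (use x in \<open>auto simp: ext_box_def extensional_def\<close>)
  qed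
  ultimately show thesis using that by blast
qed

lemma ext_box_self: "a \<in> extensional I \<Longrightarrow> \<epsilon> > 0 \<Longrightarrow> a \<in> ext_box I a \<epsilon>"
  by (simp add: ext_box_def)

lemma extensional_upd [simp]: "i \<in> I \<Longrightarrow> x(i := t) \<in> extensional I \<longleftrightarrow> x \<in> extensional I"
  by (auto simp: extensional_def)

text \<open>A one-variable derivative at \<open>x\<close> sees only the points
  \<open>x(i := t)\<close> with \<open>t\<close> near \<open>x i\<close>, and these lie in
  \<open>U\<close>. Hence \<open>Ck_on\<close> on an open set depends on the values in that set
  only.\<close>

lemma eventually_upd_in:
  assumes "open_ext I U" "x \<in> U" "i \<in> I"
  shows "eventually (\<lambda>t. x(i := t) \<in> U) (nhds (x i))"
proof -
  obtain \<epsilon> where e: "\<epsilon> > 0" "ext_box I x \<epsilon> \<subseteq> U" using ext_box_within[OF assms(1,2)] .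
  have "x \<in> extensional I" using assms open_ext_subset by blast
  then have "x(i := t) \<in> U" if "dist t (x i) < \<epsilon>" for t
    using that assms(3) e by (intro subsetD[OF e(2)]) (auto simp: ext_box_def dist_real_def)
  then show ?thesis using e(1) by (auto simp: eventually_nhds_metric)
qed

section \<open>Functions of class C^k and their partial derivatives\<close>

definition pd :: "'i \<Rightarrow> (('i \<Rightarrow> real) \<Rightarrow> real) \<Rightarrow> ('i \<Rightarrow> real) \<Rightarrow> real" where
  "pd i f x = deriv (\<lambda>t. f (x(i := t))) (x i)"

lemma pd_eqI: "((\<lambda>t. f (x(i := t))) has_real_derivative d) (at (x i)) \<Longrightarrow> pd i f x = d"
  unfolding pd_def by (rule DERIV_imp_deriv)

lemma has_pd_cong:
  assumes "open_ext I U" "x \<in> U" "i \<in> I" "\<And>y. y \<in> U \<Longrightarrow> f y = h y"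
  shows "((\<lambda>t. f (x(i := t))) has_real_derivative d) (at (x i)) \<longleftrightarrow>
    ((\<lambda>t. h (x(i := t))) has_real_derivative d) (at (x i))"
  by (rule DERIV_cong_ev[OF refl _ refl])
     (rule eventually_mono[OF eventually_upd_in[OF assms(1-3)]], simp add: assms(4))

lemma Ck_on_cong:
  assumes "open_ext I U" "\<And>y. y \<in> U \<Longrightarrow> f y = h y"
  shows "Ck_on k I U f \<longleftrightarrow> Ck_on k I U h"
proof -
  have 1: "continuous_map (subtopology (powertop_real I) U) euclideanreal f \<longleftrightarrow>
    continuous_map (subtopology (powertop_real I) U) euclideanreal h"
    by (intro iffI) (erule continuous_map_eq; use assms(2) in auto)+
  show ?thesis
  proof (cases k)
    case (Suc k')
    have "(\<forall>x\<in>U. ((\<lambda>t. f (x(i := t))) has_real_derivative f' i x) (at (x i))) \<longleftrightarrow>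
      (\<forall>x\<in>U. ((\<lambda>t. h (x(i := t))) has_real_derivative f' i x) (at (x i)))" if "i \<in> I" for i f'
      by (intro ball_cong refl has_pd_cong[OF assms(1) _ that assms(2)])
    then show ?thesis unfolding Suc Ck_on.simps 1 by (simp cong: ball_cong)
  qed (use 1 in simp)
qed

lemma Ck_on_0: "open_ext I U \<Longrightarrow> Ck_on 0 I U f \<longleftrightarrow> continuous_on U f"
  by (simp add: continuous_map_ext open_ext_subset)

text \<open>The derivative witness hidden in \<open>Ck_on\<close> agrees with \<open>pd i f\<close>
  on \<open>U\<close>, and \<open>Ck_on\<close> only sees values on \<open>U\<close>. This replaces
  the existential quantifier by a canonical function.\<close>

lemma Ck_on_Suc:
  assumes "open_ext I U"
  shows "Ck_on (Suc k) I U f \<longleftrightarrow> continuous_on U f \<and>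
    (\<forall>i\<in>I. (\<forall>x\<in>U. ((\<lambda>t. f (x(i := t))) has_real_derivative pd i f x) (at (x i))) \<and> Ck_on k I U (pd i f))"
proof
  assume L: "Ck_on (Suc k) I U f"
  then obtain f' where c: "continuous_on U f" and
    f': "\<forall>i\<in>I. (\<forall>x\<in>U. ((\<lambda>t. f (x(i := t))) has_real_derivative f' i x) (at (x i))) \<and> Ck_on k I U (f' i)"
    by (auto simp: continuous_map_ext open_ext_subset[OF assms])
  have eq: "pd i f x = f' i x" if "i \<in> I" "x \<in> U" for i x using f' that by (blast intro: pd_eqI)
  then have "Ck_on k I U (pd i f)" if "i \<in> I" for i
    using f' that Ck_on_cong[OF assms, of "pd i f" "f' i"] by auto
  then show "continuous_on U f \<and>
    (\<forall>i\<in>I. (\<forall>x\<in>U. ((\<lambda>t. f (x(i := t))) has_real_derivative pd i f x) (at (x i))) \<and> Ck_on k I U (pd i f))"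
    using c f' eq by auto
next
  assume "continuous_on U f \<and>
    (\<forall>i\<in>I. (\<forall>x\<in>U. ((\<lambda>t. f (x(i := t))) has_real_derivative pd i f x) (at (x i))) \<and> Ck_on k I U (pd i f))"
  then show "Ck_on (Suc k) I U f"
    unfolding Ck_on.simps continuous_map_ext[OF open_ext_subset[OF assms]] by (intro conjI exI[of _ "\<lambda>i. pd i f"]) auto
qed

lemma Ck_on_SucI:
  assumes "open_ext I U" "continuous_on U f"
    "\<And>i x. i \<in> I \<Longrightarrow> x \<in> U \<Longrightarrow> ((\<lambda>t. f (x(i := t))) has_real_derivative f' i x) (at (x i))"
    "\<And>i. i \<in> I \<Longrightarrow> Ck_on k I U (f' i)"
  shows "Ck_on (Suc k) I U f"
  unfolding Ck_on.simps continuous_map_ext[OF open_ext_subset[OF assms(1)]]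
  using assms by (intro conjI exI[of _ "\<lambda>i. f' i"]) auto

lemma Ck_on_continuous: "open_ext I U \<Longrightarrow> Ck_on k I U f \<Longrightarrow> continuous_on U f"
  by (cases k) (auto simp: continuous_map_ext open_ext_subset)

lemma Ck_on_has_pd:
  assumes "open_ext I U" "Ck_on (Suc k) I U f" "i \<in> I" "x \<in> U"
  shows "((\<lambda>t. f (x(i := t))) has_real_derivative pd i f x) (at (x i))"
  using assms(2-) Ck_on_Suc[OF assms(1)] by blast

lemma Ck_on_pd: "open_ext I U \<Longrightarrow> Ck_on (Suc k) I U f \<Longrightarrow> i \<in> I \<Longrightarrow> Ck_on k I U (pd i f)"
  using Ck_on_Suc by blast

lemma Ck_on_SucD: "open_ext I U \<Longrightarrow> Ck_on (Suc k) I U f \<Longrightarrow> Ck_on k I U f"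
proof (induction k arbitrary: f)
  case (Suc k)
  then show ?case unfolding Ck_on_Suc[OF Suc.prems(1)] by blast
qed (simp add: Ck_on_0 Ck_on_Suc del: Ck_on.simps)

lemma Ck_on_subset:
  "open_ext I V \<Longrightarrow> open_ext I U \<Longrightarrow> U \<subseteq> V \<Longrightarrow> Ck_on k I V f \<Longrightarrow> Ck_on k I U f"
proof (induction k arbitrary: f)
  case (Suc k)
  then show ?case unfolding Ck_on_Suc[OF Suc(2)] Ck_on_Suc[OF Suc(3)]
    by (blast intro: continuous_on_subset)
qed (auto simp: Ck_on_0 simp del: Ck_on.simps intro: continuous_on_subset)

text \<open>A relatively open \<open>N\<close> around \<open>x\<close> gives the same filter
  \<open>at x within _\<close> as \<open>U\<close>, which settles continuity. As
  \<open>pd i f\<close> is one global function, the local derivatives need no gluing in the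
  induction.\<close>

lemma Ck_on_local:
  assumes "open_ext I U" "\<And>x. x \<in> U \<Longrightarrow> \<exists>N. open_ext I N \<and> x \<in> N \<and> N \<subseteq> U \<and> Ck_on k I N f"
  shows "Ck_on k I U f"
  using assms
proof (induction k arbitrary: f)
  have c: "continuous_on U f"
    if *: "\<And>x. x \<in> U \<Longrightarrow> \<exists>N. open_ext I N \<and> x \<in> N \<and> N \<subseteq> U \<and> continuous_on N f" for f
  proof -
    obtain N where N: "\<And>x. x \<in> U \<Longrightarrow> open_ext I (N x) \<and> x \<in> N x \<and> N x \<subseteq> U \<and> continuous_on (N x) f"
      using * by metis
    have "\<exists>W. open W \<and> N x = extensional I \<inter> W" if "x \<in> U" for x
      using N[OF that] by (auto simp: openin_open)
    then obtain W where W: "\<And>x. x \<in> U \<Longrightarrow> open (W x) \<and> N x = extensional I \<inter> W x" by metis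
    show ?thesis
      unfolding continuous_on_def
    proof
      fix x assume x: "x \<in> U"
      have "(f \<longlongrightarrow> f x) (at x within N x)" using N[OF x] by (auto simp: continuous_on_def)
      moreover have "at x within N x = at x within U"
        by (rule at_within_nhd[where S="W x"]) (use N[OF x] W[OF x] x open_ext_subset[OF assms(1)] in auto)
      ultimately show "(f \<longlongrightarrow> f x) (at x within U)" by simp
    qed
  qed
  {
    case 0
    then show ?case using c by (metis Ck_on_0)
  next
    case (Suc k)
    show ?case
    proof (rule Ck_on_SucI[OF Suc(2), where f'="\<lambda>i. pd i f"])
      show "continuous_on U f" using c Suc(3) Ck_on_continuous by metis
      show "((\<lambda>t. f (x(i := t))) has_real_derivative pd i f x) (at (x i))" if "i \<in> I" "x \<in> U" for i x
        using Suc(3)[OF that(2)] that(1) Ck_on_has_pd by metis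
      show "Ck_on k I U (pd i f)" if "i \<in> I" for i
        by (rule Suc.IH[OF Suc(2)]) (use Suc(3) Ck_on_pd that in metis)
    qed
  }
qed

lemma Ck_on_const [simp]: "open_ext I U \<Longrightarrow> Ck_on k I U (\<lambda>x. c)"
proof (induction k arbitrary: c)
  case (Suc k)
  then show ?case by (intro Ck_on_SucI[where f'="\<lambda>i x. 0"]) auto
qed (simp add: Ck_on_0 del: Ck_on.simps)

lemma Ck_on_coord: "open_ext I U \<Longrightarrow> i \<in> I \<Longrightarrow> Ck_on k I U (\<lambda>x. x i)"
proof (cases k)
  case (Suc n)
  assume "open_ext I U" "i \<in> I"
  then show ?thesis unfolding Suc
    by (intro Ck_on_SucI[where f'="\<lambda>j x. if i = j then 1 else 0"])
       (auto intro!: derivative_eq_intros simp del: Ck_on.simps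
         simp: continuous_on_coord)
qed (simp add: Ck_on_0 continuous_on_coord del: Ck_on.simps)

lemma Ck_on_add:
  "open_ext I U \<Longrightarrow> Ck_on k I U f \<Longrightarrow> Ck_on k I U h \<Longrightarrow> Ck_on k I U (\<lambda>x. f x + h x)"
proof (induction k arbitrary: f h)
  case (Suc k)
  note P = Suc.prems
  show ?case
    by (rule Ck_on_SucI[where f'="\<lambda>i x. pd i f x + pd i h x", OF P(1)])
      (intro continuous_on_add Suc.IH DERIV_add Ck_on_pd[OF P(1)] P Ck_on_has_pd[OF P(1,2)]
        Ck_on_has_pd[OF P(1,3)] Ck_on_continuous[OF P(1,2)] Ck_on_continuous[OF P(1,3)]; assumption)+
qed (auto simp: Ck_on_0 intro: continuous_on_add simp del: Ck_on.simps)

lemma Ck_on_mult: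
  "open_ext I U \<Longrightarrow> Ck_on k I U f \<Longrightarrow> Ck_on k I U h \<Longrightarrow> Ck_on k I U (\<lambda>x. f x * h x)"
proof (induction k arbitrary: f h)
  case (Suc k)
  note ff = Ck_on_SucD[OF Suc.prems(1,2)] Ck_on_SucD[OF Suc.prems(1,3)]
  show ?case
  proof (rule Ck_on_SucI[where f'="\<lambda>i x. pd i f x * h x + f x * pd i h x"])
    show "continuous_on U (\<lambda>x. f x * h x)"
      by (intro continuous_on_mult Ck_on_continuous[OF Suc.prems(1,2)] Ck_on_continuous[OF Suc.prems(1,3)])
    fix i assume i: "i \<in> I"
    show "Ck_on k I U (\<lambda>x. pd i f x * h x + f x * pd i h x)"
      by (intro Ck_on_add Suc.IH Suc.prems ff Ck_on_pd i)
    fix x assume x: "x \<in> U"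
    have "((\<lambda>t. f (x(i := t)) * h (x(i := t))) has_real_derivative
      pd i f x * h (x(i := x i)) + pd i h x * f (x(i := x i))) (at (x i))"
      by (intro DERIV_mult Ck_on_has_pd[OF Suc.prems(1,2) i x] Ck_on_has_pd[OF Suc.prems(1,3) i x])
    then show "((\<lambda>t. f (x(i := t)) * h (x(i := t))) has_real_derivative
      pd i f x * h x + f x * pd i h x) (at (x i))" by (simp add: mult.commute)
  qed (use Suc.prems in auto)
qed (auto simp: Ck_on_0 intro: continuous_on_mult simp del: Ck_on.simps)

lemma Ck_on_sum:
  assumes "open_ext I U" "\<And>s. s \<in> S \<Longrightarrow> Ck_on k I U (f s)"
  shows "Ck_on k I U (\<lambda>x. \<Sum>s\<in>S. f s x)"
proof (cases "finite S")
  case True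
  then show ?thesis using assms(2)
    by (induction S) (auto intro!: Ck_on_add assms(1) Ck_on_const[OF assms(1)] simp del: Ck_on.simps)
qed (use assms(1) in \<open>simp del: Ck_on.simps\<close>)

text \<open>The derivative \<open>- f' * (1/f)^2\<close> contains the reciprocal itself, but at one
  order less, where the induction hypothesis applies.\<close>

lemma Ck_on_inverse:
  assumes "open_ext I U" "\<And>x. x \<in> U \<Longrightarrow> f x \<noteq> 0"
  shows "Ck_on k I U f \<Longrightarrow> Ck_on k I U (\<lambda>x. inverse (f x))"
proof (induction k)
  case (Suc k)
  note f = Ck_on_SucD[OF assms(1) Suc.prems]
  show ?case
  proof (rule Ck_on_SucI[where f'="\<lambda>i x. - 1 * (pd i f x * (inverse (f x) * inverse (f x)))"])
    show "continuous_on U (\<lambda>x. inverse (f x))"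
      by (intro continuous_on_inverse Ck_on_continuous[OF assms(1) Suc.prems]) (use assms(2) in blast)
    fix i assume i: "i \<in> I"
    show "Ck_on k I U (\<lambda>x. - 1 * (pd i f x * (inverse (f x) * inverse (f x))))"
      by (intro Ck_on_mult Ck_on_const assms(1) Suc.IH f Ck_on_pd[OF assms(1) Suc.prems i])
    fix x assume x: "x \<in> U"
    have "((\<lambda>t. inverse (f (x(i := t)))) has_real_derivative
      - (inverse (f (x(i := x i))) * pd i f x * inverse (f (x(i := x i))))) (at (x i))"
      by (intro DERIV_inverse' Ck_on_has_pd[OF assms(1) Suc.prems i x]) (simp add: assms(2) x)
    then show "((\<lambda>t. inverse (f (x(i := t)))) has_real_derivative
      - 1 * (pd i f x * (inverse (f x) * inverse (f x)))) (at (x i))" by (simp add: mult_ac)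
  qed (use assms in auto)
qed (use assms in \<open>auto simp: Ck_on_0 intro!: continuous_on_inverse simp del: Ck_on.simps\<close>)

text \<open>Composition with a smooth function of one variable, given as the sequence
  \<open>r\<close> of its successive derivatives. The index \<open>n\<close> is general because the
  derivative of \<open>r n (f x)\<close> involves \<open>r (Suc n)\<close>.\<close>

lemma Ck_on_DERIV_tower:
  fixes r :: "nat \<Rightarrow> real \<Rightarrow> real"
  assumes "open_ext I U" "\<And>n x. (r n has_real_derivative r (Suc n) x) (at x)"
  shows "Ck_on k I U f \<Longrightarrow> Ck_on k I U (\<lambda>x. r n (f x))"
proof (induction k arbitrary: n)
  have c: "continuous_on UNIV (r n)" for n
    using assms(2) DERIV_isCont by (blast intro: continuous_at_imp_continuous_on)
  have c': "continuous_on U (\<lambda>x. r n (f x))" if "continuous_on U f" for n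
    using continuous_on_compose2[OF c that] by simp
  {
    case 0
    then show ?case using assms(1) c' by (simp add: Ck_on_0 del: Ck_on.simps)
  next
    case (Suc k)
    show ?case
    proof (rule Ck_on_SucI[where f'="\<lambda>i x. r (Suc n) (f x) * pd i f x"])
      show "continuous_on U (\<lambda>x. r n (f x))" using c' Ck_on_continuous assms(1) Suc.prems by metis
      fix i assume i: "i \<in> I"
      show "Ck_on k I U (\<lambda>x. r (Suc n) (f x) * pd i f x)"
        by (intro Ck_on_mult Suc.IH assms(1) Ck_on_SucD[OF assms(1) Suc.prems] Ck_on_pd[OF assms(1) Suc.prems i])
      fix x assume x: "x \<in> U"
      show "((\<lambda>t. r n (f (x(i := t)))) has_real_derivative r (Suc n) (f x) * pd i f x) (at (x i))"
        using DERIV_chain2[where f="r n" and g="\<lambda>t. f (x(i := t))" and x="x i",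
            OF assms(2) Ck_on_has_pd[OF assms(1) Suc.prems i x]] by simp
    qed (use assms in auto)
  }
qed

section \<open>Mean values and the chain rule\<close>

lemma MVT_unordered:
  fixes g :: "real \<Rightarrow> real"
  assumes "\<And>s. min a b \<le> s \<Longrightarrow> s \<le> max a b \<Longrightarrow> (g has_real_derivative g' s) (at s)"
  obtains \<xi> where "\<bar>\<xi> - a\<bar> \<le> \<bar>b - a\<bar>" "g b - g a = (b - a) * g' \<xi>"
proof -
  consider "a = b" | "a < b" | "b < a" by linarith
  then show thesis
  proof cases
    case 2
    then obtain z where "a < z" "z < b" "g b - g a = (b - a) * g' z"
      using MVT2[of a b g g'] assms by auto
    then show thesis using that[of z] by auto
  next
    case 3
    then obtain z where "b < z" "z < a" "g a - g b = (a - b) * g' z"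
      using MVT2[of b a g g'] assms by auto
    then show thesis using that[of z] by (auto simp: algebra_simps)
  qed (use that[of a] in auto)
qed

lemma continuous_on_box_close:
  assumes "open_ext I U" "continuous_on U f" "a \<in> U" "(e::real) > 0"
  obtains \<delta> where "\<delta> > 0" "ext_box I a \<delta> \<subseteq> U" "\<And>y. y \<in> ext_box I a \<delta> \<Longrightarrow> \<bar>f y - f a\<bar> < e"
proof -
  have "openin (top_of_set U) (U \<inter> f -` ball (f a) e)"
    by (rule continuous_openin_preimage_gen[OF assms(2)]) simp
  then have "open_ext I (U \<inter> f -` ball (f a) e)" using assms(1) openin_trans by blast
  moreover have "a \<in> U \<inter> f -` ball (f a) e" using assms by simp
  ultimately obtain \<delta> where "\<delta> > 0" "ext_box I a \<delta> \<subseteq> U \<inter> f -` ball (f a) e"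
    by (rule ext_box_within)
  then show thesis using that[of \<delta>] by (force simp: dist_real_def)
qed

text \<open>Smoothness is given by partial derivatives only, so the chain rule is proved by letting
  the coordinates of the curve move one after the other. Each change is a one-variable increment,
  controlled by the mean value theorem and the continuity of the partial derivative.\<close>

lemma DERIV_ext_curve:
  fixes c :: "real \<Rightarrow> 'i \<Rightarrow> real"
  assumes I: "finite I" and U: "open_ext I U" and f: "Ck_on (Suc 0) I U f"
    and c0: "c t0 \<in> U" and c: "eventually (\<lambda>t. c t \<in> extensional I) (nhds t0)"
    and c': "\<And>i. i \<in> I \<Longrightarrow> ((\<lambda>t. c t i) has_real_derivative c' i) (at t0)"
  shows "((\<lambda>t. f (c t)) has_real_derivative (\<Sum>i\<in>I. pd i f (c t0) * c' i)) (at t0)"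
proof -
  define a where "a = c t0"
  have aU: "a \<in> U" "a \<in> extensional I" using c0 U open_ext_subset by (auto simp: a_def)
  \<comment> \<open>Coordinates in \<open>S\<close> follow the curve, the others stay at their
    values in \<open>a\<close>; the induction lets \<open>S\<close> grow up to
    \<open>I\<close>.\<close>
  define mix where "mix S t = (\<lambda>i. if i \<in> I then if i \<in> S then c t i else a i else undefined)" for S t
  have mix0: "mix S t0 = a" for S using aU by (auto simp: mix_def a_def extensional_def)
  have main: "S \<subseteq> I \<Longrightarrow> ((\<lambda>t. f (mix S t)) has_real_derivative (\<Sum>i\<in>S. pd i f a * c' i)) (at t0)"
    if "finite S" for S
    using that
  proof (induction S)
    case empty
    have "mix {} t = a" for t using aU by (auto simp: mix_def extensional_def)
    then show ?case by simp
  next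
    case (insert k S)
    then have k: "k \<in> I" "k \<notin> S" and S: "S \<subseteq> I" by auto
    define D where "D t = f (mix (insert k S) t) - f (mix S t)" for t
    \<comment> \<open>This is the Caratheodory slope of \<open>f\<close> in direction
      \<open>k\<close>; the value at increment \<open>0\<close> is chosen to make it continuous at
      \<open>t0\<close>.\<close>
    define h where "h t = (if c t k = a k then pd k f a else D t / (c t k - a k))" for t
    have upd: "mix (insert k S) t = (mix S t)(k := c t k)" "(mix S t)(k := a k) = mix S t" for t
      using k by (auto simp: mix_def fun_eq_iff)
    have Dh: "D t = h t * (c t k - a k)" for t
      using upd[of t] by (auto simp: h_def D_def)
    have h0: "h t0 = pd k f a" by (simp add: h_def a_def)
    have "isCont h t0" unfolding isCont_def h0
    proof (rule tendstoI)
      fix e :: real assume e: "e > 0"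
      have pdc: "continuous_on U (pd k f)"
        using Ck_on_pd[OF U f k(1)] Ck_on_0[OF U] by simp
      obtain \<delta> where \<delta>: "\<delta> > 0" "ext_box I a \<delta> \<subseteq> U" "\<And>y. y \<in> ext_box I a \<delta> \<Longrightarrow> \<bar>pd k f y - pd k f a\<bar> < e"
        by (rule continuous_on_box_close[OF U pdc aU(1) e]) blast
      have "eventually (\<lambda>t. \<forall>i\<in>I. \<bar>c t i - a i\<bar> < \<delta>) (at t0)"
      proof (rule eventually_ball_finite[OF I], rule ballI)
        fix i assume "i \<in> I"
        then have "isCont (\<lambda>t. c t i) t0" using c' DERIV_isCont by blast
        then have "((\<lambda>t. c t i) \<longlongrightarrow> a i) (at t0)" by (simp add: isCont_def a_def)
        from tendstoD[OF this \<delta>(1)] show "eventually (\<lambda>t. \<bar>c t i - a i\<bar> < \<delta>) (at t0)"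
          by (simp add: dist_real_def)
      qed
      then show "eventually (\<lambda>t. dist (h t) (pd k f a) < e) (at t0)"
      proof (rule eventually_mono)
        fix t assume t: "\<forall>i\<in>I. \<bar>c t i - a i\<bar> < \<delta>"
        have box: "(mix S t)(k := s) \<in> ext_box I a \<delta>" if "\<bar>s - a k\<bar> \<le> \<bar>c t k - a k\<bar>" for s
          using that t k \<delta>(1) by (fastforce simp: ext_box_def mix_def extensional_def)
        have "((\<lambda>s. f ((mix S t)(k := s))) has_real_derivative pd k f ((mix S t)(k := s))) (at s)"
          if "min (a k) (c t k) \<le> s" "s \<le> max (a k) (c t k)" for s
        proof -
          have "(mix S t)(k := s) \<in> U" using box[of s] that \<delta>(2) by (auto simp: min_def max_def split: if_splits)
          from Ck_on_has_pd[OF U f k(1) this] show ?thesis by simp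
        qed
        then obtain \<xi> where xi: "\<bar>\<xi> - a k\<bar> \<le> \<bar>c t k - a k\<bar>"
          "f ((mix S t)(k := c t k)) - f ((mix S t)(k := a k)) = (c t k - a k) * pd k f ((mix S t)(k := \<xi>))"
          by (rule MVT_unordered)
        have "\<bar>pd k f ((mix S t)(k := \<xi>)) - pd k f a\<bar> < e" using \<delta>(3)[OF box[OF xi(1)]] .
        then show "dist (h t) (pd k f a) < e"
          using xi(2) e by (auto simp: h_def D_def upd dist_real_def)
      qed
    qed
    moreover obtain g where g: "\<And>t. c t k - c t0 k = g t * (t - t0)" "isCont g t0" "g t0 = c' k"
      using c'[OF k(1)] unfolding CARAT_DERIV by auto
    ultimately have "isCont (\<lambda>t. h t * g t) t0" by (intro continuous_intros)
    moreover have "D t - D t0 = h t * g t * (t - t0)" for t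
      using Dh[of t] Dh[of t0] g(1)[of t] by (simp add: a_def)
    ultimately have "(D has_real_derivative pd k f a * c' k) (at t0)"
      unfolding CARAT_DERIV using h0 g(3) by (intro exI[of _ "\<lambda>t. h t * g t"]) auto
    from DERIV_add[OF insert.IH[OF S] this]
    show ?case using insert.hyps by (simp add: D_def add.commute)
  qed
  have "eventually (\<lambda>t. f (mix I t) = f (c t)) (nhds t0)"
    by (rule eventually_mono[OF c]) (auto intro!: arg_cong[where f=f] simp: mix_def extensional_def)
  from DERIV_cong_ev[OF refl this refl] main[OF I subset_refl] show ?thesis
    by (auto simp: a_def)
qed

lemma continuous_on_ext_map:
  assumes "\<And>x i. x \<in> U \<Longrightarrow> i \<notin> I \<Longrightarrow> T x i = undefined"
    "\<And>i. i \<in> I \<Longrightarrow> continuous_on U (\<lambda>x. T x i :: real)"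
  shows "continuous_on U T"
proof (rule continuous_on_coordinatewise_then_product)
  fix i show "continuous_on U (\<lambda>x. T x i)"
  proof (cases "i \<in> I")
    case False
    then have "continuous_on U (\<lambda>x. T x i) \<longleftrightarrow> continuous_on U (\<lambda>x. undefined :: real)"
      using assms(1) by (intro continuous_on_cong) auto
    then show ?thesis by simp
  qed (use assms(2) in auto)
qed

text \<open>By the chain rule the partial derivatives of the composite are sums of products of
  \<open>pd i f\<close> after \<open>T\<close> with partial derivatives of \<open>T\<close>. The
  first factors have one order less, so the induction on \<open>k\<close> is for all
  \<open>f\<close>, while \<open>T\<close> stays fixed and smooth.\<close>

lemma Ck_on_compose:
  assumes I: "finite I" and V: "open_ext I V" and U: "open_ext J U" and T: "\<And>x. x \<in> U \<Longrightarrow> T x \<in> V"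
    and Tk: "\<And>i. i \<in> I \<Longrightarrow> smooth_on J U (\<lambda>x. T x i)"
  shows "Ck_on k I V f \<Longrightarrow> Ck_on k J U (\<lambda>x. f (T x))"
proof (induction k arbitrary: f)
  have TI: "T x \<in> extensional I" if "x \<in> U" for x using T that open_ext_subset[OF V] by blast
  have Tc: "continuous_on U T"
    by (rule continuous_on_ext_map[where I=I])
      (use TI Ck_on_continuous[OF U] Tk in \<open>auto simp: smooth_on_def extensional_def\<close>)
  have fc: "continuous_on U (\<lambda>x. f (T x))" if "continuous_on V f" for f
    by (rule continuous_on_compose2[OF that Tc]) (use T in auto)
  {
    case 0
    then show ?case using fc by (simp add: Ck_on_0 U V del: Ck_on.simps)
  next
    case (Suc k)
    have f1: "Ck_on (Suc 0) I V f"
      using Suc.prems by (induction k) (auto dest: Ck_on_SucD[OF V] simp del: Ck_on.simps)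
    show ?case
    proof (rule Ck_on_SucI[where f'="\<lambda>j x. \<Sum>i\<in>I. pd i f (T x) * pd j (\<lambda>x. T x i) x", OF U])
      show "continuous_on U (\<lambda>x. f (T x))" using fc Ck_on_continuous[OF V Suc.prems] by blast
      fix j assume j: "j \<in> J"
      show "Ck_on k J U (\<lambda>x. \<Sum>i\<in>I. pd i f (T x) * pd j (\<lambda>x. T x i) x)"
        by (intro Ck_on_sum U Ck_on_mult Suc.IH Ck_on_pd[OF V Suc.prems] Ck_on_pd[OF U _ j])
           (use Tk in \<open>auto simp: smooth_on_def simp del: Ck_on.simps\<close>)
      fix x assume x: "x \<in> U"
      have "((\<lambda>t. f (T (x(j := t)))) has_real_derivative
          (\<Sum>i\<in>I. pd i f (T (x(j := x j))) * pd j (\<lambda>x. T x i) x)) (at (x j))"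
      proof (rule DERIV_ext_curve[OF I V f1])
        show "T (x(j := x j)) \<in> V" using T x by simp
        show "eventually (\<lambda>t. T (x(j := t)) \<in> extensional I) (nhds (x j))"
          by (rule eventually_mono[OF eventually_upd_in[OF U x j]]) (rule TI)
        fix i assume "i \<in> I"
        then have "Ck_on (Suc 0) J U (\<lambda>x. T x i)" using Tk by (simp add: smooth_on_def del: Ck_on.simps)
        from Ck_on_has_pd[OF U this j x]
        show "((\<lambda>t. T (x(j := t)) i) has_real_derivative pd j (\<lambda>x. T x i) x) (at (x j))" .
      qed
      then show "((\<lambda>t. f (T (x(j := t)))) has_real_derivative
          (\<Sum>i\<in>I. pd i f (T x) * pd j (\<lambda>x. T x i) x)) (at (x j))" by simp
    qed
  }
qed

lemma smooth_on_compose: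
  assumes "finite I" "open_ext I V" "open_ext J U" "\<And>x. x \<in> U \<Longrightarrow> T x \<in> V"
    "\<And>i. i \<in> I \<Longrightarrow> smooth_on J U (\<lambda>x. T x i)" "smooth_on I V f"
  shows "smooth_on J U (\<lambda>x. f (T x))"
  using Ck_on_compose[OF assms(1-5)] assms(6) unfolding smooth_on_def by blast

section \<open>Integration along rays and Hadamard's expansion\<close>

definition ray :: "'i set \<Rightarrow> ('i \<Rightarrow> real) \<Rightarrow> real \<Rightarrow> ('i \<Rightarrow> real) \<Rightarrow> 'i \<Rightarrow> real" where
  "ray I a s x = (\<lambda>i\<in>I. a i + s * (x i - a i))"

lemma ray_in_box:
  assumes "0 \<le> s" "s \<le> 1" "x \<in> ext_box I a \<epsilon>" "\<epsilon> > 0"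
  shows "ray I a s x \<in> ext_box I a \<epsilon>"
proof -
  have "\<bar>s * (x i - a i)\<bar> < \<epsilon>" if "i \<in> I" for i
  proof -
    have "\<bar>s * (x i - a i)\<bar> \<le> 1 * \<bar>x i - a i\<bar>" using assms unfolding abs_mult
      by (intro mult_right_mono) auto
    also have "\<dots> < \<epsilon>" using assms(3) that by (simp add: ext_box_def)
    finally show ?thesis .
  qed
  then show ?thesis by (simp add: ext_box_def ray_def)
qed

text \<open>Joint continuity in \<open>x\<close> and \<open>s\<close> is what both the continuity of
  the parameter integral and differentiation under the integral sign ask for.\<close>

lemma continuous_on_ray_integrand:
  assumes "continuous_on (ext_box I a \<epsilon>) f" "\<epsilon> > 0"
  shows "continuous_on (ext_box I a \<epsilon> \<times> {0..1}) (\<lambda>(x, s). s ^ n * f (ray I a s x))"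
proof -
  have "continuous_on (ext_box I a \<epsilon> \<times> {0..1}) (\<lambda>z. ray I a (snd z) (fst z))"
  proof (rule continuous_on_ext_map[where I=I])
    fix i assume i: "i \<in> I"
    have "continuous_on (ext_box I a \<epsilon> \<times> {0..1}) (\<lambda>z. fst z i :: real)"
      by (rule continuous_on_compose2[OF continuous_on_coord[of UNIV]]) (auto intro: continuous_intros)
    then show "continuous_on (ext_box I a \<epsilon> \<times> {0..1}) (\<lambda>z. ray I a (snd z) (fst z) i)"
      using i by (simp add: ray_def) (intro continuous_intros)
  qed (auto simp: ray_def)
  then have "continuous_on (ext_box I a \<epsilon> \<times> {0..1}) (\<lambda>z. f (ray I a (snd z) (fst z)))"
    by (rule continuous_on_compose2[OF assms(1)]) (use ray_in_box[OF _ _ _ assms(2)] in auto)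
  then show ?thesis by (simp add: split_beta continuous_intros)
qed

lemma integrable_ray_integrand:
  assumes "continuous_on (ext_box I a \<epsilon>) f" "\<epsilon> > 0" "x \<in> ext_box I a \<epsilon>"
  shows "(\<lambda>s. s ^ n * f (ray I a s x)) integrable_on {0..1}"
proof -
  have "continuous_on {0..1::real} (\<lambda>s. (x, s))"
    by (intro continuous_on_Pair continuous_on_const continuous_on_id)
  moreover have "(\<lambda>s. (x, s)) ` {0..1} \<subseteq> ext_box I a \<epsilon> \<times> {0..1::real}" using assms(3) by auto
  ultimately have "continuous_on {0..1} (\<lambda>s. s ^ n * f (ray I a s x))"
    using continuous_on_compose2[OF continuous_on_ray_integrand[OF assms(1,2), of n]] by fastforce
  then show ?thesis by (rule integrable_continuous_real)
qed

text \<open>Differentiation under the integral sign. The point \<open>ray I a s x\<close> moves with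
  speed \<open>s\<close> when a coordinate of \<open>x\<close> moves, so each derivative brings a
  factor \<open>s\<close>; this is why the statement carries the weight
  \<open>s ^ n\<close>.\<close>

lemma Ck_on_ray_integral:
  fixes a :: "'i \<Rightarrow> real"
  assumes I: "finite I" and e: "\<epsilon> > 0"
  defines "U \<equiv> ext_box I a \<epsilon>"
  shows "Ck_on k I U f \<Longrightarrow> Ck_on k I U (\<lambda>x. integral {0..1} (\<lambda>s. s ^ n * f (ray I a s x)))"
proof (induction k arbitrary: f n)
  have U: "open_ext I U" using I by (simp add: U_def open_ext_box)
  have c: "continuous_on U (\<lambda>x. integral {0..1} (\<lambda>s. s ^ n * f (ray I a s x)))"
    if "continuous_on U f" for f n
    using integral_continuous_on_param[of U 0 1 "\<lambda>x s. s ^ n * f (ray I a s x)"]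
      continuous_on_ray_integrand[of I a \<epsilon> f n] that e by (simp add: U_def)
  {
    case 0
    then show ?case using c by (simp add: Ck_on_0 U del: Ck_on.simps)
  next
    case (Suc k)
    note fc = Ck_on_continuous[OF U Suc.prems]
    show ?case
    proof (rule Ck_on_SucI[where f'="\<lambda>i x. integral {0..1} (\<lambda>s. s ^ (Suc n) * pd i f (ray I a s x))", OF U])
      fix i assume i: "i \<in> I"
      show "Ck_on k I U (\<lambda>x. integral {0..1} (\<lambda>s. s ^ Suc n * pd i f (ray I a s x)))"
        by (intro Suc.IH Ck_on_pd[OF U Suc.prems i])
      fix x assume x: "x \<in> U"
      let ?A = "{t. \<bar>t - a i\<bar> < \<epsilon>}"
      have Aeq: "?A = {a i - \<epsilon><..<a i + \<epsilon>}" by auto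
      have upd: "x(i := t) \<in> U" if "t \<in> ?A" for t
        using x i that by (auto simp: U_def ext_box_def)
      have xA: "x i \<in> ?A" using x i by (auto simp: U_def ext_box_def)
      have "((\<lambda>t. integral (cbox 0 1) (\<lambda>s. s ^ n * f (ray I a s (x(i := t))))) has_real_derivative
          integral (cbox 0 1) (\<lambda>s. s ^ Suc n * pd i f (ray I a s (x(i := x i))))) (at (x i) within ?A)"
      proof (rule leibniz_rule_field_derivative[where
            fx="\<lambda>t s. s ^ Suc n * pd i f (ray I a s (x(i := t)))"])
        fix t s :: real assume t: "t \<in> ?A" and s: "s \<in> cbox 0 1"
        let ?y = "ray I a s (x(i := t))"
        have y: "?y \<in> U" unfolding U_def by (rule ray_in_box) (use s upd[OF t] e in \<open>auto simp: U_def\<close>)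
        have yi: "?y(i := a i + s * (t' - a i)) = ray I a s (x(i := t'))" for t'
          using i by (auto simp: ray_def fun_eq_iff)
        have "((\<lambda>t'. f (?y(i := a i + s * (t' - a i)))) has_real_derivative pd i f ?y * s) (at t)"
        proof (rule DERIV_chain2[where f="\<lambda>r. f (?y(i := r))"])
          have "?y i = a i + s * (t - a i)" using i by (simp add: ray_def)
          from Ck_on_has_pd[OF U Suc.prems i y, unfolded this]
          show "((\<lambda>r. f (?y(i := r))) has_real_derivative pd i f ?y) (at (a i + s * (t - a i)))" .
        qed (auto intro!: derivative_eq_intros)
        then have "((\<lambda>t'. s ^ n * f (ray I a s (x(i := t')))) has_real_derivative s ^ n * (pd i f ?y * s)) (at t)"
          unfolding yi by (rule DERIV_cmult)
        then show "((\<lambda>t'. s ^ n * f (ray I a s (x(i := t')))) has_real_derivative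
            s ^ Suc n * pd i f ?y) (at t within ?A)"
          by (simp add: has_field_derivative_at_within mult_ac)
      next
        fix t assume t: "t \<in> ?A"
        show "(\<lambda>s. s ^ n * f (ray I a s (x(i := t)))) integrable_on cbox 0 1"
          using integrable_ray_integrand[OF fc[unfolded U_def] e upd[OF t, unfolded U_def]] by simp
      next
        have pc: "continuous_on U (pd i f)" by (rule Ck_on_continuous[OF U Ck_on_pd[OF U Suc.prems i]])
        have "continuous_on (?A \<times> {0..1}) (\<lambda>z::real\<times>real. x(i := fst z))"
        proof (rule continuous_on_coordinatewise_then_product)
          fix l show "continuous_on (?A \<times> {0..1}) (\<lambda>z::real\<times>real. (x(i := fst z)) l)"
            by (cases "l = i") (auto intro!: continuous_intros)
        qed
        then have "continuous_on (?A \<times> {0..1}) (\<lambda>z::real\<times>real. (x(i := fst z), snd z))"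
          by (rule continuous_on_Pair[OF _ continuous_on_snd[OF continuous_on_id]])
        moreover have "(\<lambda>z::real\<times>real. (x(i := fst z), snd z)) ` (?A \<times> {0..1}) \<subseteq> ext_box I a \<epsilon> \<times> {0..1}"
          using upd by (auto simp: U_def)
        ultimately have "continuous_on (?A \<times> {0..1}) (\<lambda>z. case (x(i := fst z), snd z) of (x, s) \<Rightarrow> s ^ Suc n * pd i f (ray I a s x))"
          by (rule continuous_on_compose2[OF continuous_on_ray_integrand[OF pc[unfolded U_def] e]])
        then
        show "continuous_on (?A \<times> cbox 0 1) (\<lambda>(t, s). s ^ Suc n * pd i f (ray I a s (x(i := t))))"
          by (simp add: split_beta)
      qed (use xA in \<open>auto simp: Aeq\<close>)
      moreover have "at (x i) within ?A = at (x i)"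
        by (rule at_within_open[OF xA]) (simp add: Aeq)
      ultimately show "((\<lambda>t. integral {0..1} (\<lambda>s. s ^ n * f (ray I a s (x(i := t))))) has_real_derivative
          integral {0..1} (\<lambda>s. s ^ Suc n * pd i f (ray I a s x))) (at (x i))" by simp
    qed (rule c[OF fc])
  }
qed

text \<open>The fundamental theorem of calculus along the ray from \<open>a\<close> to
  \<open>x\<close> writes \<open>f x - f a\<close> as the integral of the gradient against
  \<open>x - a\<close>; \<open>G i\<close> is the integral of the partial derivative in direction
  \<open>i\<close>. At \<open>x = a\<close> the ray is constant, which gives
  \<open>G i a\<close>.\<close>

lemma hadamard:
  assumes I: "finite I" and e: "\<epsilon> > 0" and a: "a \<in> extensional I"
  defines "U \<equiv> ext_box I a \<epsilon>"
  assumes f: "smooth_on I U f"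
  obtains G where "\<And>i. i \<in> I \<Longrightarrow> smooth_on I U (G i)" "\<And>i. i \<in> I \<Longrightarrow> G i a = pd i f a"
    "\<And>x. x \<in> U \<Longrightarrow> f x = f a + (\<Sum>i\<in>I. (x i - a i) * G i x)"
proof
  have U: "open_ext I U" using I by (simp add: U_def open_ext_box)
  have fk: "Ck_on k I U f" for k using f by (simp add: smooth_on_def)
  define G where "G i x = integral {0..1} (\<lambda>s. s ^ 0 * pd i f (ray I a s x))" for i x
  show "smooth_on I U (G i)" if "i \<in> I" for i
    unfolding smooth_on_def G_def U_def
    by (intro allI Ck_on_ray_integral I e Ck_on_pd[OF U[unfolded U_def] fk[unfolded U_def] that])
  have ra: "ray I a s a = a" for s using a by (auto simp: ray_def extensional_def)
  show "G i a = pd i f a" for i by (simp add: G_def ra)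
  show "f x = f a + (\<Sum>i\<in>I. (x i - a i) * G i x)" if x: "x \<in> U" for x
  proof -
    have y: "ray I a s x \<in> U" if "s \<in> {0..1}" for s
      unfolding U_def by (rule ray_in_box) (use that x e in \<open>auto simp: U_def\<close>)
    have r1: "ray I a 1 x = x" using x by (auto simp: U_def ext_box_def ray_def extensional_def)
    have r0: "ray I a 0 x = a" using a by (auto simp: ray_def extensional_def)
    have "((\<lambda>s. \<Sum>i\<in>I. pd i f (ray I a s x) * (x i - a i)) has_integral f (ray I a 1 x) - f (ray I a 0 x)) {0..1}"
    proof (rule fundamental_theorem_of_calculus)
      fix s :: real assume s: "s \<in> {0..1}"
      have "((\<lambda>s. f (ray I a s x)) has_real_derivative (\<Sum>i\<in>I. pd i f (ray I a s x) * (x i - a i))) (at s)"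
        by (rule DERIV_ext_curve[where c="\<lambda>s. ray I a s x", OF I U fk y[OF s]])
           (auto simp: ray_def intro!: derivative_eq_intros)
      then show "((\<lambda>s. f (ray I a s x)) has_vector_derivative (\<Sum>i\<in>I. pd i f (ray I a s x) * (x i - a i))) (at s within {0..1})"
        by (simp add: has_real_derivative_iff_has_vector_derivative has_vector_derivative_at_within)
    qed simp
    moreover have "((\<lambda>s. \<Sum>i\<in>I. pd i f (ray I a s x) * (x i - a i)) has_integral (\<Sum>i\<in>I. G i x * (x i - a i))) {0..1}"
    proof (intro has_integral_sum I has_integral_mult_left)
      fix i assume i: "i \<in> I"
      have pc: "continuous_on U (pd i f)" by (rule Ck_on_continuous[OF U Ck_on_pd[OF U fk i]])
      have "(\<lambda>s. s ^ 0 * pd i f (ray I a s x)) integrable_on {0..1}"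
        by (rule integrable_ray_integrand[OF pc[unfolded U_def] e x[unfolded U_def]])
      then show "((\<lambda>s. pd i f (ray I a s x)) has_integral G i x) {0..1}"
        by (simp add: G_def integrable_integral)
    qed
    ultimately have "f x - f a = (\<Sum>i\<in>I. G i x * (x i - a i))"
      unfolding r0 r1 by (rule has_integral_unique)
    then show ?thesis by (simp add: mult.commute)
  qed
qed

section \<open>A smooth step function\<close>

text \<open>The derivatives of \<open>exp (- 1 / t)\<close> all have this form.\<close>

definition exp_flat :: "real poly \<Rightarrow> real \<Rightarrow> real" where
  "exp_flat P t = (if t \<le> 0 then 0 else poly P (1 / t) * exp (- (1 / t)))"

lemma tendsto_poly_div_exp_0: "((\<lambda>x. poly P x * exp (- x)) \<longlongrightarrow> (0::real)) at_top"
proof -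
  have "((\<lambda>x. \<Sum>i\<le>degree P. coeff P i * (x ^ i / exp x)) \<longlongrightarrow> (\<Sum>i\<le>degree P. coeff P i * 0)) at_top"
    by (intro tendsto_sum tendsto_mult tendsto_const tendsto_power_div_exp_0)
  moreover have "(\<Sum>i\<le>degree P. coeff P i * (x ^ i / exp x)) = poly P x * exp (- x)" for x :: real
    by (simp add: poly_altdef sum_distrib_right exp_minus divide_inverse sum_distrib_left mult_ac)
  ultimately show ?thesis by simp
qed

text \<open>For \<open>t > 0\<close> the product rule gives \<open>(P - pderiv P)\<close> at
  \<open>1 / t\<close>, divided by \<open>t^2\<close>, times the exponential; so the new polynomial
  is \<open>P - pderiv P\<close> times the square of the indeterminate. At \<open>0\<close> the
  exponential beats every polynomial.\<close>

lemma DERIV_exp_flat: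
  "(exp_flat P has_real_derivative exp_flat ([:0, 0, 1:] * (P - pderiv P)) t) (at t)"
proof -
  consider "t < 0" | "t = 0" | "t > 0" by linarith
  then show ?thesis
  proof cases
    case 1
    have "eventually (\<lambda>s. exp_flat P s = 0) (nhds t)"
      by (rule eventually_mono[OF eventually_nhds_in_open[of "{..<0}"]]) (use 1 in \<open>auto simp: exp_flat_def\<close>)
    then have "(exp_flat P has_real_derivative 0) (at t)"
      using DERIV_cong_ev[OF refl _ refl, of "exp_flat P" "\<lambda>_. 0" t 0] by simp
    moreover have "exp_flat Q t = 0" for Q using 1 by (simp add: exp_flat_def)
    ultimately show ?thesis by simp
  next
    case 3
    have ev: "eventually (\<lambda>s. exp_flat P s = poly P (1 / s) * exp (- (1 / s))) (nhds t)"
      by (rule eventually_mono[OF eventually_nhds_in_open[of "{0<..}"]]) (use 3 in \<open>auto simp: exp_flat_def\<close>)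
    have "((\<lambda>s. poly P (1 / s) * exp (- (1 / s))) has_real_derivative
       poly (pderiv P) (1 / t) * (- 1 / (t * t)) * exp (- (1 / t)) + exp (- (1 / t)) * (1 / (t * t)) * poly P (1 / t)) (at t)"
      using 3 by (auto intro!: derivative_eq_intros DERIV_chain2[OF poly_DERIV])
    moreover have "poly (pderiv P) (1 / t) * (- 1 / (t * t)) * exp (- (1 / t)) + exp (- (1 / t)) * (1 / (t * t)) * poly P (1 / t)
       = exp_flat ([:0, 0, 1:] * (P - pderiv P)) t"
      using 3 by (simp add: exp_flat_def field_simps)
    ultimately show ?thesis using DERIV_cong_ev[OF refl ev refl] by simp
  next
    case 2
    have "((\<lambda>h. (exp_flat P (0 + h) - exp_flat P 0) / h) \<longlongrightarrow> 0) (at_right 0)"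
    proof -
      \<comment> \<open>Dividing by \<open>h\<close> multiplies the polynomial in
        \<open>1 / h\<close> by the indeterminate; hence the factor \<open>[:0, 1:]\<close>.\<close>
      have "((\<lambda>h. poly ([:0,1:] * P) (inverse h) * exp (- (inverse h))) \<longlongrightarrow> 0) (at_right 0)"
        by (rule filterlim_compose[OF tendsto_poly_div_exp_0 filterlim_inverse_at_top_right])
      moreover have "eventually (\<lambda>h. poly ([:0,1:] * P) (inverse h) * exp (- (inverse h)) =
          (exp_flat P (0 + h) - exp_flat P 0) / h) (at_right 0)"
        by (rule eventually_mono[OF eventually_at_right_less[of 0]])
           (simp add: exp_flat_def inverse_eq_divide)
      ultimately show ?thesis by (rule Lim_transform_eventually)
    qed
    moreover have "((\<lambda>h. (exp_flat P (0 + h) - exp_flat P 0) / h) \<longlongrightarrow> 0) (at_left 0)"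
      by (rule Lim_transform_eventually[OF tendsto_const])
         (auto simp: exp_flat_def eventually_at_filter)
    ultimately have "((\<lambda>h. (exp_flat P (0 + h) - exp_flat P 0) / h) \<longlongrightarrow> 0) (at 0)"
      by (simp add: filterlim_at_split)
    then show ?thesis using 2 by (simp add: DERIV_def exp_flat_def)
  qed
qed

text \<open>The usual quotient of flat exponentials, rising from \<open>0\<close> to
  \<open>1\<close> over the unit interval. The denominator never vanishes, since \<open>t\<close>
  and \<open>1 - t\<close> are not both at most \<open>0\<close>. The form
  \<open>1 + - 1 * t\<close> matches the closure rules for sums and products.\<close>

definition smooth_step :: "real \<Rightarrow> real" where
  "smooth_step t = exp_flat 1 t * inverse (exp_flat 1 t + exp_flat 1 (1 + - 1 * t))"

lemma exp_flat_1_ge_0: "exp_flat 1 t \<ge> 0" and exp_flat_1_pos: "t > 0 \<Longrightarrow> exp_flat 1 t > 0"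
  by (auto simp: exp_flat_def)

lemma exp_flat_sum_pos: "exp_flat 1 t + exp_flat 1 (1 + - 1 * t) > 0"
proof (cases "t > 0")
  case True
  then show ?thesis using exp_flat_1_pos exp_flat_1_ge_0 by (intro add_pos_nonneg)
next
  case False
  then have "1 + - 1 * t > 0" by linarith
  then show ?thesis using exp_flat_1_pos[of "1 + - 1 * t"] exp_flat_1_ge_0[of t] by linarith
qed

lemma smooth_step_0: "t \<le> 0 \<Longrightarrow> smooth_step t = 0"
  by (simp add: smooth_step_def exp_flat_def)

lemma smooth_step_1: "t \<ge> 1 \<Longrightarrow> smooth_step t = 1"
  by (simp add: smooth_step_def exp_flat_def)

lemma Ck_on_smooth_step:
  assumes U: "open_ext I U" and f: "Ck_on k I U f"
  shows "Ck_on k I U (\<lambda>x. smooth_step (f x))"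
proof -
  \<comment> \<open>Iterating the derivative rule of \<open>exp_flat\<close> on the constant
    polynomial gives the tower of derivatives required for composition.\<close>
  define P where "P n = ((\<lambda>P. [:0, 0, 1:] * (P - pderiv P)) ^^ n) (1 :: real poly)" for n
  have e: "Ck_on k I U (\<lambda>x. exp_flat 1 (h x))" if "Ck_on k I U h" for h
    using Ck_on_DERIV_tower[where r="\<lambda>n. exp_flat (P n)" and n=0, OF U _ that] DERIV_exp_flat
    by (simp add: P_def del: Ck_on.simps)
  show ?thesis unfolding smooth_step_def
    by (intro Ck_on_mult e f Ck_on_inverse Ck_on_add U Ck_on_const)
       (rule less_imp_neq[OF exp_flat_sum_pos, symmetric])
qed

lemma smooth_on_subset:
  "open_ext I V \<Longrightarrow> open_ext I U \<Longrightarrow> U \<subseteq> V \<Longrightarrow> smooth_on I V f \<Longrightarrow> smooth_on I U f"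
  unfolding smooth_on_def using Ck_on_subset by blast

lemma smooth_on_cong:
  "open_ext I U \<Longrightarrow> (\<And>y. y \<in> U \<Longrightarrow> f y = h y) \<Longrightarrow> smooth_on I U f \<longleftrightarrow> smooth_on I U h"
  unfolding smooth_on_def using Ck_on_cong by metis

lemma smooth_on_local:
  "open_ext I U \<Longrightarrow> (\<And>x. x \<in> U \<Longrightarrow> \<exists>N. open_ext I N \<and> x \<in> N \<and> N \<subseteq> U \<and> smooth_on I N f) \<Longrightarrow> smooth_on I U f"
  unfolding smooth_on_def by (intro allI Ck_on_local) blast+

lemma smooth_on_pd: "open_ext I U \<Longrightarrow> smooth_on I U f \<Longrightarrow> i \<in> I \<Longrightarrow> smooth_on I U (pd i f)"
  unfolding smooth_on_def by (intro allI Ck_on_pd) blast+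

lemma smooth_on_const [simp]: "open_ext I U \<Longrightarrow> smooth_on I U (\<lambda>x. c)"
  and smooth_on_coord: "open_ext I U \<Longrightarrow> i \<in> I \<Longrightarrow> smooth_on I U (\<lambda>x. x i)"
  and smooth_on_add: "open_ext I U \<Longrightarrow> smooth_on I U f \<Longrightarrow> smooth_on I U h \<Longrightarrow> smooth_on I U (\<lambda>x. f x + h x)"
  and smooth_on_mult: "open_ext I U \<Longrightarrow> smooth_on I U f \<Longrightarrow> smooth_on I U h \<Longrightarrow> smooth_on I U (\<lambda>x. f x * h x)"
  and smooth_on_sum: "open_ext I U \<Longrightarrow> (\<And>s. s \<in> S \<Longrightarrow> smooth_on I U (ff s)) \<Longrightarrow> smooth_on I U (\<lambda>x. \<Sum>s\<in>S. ff s x)"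
  and smooth_on_inverse: "open_ext I U \<Longrightarrow> (\<And>x. x \<in> U \<Longrightarrow> f x \<noteq> 0) \<Longrightarrow> smooth_on I U f \<Longrightarrow> smooth_on I U (\<lambda>x. inverse (f x))"
  and smooth_on_step: "open_ext I U \<Longrightarrow> smooth_on I U f \<Longrightarrow> smooth_on I U (\<lambda>x. smooth_step (f x))"
  unfolding smooth_on_def
  by (simp_all add: Ck_on_coord Ck_on_add Ck_on_mult Ck_on_sum Ck_on_inverse Ck_on_smooth_step del: Ck_on.simps)

lemma smooth_on_continuous: "open_ext I U \<Longrightarrow> smooth_on I U f \<Longrightarrow> continuous_on U f"
  unfolding smooth_on_def using Ck_on_continuous by blast

section \<open>Smooth functions on a manifold\<close>

text \<open>The manifold axioms in terms of subspace topologies of the function space. In this form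
  they are established again for products.\<close>

locale charted =
  fixes M :: "('a, 'i, 'z) manifold_scheme"
  assumes Hausdorff: "Hausdorff_space (mtop M)"
    and finite_coords: "finite (coords M)"
    and cover: "(\<Union>(U, \<phi>)\<in>atlas M. U) = points M"
    and chart_open: "(U, \<phi>) \<in> atlas M \<Longrightarrow> openin (mtop M) U"
    and chart_image: "(U, \<phi>) \<in> atlas M \<Longrightarrow> open_ext (coords M) (\<phi> ` U)"
    and chart_homeo: "(U, \<phi>) \<in> atlas M \<Longrightarrow>
      homeomorphic_map (subtopology (mtop M) U) (top_of_set (\<phi> ` U)) \<phi>"
    and transition: "(U, \<phi>) \<in> atlas M \<Longrightarrow> (V, \<psi>) \<in> atlas M \<Longrightarrow> i \<in> coords M \<Longrightarrow>
      smooth_on (coords M) (\<phi> ` (U \<inter> V)) (\<lambda>x. \<psi> (inv_into U \<phi> x) i)"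

lemma smooth_manifold_charted: "smooth_manifold M \<Longrightarrow> charted M"
proof
  assume M: "smooth_manifold M"
  show "Hausdorff_space (mtop M)" "finite (coords M)" "(\<Union>(U, \<phi>)\<in>atlas M. U) = points M"
    using M by (auto simp: smooth_manifold_def)
  fix U \<phi> assume U: "(U, \<phi>) \<in> atlas M"
  show "openin (mtop M) U" using M U by (auto simp: smooth_manifold_def)
  show o: "open_ext (coords M) (\<phi> ` U)"
    using M U unfolding smooth_manifold_def powertop_real_eq by blast
  have "homeomorphic_map (subtopology (mtop M) U) (subtopology (powertop_real (coords M)) (\<phi> ` U)) \<phi>"
    using M U unfolding smooth_manifold_def by blast
  then show "homeomorphic_map (subtopology (mtop M) U) (top_of_set (\<phi> ` U)) \<phi>"
    using open_ext_subset[OF o] by (simp add: powertop_real_eq subtopology_subtopology inf_absorb2)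
  show "smooth_on (coords M) (\<phi> ` (U \<inter> V)) (\<lambda>x. \<psi> (inv_into U \<phi> x) i)"
    if "(V, \<psi>) \<in> atlas M" "i \<in> coords M" for V \<psi> i
    using M U that unfolding smooth_manifold_def by blast
qed

lemma smooth_on_prod:
  assumes "open_ext I U" "finite S" "\<And>s. s \<in> S \<Longrightarrow> smooth_on I U (f s)"
  shows "smooth_on I U (\<lambda>x. \<Prod>s\<in>S. f s x)"
  using assms(2,3) by (induction S) (auto intro!: smooth_on_mult assms(1) simp: assms(1))

lemma compactin_closed_box:
  fixes a :: "'i \<Rightarrow> real"
  shows "compactin (top_of_set (extensional I)) {y \<in> extensional I. \<forall>i\<in>I. \<bar>y i - a i\<bar> \<le> r}"
proof -
  have "{y \<in> extensional I. \<forall>i\<in>I. \<bar>y i - a i\<bar> \<le> r} = (\<Pi>\<^sub>E i\<in>I. {a i - r..a i + r})"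
    by (auto simp: PiE_def Pi_def abs_le_iff algebra_simps)
  moreover have "compactin (powertop_real I) (\<Pi>\<^sub>E i\<in>I. {a i - r..a i + r})"
    by (subst compactin_PiE) simp
  ultimately show ?thesis by (simp add: powertop_real_eq)
qed

lemma pd_lin:
  assumes U: "open_ext I U" and f: "smooth_on I U f" and h: "smooth_on I U h" and "i \<in> I" "x \<in> U"
  shows "pd i (\<lambda>y. a * f y + c * h y) x = a * pd i f x + c * pd i h x"
    and "pd i (\<lambda>y. f y * h y) x = f x * pd i h x + h x * pd i f x"
proof -
  have d: "((\<lambda>t. f (x(i := t))) has_real_derivative pd i f x) (at (x i))"
    "((\<lambda>t. h (x(i := t))) has_real_derivative pd i h x) (at (x i))"
    using Ck_on_has_pd[OF U _ assms(4,5)] f h unfolding smooth_on_def by blast+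
  show "pd i (\<lambda>y. a * f y + c * h y) x = a * pd i f x + c * pd i h x"
    by (rule pd_eqI) (intro DERIV_add DERIV_cmult d)
  show "pd i (\<lambda>y. f y * h y) x = f x * pd i h x + h x * pd i f x"
    by (rule pd_eqI) (use DERIV_mult[OF d] in \<open>simp add: algebra_simps\<close>)
qed

lemma pd_cong:
  assumes "open_ext I U" "x \<in> U" "i \<in> I" "\<And>y. y \<in> U \<Longrightarrow> f y = h y"
  shows "pd i f x = pd i h x"
  unfolding pd_def
  by (rule deriv_cong_ev[OF eventually_mono[OF eventually_upd_in[OF assms(1-3)]] refl]) (rule assms(4))

lemma pd_coord: "pd i (\<lambda>y. y j) x = (if i = j then 1 else 0)"
  by (rule pd_eqI) (auto intro!: derivative_eq_intros)

context charted
begin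

lemma chart_subset: "(U, \<phi>) \<in> atlas M \<Longrightarrow> U \<subseteq> points M"
  using chart_open openin_subset by blast

lemma chart_at:
  assumes "p \<in> points M"
  obtains U \<phi> where "(U, \<phi>) \<in> atlas M" "p \<in> U"
  using assms cover by blast

lemma chart_inj: "(U, \<phi>) \<in> atlas M \<Longrightarrow> inj_on \<phi> U"
  using homeomorphic_imp_injective_map[OF chart_homeo] chart_subset by (simp add: inf_absorb2)

lemma chart_inv [simp]: "(U, \<phi>) \<in> atlas M \<Longrightarrow> p \<in> U \<Longrightarrow> inv_into U \<phi> (\<phi> p) = p"
  using chart_inj by (simp add: inv_into_f_f)

lemma chart_image_open:
  assumes "(U, \<phi>) \<in> atlas M" "openin (mtop M) W" "W \<subseteq> U"
  shows "open_ext (coords M) (\<phi> ` W)"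
proof -
  have "openin (subtopology (mtop M) U) W"
    unfolding openin_subtopology using assms(2,3) by (intro exI[of _ W]) auto
  then have "openin (top_of_set (\<phi> ` U)) (\<phi> ` W)"
    using homeomorphic_map_openness[OF chart_homeo[OF assms(1)]] assms(3) chart_subset[OF assms(1)]
    by (simp add: inf_absorb2)
  then show ?thesis using chart_image[OF assms(1)] openin_trans by blast
qed

lemma chart_preimage_open:
  assumes "(U, \<phi>) \<in> atlas M" "open_ext (coords M) S"
  shows "openin (mtop M) {x \<in> U. \<phi> x \<in> S}"
proof -
  have "openin (top_of_set (\<phi> ` U)) (\<phi> ` U \<inter> S)"
    using assms(2) open_ext_subset[OF chart_image[OF assms(1)]] unfolding openin_open by blast
  from openin_continuous_map_preimage[OF homeomorphic_imp_continuous_map[OF chart_homeo[OF assms(1)]] this]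
  have "openin (subtopology (mtop M) U) {x \<in> topspace (subtopology (mtop M) U). \<phi> x \<in> \<phi> ` U \<inter> S}" .
  moreover have "{x \<in> topspace (subtopology (mtop M) U). \<phi> x \<in> \<phi> ` U \<inter> S} = {x \<in> U. \<phi> x \<in> S}"
    using chart_subset[OF assms(1)] by auto
  ultimately show ?thesis using chart_open[OF assms(1)] openin_trans_full by metis
qed

lemma C_infD: "f \<in> C_inf M \<Longrightarrow> (U, \<phi>) \<in> atlas M \<Longrightarrow> smooth_on (coords M) (\<phi> ` U) (\<lambda>x. f (inv_into U \<phi> x))"
  unfolding C_inf_def by blast

text \<open>Transition maps carry smoothness from the chosen chart at a point to every other chart
  there. So one chart around each point is enough, although \<open>C_inf\<close> demands all charts
  of the atlas.\<close>

lemma C_inf_localI: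
  assumes "\<And>p. p \<in> points M \<Longrightarrow> \<exists>U \<phi> W. (U, \<phi>) \<in> atlas M \<and> openin (mtop M) W \<and> p \<in> W \<and> W \<subseteq> U \<and>
    smooth_on (coords M) (\<phi> ` W) (\<lambda>x. f (inv_into U \<phi> x))"
  shows "f \<in> C_inf M"
proof -
  have "smooth_on (coords M) (\<psi> ` V) (\<lambda>x. f (inv_into V \<psi> x))" if V: "(V, \<psi>) \<in> atlas M" for V \<psi>
  proof (rule smooth_on_local[OF chart_image[OF V]])
    fix y assume "y \<in> \<psi> ` V"
    then obtain p where p: "p \<in> V" "y = \<psi> p" by blast
    then obtain U \<phi> W where U: "(U, \<phi>) \<in> atlas M" and W: "openin (mtop M) W" "p \<in> W" "W \<subseteq> U"
      and s: "smooth_on (coords M) (\<phi> ` W) (\<lambda>x. f (inv_into U \<phi> x))"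
      using assms chart_subset[OF V] by blast
    have o: "openin (mtop M) (W \<inter> V)" using W chart_open[OF V] by blast
    have N: "open_ext (coords M) (\<psi> ` (W \<inter> V))" by (rule chart_image_open[OF V o]) simp
    have N': "open_ext (coords M) (\<psi> ` (V \<inter> U))"
      by (rule chart_image_open[OF V]) (use chart_open[OF V] chart_open[OF U] in auto)
    have "smooth_on (coords M) (\<psi> ` (W \<inter> V)) (\<lambda>x. (\<lambda>x. f (inv_into U \<phi> x)) (\<phi> (inv_into V \<psi> x)))"
    proof (rule smooth_on_compose[OF finite_coords chart_image_open[OF U W(1,3)] N _ _ s])
      show "\<phi> (inv_into V \<psi> x) \<in> \<phi> ` W" if "x \<in> \<psi> ` (W \<inter> V)" for x
        using that V by auto
      show "smooth_on (coords M) (\<psi> ` (W \<inter> V)) (\<lambda>x. \<phi> (inv_into V \<psi> x) i)" if "i \<in> coords M" for i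
        by (rule smooth_on_subset[OF N' N _ transition[OF V U that]]) (use W in blast)
    qed
    moreover have eq: "f (inv_into U \<phi> (\<phi> (inv_into V \<psi> x))) = f (inv_into V \<psi> x)" if "x \<in> \<psi> ` (W \<inter> V)" for x
      using that V U W(3) by auto
    ultimately have "smooth_on (coords M) (\<psi> ` (W \<inter> V)) (\<lambda>x. f (inv_into V \<psi> x))"
      using smooth_on_cong[OF N eq] by simp
    then show "\<exists>N. open_ext (coords M) N \<and> y \<in> N \<and> N \<subseteq> \<psi> ` V \<and> smooth_on (coords M) N (\<lambda>x. f (inv_into V \<psi> x))"
      using N p W(2) by blast
  qed
  then show ?thesis unfolding C_inf_def by blast
qed

lemma C_inf_local:
  assumes "\<And>p. p \<in> points M \<Longrightarrow> \<exists>W h. openin (mtop M) W \<and> p \<in> W \<and> h \<in> C_inf M \<and> (\<forall>x\<in>W. f x = h x)"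
  shows "f \<in> C_inf M"
proof (rule C_inf_localI)
  fix p assume p: "p \<in> points M"
  obtain U \<phi> where U: "(U, \<phi>) \<in> atlas M" "p \<in> U" using chart_at[OF p] .
  obtain W h where W: "openin (mtop M) W" "p \<in> W" "h \<in> C_inf M" "\<forall>x\<in>W. f x = h x"
    using assms[OF p] by blast
  have o: "openin (mtop M) (W \<inter> U)" using W chart_open[OF U(1)] by blast
  have N: "open_ext (coords M) (\<phi> ` (W \<inter> U))" by (rule chart_image_open[OF U(1) o]) simp
  have "smooth_on (coords M) (\<phi> ` (W \<inter> U)) (\<lambda>x. h (inv_into U \<phi> x))"
    by (rule smooth_on_subset[OF chart_image[OF U(1)] N _ C_infD[OF W(3) U(1)]]) blast
  then have "smooth_on (coords M) (\<phi> ` (W \<inter> U)) (\<lambda>x. f (inv_into U \<phi> x))"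
    using W(4) U(1) by (subst smooth_on_cong[OF N]) auto
  then show "\<exists>U \<phi> W. (U, \<phi>) \<in> atlas M \<and> openin (mtop M) W \<and> p \<in> W \<and> W \<subseteq> U \<and>
    smooth_on (coords M) (\<phi> ` W) (\<lambda>x. f (inv_into U \<phi> x))"
    using U W o by blast
qed

lemma C_inf_cong: "(\<And>x. x \<in> points M \<Longrightarrow> f x = h x) \<Longrightarrow> f \<in> C_inf M \<longleftrightarrow> h \<in> C_inf M"
proof -
  have "f \<in> C_inf M" if "\<And>x. x \<in> points M \<Longrightarrow> f x = h x" "h \<in> C_inf M" for f h
    by (rule C_inf_local) (use that in blast)
  then show "(\<And>x. x \<in> points M \<Longrightarrow> f x = h x) \<Longrightarrow> f \<in> C_inf M \<longleftrightarrow> h \<in> C_inf M" by metis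
qed

lemma C_infI: "(\<And>U \<phi>. (U, \<phi>) \<in> atlas M \<Longrightarrow> smooth_on (coords M) (\<phi> ` U) (\<lambda>x. f (inv_into U \<phi> x))) \<Longrightarrow> f \<in> C_inf M"
  unfolding C_inf_def by blast

lemma C_inf_const [simp]: "(\<lambda>x. c) \<in> C_inf M"
  by (rule C_infI) (rule smooth_on_const[OF chart_image])

lemma C_inf_add: "f \<in> C_inf M \<Longrightarrow> h \<in> C_inf M \<Longrightarrow> (\<lambda>x. f x + h x) \<in> C_inf M"
  by (rule C_infI) (rule smooth_on_add[OF chart_image C_infD C_infD])

lemma C_inf_mult: "f \<in> C_inf M \<Longrightarrow> h \<in> C_inf M \<Longrightarrow> (\<lambda>x. f x * h x) \<in> C_inf M"
  by (rule C_infI) (rule smooth_on_mult[OF chart_image C_infD C_infD])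

lemma C_inf_cmult: "f \<in> C_inf M \<Longrightarrow> (\<lambda>x. c * f x) \<in> C_inf M"
  by (intro C_inf_mult C_inf_const)

lemma C_inf_diff: "f \<in> C_inf M \<Longrightarrow> h \<in> C_inf M \<Longrightarrow> (\<lambda>x. f x - h x) \<in> C_inf M"
  using C_inf_add[OF _ C_inf_cmult[of h "- 1"], of f] by simp

lemma C_inf_power: "f \<in> C_inf M \<Longrightarrow> (\<lambda>x. (f x)\<^sup>2) \<in> C_inf M"
  unfolding power2_eq_square by (rule C_inf_mult)

lemma C_inf_sum: "(\<And>s. s \<in> S \<Longrightarrow> f s \<in> C_inf M) \<Longrightarrow> (\<lambda>x. \<Sum>s\<in>S. f s x) \<in> C_inf M"
  by (rule C_infI) (rule smooth_on_sum[OF chart_image C_infD])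

lemma C_inf_inverse:
  assumes "f \<in> C_inf M" "\<And>x. x \<in> points M \<Longrightarrow> f x \<noteq> 0"
  shows "(\<lambda>x. inverse (f x)) \<in> C_inf M"
proof (rule C_infI)
  fix U \<phi> assume U: "(U, \<phi>) \<in> atlas M"
  show "smooth_on (coords M) (\<phi> ` U) (\<lambda>x. inverse (f (inv_into U \<phi> x)))"
    by (rule smooth_on_inverse[OF chart_image[OF U] _ C_infD[OF assms(1) U]])
       (rule assms(2), rule subsetD[OF chart_subset[OF U]], rule inv_into_into)
qed

lemma C_inf_preimage_open:
  assumes f: "f \<in> C_inf M" and S: "open (S :: real set)"
  shows "openin (mtop M) {x \<in> points M. f x \<in> S}"
proof (subst openin_subopen, intro ballI)
  fix p assume "p \<in> {x \<in> points M. f x \<in> S}"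
  then have p: "p \<in> points M" "f p \<in> S" by auto
  obtain U \<phi> where U: "(U, \<phi>) \<in> atlas M" "p \<in> U" using chart_at[OF p(1)] .
  have "openin (top_of_set (\<phi> ` U)) (\<phi> ` U \<inter> (\<lambda>x. f (inv_into U \<phi> x)) -` S)"
    by (rule continuous_openin_preimage_gen[OF smooth_on_continuous[OF chart_image C_infD] S]) (use U f in auto)
  then have "open_ext (coords M) (\<phi> ` U \<inter> (\<lambda>x. f (inv_into U \<phi> x)) -` S)"
    using chart_image[OF U(1)] openin_trans by blast
  note chart_preimage_open[OF U(1) this]
  moreover have "{x \<in> U. \<phi> x \<in> \<phi> ` U \<inter> (\<lambda>x. f (inv_into U \<phi> x)) -` S} = {x \<in> U. f x \<in> S}"
    by (rule Collect_cong) (simp add: U(1) imageI cong: conj_cong)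
  ultimately have "openin (mtop M) {x \<in> U. f x \<in> S}" by simp
  then show "\<exists>T. openin (mtop M) T \<and> p \<in> T \<and> T \<subseteq> {x \<in> points M. f x \<in> S}"
    using U p chart_subset[OF U(1)] by (intro exI[of _ "{x \<in> U. f x \<in> S}"]) auto
qed

text \<open>Two open sets cover the manifold: on \<open>W\<close> the function is a product of
  smooth functions, and on the complement of the closed set \<open>K\<close> it is
  \<open>0\<close>.\<close>

lemma C_inf_cut_off:
  assumes U: "(U, \<phi>) \<in> atlas M" and W: "openin (mtop M) W" "W \<subseteq> U"
    and K: "closedin (mtop M) K" "K \<subseteq> W" and \<eta>: "\<eta> \<in> C_inf M" "\<And>x. x \<in> points M - K \<Longrightarrow> \<eta> x = 0"
    and u: "smooth_on (coords M) (\<phi> ` W) u"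
  shows "(\<lambda>x. if x \<in> W then \<eta> x * u (\<phi> x) else 0) \<in> C_inf M" (is "?h \<in> _")
proof (rule C_inf_localI)
  fix p assume p: "p \<in> points M"
  note o = chart_image_open[OF U W]
  show "\<exists>U \<phi> W. (U, \<phi>) \<in> atlas M \<and> openin (mtop M) W \<and> p \<in> W \<and> W \<subseteq> U \<and>
    smooth_on (coords M) (\<phi> ` W) (\<lambda>x. ?h (inv_into U \<phi> x))"
  proof (cases "p \<in> W")
    case True
    have "smooth_on (coords M) (\<phi> ` W) (\<lambda>x. \<eta> (inv_into U \<phi> x) * u x)"
      by (intro smooth_on_mult o u smooth_on_subset[OF chart_image[OF U] o _ C_infD[OF \<eta>(1) U]])
         (use W in blast)
    then have "smooth_on (coords M) (\<phi> ` W) (\<lambda>x. ?h (inv_into U \<phi> x))"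
      using U W(2) by (subst smooth_on_cong[OF o]) auto
    then show ?thesis using U W True by blast
  next
    case False
    obtain V \<psi> where V: "(V, \<psi>) \<in> atlas M" "p \<in> V" using chart_at[OF p] .
    let ?W = "V \<inter> (points M - K)"
    have o': "openin (mtop M) ?W" using K chart_open[OF V(1)] by blast
    have o: "open_ext (coords M) (\<psi> ` ?W)" by (rule chart_image_open[OF V(1) o']) blast
    have "smooth_on (coords M) (\<psi> ` ?W) (\<lambda>x. ?h (inv_into V \<psi> x))"
      using V \<eta>(2) by (subst smooth_on_cong[OF o, where h="\<lambda>x. 0"]) (auto simp: o)
    then show ?thesis using o' V p False K(2) by blast
  qed
qed

text \<open>A product of one-dimensional steps in a chart, extended by \<open>0\<close>. Besides the
  function, a closed set \<open>K\<close> inside \<open>W\<close> is delivered off which it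
  vanishes; the extension by zero of other functions rests on this set.\<close>

lemma bump:
  assumes W: "openin (mtop M) W" "p \<in> W"
  obtains \<eta> N K where "\<eta> \<in> C_inf M" "openin (mtop M) N" "p \<in> N" "N \<subseteq> K" "closedin (mtop M) K" "K \<subseteq> W"
    "\<And>x. x \<in> N \<Longrightarrow> \<eta> x = 1" "\<And>x. x \<in> points M - K \<Longrightarrow> \<eta> x = 0"
proof -
  have p: "p \<in> points M" using W openin_subset by blast
  obtain U \<phi> where U: "(U, \<phi>) \<in> atlas M" "p \<in> U" using chart_at[OF p] .
  define a where "a = \<phi> p"
  have "openin (mtop M) (W \<inter> U)" using W chart_open[OF U(1)] by blast
  then have o: "open_ext (coords M) (\<phi> ` (W \<inter> U))" by (rule chart_image_open[OF U(1)]) simp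
  moreover have "a \<in> \<phi> ` (W \<inter> U)" using W U by (auto simp: a_def)
  ultimately obtain \<epsilon> where e: "\<epsilon> > 0" "ext_box (coords M) a \<epsilon> \<subseteq> \<phi> ` (W \<inter> U)"
    by (rule ext_box_within)
  have aE: "a \<in> extensional (coords M)"
    using open_ext_subset[OF chart_image[OF U(1)]] U by (auto simp: a_def)
  define C where "C = {y \<in> extensional (coords M). \<forall>i\<in>coords M. \<bar>y i - a i\<bar> \<le> \<epsilon> / 2}"
  have CU: "C \<subseteq> \<phi> ` (W \<inter> U)"
    by (rule subset_trans[OF _ e(2)])
       (use e(1) in \<open>auto simp: C_def ext_box_def intro: le_less_trans[of _ "\<epsilon> / 2"]\<close>)
  define K where "K = inv_into U \<phi> ` C"
  have KW: "K \<subseteq> W" and KU: "K \<subseteq> U" using CU U(1) by (auto simp: K_def)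
  have "compactin (top_of_set (\<phi> ` U)) C"
    using compactin_closed_box[of "coords M" a "\<epsilon> / 2"] CU open_ext_subset[OF chart_image[OF U(1)]]
    unfolding C_def[symmetric] compactin_subtopology by blast
  moreover have "homeomorphic_map (top_of_set (\<phi> ` U)) (subtopology (mtop M) U) (inv_into U \<phi>)"
  proof -
    obtain g where g: "homeomorphic_maps (subtopology (mtop M) U) (top_of_set (\<phi> ` U)) \<phi> g"
      using chart_homeo[OF U(1)] homeomorphic_map_maps by blast
    have "inv_into U \<phi> x = g x" if "x \<in> \<phi> ` U" for x
      using g that U(1) chart_subset[OF U(1)] by (auto simp: homeomorphic_maps_def inf_absorb2)
    then show ?thesis using homeomorphic_map_eq[of "top_of_set (\<phi> ` U)" "subtopology (mtop M) U" g] g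
      homeomorphic_maps_imp_map homeomorphic_maps_sym by (metis topspace_euclidean_subtopology)
  qed
  ultimately have "compactin (subtopology (mtop M) U) K"
    unfolding K_def by (intro image_compactin[OF _ homeomorphic_imp_continuous_map])
  then have "compactin (mtop M) K" by (simp add: compactin_subtopology)
  \<comment> \<open>The closed box is compact, and compact sets in a Hausdorff space are closed.
    Closedness inside the chart domain alone would not make the extension by \<open>0\<close>
    smooth.\<close>
  then have K: "closedin (mtop M) K" by (rule compactin_imp_closedin[OF Hausdorff])
  \<comment> \<open>With this value \<open>2 + c * d^2\<close> is at most \<open>0\<close> for
    \<open>d >= \<epsilon> / 2\<close> and at least \<open>1\<close> for
    \<open>d <= \<epsilon> / 4\<close>. The square stands in for the absolute value, which is not
    smooth.\<close>
  define c where "c = - (8 / \<epsilon>\<^sup>2)"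
  define u where "u y = (\<Prod>i\<in>coords M. smooth_step (2 + c * ((y i + - a i) * (y i + - a i))))" for y
  have us: "smooth_on (coords M) (\<phi> ` U) u" unfolding u_def
    by (intro smooth_on_prod smooth_on_step smooth_on_add smooth_on_mult smooth_on_const smooth_on_coord
        chart_image[OF U(1)] finite_coords)
  have u0: "u y = 0" if y: "y \<in> extensional (coords M)" "y \<notin> C" for y
  proof -
    obtain i where i: "i \<in> coords M" "\<bar>y i - a i\<bar> > \<epsilon> / 2" using y by (force simp: C_def)
    then have "(\<epsilon> / 2)\<^sup>2 \<le> \<bar>y i - a i\<bar>\<^sup>2" using e(1) by (intro power_mono) auto
    then have "2 + c * ((y i + - a i) * (y i + - a i)) \<le> 0"
      using e(1) by (simp add: c_def power2_eq_square field_simps)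
    then have "smooth_step (2 + c * ((y i + - a i) * (y i + - a i))) = 0" by (rule smooth_step_0)
    then show ?thesis unfolding u_def using i(1) finite_coords by (intro prod_zero) auto
  qed
  have u1: "u y = 1" if y: "y \<in> ext_box (coords M) a (\<epsilon> / 4)" for y
    unfolding u_def
  proof (intro prod.neutral ballI smooth_step_1)
    fix i assume "i \<in> coords M"
    then have "\<bar>y i - a i\<bar>\<^sup>2 \<le> (\<epsilon> / 4)\<^sup>2" using y e(1) by (intro power_mono) (auto simp: ext_box_def)
    then have "16 * ((y i + - a i) * (y i + - a i)) \<le> \<epsilon>\<^sup>2"
      by (simp add: power_divide power2_eq_square algebra_simps)
    moreover have "0 \<le> (y i + - a i) * (y i + - a i)" by simp
    ultimately have "8 * ((y i + - a i) * (y i + - a i)) \<le> \<epsilon>\<^sup>2" by linarith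
    then have "8 / \<epsilon>\<^sup>2 * ((y i + - a i) * (y i + - a i)) \<le> 1"
      using e(1) by (simp add: divide_le_eq)
    then show "1 \<le> 2 + c * ((y i + - a i) * (y i + - a i))"
      unfolding c_def by linarith
  qed
  define \<eta> where "\<eta> x = (if x \<in> U then u (\<phi> x) else 0)" for x
  have UE: "\<phi> x \<in> extensional (coords M)" if "x \<in> U" for x
    using that open_ext_subset[OF chart_image[OF U(1)]] by auto
  have \<eta>0: "\<eta> x = 0" if "x \<in> points M - K" for x
  proof (cases "x \<in> U")
    case True
    then have "\<phi> x \<notin> C" using that U(1) by (force simp: K_def)
    then show ?thesis using u0 UE True by (simp add: \<eta>_def)
  qed (simp add: \<eta>_def)
  have "\<eta> \<in> C_inf M"
  proof (rule C_inf_localI)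
    fix x assume x: "x \<in> points M"
    show "\<exists>U \<phi> W. (U, \<phi>) \<in> atlas M \<and> openin (mtop M) W \<and> x \<in> W \<and> W \<subseteq> U \<and>
      smooth_on (coords M) (\<phi> ` W) (\<lambda>x. \<eta> (inv_into U \<phi> x))"
    proof (cases "x \<in> U")
      case True
      have "smooth_on (coords M) (\<phi> ` U) (\<lambda>x. \<eta> (inv_into U \<phi> x))"
        using us U by (subst smooth_on_cong[OF chart_image[OF U(1)], where h=u]) (auto simp: \<eta>_def)
      then show ?thesis using U True chart_open[OF U(1)] by blast
    next
      case False
      obtain V \<psi> where V: "(V, \<psi>) \<in> atlas M" "x \<in> V" using chart_at[OF x] .
      let ?W = "V \<inter> (points M - K)"
      have o': "openin (mtop M) ?W" using K chart_open[OF V(1)] by blast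
      have o: "open_ext (coords M) (\<psi> ` ?W)" by (rule chart_image_open[OF V(1) o']) blast
      have "smooth_on (coords M) (\<psi> ` ?W) (\<lambda>x. \<eta> (inv_into V \<psi> x))"
        using V \<eta>0 by (subst smooth_on_cong[OF o, where h="\<lambda>x. 0"]) (auto simp: o)
      then show ?thesis using o' V x False KU by blast
    qed
  qed
  moreover have "openin (mtop M) {x \<in> U. \<phi> x \<in> ext_box (coords M) a (\<epsilon> / 4)}"
    by (rule chart_preimage_open[OF U(1) open_ext_box[OF finite_coords]])
  moreover have "p \<in> {x \<in> U. \<phi> x \<in> ext_box (coords M) a (\<epsilon> / 4)}"
    using U(2) ext_box_self[OF aE] e(1) by (simp add: a_def)
  moreover have "{x \<in> U. \<phi> x \<in> ext_box (coords M) a (\<epsilon> / 4)} \<subseteq> K"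
  proof
    fix x assume x: "x \<in> {x \<in> U. \<phi> x \<in> ext_box (coords M) a (\<epsilon> / 4)}"
    then have "\<phi> x \<in> C" using e(1) by (auto simp: C_def ext_box_def dest!: bspec)
    moreover have "x = inv_into U \<phi> (\<phi> x)" using x U(1) by simp
    ultimately show "x \<in> K" unfolding K_def by blast
  qed
  moreover have "\<eta> x = 1" if "x \<in> {x \<in> U. \<phi> x \<in> ext_box (coords M) a (\<epsilon> / 4)}" for x
    using that u1 by (simp add: \<eta>_def)
  ultimately show thesis using that[of \<eta> _ K] K KW \<eta>0 by blast
qed

text \<open>Tangent vectors act on global functions only. A function given in a chart, such as a
  coordinate, enters through a global function that agrees with it near \<open>p\<close>.\<close>

lemma C_inf_extend:
  assumes U: "(U, \<phi>) \<in> atlas M" and W: "openin (mtop M) W" "p \<in> W" "W \<subseteq> U"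
    and u: "smooth_on (coords M) (\<phi> ` W) u"
  obtains h N where "h \<in> C_inf M" "openin (mtop M) N" "p \<in> N" "N \<subseteq> W" "\<And>x. x \<in> N \<Longrightarrow> h x = u (\<phi> x)"
proof -
  obtain \<eta> N K where \<eta>: "\<eta> \<in> C_inf M" "openin (mtop M) N" "p \<in> N" "N \<subseteq> K" "closedin (mtop M) K" "K \<subseteq> W"
    "\<And>x. x \<in> N \<Longrightarrow> \<eta> x = 1" "\<And>x. x \<in> points M - K \<Longrightarrow> \<eta> x = 0"
    by (rule bump[OF W(1,2)]) blast
  from that[OF C_inf_cut_off[OF U W(1,3) \<eta>(5,6,1,8) u] \<eta>(2,3)] \<eta> show thesis by fastforce
qed

text \<open>The candidate is \<open>f / (f^2 + (1 - \<eta>)^2)\<close>. On \<open>K\<close> the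
  first square is positive, off \<open>K\<close> the second is \<open>1\<close>, and near
  \<open>p\<close>, where \<open>\<eta> = 1\<close>, the quotient is \<open>1 / f\<close>.\<close>

lemma C_inf_local_inverse:
  assumes f: "f \<in> C_inf M" and p: "p \<in> points M" "f p \<noteq> 0"
  obtains h N where "h \<in> C_inf M" "openin (mtop M) N" "p \<in> N" "\<And>x. x \<in> N \<Longrightarrow> h x * f x = 1"
proof -
  let ?W = "{x \<in> points M. f x \<in> - {0}}"
  have W: "openin (mtop M) ?W" by (rule C_inf_preimage_open[OF f]) (simp add: open_Compl)
  have "p \<in> ?W" using p by simp
  obtain \<eta> N K where \<eta>: "\<eta> \<in> C_inf M" "openin (mtop M) N" "p \<in> N" "N \<subseteq> K" "closedin (mtop M) K" "K \<subseteq> ?W"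
    "\<And>x. x \<in> N \<Longrightarrow> \<eta> x = 1" "\<And>x. x \<in> points M - K \<Longrightarrow> \<eta> x = 0"
    by (rule bump[OF W \<open>p \<in> ?W\<close>]) blast
  have "f x * f x + (1 - \<eta> x) * (1 - \<eta> x) \<noteq> 0" if "x \<in> points M" for x
  proof (cases "x \<in> K")
    case True
    then have "f x * f x > 0" using \<eta>(6) by (auto simp: zero_less_mult_iff linorder_neq_iff)
    moreover have "(1 - \<eta> x) * (1 - \<eta> x) \<ge> 0" by simp
    ultimately show ?thesis by linarith
  next
    case False
    then have "\<eta> x = 0" using \<eta>(8) that by blast
    moreover have "f x * f x + 1 > 0" by (simp add: add_nonneg_pos)
    ultimately show ?thesis by simp
  qed
  then have "(\<lambda>x. f x * inverse (f x * f x + (1 - \<eta> x) * (1 - \<eta> x))) \<in> C_inf M"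
    by (rule C_inf_mult[OF f C_inf_inverse[OF C_inf_add[OF C_inf_mult[OF f f]
      C_inf_mult[OF C_inf_diff[OF C_inf_const \<eta>(1)] C_inf_diff[OF C_inf_const \<eta>(1)]]]]])
  then show thesis
  proof (rule that[OF _ \<eta>(2,3)])
    fix x assume "x \<in> N"
    then show "f x * inverse (f x * f x + (1 - \<eta> x) * (1 - \<eta> x)) * f x = 1"
      using subsetD[OF \<eta>(6) subsetD[OF \<eta>(4)], of x] \<eta>(7)[of x] by (auto simp: field_simps)
  qed
qed

section \<open>Tangent vectors and vector fields\<close>

lemma tangent_lin:
  "v \<in> tangent_space M p \<Longrightarrow> f \<in> C_inf M \<Longrightarrow> h \<in> C_inf M \<Longrightarrow> v (\<lambda>x. a * f x + c * h x) = a * v f + c * v h"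
  and tangent_mult:
  "v \<in> tangent_space M p \<Longrightarrow> f \<in> C_inf M \<Longrightarrow> h \<in> C_inf M \<Longrightarrow> v (\<lambda>x. f x * h x) = f p * v h + h p * v f"
  and tangent_off: "v \<in> tangent_space M p \<Longrightarrow> f \<notin> C_inf M \<Longrightarrow> v f = 0"
  by (simp_all add: tangent_space_def)

lemma tangent_add:
  "v \<in> tangent_space M p \<Longrightarrow> f \<in> C_inf M \<Longrightarrow> h \<in> C_inf M \<Longrightarrow> v (\<lambda>x. f x + h x) = v f + v h"
  using tangent_lin[of v p f h 1 1] by simp

lemma tangent_diff:
  "v \<in> tangent_space M p \<Longrightarrow> f \<in> C_inf M \<Longrightarrow> h \<in> C_inf M \<Longrightarrow> v (\<lambda>x. f x - h x) = v f - v h"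
  using tangent_lin[of v p f h 1 "- 1"] by simp

lemma tangent_const: "v \<in> tangent_space M p \<Longrightarrow> v (\<lambda>x. c) = 0"
proof -
  assume v: "v \<in> tangent_space M p"
  have "v (\<lambda>x. 1) = 0" using tangent_mult[OF v C_inf_const[of 1] C_inf_const[of 1]] by simp
  then show ?thesis using tangent_lin[OF v C_inf_const[of 1] C_inf_const[of 1], of c 0] by simp
qed

lemma tangent_power2:
  "v \<in> tangent_space M p \<Longrightarrow> f \<in> C_inf M \<Longrightarrow> v (\<lambda>x. (f x)\<^sup>2) = 2 * f p * v f"
  using tangent_mult[of v p f f] by (simp add: power2_eq_square)

lemma tangent_sum:
  assumes v: "v \<in> tangent_space M p" and f: "\<And>s. s \<in> S \<Longrightarrow> f s \<in> C_inf M"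
  shows "v (\<lambda>x. \<Sum>s\<in>S. f s x) = (\<Sum>s\<in>S. v (f s))"
proof (cases "finite S")
  case True
  then show ?thesis using f
  proof (induction S)
    case (insert s S)
    have "v (\<lambda>x. f s x + (\<Sum>s\<in>S. f s x)) = v (f s) + v (\<lambda>x. \<Sum>s\<in>S. f s x)"
      by (rule tangent_add[OF v insert.prems C_inf_sum[OF insert.prems]]) auto
    then show ?case using insert by simp
  qed (simp add: tangent_const[OF v])
qed (simp add: tangent_const[OF v])

text \<open>The difference \<open>d\<close> of the two functions satisfies \<open>d = d * e\<close>
  with a smooth \<open>e\<close> that vanishes at \<open>p\<close>, as \<open>d\<close> does. The
  Leibniz rule then gives \<open>v d = 0\<close>.\<close>

lemma tangent_local:
  assumes v: "v \<in> tangent_space M p" and W: "openin (mtop M) W" "p \<in> W"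
    and f: "f \<in> C_inf M" and h: "h \<in> C_inf M" and eq: "\<And>x. x \<in> W \<Longrightarrow> f x = h x"
  shows "v f = v h"
proof -
  obtain \<eta> N K where \<eta>: "\<eta> \<in> C_inf M" "openin (mtop M) N" "p \<in> N" "N \<subseteq> K" "closedin (mtop M) K" "K \<subseteq> W"
    "\<And>x. x \<in> N \<Longrightarrow> \<eta> x = 1" "\<And>x. x \<in> points M - K \<Longrightarrow> \<eta> x = 0"
    by (rule bump[OF W]) blast
  have p: "p \<in> points M" using W openin_subset by blast
  define d where "d = (\<lambda>x. f x - h x)"
  \<comment> \<open>The value \<open>1\<close> outside \<open>points M\<close> makes
    \<open>d = d * e\<close> an equation of total functions.\<close>
  define e where "e x = (if x \<in> points M then 1 - \<eta> x else 1)" for x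
  have e: "e \<in> C_inf M"
    using C_inf_cong[of e "\<lambda>x. 1 - \<eta> x"] C_inf_diff[OF C_inf_const \<eta>(1)] by (simp add: e_def)
  have d: "d \<in> C_inf M" unfolding d_def by (rule C_inf_diff[OF f h])
  have "d = (\<lambda>x. d x * e x)"
  proof
    fix x
    show "d x = d x * e x"
    proof (cases "x \<in> W")
      case False
      then have "x \<in> points M \<Longrightarrow> \<eta> x = 0" using \<eta>(6,8) by blast
      then show ?thesis by (simp add: e_def)
    qed (simp add: d_def eq)
  qed
  then have "v d = v (\<lambda>x. d x * e x)" by simp
  also have "\<dots> = d p * v e + e p * v d" by (rule tangent_mult[OF v d e])
  also have "\<dots> = 0" using eq[OF W(2)] p \<eta>(7)[OF \<eta>(3)] by (simp add: d_def e_def)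
  finally show ?thesis using tangent_diff[OF v f h] by (simp add: d_def)
qed

text \<open>Derivations ignore values off \<open>points M\<close>. Functions outside
  \<open>C_inf M\<close> form a separate case, where both sides are \<open>0\<close> by
  convention.\<close>

lemma tangent_cong:
  assumes v: "v \<in> tangent_space M p" and p: "p \<in> points M" and eq: "\<And>x. x \<in> points M \<Longrightarrow> f x = h x"
  shows "v f = v h"
proof (cases "f \<in> C_inf M")
  case True
  then have "h \<in> C_inf M" using C_inf_cong[OF eq] by simp
  then show ?thesis using tangent_local[OF v openin_topspace p True _ eq] by blast
next
  case False
  then have "h \<notin> C_inf M" using C_inf_cong[OF eq] by simp
  then show ?thesis using tangent_off[OF v] False by simp
qed

lemma tangent_comb:
  assumes "u \<in> tangent_space M p" "v \<in> tangent_space M p"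
  shows "(\<lambda>f. a * u f + c * v f) \<in> tangent_space M p"
  unfolding tangent_space_def
proof (intro CollectI conjI ballI allI impI)
  fix f h r s assume fh: "f \<in> C_inf M" "h \<in> C_inf M"
  show "a * u (\<lambda>x. r * f x + s * h x) + c * v (\<lambda>x. r * f x + s * h x) =
    r * (a * u f + c * v f) + s * (a * u h + c * v h)"
    unfolding tangent_lin[OF assms(1) fh] tangent_lin[OF assms(2) fh] by (simp add: algebra_simps)
next
  fix f h assume fh: "f \<in> C_inf M" "h \<in> C_inf M"
  show "a * u (\<lambda>x. f x * h x) + c * v (\<lambda>x. f x * h x) =
    f p * (a * u h + c * v h) + h p * (a * u f + c * v f)"
    unfolding tangent_mult[OF assms(1) fh] tangent_mult[OF assms(2) fh] by (simp add: algebra_simps)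
next
  fix f assume "f \<notin> C_inf M"
  then show "a * u f + c * v f = 0" using tangent_off[OF assms(1)] tangent_off[OF assms(2)] by simp
qed

lemma tangent_zero: "(\<lambda>f. 0) \<in> tangent_space M p"
  by (simp add: tangent_space_def)

lemma tangent_scale: "v \<in> tangent_space M p \<Longrightarrow> (\<lambda>f. c * v f) \<in> tangent_space M p"
  using tangent_comb[of v p v c 0] by simp

lemma tangent_plus: "u \<in> tangent_space M p \<Longrightarrow> v \<in> tangent_space M p \<Longrightarrow> (\<lambda>f. u f + v f) \<in> tangent_space M p"
  using tangent_comb[of u p v 1 1] by simp

lemma tangent_setsum:
  assumes "\<And>s. s \<in> S \<Longrightarrow> v s \<in> tangent_space M p"
  shows "(\<lambda>f. \<Sum>s\<in>S. c s * v s f) \<in> tangent_space M p"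
proof (cases "finite S")
  case True
  then show ?thesis using assms
  proof (induction S)
    case (insert s S)
    have "(\<lambda>f. c s * v s f + 1 * (\<Sum>s\<in>S. c s * v s f)) \<in> tangent_space M p"
      by (rule tangent_comb[OF insert.prems insert.IH]) (auto intro: insert.prems)
    then show ?case using insert.hyps by simp
  qed (simp add: tangent_zero)
qed (simp add: tangent_zero)

section \<open>Coordinate functions, local frames and extensions of vectors\<close>

lemma chart_coordinates:
  assumes U: "(U, \<phi>) \<in> atlas M" and p: "p \<in> U"
  obtains x N where "openin (mtop M) N" "p \<in> N" "N \<subseteq> U" "\<And>i. i \<in> coords M \<Longrightarrow> x i \<in> C_inf M"
    "\<And>i q. i \<in> coords M \<Longrightarrow> q \<in> N \<Longrightarrow> x i q = \<phi> q i"
proof -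
  have "\<exists>h N. h \<in> C_inf M \<and> openin (mtop M) N \<and> p \<in> N \<and> N \<subseteq> U \<and> (\<forall>q\<in>N. h q = \<phi> q i)"
    if i: "i \<in> coords M" for i
  proof -
    obtain h N where "h \<in> C_inf M" "openin (mtop M) N" "p \<in> N" "N \<subseteq> U" "\<And>x. x \<in> N \<Longrightarrow> h x = (\<lambda>y. y i) (\<phi> x)"
      by (rule C_inf_extend[where u="\<lambda>y. y i", OF U chart_open[OF U] p subset_refl smooth_on_coord[OF chart_image[OF U] i]]) blast
    then show ?thesis by (intro exI[of _ h] exI[of _ N]) auto
  qed
  then obtain x N where xN: "\<And>i. i \<in> coords M \<Longrightarrow> x i \<in> C_inf M \<and> openin (mtop M) (N i) \<and> p \<in> N i \<and>
      N i \<subseteq> U \<and> (\<forall>q\<in>N i. x i q = \<phi> q i)" by metis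
  have fin: "finite (insert U (N ` coords M))" using finite_coords by simp
  have "openin (mtop M) (\<Inter>(insert U (N ` coords M)))"
    by (rule openin_Inter[OF fin]) (use xN chart_open[OF U] in auto)
  then show thesis
    by (rule that[where x=x]) (use xN p in auto)
qed

text \<open>Hadamard's expansion at \<open>q\<close> writes \<open>f\<close> as a constant plus
  products of \<open>x i - a i\<close> with smooth functions; by the Leibniz rule only the
  derivative of the vanishing factor survives. The same functions \<open>x i\<close> serve all
  points \<open>q\<close> of \<open>N\<close>, which makes the coefficients of a vector field
  smooth.\<close>

lemma coordinate_formula:
  assumes U: "(U, \<phi>) \<in> atlas M" and N: "openin (mtop M) N" "N \<subseteq> U" "q \<in> N"
    and x: "\<And>i. i \<in> coords M \<Longrightarrow> x i \<in> C_inf M"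
      "\<And>i q. i \<in> coords M \<Longrightarrow> q \<in> N \<Longrightarrow> x i q = \<phi> q i"
    and v: "v \<in> tangent_space M q" and f: "f \<in> C_inf M"
  shows "v f = (\<Sum>i\<in>coords M. v (x i) * pd i (\<lambda>y. f (inv_into U \<phi> y)) (\<phi> q))"
proof -
  define a where "a = \<phi> q"
  have qU: "q \<in> U" using N by blast
  have aU: "a \<in> \<phi> ` U" using qU by (simp add: a_def)
  obtain \<epsilon> where e: "\<epsilon> > 0" "ext_box (coords M) a \<epsilon> \<subseteq> \<phi> ` U"
    by (rule ext_box_within[OF chart_image[OF U] aU])
  have aE: "a \<in> extensional (coords M)" using aU open_ext_subset[OF chart_image[OF U]] by blast
  have box: "open_ext (coords M) (ext_box (coords M) a \<epsilon>)" by (rule open_ext_box[OF finite_coords])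
  obtain G where G: "\<And>i. i \<in> coords M \<Longrightarrow> smooth_on (coords M) (ext_box (coords M) a \<epsilon>) (G i)"
    "\<And>i. i \<in> coords M \<Longrightarrow> G i a = pd i (\<lambda>y. f (inv_into U \<phi> y)) a"
    "\<And>y. y \<in> ext_box (coords M) a \<epsilon> \<Longrightarrow> f (inv_into U \<phi> y) = f (inv_into U \<phi> a) + (\<Sum>i\<in>coords M. (y i - a i) * G i y)"
    by (rule hadamard[OF finite_coords e(1) aE smooth_on_subset[OF chart_image[OF U] box e(2) C_infD[OF f U]]]) blast
  define W where "W = {z \<in> U. \<phi> z \<in> ext_box (coords M) a \<epsilon>}"
  have W: "openin (mtop M) W" "q \<in> W" "W \<subseteq> U"
    using chart_preimage_open[OF U box] ext_box_self[OF aE e(1)] qU by (auto simp: W_def a_def)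
  have "\<exists>h N. h \<in> C_inf M \<and> openin (mtop M) N \<and> q \<in> N \<and> N \<subseteq> W \<and> (\<forall>z\<in>N. h z = G i (\<phi> z))"
    if "i \<in> coords M" for i
  proof -
    have "smooth_on (coords M) (\<phi> ` W) (G i)"
      by (rule smooth_on_subset[OF box chart_image_open[OF U W(1,3)] _ G(1)[OF that]]) (auto simp: W_def)
    then obtain h N where "h \<in> C_inf M" "openin (mtop M) N" "q \<in> N" "N \<subseteq> W" "\<And>z. z \<in> N \<Longrightarrow> h z = G i (\<phi> z)"
      by (rule C_inf_extend[OF U W]) blast
    then show ?thesis by (intro exI[of _ h] exI[of _ N]) auto
  qed
  then obtain h N' where h: "\<And>i. i \<in> coords M \<Longrightarrow> h i \<in> C_inf M \<and> openin (mtop M) (N' i) \<and> q \<in> N' i \<and>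
      N' i \<subseteq> W \<and> (\<forall>z\<in>N' i. h i z = G i (\<phi> z))" by metis
  let ?N = "\<Inter>(insert N (insert W (N' ` coords M)))"
  have "openin (mtop M) ?N"
    by (rule openin_Inter) (use h N W finite_coords in auto)
  moreover have "q \<in> ?N" using h N W by auto
  ultimately have "v f = v (\<lambda>z. f q + (\<Sum>i\<in>coords M. (x i z - a i) * h i z))"
  proof (rule tangent_local[OF v _ _ f])
    show "(\<lambda>z. f q + (\<Sum>i\<in>coords M. (x i z - a i) * h i z)) \<in> C_inf M"
      by (rule C_inf_add[OF C_inf_const C_inf_sum[OF C_inf_mult[OF C_inf_diff[OF x(1) C_inf_const]]]])
         (use h in auto)
    fix z assume z: "z \<in> ?N"
    then have zW: "z \<in> W" "z \<in> N" by auto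
    then have "f z = f (inv_into U \<phi> (\<phi> z))" using U W(3) by auto
    also have "\<dots> = f (inv_into U \<phi> a) + (\<Sum>i\<in>coords M. (\<phi> z i - a i) * G i (\<phi> z))"
      by (rule G(3)) (use zW in \<open>simp add: W_def\<close>)
    also have "f (inv_into U \<phi> a) = f q" using U qU by (simp add: a_def)
    also have "(\<Sum>i\<in>coords M. (\<phi> z i - a i) * G i (\<phi> z)) = (\<Sum>i\<in>coords M. (x i z - a i) * h i z)"
    proof (rule sum.cong[OF refl])
      fix i assume i: "i \<in> coords M"
      then have "z \<in> N' i" using z by auto
      then show "(\<phi> z i - a i) * G i (\<phi> z) = (x i z - a i) * h i z" using h[OF i] x(2)[OF i zW(2)] by simp
    qed
    finally show "f z = f q + (\<Sum>i\<in>coords M. (x i z - a i) * h i z)" .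
  qed
  also have "\<dots> = v (\<lambda>z. f q) + v (\<lambda>z. \<Sum>i\<in>coords M. (x i z - a i) * h i z)"
    by (rule tangent_add[OF v C_inf_const C_inf_sum[OF C_inf_mult[OF C_inf_diff[OF x(1) C_inf_const]]]])
       (use h in auto)
  also have "\<dots> = (\<Sum>i\<in>coords M. v (\<lambda>z. (x i z - a i) * h i z))"
    by (subst tangent_sum[OF v C_inf_mult[OF C_inf_diff[OF x(1) C_inf_const]]])
       (use h in \<open>auto simp: tangent_const[OF v]\<close>)
  also have "\<dots> = (\<Sum>i\<in>coords M. v (x i) * pd i (\<lambda>y. f (inv_into U \<phi> y)) (\<phi> q))"
  proof (rule sum.cong[OF refl])
    fix i assume i: "i \<in> coords M"
    have hi: "h i \<in> C_inf M" "h i q = G i a" using h[OF i] by (auto simp: a_def)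
    have "v (\<lambda>z. (x i z - a i) * h i z) = (x i q - a i) * v (h i) + h i q * v (\<lambda>z. x i z - a i)"
      by (rule tangent_mult[OF v C_inf_diff[OF x(1)[OF i] C_inf_const] hi(1)])
    also have "x i q - a i = 0" using x(2)[OF i N(3)] by (simp add: a_def)
    also have "v (\<lambda>z. x i z - a i) = v (x i)"
      using tangent_diff[OF v x(1)[OF i] C_inf_const] by (simp add: tangent_const[OF v])
    finally show "v (\<lambda>z. (x i z - a i) * h i z) = v (x i) * pd i (\<lambda>y. f (inv_into U \<phi> y)) (\<phi> q)"
      using hi(2) G(2)[OF i] by (simp add: a_def)
  qed
  finally show ?thesis .
qed

text \<open>Functions and fields are global, while the relations between coordinates and coordinate
  fields are imposed on \<open>N\<close> only. The coefficients of \<open>v\<close> are the numbers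
  \<open>v (x i)\<close>, hence smooth for a smooth field.\<close>

definition local_frame :: "'a set \<Rightarrow> ('i \<Rightarrow> 'a \<Rightarrow> real) \<Rightarrow> ('i \<Rightarrow> 'a vfield) \<Rightarrow> bool" where
  "local_frame N x E \<longleftrightarrow> openin (mtop M) N \<and> (\<forall>i\<in>coords M. x i \<in> C_inf M \<and> E i \<in> \<Gamma> M) \<and>
    (\<forall>q\<in>N. \<forall>v\<in>tangent_space M q. \<forall>f\<in>C_inf M. v f = (\<Sum>i\<in>coords M. v (x i) * E i q f)) \<and>
    (\<forall>q\<in>N. \<forall>i\<in>coords M. \<forall>j\<in>coords M. E i q (x j) = (if i = j then 1 else 0))"

lemma local_frameD:
  assumes "local_frame N x E"
  shows "openin (mtop M) N" "i \<in> coords M \<Longrightarrow> x i \<in> C_inf M" "i \<in> coords M \<Longrightarrow> E i \<in> \<Gamma> M"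
    "q \<in> N \<Longrightarrow> v \<in> tangent_space M q \<Longrightarrow> f \<in> C_inf M \<Longrightarrow> v f = (\<Sum>i\<in>coords M. v (x i) * E i q f)"
    "q \<in> N \<Longrightarrow> i \<in> coords M \<Longrightarrow> j \<in> coords M \<Longrightarrow> E i q (x j) = (if i = j then 1 else 0)"
  using assms unfolding local_frame_def by simp_all

lemma vfield_tangent: "X \<in> \<Gamma> M \<Longrightarrow> p \<in> points M \<Longrightarrow> X p \<in> tangent_space M p"
  and vfield_smooth: "X \<in> \<Gamma> M \<Longrightarrow> f \<in> C_inf M \<Longrightarrow> X \<rhd> f \<in> C_inf M"
  and vfield_smooth': "X \<in> \<Gamma> M \<Longrightarrow> f \<in> C_inf M \<Longrightarrow> (\<lambda>p. X p f) \<in> C_inf M"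
  by (auto simp: vfields_def vfield_app_def)

lemma vfieldI:
  "(\<And>p. p \<in> points M \<Longrightarrow> X p \<in> tangent_space M p) \<Longrightarrow> (\<And>f. f \<in> C_inf M \<Longrightarrow> (\<lambda>p. X p f) \<in> C_inf M) \<Longrightarrow> X \<in> \<Gamma> M"
  by (simp add: vfields_def vfield_app_def)

text \<open>The coordinate derivations become global fields after multiplication by a bump function;
  they keep their values on the smaller set \<open>N'\<close>, where that function is
  \<open>1\<close>.\<close>

lemma chart_frame:
  assumes U: "(U, \<phi>) \<in> atlas M" and N: "openin (mtop M) N" "p \<in> N" "N \<subseteq> U"
    and x: "\<And>i. i \<in> coords M \<Longrightarrow> x i \<in> C_inf M" "\<And>i q. i \<in> coords M \<Longrightarrow> q \<in> N \<Longrightarrow> x i q = \<phi> q i"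
  obtains E N' where "p \<in> N'" "N' \<subseteq> N" "local_frame N' x E"
    "\<And>q f i. q \<in> N' \<Longrightarrow> i \<in> coords M \<Longrightarrow> f \<in> C_inf M \<Longrightarrow> E i q f = pd i (\<lambda>y. f (inv_into U \<phi> y)) (\<phi> q)"
proof -
  obtain \<eta> N' K where \<eta>: "\<eta> \<in> C_inf M" "openin (mtop M) N'" "p \<in> N'" "N' \<subseteq> K" "closedin (mtop M) K" "K \<subseteq> N"
    "\<And>x. x \<in> N' \<Longrightarrow> \<eta> x = 1" "\<And>x. x \<in> points M - K \<Longrightarrow> \<eta> x = 0"
    by (rule bump[OF N(1,2)]) blast
  define D where "D i q f = pd i (\<lambda>y. f (inv_into U \<phi> y)) (\<phi> q)" for i q f
  \<comment> \<open>The outer test enforces the convention that tangent vectors are \<open>0\<close>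
    off \<open>C_inf M\<close>; the inner one is the extension by zero.\<close>
  define E where "E i q f = (if f \<in> C_inf M then if q \<in> N then \<eta> q * D i q f else 0 else 0)" for i q f
  have D1: "D i q (\<lambda>x. a * f x + c * h x) = a * D i q f + c * D i q h"
    and D2: "D i q (\<lambda>x. f x * h x) = f q * D i q h + h q * D i q f"
    if "i \<in> coords M" "q \<in> U" "f \<in> C_inf M" "h \<in> C_inf M" for i q f h a c
    using pd_lin[OF chart_image[OF U] C_infD[OF that(3) U] C_infD[OF that(4) U] that(1), of "\<phi> q"] that(2) U
    by (simp_all add: D_def)
  have E_\<Gamma>: "E i \<in> \<Gamma> M" if i: "i \<in> coords M" for i
  proof (rule vfieldI)
    fix q assume "q \<in> points M"
    show "E i q \<in> tangent_space M q"
      unfolding tangent_space_def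
    proof (intro CollectI conjI ballI allI impI)
      fix f h a c assume fh: "f \<in> C_inf M" "h \<in> C_inf M"
      have "(\<lambda>x. a * f x + c * h x) \<in> C_inf M" by (intro C_inf_add C_inf_cmult fh)
      then show "E i q (\<lambda>x. a * f x + c * h x) = a * E i q f + c * E i q h"
        using D1[OF i _ fh, of q] N(3) fh by (auto simp: E_def algebra_simps)
    next
      fix f h assume fh: "f \<in> C_inf M" "h \<in> C_inf M"
      have "(\<lambda>x. f x * h x) \<in> C_inf M" by (intro C_inf_mult fh)
      then show "E i q (\<lambda>x. f x * h x) = f q * E i q h + h q * E i q f"
        using D2[OF i _ fh, of q] N(3) fh by (auto simp: E_def algebra_simps)
    qed (simp add: E_def)
  next
    fix f assume f: "f \<in> C_inf M"
    have "(\<lambda>q. if q \<in> N then \<eta> q * pd i (\<lambda>y. f (inv_into U \<phi> y)) (\<phi> q) else 0) \<in> C_inf M"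
      by (rule C_inf_cut_off[OF U N(1,3) \<eta>(5,6,1,8) smooth_on_subset[OF chart_image[OF U] chart_image_open[OF U N(1,3)]
        _ smooth_on_pd[OF chart_image[OF U] C_infD[OF f U] i]]]) (use N(3) in auto)
    then show "(\<lambda>q. E i q f) \<in> C_inf M" unfolding E_def D_def using f by simp
  qed
  have E_eq: "E i q f = D i q f" if "q \<in> N'" "f \<in> C_inf M" for q f i
  proof -
    have "q \<in> N" using \<eta>(4,6) that(1) by blast
    then show ?thesis using that \<eta>(7) by (simp add: E_def)
  qed
  have "local_frame N' x E"
    unfolding local_frame_def
  proof (intro conjI ballI)
    fix q v f assume q: "q \<in> N'" and v: "v \<in> tangent_space M q" "f \<in> C_inf M"
    have qN: "q \<in> N" using \<eta>(4,6) q by blast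
    show "v f = (\<Sum>i\<in>coords M. v (x i) * E i q f)"
      using coordinate_formula[OF U N(1,3) qN x v] by (simp add: E_eq[OF q v(2)] D_def)
  next
    fix q i j assume q: "q \<in> N'" and ij: "i \<in> coords M" "j \<in> coords M"
    have qN: "q \<in> N" using \<eta>(4,6) q by blast
    have o: "open_ext (coords M) (\<phi> ` N)" by (rule chart_image_open[OF U N(1,3)])
    have "pd i (\<lambda>y. x j (inv_into U \<phi> y)) (\<phi> q) = pd i (\<lambda>y. y j) (\<phi> q)"
    proof (rule pd_cong[OF o _ ij(1)])
      fix y assume "y \<in> \<phi> ` N"
      then obtain z where "z \<in> N" "y = \<phi> z" by blast
      then show "x j (inv_into U \<phi> y) = y j" using x(2)[OF ij(2)] N(3) U by auto
    qed (use qN in blast)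
    then show "E i q (x j) = (if i = j then 1 else 0)"
      using E_eq[OF q x(1)[OF ij(2)]] by (simp add: D_def pd_coord)
  qed (use \<eta> x E_\<Gamma> in auto)
  then show thesis using that[of N' E] \<eta> E_eq by (auto simp: D_def)
qed

lemma frame_exists:
  assumes "p \<in> points M"
  obtains N x E where "p \<in> N" "local_frame N x E"
proof -
  obtain U \<phi> where U: "(U, \<phi>) \<in> atlas M" "p \<in> U" by (rule chart_at[OF assms])
  obtain x N where x: "openin (mtop M) N" "p \<in> N" "N \<subseteq> U" "\<And>i. i \<in> coords M \<Longrightarrow> x i \<in> C_inf M"
    "\<And>i q. i \<in> coords M \<Longrightarrow> q \<in> N \<Longrightarrow> x i q = \<phi> q i"
    by (rule chart_coordinates[OF U]) blast
  show thesis by (rule chart_frame[OF U(1) x]) (assumption | rule that)+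
qed

lemma vfield_setsum:
  assumes "\<And>s. s \<in> S \<Longrightarrow> X s \<in> \<Gamma> M" "\<And>s. s \<in> S \<Longrightarrow> a s \<in> C_inf M"
  shows "(\<lambda>p f. \<Sum>s\<in>S. a s p * X s p f) \<in> \<Gamma> M"
  by (rule vfieldI, rule tangent_setsum[OF vfield_tangent[OF assms(1)]], assumption+)
     (rule C_inf_sum[OF C_inf_mult[OF assms(2) vfield_smooth'[OF assms(1)]]])

lemma vfield_comb:
  assumes "X \<in> \<Gamma> M" "Y \<in> \<Gamma> M" "a \<in> C_inf M" "c \<in> C_inf M"
  shows "(\<lambda>p f. a p * X p f + c p * Y p f) \<in> \<Gamma> M"
  by (rule vfieldI, rule tangent_comb[OF vfield_tangent[OF assms(1)] vfield_tangent[OF assms(2)]], assumption+)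
     (rule C_inf_add[OF C_inf_mult[OF assms(3) vfield_smooth'[OF assms(1)]] C_inf_mult[OF assms(4) vfield_smooth'[OF assms(2)]]])

lemma frame_expansion:
  assumes "local_frame N x E" "q \<in> N" "v \<in> tangent_space M q"
  shows "v = (\<lambda>f. \<Sum>i\<in>coords M. v (x i) * E i q f)"
proof
  fix f
  show "v f = (\<Sum>i\<in>coords M. v (x i) * E i q f)"
  proof (cases "f \<in> C_inf M")
    case True
    then show ?thesis using local_frameD(4)[OF assms(1-3)] by simp
  next
    case False
    have "q \<in> points M" using local_frameD(1)[OF assms(1)] assms(2) openin_subset by blast
    then have "E i q f = 0" if "i \<in> coords M" for i
      using tangent_off[OF vfield_tangent[OF local_frameD(3)[OF assms(1) that]] False] by simp
    then show ?thesis using tangent_off[OF assms(3) False] by simp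
  qed
qed

text \<open>Freezing the coefficients of \<open>v\<close> in a frame around \<open>p\<close> gives a
  smooth field, because the frame fields are global.\<close>

lemma vfield_extension:
  assumes "p \<in> points M" "v \<in> tangent_space M p"
  obtains Z where "Z \<in> \<Gamma> M" "Z p = v"
proof -
  obtain N x E where F: "p \<in> N" "local_frame N x E" by (rule frame_exists[OF assms(1)])
  have "(\<lambda>q f. \<Sum>i\<in>coords M. v (x i) * E i q f) \<in> \<Gamma> M"
    by (rule vfield_setsum[OF local_frameD(3)[OF F(2)] C_inf_const])
  from that[OF this] show thesis using frame_expansion[OF F(2,1) assms(2)] by simp
qed

section \<open>Brackets and tensoriality\<close>

lemma bracket_vfield:
  assumes X: "X \<in> \<Gamma> M" and Y: "Y \<in> \<Gamma> M"
  shows "bracket X Y \<in> \<Gamma> M"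
proof (rule vfieldI)
  fix p assume p: "p \<in> points M"
  note Xp = vfield_tangent[OF X p] and Yp = vfield_tangent[OF Y p]
  show "bracket X Y p \<in> tangent_space M p"
    unfolding tangent_space_def
  proof (intro CollectI conjI ballI allI impI)
    fix f h a c assume fh: "f \<in> C_inf M" "h \<in> C_inf M"
    have *: "v (Z \<rhd> (\<lambda>x. a * f x + c * h x)) = a * v (Z \<rhd> f) + c * v (Z \<rhd> h)"
      if v: "v \<in> tangent_space M p" and Z: "Z \<in> \<Gamma> M" for v Z
    proof -
      have "v (Z \<rhd> (\<lambda>x. a * f x + c * h x)) = v (\<lambda>q. a * (Z \<rhd> f) q + c * (Z \<rhd> h) q)"
        by (rule tangent_cong[OF v p]) (simp add: vfield_app_def tangent_lin[OF vfield_tangent[OF Z] fh])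
      then show ?thesis using tangent_lin[OF v vfield_smooth[OF Z fh(1)] vfield_smooth[OF Z fh(2)]] by simp
    qed
    show "bracket X Y p (\<lambda>x. a * f x + c * h x) = a * bracket X Y p f + c * bracket X Y p h"
      by (simp add: bracket_def *[OF Xp Y] *[OF Yp X] algebra_simps)
  next
    fix f h assume fh: "f \<in> C_inf M" "h \<in> C_inf M"
    have *: "v (Z \<rhd> (\<lambda>x. f x * h x)) = f p * v (Z \<rhd> h) + Z p h * v f + (h p * v (Z \<rhd> f) + Z p f * v h)"
      if v: "v \<in> tangent_space M p" and Z: "Z \<in> \<Gamma> M" for v Z
    proof -
      note s = vfield_smooth[OF Z fh(1)] vfield_smooth[OF Z fh(2)]
      have "v (Z \<rhd> (\<lambda>x. f x * h x)) = v (\<lambda>q. f q * (Z \<rhd> h) q + h q * (Z \<rhd> f) q)"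
        by (rule tangent_cong[OF v p]) (simp add: vfield_app_def tangent_mult[OF vfield_tangent[OF Z] fh])
      also have "\<dots> = v (\<lambda>q. f q * (Z \<rhd> h) q) + v (\<lambda>q. h q * (Z \<rhd> f) q)"
        by (intro tangent_add[OF v] C_inf_mult fh s)
      finally show ?thesis using tangent_mult[OF v fh(1) s(2)] tangent_mult[OF v fh(2) s(1)]
        by (simp add: vfield_app_def)
    qed
    show "bracket X Y p (\<lambda>x. f x * h x) = f p * bracket X Y p h + h p * bracket X Y p f"
      by (simp add: bracket_def *[OF Xp Y] *[OF Yp X] algebra_simps)
  next
    fix f assume f: "f \<notin> C_inf M"
    have *: "v (Z \<rhd> f) = 0" if v: "v \<in> tangent_space M p" and Z: "Z \<in> \<Gamma> M" for v Z
    proof -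
      have "v (Z \<rhd> f) = v (\<lambda>q. 0)"
        by (rule tangent_cong[OF v p]) (simp add: vfield_app_def tangent_off[OF vfield_tangent[OF Z] f])
      then show ?thesis by (simp add: tangent_const[OF v])
    qed
    show "bracket X Y p f = 0" by (simp add: bracket_def *[OF Xp Y] *[OF Yp X])
  qed
next
  fix f assume f: "f \<in> C_inf M"
  show "(\<lambda>p. bracket X Y p f) \<in> C_inf M"
    unfolding bracket_def
    by (rule C_inf_diff[OF vfield_smooth'[OF X vfield_smooth[OF Y f]] vfield_smooth'[OF Y vfield_smooth[OF X f]]])
qed

lemma bracket_cong:
  assumes "X \<in> \<Gamma> M" "Y \<in> \<Gamma> M" "\<And>q. q \<in> points M \<Longrightarrow> X q = X' q" "\<And>q. q \<in> points M \<Longrightarrow> Y q = Y' q"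
    and p: "p \<in> points M"
  shows "bracket X Y p = bracket X' Y' p"
proof
  fix f
  have "X p (Y \<rhd> f) = X p (Y' \<rhd> f)" "Y p (X \<rhd> f) = Y p (X' \<rhd> f)"
    by (rule tangent_cong[OF vfield_tangent[OF _ p] p]; simp add: assms vfield_app_def)+
  then show "bracket X Y p f = bracket X' Y' p f" using assms by (simp add: bracket_def)
qed

lemma bracket_antisym: "bracket X Y p f = - bracket Y X p f"
  by (simp add: bracket_def)

lemma bracket_comb:
  assumes Y: "Y \<in> \<Gamma> M" and Z: "Z \<in> \<Gamma> M" and W: "W \<in> \<Gamma> M" and a: "a \<in> C_inf M" and c: "c \<in> C_inf M"
    and p: "p \<in> points M"
  shows "bracket Y (\<lambda>q f. a q * Z q f + c q * W q f) p f =
    a p * bracket Y Z p f + c p * bracket Y W p f + Y p a * Z p f + Y p c * W p f"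
proof (cases "f \<in> C_inf M")
  case f: True
  note Yp = vfield_tangent[OF Y p]
  have "Y p ((\<lambda>q f. a q * Z q f + c q * W q f) \<rhd> f) =
      Y p (\<lambda>q. a q * (Z \<rhd> f) q) + Y p (\<lambda>q. c q * (W \<rhd> f) q)"
    unfolding vfield_app_def
    by (rule tangent_add[OF Yp C_inf_mult[OF a vfield_smooth'[OF Z f]] C_inf_mult[OF c vfield_smooth'[OF W f]]])
  then show ?thesis
    using tangent_mult[OF Yp a vfield_smooth[OF Z f]] tangent_mult[OF Yp c vfield_smooth[OF W f]]
    by (simp add: bracket_def vfield_app_def algebra_simps)
next
  case False
  note b = tangent_off[OF vfield_tangent[OF bracket_vfield p] False]
  show ?thesis
    by (simp add: b[OF Y Z] b[OF Y W] b[OF Y vfield_comb[OF Z W a c]]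
        tangent_off[OF vfield_tangent[OF Z p] False] tangent_off[OF vfield_tangent[OF W p] False])
qed

text \<open>After multiplication by a bump function a field is a combination of global frame fields,
  so linearity over smooth functions expresses \<open>A Z\<close> through the values
  \<open>Z p (x i)\<close> alone. The premise \<open>cong\<close> is there because the expansion
  holds at points of the manifold, not as an equation of total functions.\<close>

lemma tensorial:
  fixes A :: "'a vfield \<Rightarrow> real"
  assumes cong: "\<And>Z Z'. Z \<in> \<Gamma> M \<Longrightarrow> Z' \<in> \<Gamma> M \<Longrightarrow> (\<And>q. q \<in> points M \<Longrightarrow> Z q = Z' q) \<Longrightarrow> A Z = A Z'"
    and lin: "\<And>Z W a c. Z \<in> \<Gamma> M \<Longrightarrow> W \<in> \<Gamma> M \<Longrightarrow> a \<in> C_inf M \<Longrightarrow> c \<in> C_inf M \<Longrightarrow>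
      A (\<lambda>q f. a q * Z q f + c q * W q f) = a p * A Z + c p * A W"
    and p: "p \<in> points M" and Z: "Z \<in> \<Gamma> M" "Z' \<in> \<Gamma> M" "Z p = Z' p"
  shows "A Z = A Z'"
proof -
  have zero: "A (\<lambda>q f. 0) = 0"
    using lin[OF Z(1,1) C_inf_const[of 0] C_inf_const[of 0]] by simp
  have sum: "A (\<lambda>q f. \<Sum>s\<in>S. a s q * X s q f) = (\<Sum>s\<in>S. a s p * A (X s))"
    if "finite S" "\<And>s. s \<in> S \<Longrightarrow> X s \<in> \<Gamma> M" "\<And>s. s \<in> S \<Longrightarrow> a s \<in> C_inf M" for S :: "'i set" and a X
    using that
  proof (induction S)
    case (insert s S)
    have "A (\<lambda>q f. a s q * X s q f + 1 * (\<Sum>s\<in>S. a s q * X s q f)) =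
        a s p * A (X s) + 1 * A (\<lambda>q f. \<Sum>s\<in>S. a s q * X s q f)"
      by (rule lin[OF insert.prems(1) vfield_setsum[OF insert.prems] insert.prems(2) C_inf_const]) auto
    then show ?case using insert by simp
  qed (simp add: zero)
  obtain N x E where F: "p \<in> N" "local_frame N x E" by (rule frame_exists[OF p])
  obtain \<eta> N' K where \<eta>: "\<eta> \<in> C_inf M" "openin (mtop M) N'" "p \<in> N'" "N' \<subseteq> K" "closedin (mtop M) K" "K \<subseteq> N"
    "\<And>x. x \<in> N' \<Longrightarrow> \<eta> x = 1" "\<And>x. x \<in> points M - K \<Longrightarrow> \<eta> x = 0"
    by (rule bump[OF local_frameD(1)[OF F(2)] F(1)]) blast
  have main: "A Z = (\<Sum>i\<in>coords M. Z p (x i) * A (E i))" if Z: "Z \<in> \<Gamma> M" for Z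
  proof -
    \<comment> \<open>The cut-off is \<open>1\<close> at \<open>p\<close>, so by linearity
      \<open>A\<close> does not notice it. The term with coefficient \<open>0\<close> fits the
      two-term form of \<open>lin\<close>.\<close>
    have "A Z = A (\<lambda>q f. \<eta> q * Z q f + 0 * Z q f)"
      using lin[OF Z Z \<eta>(1) C_inf_const[of 0]] \<eta>(7)[OF \<eta>(3)] by simp
    also have "\<dots> = A (\<lambda>q f. \<Sum>i\<in>coords M. (\<eta> q * Z q (x i)) * E i q f)"
    proof (rule cong)
      show "(\<lambda>q f. \<eta> q * Z q f + 0 * Z q f) \<in> \<Gamma> M"
        by (rule vfield_comb[OF Z Z \<eta>(1) C_inf_const])
      show "(\<lambda>q f. \<Sum>i\<in>coords M. (\<eta> q * Z q (x i)) * E i q f) \<in> \<Gamma> M"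
        by (rule vfield_setsum[OF local_frameD(3)[OF F(2)] C_inf_mult[OF \<eta>(1) vfield_smooth'[OF Z local_frameD(2)[OF F(2)]]]])
      fix q assume q: "q \<in> points M"
      show "(\<lambda>f. \<eta> q * Z q f + 0 * Z q f) = (\<lambda>f. \<Sum>i\<in>coords M. (\<eta> q * Z q (x i)) * E i q f)"
      proof
        fix f
        show "\<eta> q * Z q f + 0 * Z q f = (\<Sum>i\<in>coords M. (\<eta> q * Z q (x i)) * E i q f)"
        proof (cases "q \<in> K")
          case True
          then have "q \<in> N" using \<eta>(6) by blast
          from fun_cong[OF frame_expansion[OF F(2) this vfield_tangent[OF Z q]], of f]
          show ?thesis by (simp add: sum_distrib_left mult_ac)
        next
          case False
          then show ?thesis using \<eta>(8) q by simp
        qed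
      qed
    qed
    also have "\<dots> = (\<Sum>i\<in>coords M. (\<eta> p * Z p (x i)) * A (E i))"
      by (rule sum[OF finite_coords local_frameD(3)[OF F(2)]
          C_inf_mult[OF \<eta>(1) vfield_smooth'[OF Z local_frameD(2)[OF F(2)]]]])
    finally show ?thesis using \<eta>(7)[OF \<eta>(3)] by simp
  qed
  show ?thesis using main[OF Z(1)] main[OF Z(2)] Z(3) by simp
qed

end

section \<open>Koszul forms\<close>

lemma (in charted) tangent_lin2:
  assumes v: "v \<in> tangent_space M p" and "a \<in> C_inf M" "f \<in> C_inf M" "c \<in> C_inf M" "h \<in> C_inf M"
  shows "v (\<lambda>q. a q * f q + c q * h q) = (a p * v f + f p * v a) + (c p * v h + h p * v c)"
  using tangent_add[OF v C_inf_mult[OF assms(2,3)] C_inf_mult[OF assms(4,5)]]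
    tangent_mult[OF v assms(2,3)] tangent_mult[OF v assms(4,5)] by simp

locale ap_mfd = charted M for M :: "('a, 'i) almost_product" +
  assumes metric_sym: "p \<in> points M \<Longrightarrow> u \<in> tangent_space M p \<Longrightarrow> v \<in> tangent_space M p \<Longrightarrow>
      metric M p u v = metric M p v u"
    and metric_lin: "p \<in> points M \<Longrightarrow> u \<in> tangent_space M p \<Longrightarrow> v \<in> tangent_space M p \<Longrightarrow> w \<in> tangent_space M p \<Longrightarrow>
      metric M p (\<lambda>f. a * u f + c * v f) w = a * metric M p u w + c * metric M p v w"
    and inner_smooth: "X \<in> \<Gamma> M \<Longrightarrow> Y \<in> \<Gamma> M \<Longrightarrow> inner_vf M X Y \<in> C_inf M"
    and endo_in: "p \<in> points M \<Longrightarrow> v \<in> tangent_space M p \<Longrightarrow> endo M p v \<in> tangent_space M p"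
    and endo_invol: "p \<in> points M \<Longrightarrow> v \<in> tangent_space M p \<Longrightarrow> endo M p (endo M p v) = v"
    and endo_lin: "p \<in> points M \<Longrightarrow> u \<in> tangent_space M p \<Longrightarrow> v \<in> tangent_space M p \<Longrightarrow>
      endo M p (\<lambda>f. a * u f + c * v f) = (\<lambda>f. a * endo M p u f + c * endo M p v f)"
    and endo_isom: "p \<in> points M \<Longrightarrow> u \<in> tangent_space M p \<Longrightarrow> v \<in> tangent_space M p \<Longrightarrow>
      metric M p (endo M p u) (endo M p v) = metric M p u v"
    and endo_smooth: "X \<in> \<Gamma> M \<Longrightarrow> endo_vf M X \<in> \<Gamma> M"

lemma almost_product_ap_mfd: "almost_product_manifold M \<Longrightarrow> ap_mfd M"
  unfolding ap_mfd_def ap_mfd_axioms_def almost_product_manifold_def singular_semi_riemannian_def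
  by (simp add: smooth_manifold_charted)

context ap_mfd
begin

lemma metric_lin_right: "p \<in> points M \<Longrightarrow> u \<in> tangent_space M p \<Longrightarrow> v \<in> tangent_space M p \<Longrightarrow> w \<in> tangent_space M p \<Longrightarrow>
    metric M p w (\<lambda>f. a * u f + c * v f) = a * metric M p w u + c * metric M p w v"
  by (simp add: metric_sym[of p w] metric_lin tangent_comb)

lemma metric_zero: "p \<in> points M \<Longrightarrow> w \<in> tangent_space M p \<Longrightarrow> metric M p (\<lambda>f. 0) w = 0"
  using metric_lin[of p "\<lambda>f. 0" "\<lambda>f. 0" w 0 0] by (simp add: tangent_zero)

lemma metric_sum:
  assumes p: "p \<in> points M" and "\<And>s. s \<in> S \<Longrightarrow> v s \<in> tangent_space M p" "w \<in> tangent_space M p"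
  shows "metric M p (\<lambda>f. \<Sum>s\<in>S. c s * v s f) w = (\<Sum>s\<in>S. c s * metric M p (v s) w)"
proof (cases "finite S")
  case True
  then show ?thesis using assms(2)
  proof (induction S)
    case (insert s S)
    have "metric M p (\<lambda>f. c s * v s f + 1 * (\<Sum>s\<in>S. c s * v s f)) w =
        c s * metric M p (v s) w + 1 * metric M p (\<lambda>f. \<Sum>s\<in>S. c s * v s f) w"
      by (rule metric_lin[OF p insert.prems tangent_setsum[OF insert.prems] assms(3)]) auto
    then show ?case using insert by simp
  qed (simp add: metric_zero p assms(3))
qed (simp add: metric_zero p assms(3))

lemma metric_sum_right:
  assumes p: "p \<in> points M" and v: "\<And>s. s \<in> S \<Longrightarrow> v s \<in> tangent_space M p" and w: "w \<in> tangent_space M p"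
  shows "metric M p w (\<lambda>f. \<Sum>s\<in>S. c s * v s f) = (\<Sum>s\<in>S. c s * metric M p w (v s))"
proof -
  have "metric M p w (\<lambda>f. \<Sum>s\<in>S. c s * v s f) = metric M p (\<lambda>f. \<Sum>s\<in>S. c s * v s f) w"
    by (rule metric_sym[OF p w tangent_setsum]) (rule v)
  also have "\<dots> = (\<Sum>s\<in>S. c s * metric M p (v s) w)" by (rule metric_sum[OF p v w])
  also have "\<dots> = (\<Sum>s\<in>S. c s * metric M p w (v s))"
    by (rule sum.cong[OF refl]) (simp add: metric_sym[OF p w v])
  finally show ?thesis .
qed

lemma metric_scale: "p \<in> points M \<Longrightarrow> u \<in> tangent_space M p \<Longrightarrow> w \<in> tangent_space M p \<Longrightarrow>
    metric M p (\<lambda>f. a * u f) w = a * metric M p u w"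
  using metric_lin[of p u u w a 0] by simp

lemma metric_scale_right: "p \<in> points M \<Longrightarrow> u \<in> tangent_space M p \<Longrightarrow> w \<in> tangent_space M p \<Longrightarrow>
    metric M p w (\<lambda>f. a * u f) = a * metric M p w u"
  using metric_lin_right[of p u u w a 0] by simp

lemma endo_adjoint: "p \<in> points M \<Longrightarrow> u \<in> tangent_space M p \<Longrightarrow> v \<in> tangent_space M p \<Longrightarrow>
    metric M p (endo M p u) v = metric M p u (endo M p v)"
  using endo_isom[of p u "endo M p v"] endo_in endo_invol by simp

lemma inner_sym: "X \<in> \<Gamma> M \<Longrightarrow> Y \<in> \<Gamma> M \<Longrightarrow> p \<in> points M \<Longrightarrow> inner_vf M X Y p = inner_vf M Y X p"
  by (simp add: inner_vf_def metric_sym vfield_tangent)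

lemma inner_adjoint: "X \<in> \<Gamma> M \<Longrightarrow> Y \<in> \<Gamma> M \<Longrightarrow> p \<in> points M \<Longrightarrow>
    inner_vf M (endo_vf M X) Y p = inner_vf M X (endo_vf M Y) p"
  by (simp add: inner_vf_def endo_vf_def endo_adjoint vfield_tangent)

lemma inner_isom: "X \<in> \<Gamma> M \<Longrightarrow> Y \<in> \<Gamma> M \<Longrightarrow> p \<in> points M \<Longrightarrow>
    inner_vf M (endo_vf M X) (endo_vf M Y) p = inner_vf M X Y p"
  by (simp add: inner_vf_def endo_vf_def endo_isom vfield_tangent)

lemma inner_comb:
  assumes "X \<in> \<Gamma> M" "Z \<in> \<Gamma> M" "W \<in> \<Gamma> M" "p \<in> points M"
  shows "inner_vf M X (\<lambda>q f. a q * Z q f + c q * W q f) p = a p * inner_vf M X Z p + c p * inner_vf M X W p"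
    and "inner_vf M (\<lambda>q f. a q * Z q f + c q * W q f) X p = a p * inner_vf M Z X p + c p * inner_vf M W X p"
  using assms by (simp_all add: inner_vf_def metric_lin metric_lin_right vfield_tangent)

text \<open>Lifts and images under the endomorphism are compared at points of the manifold only, so
  agreement there has to take the place of equality of the fields as functions.\<close>

lemma koszul_cong:
  assumes X: "X \<in> \<Gamma> M" and Y: "Y \<in> \<Gamma> M" and Z: "Z \<in> \<Gamma> M"
    and eq: "\<And>q. q \<in> points M \<Longrightarrow> X q = X' q" "\<And>q. q \<in> points M \<Longrightarrow> Y q = Y' q" "\<And>q. q \<in> points M \<Longrightarrow> Z q = Z' q"
    and p: "p \<in> points M"
  shows "koszul M X Y Z p = koszul M X' Y' Z' p"
proof -
  have i: "v (inner_vf M A C) = v (inner_vf M A' C')"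
    if "v \<in> tangent_space M p" "\<And>q. q \<in> points M \<Longrightarrow> A q = A' q" "\<And>q. q \<in> points M \<Longrightarrow> C q = C' q" for v A A' C C'
    by (rule tangent_cong[OF that(1) p]) (simp add: inner_vf_def that)
  have "X p (inner_vf M Y Z) = X' p (inner_vf M Y' Z')"
    using i[OF vfield_tangent[OF X p] eq(2,3)] eq(1)[OF p] by simp
  moreover have "Y p (inner_vf M Z X) = Y' p (inner_vf M Z' X')"
    using i[OF vfield_tangent[OF Y p] eq(3,1)] eq(2)[OF p] by simp
  moreover have "Z p (inner_vf M X Y) = Z' p (inner_vf M X' Y')"
    using i[OF vfield_tangent[OF Z p] eq(1,2)] eq(3)[OF p] by simp
  ultimately show ?thesis
    unfolding koszul_def vfield_app_def
    by (simp add: inner_vf_def eq[OF p] bracket_cong[OF Y Z eq(2,3) p] bracket_cong[OF Z X eq(3,1) p]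
        bracket_cong[OF X Y eq(1,2) p])
qed

text \<open>The derivatives of \<open>a\<close> and \<open>c\<close> produced by \<open>X\<close>
  and \<open>Y\<close> acting on inner products cancel against those from the two brackets that
  contain the third argument.\<close>

lemma koszul_lin:
  assumes X: "X \<in> \<Gamma> M" and Y: "Y \<in> \<Gamma> M" and Z: "Z \<in> \<Gamma> M" and W: "W \<in> \<Gamma> M"
    and a: "a \<in> C_inf M" and c: "c \<in> C_inf M" and p: "p \<in> points M"
  shows "koszul M X Y (\<lambda>q f. a q * Z q f + c q * W q f) p = a p * koszul M X Y Z p + c p * koszul M X Y W p"
proof -
  let ?Z = "\<lambda>q f. a q * Z q f + c q * W q f"
  note t = vfield_tangent[OF X p] vfield_tangent[OF Y p] vfield_tangent[OF Z p] vfield_tangent[OF W p]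
  have 1: "X p (inner_vf M Y ?Z) = (a p * X p (inner_vf M Y Z) + inner_vf M Y Z p * X p a) +
      (c p * X p (inner_vf M Y W) + inner_vf M Y W p * X p c)"
    using tangent_cong[OF t(1) p inner_comb(1)[OF Y Z W]]
      tangent_lin2[OF t(1) a inner_smooth[OF Y Z] c inner_smooth[OF Y W]] by simp
  have 2: "Y p (inner_vf M ?Z X) = (a p * Y p (inner_vf M Z X) + inner_vf M Z X p * Y p a) +
      (c p * Y p (inner_vf M W X) + inner_vf M W X p * Y p c)"
    using tangent_cong[OF t(2) p inner_comb(2)[OF X Z W]]
      tangent_lin2[OF t(2) a inner_smooth[OF Z X] c inner_smooth[OF W X]] by simp
  note b = vfield_tangent[OF bracket_vfield p]
  have "bracket Y ?Z p = (\<lambda>f. 1 * (a p * bracket Y Z p f + c p * bracket Y W p f) + 1 * (Y p a * Z p f + Y p c * W p f))"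
    by (rule ext) (simp add: bracket_comb[OF Y Z W a c p])
  then have 4: "inner_vf M X (bracket Y ?Z) p = a p * inner_vf M X (bracket Y Z) p + c p * inner_vf M X (bracket Y W) p +
      Y p a * inner_vf M X Z p + Y p c * inner_vf M X W p"
    using t by (simp only: inner_vf_def metric_lin_right[OF p] tangent_comb b[OF Y Z] b[OF Y W])
       (simp add: metric_lin_right[OF p] b[OF Y Z] b[OF Y W])
  have "bracket ?Z X p = (\<lambda>f. 1 * (a p * bracket Z X p f + c p * bracket W X p f) + (- 1) * (X p a * Z p f + X p c * W p f))"
    by (rule ext) (use bracket_comb[OF X Z W a c p] in
      \<open>simp add: bracket_antisym[of ?Z X] bracket_antisym[of Z X] bracket_antisym[of W X]\<close>)
  then have 5: "inner_vf M Y (bracket ?Z X) p = a p * inner_vf M Y (bracket Z X) p + c p * inner_vf M Y (bracket W X) p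
      - X p a * inner_vf M Y Z p - X p c * inner_vf M Y W p"
    using t by (simp only: inner_vf_def metric_lin_right[OF p] tangent_comb b[OF Z X] b[OF W X])
       (simp add: metric_lin_right[OF p] b[OF Z X] b[OF W X])
  have 6: "inner_vf M ?Z (bracket X Y) p = a p * inner_vf M Z (bracket X Y) p + c p * inner_vf M W (bracket X Y) p"
    by (rule inner_comb(2)[OF bracket_vfield[OF X Y] Z W p])
  show ?thesis
    unfolding koszul_def vfield_app_def 1 2 4 5 6 inner_sym[OF X Z p] inner_sym[OF X W p]
    by (simp add: algebra_simps)
qed

text \<open>The counterpart of a connection being metric: in the sum all terms cancel in pairs
  except the derivative along \<open>X\<close>, which occurs twice.\<close>

lemma koszul_compat:
  assumes X: "X \<in> \<Gamma> M" and Y: "Y \<in> \<Gamma> M" and Z: "Z \<in> \<Gamma> M" and p: "p \<in> points M"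
  shows "koszul M X Y Z p + koszul M X Z Y p = X p (inner_vf M Y Z)"
proof -
  have i: "v (inner_vf M A C) = v (inner_vf M C A)"
    if "v \<in> tangent_space M p" "A \<in> \<Gamma> M" "C \<in> \<Gamma> M" for v A C
    by (rule tangent_cong[OF that(1) p inner_sym[OF that(2,3)]])
  have "inner_vf M A (bracket C D) p = - inner_vf M A (bracket D C) p"
    if "A \<in> \<Gamma> M" "C \<in> \<Gamma> M" "D \<in> \<Gamma> M" for A C D
  proof -
    have "bracket C D p = (\<lambda>f. - 1 * bracket D C p f)" by (rule ext) (simp add: bracket_def)
    then show ?thesis
      using metric_scale_right[OF p vfield_tangent[OF bracket_vfield[OF that(3,2)] p] vfield_tangent[OF that(1) p], of "- 1"]
      by (simp add: inner_vf_def)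
  qed
  note b = this
  show ?thesis
    unfolding koszul_def vfield_app_def
    using i[OF vfield_tangent[OF X p] Y Z] i[OF vfield_tangent[OF Y p] X Z] i[OF vfield_tangent[OF Z p] X Y]
      b[OF X Y Z] b[OF Y X Z] b[OF Z X Y]
    by (simp add: field_simps)
qed

text \<open>The counterpart of vanishing torsion: the derivative terms are symmetric in
  \<open>X\<close> and \<open>Y\<close>, and of the brackets only the one of \<open>X\<close> and
  \<open>Y\<close> survives.\<close>

lemma koszul_torsion:
  assumes X: "X \<in> \<Gamma> M" and Y: "Y \<in> \<Gamma> M" and Z: "Z \<in> \<Gamma> M" and p: "p \<in> points M"
  shows "koszul M X Y Z p - koszul M Y X Z p = inner_vf M Z (bracket X Y) p"
proof -
  have i: "v (inner_vf M A C) = v (inner_vf M C A)"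
    if "v \<in> tangent_space M p" "A \<in> \<Gamma> M" "C \<in> \<Gamma> M" for v A C
    by (rule tangent_cong[OF that(1) p inner_sym[OF that(2,3)]])
  have "inner_vf M A (bracket C D) p = - inner_vf M A (bracket D C) p"
    if "A \<in> \<Gamma> M" "C \<in> \<Gamma> M" "D \<in> \<Gamma> M" for A C D
  proof -
    have "bracket C D p = (\<lambda>f. - 1 * bracket D C p f)" by (rule ext) (simp add: bracket_def)
    then show ?thesis
      using metric_scale_right[OF p vfield_tangent[OF bracket_vfield[OF that(3,2)] p] vfield_tangent[OF that(1) p], of "- 1"]
      by (simp add: inner_vf_def)
  qed
  note b = this
  show ?thesis
    unfolding koszul_def vfield_app_def
    using i[OF vfield_tangent[OF X p] Y Z] i[OF vfield_tangent[OF Y p] X Z] i[OF vfield_tangent[OF Z p] X Y]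
      b[OF X Y Z] b[OF Y X Z] b[OF Z X Y]
    by (simp add: field_simps)
qed

lemma koszul_smooth:
  assumes X: "X \<in> \<Gamma> M" and Y: "Y \<in> \<Gamma> M" and Z: "Z \<in> \<Gamma> M"
  shows "koszul M X Y Z \<in> C_inf M"
  unfolding koszul_def
  by (rule C_inf_cmult C_inf_add C_inf_diff vfield_smooth inner_smooth bracket_vfield X Y Z)+

lemma ap_koszul_smooth:
  assumes X: "X \<in> \<Gamma> M" and Y: "Y \<in> \<Gamma> M" and Z: "Z \<in> \<Gamma> M"
  shows "ap_koszul M X Y Z \<in> C_inf M"
  unfolding ap_koszul_def
  by (rule C_inf_cmult C_inf_add koszul_smooth endo_smooth X Y Z)+

lemma endo_vf_invol: "X \<in> \<Gamma> M \<Longrightarrow> p \<in> points M \<Longrightarrow> endo_vf M (endo_vf M X) p = X p"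
  by (simp add: endo_vf_def endo_invol vfield_tangent)

lemma ap_koszul_cong:
  assumes X: "X \<in> \<Gamma> M" and Y: "Y \<in> \<Gamma> M" and Z: "Z \<in> \<Gamma> M"
    and eq: "\<And>q. q \<in> points M \<Longrightarrow> X q = X' q" "\<And>q. q \<in> points M \<Longrightarrow> Y q = Y' q" "\<And>q. q \<in> points M \<Longrightarrow> Z q = Z' q"
    and p: "p \<in> points M"
  shows "ap_koszul M X Y Z p = ap_koszul M X' Y' Z' p"
proof -
  have "koszul M X (endo_vf M Y) (endo_vf M Z) p = koszul M X' (endo_vf M Y') (endo_vf M Z') p"
    by (rule koszul_cong[OF X endo_smooth[OF Y] endo_smooth[OF Z] _ _ _ p]) (simp_all add: eq endo_vf_def)
  then show ?thesis unfolding ap_koszul_def using koszul_cong[OF X Y Z eq p] by simp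
qed

lemma ap_koszul_lin:
  assumes X: "X \<in> \<Gamma> M" and Y: "Y \<in> \<Gamma> M" and Z: "Z \<in> \<Gamma> M" and W: "W \<in> \<Gamma> M"
    and a: "a \<in> C_inf M" and c: "c \<in> C_inf M" and p: "p \<in> points M"
  shows "ap_koszul M X Y (\<lambda>q f. a q * Z q f + c q * W q f) p = a p * ap_koszul M X Y Z p + c p * ap_koszul M X Y W p"
proof -
  have "koszul M X (endo_vf M Y) (endo_vf M (\<lambda>q f. a q * Z q f + c q * W q f)) p =
      koszul M X (endo_vf M Y) (\<lambda>q f. a q * endo_vf M Z q f + c q * endo_vf M W q f) p"
    by (rule koszul_cong[OF X endo_smooth[OF Y] endo_smooth[OF vfield_comb[OF Z W a c]] refl refl _ p])
       (simp add: endo_vf_def endo_lin vfield_tangent Z W)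
  then show ?thesis unfolding ap_koszul_def
    by (simp add: koszul_lin[OF X endo_smooth[OF Y] endo_smooth[OF Z] endo_smooth[OF W] a c p]
        koszul_lin[OF X Y Z W a c p] algebra_simps)
qed

lemma ap_koszul_tensorial:
  assumes X: "X \<in> \<Gamma> M" and Y: "Y \<in> \<Gamma> M" and "Z \<in> \<Gamma> M" "Z' \<in> \<Gamma> M" "Z p = Z' p" and p: "p \<in> points M"
  shows "ap_koszul M X Y Z p = ap_koszul M X Y Z' p"
  by (rule tensorial[where A="\<lambda>Z. ap_koszul M X Y Z p", OF _ ap_koszul_lin[OF X Y _ _ _ _ p] p assms(3,4,5)])
     (rule ap_koszul_cong[OF X Y _ refl refl _ p])

text \<open>Tensoriality in the last argument makes the description in \<open>nabla_flat\<close>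
  unique, so any field through the vector may be used.\<close>

lemma nabla_flat_eq:
  assumes X: "X \<in> \<Gamma> M" and Y: "Y \<in> \<Gamma> M" and Z: "Z \<in> \<Gamma> M" and p: "p \<in> points M"
  shows "nabla_flat M X Y p (Z p) = ap_koszul M X Y Z p"
proof -
  have "(THE r. \<exists>Z'\<in>\<Gamma> M. Z' p = Z p \<and> r = ap_koszul M X Y Z' p) = ap_koszul M X Y Z p"
  proof (rule the_equality)
    show "\<exists>Z'\<in>\<Gamma> M. Z' p = Z p \<and> ap_koszul M X Y Z p = ap_koszul M X Y Z' p" using Z by blast
    fix r assume "\<exists>Z'\<in>\<Gamma> M. Z' p = Z p \<and> r = ap_koszul M X Y Z' p"
    then obtain Z' where Z': "Z' \<in> \<Gamma> M" "Z' p = Z p" "r = ap_koszul M X Y Z' p" by blast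
    show "r = ap_koszul M X Y Z p" unfolding Z'(3) by (rule ap_koszul_tensorial[OF X Y Z'(1) Z Z'(2) p])
  qed
  then show ?thesis using vfield_tangent[OF Z p] by (simp add: nabla_flat_def)
qed

lemma nabla_flat_off: "v \<notin> tangent_space M p \<Longrightarrow> nabla_flat M X Y p v = 0"
  by (simp add: nabla_flat_def)

text \<open>The last conjunct is the normal form of covectors as total functions, shared with
  \<open>flat\<close>, so that forms and flats can be compared by equality. Smoothness is tested on
  vector fields instead of charts.\<close>

definition one_form :: "('a \<Rightarrow> 'a covector) \<Rightarrow> bool" where
  "one_form \<omega> \<longleftrightarrow> (\<forall>Z\<in>\<Gamma> M. (\<lambda>p. \<omega> p (Z p)) \<in> C_inf M) \<and>
    (\<forall>p\<in>points M. \<forall>u\<in>tangent_space M p. \<forall>v\<in>tangent_space M p. \<forall>a c.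
       \<omega> p (\<lambda>f. a * u f + c * v f) = a * \<omega> p u + c * \<omega> p v) \<and>
    (\<forall>p\<in>points M. \<forall>v. v \<notin> tangent_space M p \<longrightarrow> \<omega> p v = 0)"

lemma one_formD:
  assumes "one_form \<omega>"
  shows "Z \<in> \<Gamma> M \<Longrightarrow> (\<lambda>p. \<omega> p (Z p)) \<in> C_inf M"
    "p \<in> points M \<Longrightarrow> u \<in> tangent_space M p \<Longrightarrow> v \<in> tangent_space M p \<Longrightarrow>
       \<omega> p (\<lambda>f. a * u f + c * v f) = a * \<omega> p u + c * \<omega> p v"
    "p \<in> points M \<Longrightarrow> v \<notin> tangent_space M p \<Longrightarrow> \<omega> p v = 0"
  using assms by (simp_all add: one_form_def)

lemma one_form_sum:
  assumes \<omega>: "one_form \<omega>" and p: "p \<in> points M" and "\<And>s. s \<in> S \<Longrightarrow> v s \<in> tangent_space M p"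
  shows "\<omega> p (\<lambda>f. \<Sum>s\<in>S. c s * v s f) = (\<Sum>s\<in>S. c s * \<omega> p (v s))"
proof -
  have z: "\<omega> p (\<lambda>f. 0) = 0"
    using one_formD(2)[OF \<omega> p tangent_zero tangent_zero, of 0 0] by simp
  show ?thesis
  proof (cases "finite S")
    case True
    then show ?thesis using assms(3)
    proof (induction S)
      case (insert s S)
      have "\<omega> p (\<lambda>f. c s * v s f + 1 * (\<Sum>s\<in>S. c s * v s f)) =
          c s * \<omega> p (v s) + 1 * \<omega> p (\<lambda>f. \<Sum>s\<in>S. c s * v s f)"
        by (rule one_formD(2)[OF \<omega> p insert.prems tangent_setsum[OF insert.prems]]) auto
      then show ?case using insert by simp
    qed (simp add: z)
  qed (simp add: z)
qed

lemma one_form_nabla_flat: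
  assumes X: "X \<in> \<Gamma> M" and Y: "Y \<in> \<Gamma> M"
  shows "one_form (nabla_flat M X Y)"
  unfolding one_form_def
proof (intro conjI ballI allI impI)
  fix Z assume Z: "Z \<in> \<Gamma> M"
  show "(\<lambda>p. nabla_flat M X Y p (Z p)) \<in> C_inf M"
    using C_inf_cong[of "\<lambda>p. nabla_flat M X Y p (Z p)" "ap_koszul M X Y Z"]
      nabla_flat_eq[OF X Y Z] ap_koszul_smooth[OF X Y Z] by simp
next
  fix p u v and a c :: real assume p: "p \<in> points M" and u: "u \<in> tangent_space M p" and v: "v \<in> tangent_space M p"
  obtain U where U: "U \<in> \<Gamma> M" "U p = u" by (rule vfield_extension[OF p u])
  obtain V where V: "V \<in> \<Gamma> M" "V p = v" by (rule vfield_extension[OF p v])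
  let ?Z = "\<lambda>q f. a * U q f + c * V q f"
  have "nabla_flat M X Y p (?Z p) = ap_koszul M X Y ?Z p"
    by (rule nabla_flat_eq[OF X Y vfield_comb[OF U(1) V(1) C_inf_const C_inf_const] p])
  also have "\<dots> = a * ap_koszul M X Y U p + c * ap_koszul M X Y V p"
    by (rule ap_koszul_lin[OF X Y U(1) V(1) C_inf_const C_inf_const p])
  finally show "nabla_flat M X Y p (\<lambda>f. a * u f + c * v f) = a * nabla_flat M X Y p u + c * nabla_flat M X Y p v"
    using nabla_flat_eq[OF X Y U(1) p] nabla_flat_eq[OF X Y V(1) p] U V by simp
qed (simp add: nabla_flat_off)

lemma one_form_differential:
  assumes f: "f \<in> C_inf M" shows "one_form (differential M f)"
  unfolding one_form_def
proof (intro conjI ballI allI impI)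
  fix Z assume Z: "Z \<in> \<Gamma> M"
  show "(\<lambda>p. differential M f p (Z p)) \<in> C_inf M"
    using C_inf_cong[of "\<lambda>p. differential M f p (Z p)" "\<lambda>p. Z p f"] vfield_smooth'[OF Z f] vfield_tangent[OF Z]
    by (simp add: differential_def)
qed (simp_all add: differential_def tangent_comb)

lemma one_form_endo:
  assumes \<omega>: "one_form \<omega>" shows "one_form (form_endo M \<omega>)"
  unfolding one_form_def
proof (intro conjI ballI allI impI)
  fix Z assume Z: "Z \<in> \<Gamma> M"
  show "(\<lambda>p. form_endo M \<omega> p (Z p)) \<in> C_inf M"
    using C_inf_cong[of "\<lambda>p. form_endo M \<omega> p (Z p)" "\<lambda>p. \<omega> p (endo_vf M Z p)"]
      one_formD(1)[OF \<omega> endo_smooth[OF Z]] vfield_tangent[OF Z]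
    by (simp add: form_endo_def endo_vf_def)
qed (simp_all add: form_endo_def tangent_comb endo_lin endo_in one_formD[OF \<omega>])

lemma flat_in: "w \<in> tangent_space M p \<Longrightarrow> flat M p v w = metric M p v w"
  by (simp add: flat_def)

text \<open>Vectors with the same flat have the same products with all vectors. Replacing the two
  representatives one at a time, with symmetry in between, shows that the value does not depend on
  them.\<close>

lemma bullet_inner_flat:
  assumes p: "p \<in> points M" and v: "v \<in> tangent_space M p" and w: "w \<in> tangent_space M p"
  shows "bullet_inner M p (flat M p v) (flat M p w) = metric M p v w"
  unfolding bullet_inner_def
proof (rule the_equality)
  show "\<exists>v'\<in>tangent_space M p. \<exists>w'\<in>tangent_space M p. flat M p v = flat M p v' \<and> flat M p w = flat M p w' \<and>
      metric M p v w = metric M p v' w'" using v w by blast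
next
  fix r assume "\<exists>v'\<in>tangent_space M p. \<exists>w'\<in>tangent_space M p. flat M p v = flat M p v' \<and> flat M p w = flat M p w' \<and>
      r = metric M p v' w'"
  then obtain v' w' where *: "v' \<in> tangent_space M p" "w' \<in> tangent_space M p" "flat M p v = flat M p v'"
    "flat M p w = flat M p w'" "r = metric M p v' w'" by blast
  have "metric M p v' w' = metric M p v w'"
    using fun_cong[OF *(3), of w'] *(2) by (simp add: flat_in)
  also have "\<dots> = metric M p w' v" by (rule metric_sym[OF p v *(2)])
  also have "\<dots> = metric M p w v" using fun_cong[OF *(4), of v] v by (simp add: flat_in)
  also have "\<dots> = metric M p v w" by (rule metric_sym[OF p w v])
  finally show "r = metric M p v w" using *(5) by simp
qed

end

section \<open>The rank of the metric and the contraction\<close>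

text \<open>Supplies span, independence and dimension for the scaling that occurs in
  \<open>metric_rank\<close>.\<close>

interpretation covector: vector_space "\<lambda>(c::real) (\<omega>::'a covector). (\<lambda>v. c * \<omega> v)"
  by unfold_locales (auto simp: fun_eq_iff algebra_simps)

lemma sum_fun_app: "(\<Sum>s\<in>S. F s) x = (\<Sum>s\<in>S. F s x :: real)"
  by (induction S rule: infinite_finite_induct) auto

context ap_mfd
begin

text \<open>A coordinate-free form of a nonsingular minor of the Gram matrix, normalised to the
  identity. Such a pair certifies that the rank is at least the size of \<open>S\<close>, and it
  persists on neighbourhoods.\<close>

definition dual_system :: "'a \<Rightarrow> 's set \<Rightarrow> ('s \<Rightarrow> 'a tangent) \<Rightarrow> ('s \<Rightarrow> 'a tangent) \<Rightarrow> bool" where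
  "dual_system p S v w \<longleftrightarrow> finite S \<and> (\<forall>s\<in>S. v s \<in> tangent_space M p \<and> w s \<in> tangent_space M p) \<and>
    (\<forall>s\<in>S. \<forall>t\<in>S. metric M p (v s) (w t) = (if s = t then 1 else 0))"

lemma dual_systemD:
  assumes "dual_system p S v w"
  shows "finite S" "s \<in> S \<Longrightarrow> v s \<in> tangent_space M p" "s \<in> S \<Longrightarrow> w s \<in> tangent_space M p"
    "s \<in> S \<Longrightarrow> t \<in> S \<Longrightarrow> metric M p (v s) (w t) = (if s = t then 1 else 0)"
  using assms by (simp_all add: dual_system_def)

text \<open>A rank factorisation of the metric. The flats of the \<open>v s\<close> are then a basis
  of all flats, so the size of \<open>S\<close> is the rank.\<close>

definition complete_system :: "'a \<Rightarrow> 's set \<Rightarrow> ('s \<Rightarrow> 'a tangent) \<Rightarrow> ('s \<Rightarrow> 'a tangent) \<Rightarrow> bool" where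
  "complete_system p S v w \<longleftrightarrow> dual_system p S v w \<and> (\<forall>u\<in>tangent_space M p. \<forall>x\<in>tangent_space M p.
    metric M p u x = (\<Sum>s\<in>S. metric M p u (w s) * metric M p (v s) x))"

text \<open>Evaluating a linear relation between the flats at \<open>w t\<close> reads off its
  coefficient at \<open>t\<close>.\<close>

lemma dual_system_independent:
  assumes D: "dual_system p S v w" and p: "p \<in> points M"
  shows "inj_on (\<lambda>s. flat M p (v s)) S" "covector.independent ((\<lambda>s. flat M p (v s)) ` S)"
proof -
  have f: "flat M p (v s) (w t) = (if s = t then 1 else 0)" if "s \<in> S" "t \<in> S" for s t
    using dual_systemD[OF D] that by (simp add: flat_in)
  show inj: "inj_on (\<lambda>s. flat M p (v s)) S"
  proof (rule inj_onI)
    fix s t assume st: "s \<in> S" "t \<in> S" "flat M p (v s) = flat M p (v t)"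
    have "flat M p (v s) (w s) = flat M p (v t) (w s)" using st(3) by simp
    then show "s = t" using f[OF st(1,1)] f[OF st(2,1)] by (simp split: if_splits)
  qed
  show "covector.independent ((\<lambda>s. flat M p (v s)) ` S)"
  proof
    assume "covector.dependent ((\<lambda>s. flat M p (v s)) ` S)"
    from iffD1[OF covector.dependent_finite[OF finite_imageI[OF dual_systemD(1)[OF D]]] this]
    obtain c where c': "(\<exists>\<omega>\<in>(\<lambda>s. flat M p (v s)) ` S. c \<omega> \<noteq> 0) \<and>
      (\<Sum>\<omega>\<in>(\<lambda>s. flat M p (v s)) ` S. (\<lambda>x. c \<omega> * \<omega> x)) = 0"
      by (rule exE)
    note c = conjunct1[OF c'] conjunct2[OF c']
    obtain t where t: "t \<in> S" "c (flat M p (v t)) \<noteq> 0" using c(1) by blast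
    have "0 = (\<Sum>\<omega>\<in>(\<lambda>s. flat M p (v s)) ` S. (\<lambda>x. c \<omega> * \<omega> x)) (w t)" using c(2) by simp
    also have "\<dots> = (\<Sum>s\<in>S. c (flat M p (v s)) * flat M p (v s) (w t))"
      unfolding sum_fun_app by (subst sum.reindex[OF inj]) simp
    also have "\<dots> = (\<Sum>s\<in>S. if s = t then c (flat M p (v s)) else 0)"
      by (rule sum.cong[OF refl]) (simp add: f t(1))
    also have "\<dots> = c (flat M p (v t))" using t(1) dual_systemD(1)[OF D] by simp
    finally show False using t(2) by simp
  qed
qed

lemma dual_system_card_le:
  assumes D: "dual_system p S v w" and p: "p \<in> points M" and T: "finite T"
    and span: "\<And>s. s \<in> S \<Longrightarrow> flat M p (v s) \<in> covector.span T"
  shows "card S \<le> card T"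
proof -
  have "card ((\<lambda>s. flat M p (v s)) ` S) \<le> card T"
    using covector.independent_span_bound[OF T dual_system_independent(2)[OF D p]] span by blast
  then show ?thesis by (simp add: card_image[OF dual_system_independent(1)[OF D p]])
qed

lemma flat_sum_in_span:
  assumes "finite S" "\<And>x. \<omega> x = (\<Sum>s\<in>S. c s * \<tau> s x)"
  shows "\<omega> \<in> covector.span (\<tau> ` S)"
proof -
  have "\<omega> = (\<Sum>s\<in>S. (\<lambda>x. c s * \<tau> s x))" by (rule ext) (simp add: sum_fun_app assms(2))
  also have "\<dots> \<in> covector.span (\<tau> ` S)"
    by (rule covector.span_sum, rule covector.span_scale, rule covector.span_base) blast
  finally show ?thesis .
qed

text \<open>Every flat is a combination of the differentials of the coordinate functions, and
  independent covectors are at most as many as a spanning set. The bound guarantees a dual system of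
  maximal size.\<close>

lemma dual_system_card_le_dim:
  assumes D: "dual_system p S v w" and p: "p \<in> points M"
  shows "card S \<le> card (coords M)"
proof -
  obtain N x E where F: "p \<in> N" "local_frame N x E" by (rule frame_exists[OF p])
  let ?dx = "\<lambda>i. differential M (x i) p"
  have Ep: "E i p \<in> tangent_space M p" if "i \<in> coords M" for i
    by (rule vfield_tangent[OF local_frameD(3)[OF F(2) that] p])
  have "flat M p (v s) \<in> covector.span (?dx ` coords M)" if s: "s \<in> S" for s
  proof (rule flat_sum_in_span[OF finite_coords, where c="\<lambda>i. metric M p (v s) (E i p)"])
    fix u
    show "flat M p (v s) u = (\<Sum>i\<in>coords M. metric M p (v s) (E i p) * ?dx i u)"
    proof (cases "u \<in> tangent_space M p")
      case True
      have "metric M p (v s) u = metric M p (v s) (\<lambda>f. \<Sum>i\<in>coords M. u (x i) * E i p f)"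
        using frame_expansion[OF F(2,1) True] by simp
      also have "\<dots> = (\<Sum>i\<in>coords M. u (x i) * metric M p (v s) (E i p))"
        by (rule metric_sum_right[OF p Ep dual_systemD(2)[OF D s]])
      finally show ?thesis using True by (simp add: flat_def differential_def mult.commute)
    qed (simp add: flat_def differential_def)
  qed
  then have "card S \<le> card (?dx ` coords M)"
    by (intro dual_system_card_le[OF D p]) (simp_all add: finite_coords)
  also have "\<dots> \<le> card (coords M)" by (rule card_image_le[OF finite_coords])
  finally show ?thesis .
qed

lemma complete_system_span:
  assumes C: "complete_system p S v w" and p: "p \<in> points M" and u: "u \<in> tangent_space M p"
  shows "flat M p u \<in> covector.span ((\<lambda>s. flat M p (v s)) ` S)"
proof -
  have D: "dual_system p S v w" using C by (simp add: complete_system_def)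
  show ?thesis
    by (rule flat_sum_in_span[OF dual_systemD(1)[OF D], where c="\<lambda>s. metric M p u (w s)"])
       (use C u in \<open>simp add: complete_system_def flat_def\<close>)
qed

lemma complete_system_rank:
  assumes C: "complete_system p S v w" and p: "p \<in> points M"
  shows "metric_rank M p = card S"
  unfolding metric_rank_def
proof (rule covector.dim_unique)
  have D: "dual_system p S v w" using C by (simp add: complete_system_def)
  show "(\<lambda>s. flat M p (v s)) ` S \<subseteq> radical_annihilator M p"
    using dual_systemD(2)[OF D] by (auto simp: radical_annihilator_def)
  show "radical_annihilator M p \<subseteq> covector.span ((\<lambda>s. flat M p (v s)) ` S)"
    using complete_system_span[OF C p] by (auto simp: radical_annihilator_def)
  show "covector.independent ((\<lambda>s. flat M p (v s)) ` S)" by (rule dual_system_independent(2)[OF D p])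
  show "card ((\<lambda>s. flat M p (v s)) ` S) = card S" by (rule card_image[OF dual_system_independent(1)[OF D p]])
qed

text \<open>A dual system of maximal size is complete: if the factorisation failed for
  \<open>u\<close> and \<open>x\<close>, removing from both their components along the system would
  leave a pair with nonzero product, and after rescaling this pair would enlarge the system.\<close>

lemma complete_system_exists:
  assumes p: "p \<in> points M"
  obtains v w where "complete_system p {..<metric_rank M p} v w"
proof -
  let ?P = "\<lambda>r. \<exists>v w. dual_system p {..<r::nat} v w"
  have P0: "?P 0" by (simp add: dual_system_def)
  have bd: "r < Suc (card (coords M))" if "?P r" for r
  proof -
    obtain v w where "dual_system p {..<r} v w" using \<open>?P r\<close> by (elim exE)
    from dual_system_card_le_dim[OF this p] show ?thesis by simp
  qed
  have "\<exists>r. ?P r \<and> (\<forall>r'. ?P r' \<longrightarrow> r' \<le> r)"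
    by (rule ex_has_greatest_nat[where P="?P" and f="\<lambda>r. r" and b="Suc (card (coords M))", OF P0]) (intro allI impI bd)
  then obtain r where r': "?P r \<and> (\<forall>r'. ?P r' \<longrightarrow> r' \<le> r)" by (rule exE)
  have r: "?P r" "\<And>r'. ?P r' \<Longrightarrow> r' \<le> r" using r' by simp_all
  obtain v w where D: "dual_system p {..<r} v w" using r(1) by (elim exE)
  note d = dual_systemD[OF D]
  have "metric M p u x = (\<Sum>s<r. metric M p u (w s) * metric M p (v s) x)"
    if u: "u \<in> tangent_space M p" and x: "x \<in> tangent_space M p" for u x
  proof (rule ccontr)
    assume ne: "metric M p u x \<noteq> (\<Sum>s<r. metric M p u (w s) * metric M p (v s) x)"
    define us where "us = (\<lambda>f. \<Sum>s<r. metric M p u (w s) * v s f)"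
    define xs where "xs = (\<lambda>f. \<Sum>s<r. metric M p (v s) x * w s f)"
    have us: "us \<in> tangent_space M p" and xs: "xs \<in> tangent_space M p"
      unfolding us_def xs_def by (rule tangent_setsum[OF d(2)] tangent_setsum[OF d(3)], simp)+
    \<comment> \<open>The corrected \<open>u'\<close> is orthogonal to all \<open>w t\<close>, and
      the corrected \<open>x'\<close> to all \<open>v t\<close>.\<close>
    define u' where "u' = (\<lambda>f. 1 * u f + (- 1) * us f)"
    define x' where "x' = (\<lambda>f. 1 * x f + (- 1) * xs f)"
    have u': "u' \<in> tangent_space M p" and x': "x' \<in> tangent_space M p"
      unfolding u'_def x'_def by (rule tangent_comb u x us xs)+
    have mu: "metric M p u' y = metric M p u y - (\<Sum>s<r. metric M p u (w s) * metric M p (v s) y)"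
      if "y \<in> tangent_space M p" for y
      unfolding u'_def metric_lin[OF p u us that]
      unfolding us_def by (subst metric_sum[OF p d(2) that]) simp_all
    have mx: "metric M p y x' = metric M p y x - (\<Sum>s<r. metric M p (v s) x * metric M p y (w s))"
      if "y \<in> tangent_space M p" for y
      unfolding x'_def metric_lin_right[OF p x xs that]
      unfolding xs_def by (subst metric_sum_right[OF p d(3) that]) simp_all
    have uw: "metric M p u' (w t) = 0" if t: "t < r" for t
    proof -
      have "(\<Sum>s<r. metric M p u (w s) * metric M p (v s) (w t)) = (\<Sum>s<r. if s = t then metric M p u (w s) else 0)"
        by (rule sum.cong[OF refl]) (use d(4) t in simp)
      then show ?thesis using mu[OF d(3)] t by simp
    qed
    have vx: "metric M p (v t) x' = 0" if t: "t < r" for t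
    proof -
      have "(\<Sum>s<r. metric M p (v s) x * metric M p (v t) (w s)) = (\<Sum>s<r. if s = t then metric M p (v s) x else 0)"
        by (rule sum.cong[OF refl]) (use d(4) t in simp)
      then show ?thesis using mx[OF d(2)] t by simp
    qed
    have ux: "metric M p u' x' \<noteq> 0"
      using mx[OF u'] mu[OF x] ne uw by simp
    define c where "c = 1 / metric M p u' x'"
    have cx: "(\<lambda>f. c * x' f) \<in> tangent_space M p" by (rule tangent_scale[OF x'])
    have "dual_system p {..<Suc r} (v(r := u')) (w(r := (\<lambda>f. c * x' f)))"
      unfolding dual_system_def
      using d u' cx uw vx ux metric_scale_right[OF p x' u', of c] metric_scale_right[OF p x' d(2), of _ c]
      by (auto simp: less_Suc_eq c_def)
    then have "?P (Suc r)" by (intro exI)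
    then have "Suc r \<le> r" by (rule r(2))
    then show False by simp
  qed
  then have C: "complete_system p {..<r} v w" using D by (simp add: complete_system_def)
  then have "metric_rank M p = r" using complete_system_rank[OF C p] by simp
  then show thesis using that C by simp
qed

lemma dual_system_rank_le:
  assumes D: "dual_system p S v w" and p: "p \<in> points M"
  shows "card S \<le> metric_rank M p"
proof -
  obtain v' w' where C: "complete_system p {..<metric_rank M p} v' w'" by (rule complete_system_exists[OF p])
  have "card S \<le> card ((\<lambda>s. flat M p (v' s)) ` {..<metric_rank M p})"
    by (rule dual_system_card_le[OF D p]) (simp_all add: complete_system_span[OF C p] dual_systemD(2)[OF D])
  also have "\<dots> \<le> card {..<metric_rank M p}" by (rule card_image_le) simp
  finally show ?thesis by simp
qed

lemma metric_rank_le: "p \<in> points M \<Longrightarrow> metric_rank M p \<le> card (coords M)"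
proof -
  assume p: "p \<in> points M"
  obtain v' w' where C: "complete_system p {..<metric_rank M p} v' w'" by (rule complete_system_exists[OF p])
  then have "dual_system p {..<metric_rank M p} v' w'" by (simp add: complete_system_def)
  from dual_system_card_le_dim[OF this p] show ?thesis by simp
qed

lemma metric_rank_zero:
  assumes p: "p \<in> points M" and "metric_rank M p = 0" and u: "u \<in> tangent_space M p" and x: "x \<in> tangent_space M p"
  shows "metric M p u x = 0"
proof -
  obtain v w where C: "complete_system p {..<metric_rank M p} v w" by (rule complete_system_exists[OF p])
  then show ?thesis using assms by (simp add: complete_system_def)
qed

text \<open>A pair of dual systems at a point extends to a pair of locally dual systems of fields by
  Gaussian elimination; this replaces inverting a matrix of smooth functions.\<close>

lemma dual_fields:
  assumes p: "p \<in> points M" and S: "finite S" and V: "\<And>s. s \<in> S \<Longrightarrow> V s \<in> \<Gamma> M" and W: "\<And>s. s \<in> S \<Longrightarrow> W s \<in> \<Gamma> M"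
    and d: "\<And>s t. s \<in> S \<Longrightarrow> t \<in> S \<Longrightarrow> inner_vf M (V s) (W t) p = (if s = t then 1 else 0)"
  obtains N W' where "openin (mtop M) N" "p \<in> N" "\<And>s. s \<in> S \<Longrightarrow> W' s \<in> \<Gamma> M"
    "\<And>q s t. q \<in> N \<Longrightarrow> s \<in> S \<Longrightarrow> t \<in> S \<Longrightarrow> inner_vf M (V s) (W' t) q = (if s = t then 1 else 0)"
proof -
  have "\<exists>N W'. openin (mtop M) N \<and> p \<in> N \<and> (\<forall>s\<in>S. W' s \<in> \<Gamma> M) \<and>
    (\<forall>q\<in>N. \<forall>s\<in>S. \<forall>t\<in>S. inner_vf M (V s) (W' t) q = (if s = t then 1 else 0))"
    using S V W d
  proof (induction S)
    case empty
    then show ?case using p by (intro exI[of _ "points M"]) auto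
  next
    case (insert k S)
    have "\<exists>N W'. openin (mtop M) N \<and> p \<in> N \<and> (\<forall>s\<in>S. W' s \<in> \<Gamma> M) \<and>
      (\<forall>q\<in>N. \<forall>s\<in>S. \<forall>t\<in>S. inner_vf M (V s) (W' t) q = (if s = t then 1 else 0))"
      by (rule insert.IH) (simp_all add: insert.prems)
    then obtain N W' where N: "openin (mtop M) N" "p \<in> N" and W': "\<And>s. s \<in> S \<Longrightarrow> W' s \<in> \<Gamma> M"
      and d': "\<And>q s t. q \<in> N \<Longrightarrow> s \<in> S \<Longrightarrow> t \<in> S \<Longrightarrow> inner_vf M (V s) (W' t) q = (if s = t then 1 else 0)"
      by blast
    have Vk: "V k \<in> \<Gamma> M" and Wk: "W k \<in> \<Gamma> M" and VS: "\<And>s. s \<in> S \<Longrightarrow> V s \<in> \<Gamma> M"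
      using insert.prems by auto
    define P where "P = (\<lambda>q f. \<Sum>s\<in>S. inner_vf M (V s) (W k) q * W' s q f)"
    have P: "P \<in> \<Gamma> M" unfolding P_def
      by (rule vfield_setsum[OF W' inner_smooth[OF VS Wk]])
    \<comment> \<open>Subtracting the part seen by the earlier \<open>V s\<close> leaves a field
      orthogonal to them near \<open>p\<close>. Its product with \<open>V k\<close> is
      \<open>1\<close> at \<open>p\<close>, so it can be normalised around \<open>p\<close>.\<close>
    define Y where "Y = (\<lambda>q f. 1 * W k q f + (- 1) * P q f)"
    have Y: "Y \<in> \<Gamma> M" unfolding Y_def by (rule vfield_comb[OF Wk P C_inf_const C_inf_const])
    have iP: "inner_vf M A P q = (\<Sum>s\<in>S. inner_vf M (V s) (W k) q * inner_vf M A (W' s) q)"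
      if "A \<in> \<Gamma> M" "q \<in> points M" for A q
      unfolding inner_vf_def P_def
      by (rule metric_sum_right[OF that(2) vfield_tangent[OF W' that(2)] vfield_tangent[OF that]])
    have iY: "inner_vf M A Y q = inner_vf M A (W k) q - inner_vf M A P q"
      if "A \<in> \<Gamma> M" "q \<in> points M" for A q
      unfolding Y_def using inner_comb(1)[OF that(1) Wk P that(2), of "\<lambda>_. 1" "\<lambda>_. - 1"] by simp
    have Np: "q \<in> points M" if "q \<in> N" for q using N(1) that openin_subset by blast
    have VY: "inner_vf M (V s) Y q = 0" if "s \<in> S" "q \<in> N" for s q
    proof -
      have "inner_vf M (V s) P q = (\<Sum>t\<in>S. if s = t then inner_vf M (V t) (W k) q else 0)"
        unfolding iP[OF VS[OF that(1)] Np[OF that(2)]]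
        by (rule sum.cong[OF refl]) (simp add: d' that)
      also have "\<dots> = inner_vf M (V s) (W k) q" using insert.hyps(1) that(1) by simp
      finally show ?thesis using iY[OF VS[OF that(1)] Np[OF that(2)]] by simp
    qed
    have "inner_vf M (V k) Y p = 1"
    proof -
      have "inner_vf M (V k) P p = 0"
        unfolding iP[OF Vk p]
        by (rule sum.neutral) (use insert.hyps(2) in \<open>auto simp: insert.prems(3)\<close>)
      then show ?thesis using iY[OF Vk p] by (simp add: insert.prems(3))
    qed
    then have "inner_vf M (V k) Y p \<noteq> 0" by simp
    then obtain h N2 where h: "h \<in> C_inf M" "openin (mtop M) N2" "p \<in> N2"
      "\<And>x. x \<in> N2 \<Longrightarrow> h x * inner_vf M (V k) Y x = 1"
      by (rule C_inf_local_inverse[OF inner_smooth[OF Vk Y] p]) blast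
    define W2 where "W2 = (\<lambda>q f. h q * Y q f + 0 * Y q f)"
    have W2: "W2 \<in> \<Gamma> M" unfolding W2_def by (rule vfield_comb[OF Y Y h(1) C_inf_const])
    have iW2: "inner_vf M A W2 q = h q * inner_vf M A Y q" if "A \<in> \<Gamma> M" "q \<in> points M" for A q
      unfolding W2_def using inner_comb(1)[OF that(1) Y Y that(2), of h "\<lambda>_. 0"] by simp
    \<comment> \<open>The earlier fields are corrected against \<open>V k\<close>. Their duality is
      undisturbed, since \<open>W2\<close> is orthogonal to the earlier \<open>V s\<close>.\<close>
    define W3 where "W3 s = (\<lambda>q f. 1 * W' s q f + (- inner_vf M (V k) (W' s) q) * W2 q f)" for s
    have cs: "(\<lambda>q. - inner_vf M (V k) (W' s) q) \<in> C_inf M" if "s \<in> S" for s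
      using C_inf_cmult[OF inner_smooth[OF Vk W'[OF that]], of "- 1"] by simp
    have W3: "W3 s \<in> \<Gamma> M" if "s \<in> S" for s unfolding W3_def
      by (rule vfield_comb[OF W'[OF that] W2 C_inf_const cs[OF that]])
    have iW3: "inner_vf M A (W3 s) q = inner_vf M A (W' s) q - inner_vf M (V k) (W' s) q * inner_vf M A W2 q"
      if "A \<in> \<Gamma> M" "s \<in> S" "q \<in> points M" for A s q
      unfolding W3_def using inner_comb(1)[OF that(1) W'[OF that(2)] W2 that(3), of "\<lambda>_. 1" "\<lambda>q. - inner_vf M (V k) (W' s) q"] by simp
    show ?case
    proof (intro exI[of _ "N \<inter> N2"] exI[of _ "\<lambda>s. if s = k then W2 else W3 s"] conjI ballI)
      show "openin (mtop M) (N \<inter> N2)" "p \<in> N \<inter> N2" using N h by auto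
      show "(if s = k then W2 else W3 s) \<in> \<Gamma> M" if "s \<in> insert k S" for s using that W2 W3 by auto
      fix q s t assume q: "q \<in> N \<inter> N2" and s: "s \<in> insert k S" and t: "t \<in> insert k S"
      have qp: "q \<in> points M" using q Np by blast
      have kk: "inner_vf M (V k) W2 q = 1" using iW2[OF Vk qp] h(4) q by simp
      have sk: "inner_vf M (V s') W2 q = 0" if "s' \<in> S" for s'
        using iW2[OF VS[OF that] qp] VY[OF that] q by simp
      show "inner_vf M (V s) (if t = k then W2 else W3 t) q = (if s = t then 1 else 0)"
      proof (cases "t = k")
        case True
        then show ?thesis using s kk sk insert.hyps(2) by auto
      next
        case False
        then have tS: "t \<in> S" using t by simp
        show ?thesis
        proof (cases "s = k")
          case True
          then show ?thesis using iW3[OF Vk tS qp] kk False by simp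
        next
          case False
          then have "s \<in> S" using s by simp
          then show ?thesis using iW3[OF VS tS qp] sk d'[of q s t] q \<open>t \<noteq> k\<close> tS by simp
        qed
      qed
    qed
  qed
  then obtain N W' where "openin (mtop M) N" "p \<in> N" "\<forall>s\<in>S. W' s \<in> \<Gamma> M"
    "\<forall>q\<in>N. \<forall>s\<in>S. \<forall>t\<in>S. inner_vf M (V s) (W' t) q = (if s = t then 1 else 0)" by blast
  then show thesis by (intro that[of N W']) simp_all
qed

text \<open>A dual system of full size at \<open>p\<close> extends to fields that remain dual
  nearby, and a dual system bounds the rank from below.\<close>

lemma metric_rank_lower_semicontinuous:
  assumes p: "p \<in> points M"
  obtains N where "openin (mtop M) N" "p \<in> N" "\<And>q. q \<in> N \<Longrightarrow> metric_rank M p \<le> metric_rank M q"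
proof -
  obtain v w where "complete_system p {..<metric_rank M p} v w" by (rule complete_system_exists[OF p])
  then have D: "dual_system p {..<metric_rank M p} v w" by (simp add: complete_system_def)
  have "\<exists>Z. Z \<in> \<Gamma> M \<and> Z p = v s" if "s < metric_rank M p" for s
    by (rule vfield_extension[OF p dual_systemD(2)[OF D]]) (use that in auto)
  then obtain V where V: "\<And>s. s < metric_rank M p \<Longrightarrow> V s \<in> \<Gamma> M \<and> V s p = v s" by metis
  have "\<exists>Z. Z \<in> \<Gamma> M \<and> Z p = w s" if "s < metric_rank M p" for s
    by (rule vfield_extension[OF p dual_systemD(3)[OF D]]) (use that in auto)
  then obtain W where W: "\<And>s. s < metric_rank M p \<Longrightarrow> W s \<in> \<Gamma> M \<and> W s p = w s" by metis
  obtain N W' where N: "openin (mtop M) N" "p \<in> N" and W': "\<And>s. s \<in> {..<metric_rank M p} \<Longrightarrow> W' s \<in> \<Gamma> M"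
    and d: "\<And>q s t. q \<in> N \<Longrightarrow> s \<in> {..<metric_rank M p} \<Longrightarrow> t \<in> {..<metric_rank M p} \<Longrightarrow>
      inner_vf M (V s) (W' t) q = (if s = t then 1 else 0)"
  proof (rule dual_fields[OF p, of "{..<metric_rank M p}" V W])
    show "inner_vf M (V s) (W t) p = (if s = t then 1 else 0)"
      if "s \<in> {..<metric_rank M p}" "t \<in> {..<metric_rank M p}" for s t
      using dual_systemD(4)[OF D that] V[of s] W[of t] that by (simp add: inner_vf_def)
  qed (use V W in auto)
  show thesis
  proof (rule that[OF N])
    fix q assume q: "q \<in> N"
    then have qp: "q \<in> points M" using N(1) openin_subset by blast
    have "dual_system q {..<metric_rank M p} (\<lambda>s. V s q) (\<lambda>s. W' s q)"
      unfolding dual_system_def using d[OF q] V W' vfield_tangent[OF _ qp] by (simp add: inner_vf_def)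
    from dual_system_rank_le[OF this qp] show "metric_rank M p \<le> metric_rank M q" by simp
  qed
qed

text \<open>The rank is bounded by the number of coordinates, so it has a maximum on
  \<open>W\<close>. Where the maximum is attained, lower semicontinuity forbids smaller values
  nearby, and the rank is locally constant.\<close>

lemma regular_points_dense:
  assumes W: "openin (mtop M) W" "W \<noteq> {}"
  obtains p where "p \<in> W" "p \<in> regular_points M"
proof -
  have Wp: "W \<subseteq> points M" using W openin_subset by blast
  have "finite (metric_rank M ` W)"
    by (rule finite_subset[of _ "{..card (coords M)}"]) (use Wp metric_rank_le in auto)
  then obtain p where p: "p \<in> W" "metric_rank M p = Max (metric_rank M ` W)"
    using W(2) Max_in[of "metric_rank M ` W"] by fastforce
  have max: "metric_rank M q \<le> metric_rank M p" if "q \<in> W" for q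
    unfolding p(2) using \<open>finite _\<close> that by simp
  have pp: "p \<in> points M" using p Wp by blast
  obtain N where N: "openin (mtop M) N" "p \<in> N" "\<And>q. q \<in> N \<Longrightarrow> metric_rank M p \<le> metric_rank M q"
    by (rule metric_rank_lower_semicontinuous[OF pp]) blast
  have "\<forall>q\<in>W \<inter> N. metric_rank M q = metric_rank M p" using max N(3) by (auto intro: antisym)
  moreover have "openin (mtop M) (W \<inter> N)" "p \<in> W \<inter> N" using W N p by auto
  ultimately show thesis using that[OF p(1)] pp unfolding regular_points_def by blast
qed

lemma C_inf_eq_on_regular:
  assumes h: "h \<in> C_inf M" "h' \<in> C_inf M" and eq: "\<And>p. p \<in> regular_points M \<Longrightarrow> h p = h' p" and p: "p \<in> points M"
  shows "h p = h' p"
proof (rule ccontr)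
  assume ne: "h p \<noteq> h' p"
  let ?W = "{x \<in> points M. h x - h' x \<in> - {0}}"
  have "openin (mtop M) ?W" by (rule C_inf_preimage_open[OF C_inf_diff[OF h]]) (simp add: open_Compl)
  moreover have "?W \<noteq> {}" using p ne by auto
  ultimately obtain q where "q \<in> ?W" "q \<in> regular_points M" by (rule regular_points_dense)
  then show False using eq by simp
qed

text \<open>The choice in \<open>contraction\<close> is harmless on the manifold: two smooth
  functions with the prescribed values at the dense set of regular points agree.\<close>

lemma contraction_eq:
  assumes h: "is_contraction M \<omega> \<tau> h" and p: "p \<in> points M"
  shows "contraction M \<omega> \<tau> p = h p"
proof -
  have "is_contraction M \<omega> \<tau> (contraction M \<omega> \<tau>)"
    unfolding contraction_def by (rule someI[of "is_contraction M \<omega> \<tau>", OF h])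
  note c = this[unfolded is_contraction_def] and h' = h[unfolded is_contraction_def]
  show ?thesis
  proof (rule C_inf_eq_on_regular[OF conjunct1[OF c] conjunct1[OF h'] _ p])
    fix q assume "q \<in> regular_points M"
    then show "contraction M \<omega> \<tau> q = h q"
      using bspec[OF conjunct2[OF c]] bspec[OF conjunct2[OF h']] by metis
  qed
qed

section \<open>Sharp and inverse metric in the non-degenerate case\<close>

lemma nondegenerate_dual_frame:
  assumes nd: "nondegenerate M" and p: "p \<in> points M"
  obtains N x E W where "p \<in> N" "openin (mtop M) N" "N \<subseteq> points M" "local_frame N x E"
    "\<And>i. i \<in> coords M \<Longrightarrow> W i \<in> \<Gamma> M"
    "\<And>q i j. q \<in> N \<Longrightarrow> i \<in> coords M \<Longrightarrow> j \<in> coords M \<Longrightarrow> inner_vf M (E i) (W j) q = (if i = j then 1 else 0)"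
proof -
  obtain N0 x E where F: "p \<in> N0" "local_frame N0 x E" by (rule frame_exists[OF p])
  obtain v w where C: "complete_system p {..<metric_rank M p} v w" by (rule complete_system_exists[OF p])
  then have D: "dual_system p {..<metric_rank M p} v w" by (simp add: complete_system_def)
  note d = dual_systemD[OF D]
  \<comment> \<open>Completeness gives equal products with every vector; non-degeneracy turns this
    into an equality of vectors.\<close>
  have vexp: "u = (\<lambda>f. \<Sum>s<metric_rank M p. metric M p u (w s) * v s f)" if u: "u \<in> tangent_space M p" for u
  proof -
    define us where "us = (\<lambda>f. \<Sum>s<metric_rank M p. metric M p u (w s) * v s f)"
    have us: "us \<in> tangent_space M p" unfolding us_def by (rule tangent_setsum[OF d(2)])
    have "metric M p (\<lambda>f. 1 * u f + (- 1) * us f) y = 0" if y: "y \<in> tangent_space M p" for y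
    proof -
      have "metric M p us y = (\<Sum>s<metric_rank M p. metric M p u (w s) * metric M p (v s) y)"
        unfolding us_def by (rule metric_sum[OF p d(2) y])
      also have "\<dots> = metric M p u y" using C u y by (simp add: complete_system_def)
      finally show ?thesis using metric_lin[OF p u us y, of 1 "- 1"] by simp
    qed
    then have "(\<lambda>f. 1 * u f + (- 1) * us f) = (\<lambda>f. 0)"
      by (intro nd[unfolded nondegenerate_def, rule_format, OF p tangent_comb[OF u us]])
    then have "u f = us f" for f using fun_cong[of _ _ f] by fastforce
    then show ?thesis unfolding us_def by (rule ext)
  qed
  \<comment> \<open>The vector \<open>wj j\<close> represents the differential of
    \<open>x j\<close>: its product with \<open>u\<close> is \<open>u (x j)\<close>, as expanding
    \<open>u\<close> in the \<open>v s\<close> shows. Hence the family is dual to the frame.\<close>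
  define wj where "wj j = (\<lambda>f. \<Sum>s<metric_rank M p. v s (x j) * w s f)" for j
  have wj: "wj j \<in> tangent_space M p" for j unfolding wj_def by (rule tangent_setsum[OF d(3)])
  have Ep: "E i p \<in> tangent_space M p" if "i \<in> coords M" for i
    by (rule vfield_tangent[OF local_frameD(3)[OF F(2) that] p])
  have dual: "metric M p (E i p) (wj j) = (if i = j then 1 else 0)" if "i \<in> coords M" "j \<in> coords M" for i j
  proof -
    have "metric M p (E i p) (wj j) = (\<Sum>s<metric_rank M p. v s (x j) * metric M p (E i p) (w s))"
      unfolding wj_def by (rule metric_sum_right[OF p d(3) Ep[OF that(1)]])
    also have "\<dots> = E i p (x j)"
      by (subst vexp[OF Ep[OF that(1)]]) (simp add: mult.commute)
    finally show ?thesis using local_frameD(5)[OF F(2,1) that] by simp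
  qed
  have "\<exists>Z. Z \<in> \<Gamma> M \<and> Z p = wj j" for j
    by (rule vfield_extension[OF p wj[of j]]) auto
  then obtain W where W: "\<And>j. W j \<in> \<Gamma> M \<and> W j p = wj j" by metis
  obtain N W' where N: "openin (mtop M) N" "p \<in> N" and W': "\<And>s. s \<in> coords M \<Longrightarrow> W' s \<in> \<Gamma> M"
    and d': "\<And>q s t. q \<in> N \<Longrightarrow> s \<in> coords M \<Longrightarrow> t \<in> coords M \<Longrightarrow>
      inner_vf M (E s) (W' t) q = (if s = t then 1 else 0)"
  proof (rule dual_fields[OF p finite_coords, of E W])
    show "inner_vf M (E s) (W t) p = (if s = t then 1 else 0)" if "s \<in> coords M" "t \<in> coords M" for s t
      using dual[OF that] W[of t] by (simp add: inner_vf_def)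
  qed (use W local_frameD(3)[OF F(2)] in auto)
  show thesis
  proof (rule that)
    show "p \<in> N \<inter> N0" "openin (mtop M) (N \<inter> N0)" using N F local_frameD(1)[OF F(2)] by auto
    then show "N \<inter> N0 \<subseteq> points M" using openin_subset by blast
    show "local_frame (N \<inter> N0) x E"
      using F(2) N(1) unfolding local_frame_def by auto
  qed (use W' d' in auto)
qed

context
  assumes nd: "nondegenerate M"
begin

text \<open>The combination of the dual fields \<open>W i\<close> with coefficients from the form is
  an explicit preimage under \<open>flat\<close>, and non-degeneracy makes it the only one. The
  explicit formula is what yields smoothness of the inverse metric.\<close>

lemma sharp_local:
  assumes \<omega>: "one_form \<omega>" and F: "local_frame N x E" and q: "q \<in> N" "q \<in> points M"
    and W: "\<And>i. i \<in> coords M \<Longrightarrow> W i \<in> \<Gamma> M"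
    and d: "\<And>i j. i \<in> coords M \<Longrightarrow> j \<in> coords M \<Longrightarrow> inner_vf M (E i) (W j) q = (if i = j then 1 else 0)"
  shows "sharp M q (\<omega> q) = (\<lambda>f. \<Sum>i\<in>coords M. \<omega> q (E i q) * W i q f)"
    and "sharp M q (\<omega> q) \<in> tangent_space M q" and "flat M q (sharp M q (\<omega> q)) = \<omega> q"
proof -
  let ?v = "\<lambda>f. \<Sum>i\<in>coords M. \<omega> q (E i q) * W i q f"
  have Eq: "E i q \<in> tangent_space M q" if "i \<in> coords M" for i
    by (rule vfield_tangent[OF local_frameD(3)[OF F that] q(2)])
  have v: "?v \<in> tangent_space M q" by (rule tangent_setsum[OF vfield_tangent[OF W q(2)]])
  have vE: "metric M q ?v (E j q) = \<omega> q (E j q)" if j: "j \<in> coords M" for j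
  proof -
    have "metric M q ?v (E j q) = (\<Sum>i\<in>coords M. \<omega> q (E i q) * metric M q (W i q) (E j q))"
      by (rule metric_sum[OF q(2) vfield_tangent[OF W q(2)] Eq[OF j]])
    also have "\<dots> = (\<Sum>i\<in>coords M. if i = j then \<omega> q (E i q) else 0)"
      by (rule sum.cong[OF refl])
         (use d j in \<open>simp add: inner_vf_def metric_sym[OF q(2) vfield_tangent[OF W q(2)] Eq[OF j]]\<close>)
    finally show ?thesis using j finite_coords by simp
  qed
  have fl: "flat M q ?v = \<omega> q"
  proof
    fix y show "flat M q ?v y = \<omega> q y"
    proof (cases "y \<in> tangent_space M q")
      case True
      have "metric M q ?v y = metric M q ?v (\<lambda>f. \<Sum>i\<in>coords M. y (x i) * E i q f)"
        using frame_expansion[OF F q(1) True] by simp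
      also have "\<dots> = (\<Sum>i\<in>coords M. y (x i) * metric M q ?v (E i q))"
        by (rule metric_sum_right[OF q(2) Eq v])
      also have "\<dots> = (\<Sum>i\<in>coords M. y (x i) * \<omega> q (E i q))"
        by (rule sum.cong[OF refl]) (simp add: vE)
      also have "\<dots> = \<omega> q (\<lambda>f. \<Sum>i\<in>coords M. y (x i) * E i q f)"
        by (rule one_form_sum[OF \<omega> q(2) Eq, symmetric])
      also have "\<dots> = \<omega> q y" using frame_expansion[OF F q(1) True] by simp
      finally show ?thesis using True by (simp add: flat_in)
    qed (simp add: flat_def one_formD(3)[OF \<omega> q(2)])
  qed
  have uniq: "u = ?v" if u: "u \<in> tangent_space M q" "flat M q u = \<omega> q" for u
  proof -
    have "metric M q (\<lambda>f. 1 * u f + (- 1) * ?v f) y = 0" if y: "y \<in> tangent_space M q" for y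
    proof -
      have "flat M q u y = flat M q ?v y" using u(2) fl by simp
      then show ?thesis using metric_lin[OF q(2) u(1) v y, of 1 "- 1"] y by (simp add: flat_in)
    qed
    then have "(\<lambda>f. 1 * u f + (- 1) * ?v f) = (\<lambda>f. 0)"
      by (intro nd[unfolded nondegenerate_def, rule_format, OF q(2) tangent_comb[OF u(1) v]])
    then have "u f = ?v f" for f using fun_cong[of _ _ f] by fastforce
    then show ?thesis by (rule ext)
  qed
  have "(THE v. v \<in> tangent_space M q \<and> flat M q v = \<omega> q) = ?v"
  proof (rule the_equality)
    show "?v \<in> tangent_space M q \<and> flat M q ?v = \<omega> q" using v fl by (rule conjI)
  qed (elim conjE, rule uniq)
  then show s: "sharp M q (\<omega> q) = ?v" by (simp only: sharp_def)
  show "sharp M q (\<omega> q) \<in> tangent_space M q" unfolding s by (rule v)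
  show "flat M q (sharp M q (\<omega> q)) = \<omega> q" unfolding s by (rule fl)
qed

lemma sharp_in: "one_form \<omega> \<Longrightarrow> p \<in> points M \<Longrightarrow> sharp M p (\<omega> p) \<in> tangent_space M p"
  and flat_sharp: "one_form \<omega> \<Longrightarrow> p \<in> points M \<Longrightarrow> flat M p (sharp M p (\<omega> p)) = \<omega> p"
proof -
  assume \<omega>: "one_form \<omega>" and p: "p \<in> points M"
  obtain N x E W where F: "p \<in> N" "local_frame N x E" "\<And>i. i \<in> coords M \<Longrightarrow> W i \<in> \<Gamma> M"
    "\<And>q i j. q \<in> N \<Longrightarrow> i \<in> coords M \<Longrightarrow> j \<in> coords M \<Longrightarrow> inner_vf M (E i) (W j) q = (if i = j then 1 else 0)"
    by (rule nondegenerate_dual_frame[OF nd p]) blast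
  show "sharp M p (\<omega> p) \<in> tangent_space M p"
    by (rule sharp_local(2)[OF \<omega> F(2,1) p F(3) F(4)[OF F(1)]])
  show "flat M p (sharp M p (\<omega> p)) = \<omega> p"
    by (rule sharp_local(3)[OF \<omega> F(2,1) p F(3) F(4)[OF F(1)]])
qed

lemma metric_sharp: "one_form \<omega> \<Longrightarrow> p \<in> points M \<Longrightarrow> v \<in> tangent_space M p \<Longrightarrow> metric M p (sharp M p (\<omega> p)) v = \<omega> p v"
  using fun_cong[OF flat_sharp, of \<omega> p v] by (simp add: flat_in)

lemma cometric_smooth:
  assumes \<omega>: "one_form \<omega>" and \<tau>: "one_form \<tau>"
  shows "cometric M \<omega> \<tau> \<in> C_inf M"
proof (rule C_inf_local)
  fix p assume p: "p \<in> points M"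
  obtain N x E W where F: "p \<in> N" "openin (mtop M) N" "N \<subseteq> points M" "local_frame N x E"
    "\<And>i. i \<in> coords M \<Longrightarrow> W i \<in> \<Gamma> M"
    "\<And>q i j. q \<in> N \<Longrightarrow> i \<in> coords M \<Longrightarrow> j \<in> coords M \<Longrightarrow> inner_vf M (E i) (W j) q = (if i = j then 1 else 0)"
    by (rule nondegenerate_dual_frame[OF nd p]) blast
  let ?h = "\<lambda>q. \<Sum>i\<in>coords M. \<tau> q (E i q) * \<omega> q (W i q)"
  have "?h \<in> C_inf M"
    by (rule C_inf_sum[OF C_inf_mult[OF one_formD(1)[OF \<tau> local_frameD(3)[OF F(4)]] one_formD(1)[OF \<omega> F(5)]]])
  moreover have "cometric M \<omega> \<tau> q = ?h q" if q: "q \<in> N" for q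
  proof -
    have qp: "q \<in> points M" using q F(3) by blast
    have s: "sharp M q (\<tau> q) = (\<lambda>f. \<Sum>i\<in>coords M. \<tau> q (E i q) * W i q f)"
      by (rule sharp_local(1)[OF \<tau> F(4) q qp F(5) F(6)[OF q]])
    have "cometric M \<omega> \<tau> q = \<omega> q (sharp M q (\<tau> q))"
      by (simp add: cometric_def metric_sharp[OF \<omega> qp sharp_in[OF \<tau> qp]])
    also have "\<dots> = ?h q" unfolding s by (rule one_form_sum[OF \<omega> qp vfield_tangent[OF F(5) qp]])
    finally show ?thesis .
  qed
  ultimately show "\<exists>W h. openin (mtop M) W \<and> p \<in> W \<and> h \<in> C_inf M \<and> (\<forall>x\<in>W. cometric M \<omega> \<tau> x = h x)"
    using F(1,2) by (intro exI[of _ N] exI[of _ ?h]) simp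
qed

text \<open>The sharps represent both forms at every point and the inverse metric is smooth, so it
  satisfies the definition of a contraction.\<close>

lemma contraction_cometric:
  assumes \<omega>: "one_form \<omega>" and \<tau>: "one_form \<tau>" and p: "p \<in> points M"
  shows "contraction M \<omega> \<tau> p = cometric M \<omega> \<tau> p"
proof (rule contraction_eq[OF _ p])
  show "is_contraction M \<omega> \<tau> (cometric M \<omega> \<tau>)"
    unfolding is_contraction_def
  proof (intro conjI ballI cometric_smooth \<omega> \<tau>)
    fix q assume "q \<in> regular_points M"
    then have q: "q \<in> points M" by (simp add: regular_points_def)
    have "bullet_inner M q (\<omega> q) (\<tau> q) = bullet_inner M q (flat M q (sharp M q (\<omega> q))) (flat M q (sharp M q (\<tau> q)))"
      by (simp add: flat_sharp \<omega> \<tau> q)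
    also have "\<dots> = cometric M \<omega> \<tau> q"
      by (simp add: bullet_inner_flat sharp_in \<omega> \<tau> q cometric_def)
    finally show "cometric M \<omega> \<tau> q = bullet_inner M q (\<omega> q) (\<tau> q)" by simp
  qed
qed

end

end

lemma (in ap_mfd) endo_zero: "p \<in> points M \<Longrightarrow> endo M p (\<lambda>f. 0) = (\<lambda>f. 0)"
  using endo_lin[OF _ tangent_zero tangent_zero, of p 0 0] by simp

lemma (in ap_mfd) endo_sum:
  assumes p: "p \<in> points M" and "\<And>s. s \<in> S \<Longrightarrow> v s \<in> tangent_space M p"
  shows "endo M p (\<lambda>f. \<Sum>s\<in>S. c s * v s f) = (\<lambda>f. \<Sum>s\<in>S. c s * endo M p (v s) f)"
proof (cases "finite S")
  case True
  then show ?thesis using assms(2)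
  proof (induction S)
    case (insert s S)
    have "endo M p (\<lambda>f. c s * v s f + 1 * (\<Sum>s\<in>S. c s * v s f)) =
        (\<lambda>f. c s * endo M p (v s) f + 1 * endo M p (\<lambda>f. \<Sum>s\<in>S. c s * v s f) f)"
      by (rule endo_lin[OF p insert.prems tangent_setsum[OF insert.prems]]) auto
    then show ?case using insert by simp
  qed (simp add: endo_zero p)
qed (simp add: endo_zero p)

section \<open>Projections and slices of a product\<close>

text \<open>A factor \<open>N\<close> of a product manifold \<open>M\<close>: \<open>\<pi>\<close> is the projection onto \<open>N\<close>, \<open>\<sigma> x\<close> the embedding
  of \<open>N\<close> as the slice through \<open>x\<close>, and \<open>e\<close> sends the coordinate indices of \<open>N\<close> to those of \<open>M\<close>.\<close>

locale factor = N: charted N + M: charted M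
  for N :: "('b, 'j, 'y) manifold_scheme" and M :: "('a, 'i, 'z) manifold_scheme" +
  fixes \<pi> :: "'a \<Rightarrow> 'b" and \<sigma> :: "'a \<Rightarrow> 'b \<Rightarrow> 'a" and e :: "'j \<Rightarrow> 'i"
  assumes pr_cont: "continuous_map (mtop M) (mtop N) \<pi>"
    and sl_in: "x \<in> points M \<Longrightarrow> y \<in> points N \<Longrightarrow> \<sigma> x y \<in> points M"
    and pr_sl: "x \<in> points M \<Longrightarrow> y \<in> points N \<Longrightarrow> \<pi> (\<sigma> x y) = y"
    and sl_pr: "x \<in> points M \<Longrightarrow> \<sigma> x (\<pi> x) = x"
    and sl_sl: "\<sigma> (\<sigma> x y) y' = \<sigma> x y'"
    and e_inj: "inj_on e (coords N)" and e_in: "i \<in> coords N \<Longrightarrow> e i \<in> coords M"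
    and chart: "x \<in> points M \<Longrightarrow> (V, \<psi>) \<in> atlas N \<Longrightarrow> \<pi> x \<in> V \<Longrightarrow>
      \<exists>U \<phi>. (U, \<phi>) \<in> atlas M \<and> x \<in> U \<and> (\<forall>x'\<in>U. \<pi> x' \<in> V \<and> (\<forall>i\<in>coords N. \<psi> (\<pi> x') i = \<phi> x' (e i))) \<and>
        (\<forall>x'\<in>U. \<forall>y\<in>V. \<sigma> x' y \<in> U \<and> (\<forall>c\<in>coords M - e ` coords N. \<phi> (\<sigma> x' y) c = \<phi> x' c))"
begin

lemma pr_in: "x \<in> points M \<Longrightarrow> \<pi> x \<in> points N"
  using continuous_map_image_subset_topspace[OF pr_cont] by blast

lemma chartE:
  assumes "x \<in> points M" "(V, \<psi>) \<in> atlas N" "\<pi> x \<in> V"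
  obtains U \<phi> where "(U, \<phi>) \<in> atlas M" "x \<in> U" "\<And>x'. x' \<in> U \<Longrightarrow> \<pi> x' \<in> V"
    "\<And>x' i. x' \<in> U \<Longrightarrow> i \<in> coords N \<Longrightarrow> \<psi> (\<pi> x') i = \<phi> x' (e i)"
    "\<And>x' y. x' \<in> U \<Longrightarrow> y \<in> V \<Longrightarrow> \<sigma> x' y \<in> U"
    "\<And>x' y c. x' \<in> U \<Longrightarrow> y \<in> V \<Longrightarrow> c \<in> coords M \<Longrightarrow> c \<notin> e ` coords N \<Longrightarrow> \<phi> (\<sigma> x' y) c = \<phi> x' c"
proof -
  obtain U \<phi> where *: "(U, \<phi>) \<in> atlas M \<and> x \<in> U \<and> (\<forall>x'\<in>U. \<pi> x' \<in> V \<and> (\<forall>i\<in>coords N. \<psi> (\<pi> x') i = \<phi> x' (e i))) \<and>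
        (\<forall>x'\<in>U. \<forall>y\<in>V. \<sigma> x' y \<in> U \<and> (\<forall>c\<in>coords M - e ` coords N. \<phi> (\<sigma> x' y) c = \<phi> x' c))"
    using chart[OF assms] by (elim exE)
  show thesis by (rule that[of U \<phi>]) (use * in simp_all)
qed

lemma chart_ext: "(U, \<phi>) \<in> atlas M \<Longrightarrow> x \<in> U \<Longrightarrow> \<phi> x \<in> extensional (coords M)"
  and chart_ext': "(V, \<psi>) \<in> atlas N \<Longrightarrow> y \<in> V \<Longrightarrow> \<psi> y \<in> extensional (coords N)"
  using open_ext_subset[OF M.chart_image] open_ext_subset[OF N.chart_image] by fast+

text \<open>In the adapted charts of the locale the projection is a selection of coordinates, the
  map \<open>T\<close>.\<close>

lemma C_inf_pull:
  assumes f: "f \<in> C_inf N"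
  shows "(\<lambda>x. f (\<pi> x)) \<in> C_inf M"
proof (rule M.C_inf_localI)
  fix x assume x: "x \<in> points M"
  obtain V \<psi> where V: "(V, \<psi>) \<in> atlas N" "\<pi> x \<in> V" by (rule N.chart_at[OF pr_in[OF x]])
  obtain U \<phi> where U: "(U, \<phi>) \<in> atlas M" "x \<in> U" "\<And>x'. x' \<in> U \<Longrightarrow> \<pi> x' \<in> V"
    "\<And>x' i. x' \<in> U \<Longrightarrow> i \<in> coords N \<Longrightarrow> \<psi> (\<pi> x') i = \<phi> x' (e i)"
    by (rule chartE[OF x V]) (rule that; assumption)
  define T where "T z = (\<lambda>i\<in>coords N. z (e i))" for z :: "'i \<Rightarrow> real"
  have T: "T (\<phi> x') = \<psi> (\<pi> x')" if x': "x' \<in> U" for x'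
    by (rule extensionalityI[OF _ chart_ext'[OF V(1) U(3)[OF x']]]) (simp_all add: T_def U(4) x')
  have "smooth_on (coords M) (\<phi> ` U) (\<lambda>z. (\<lambda>y. f (inv_into V \<psi> y)) (T z))"
  proof (rule smooth_on_compose[OF N.finite_coords N.chart_image[OF V(1)] M.chart_image[OF U(1)] _ _ N.C_infD[OF f V(1)]])
    show "T z \<in> \<psi> ` V" if "z \<in> \<phi> ` U" for z using that T U(3) by auto
    show "smooth_on (coords M) (\<phi> ` U) (\<lambda>x. T x i)" if "i \<in> coords N" for i
      using that smooth_on_coord[OF M.chart_image[OF U(1)] e_in[OF that]] by (simp add: T_def)
  qed
  moreover have eq: "f (inv_into V \<psi> (T z)) = f (\<pi> (inv_into U \<phi> z))" if "z \<in> \<phi> ` U" for z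
    using that T U(1,3) V(1) by auto
  ultimately have "smooth_on (coords M) (\<phi> ` U) (\<lambda>z. f (\<pi> (inv_into U \<phi> z)))"
    using smooth_on_cong[OF M.chart_image[OF U(1)] eq] by simp
  then show "\<exists>U \<phi> W. (U, \<phi>) \<in> atlas M \<and> openin (mtop M) W \<and> x \<in> W \<and> W \<subseteq> U \<and>
    smooth_on (coords M) (\<phi> ` W) (\<lambda>z. f (\<pi> (inv_into U \<phi> z)))"
    using U(1,2) M.chart_open[OF U(1)] by (intro exI[of _ U] exI[of _ \<phi>]) simp
qed

text \<open>The coordinate expression of the slice embedding: the block of \<open>N\<close> is
  overwritten by \<open>z\<close>, the remaining coordinates are kept.\<close>

definition over :: "('i \<Rightarrow> real) \<Rightarrow> ('j \<Rightarrow> real) \<Rightarrow> 'i \<Rightarrow> real" where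
  "over a z = (\<lambda>c\<in>coords M. if c \<in> e ` coords N then z (the_inv_into (coords N) e c) else a c)"

lemma over_e: "i \<in> coords N \<Longrightarrow> over a z (e i) = z i"
  by (simp add: over_def e_in the_inv_into_f_f[OF e_inj])

lemma over_chart:
  assumes V: "(V, \<psi>) \<in> atlas N" and U: "(U, \<phi>) \<in> atlas M" and x: "x \<in> U" and y: "y \<in> V"
    and c1: "\<And>x' i. x' \<in> U \<Longrightarrow> i \<in> coords N \<Longrightarrow> \<psi> (\<pi> x') i = \<phi> x' (e i)"
    and c2: "\<sigma> x y \<in> U"
    and c3: "\<And>c. c \<in> coords M \<Longrightarrow> c \<notin> e ` coords N \<Longrightarrow> \<phi> (\<sigma> x y) c = \<phi> x c"
  shows "over (\<phi> x) (\<psi> y) = \<phi> (\<sigma> x y)"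
proof (rule extensionalityI[OF _ chart_ext[OF U c2]])
  show "over (\<phi> x) (\<psi> y) \<in> extensional (coords M)" by (simp add: over_def)
  fix c assume c: "c \<in> coords M"
  show "over (\<phi> x) (\<psi> y) c = \<phi> (\<sigma> x y) c"
  proof (cases "c \<in> e ` coords N")
    case True
    then obtain i where i: "i \<in> coords N" "c = e i" by blast
    have "\<pi> (\<sigma> x y) = y" using pr_sl M.chart_subset[OF U] N.chart_subset[OF V] x y by blast
    then show ?thesis using c1[OF c2 i(1)] over_e[OF i(1)] i(2) by simp
  next
    case False
    then show ?thesis using c c3 by (simp add: over_def)
  qed
qed

lemma C_inf_slice:
  assumes f: "f \<in> C_inf M" and x: "x \<in> points M"
  shows "(\<lambda>y. f (\<sigma> x y)) \<in> C_inf N"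
proof (rule N.C_inf_localI)
  fix y assume y: "y \<in> points N"
  obtain V \<psi> where V: "(V, \<psi>) \<in> atlas N" "y \<in> V" by (rule N.chart_at[OF y])
  \<comment> \<open>The chart is taken around the point of the slice over \<open>y\<close>, which
    may be far from \<open>x\<close>; by \<open>sl_sl\<close> both points define the same
    slice.\<close>
  define x1 where "x1 = \<sigma> x y"
  have x1: "x1 \<in> points M" "\<pi> x1 \<in> V" unfolding x1_def using sl_in[OF x y] pr_sl[OF x y] V(2) by simp_all
  obtain U \<phi> where U: "(U, \<phi>) \<in> atlas M" "x1 \<in> U" "\<And>x' i. x' \<in> U \<Longrightarrow> i \<in> coords N \<Longrightarrow> \<psi> (\<pi> x') i = \<phi> x' (e i)"
    "\<And>x' y. x' \<in> U \<Longrightarrow> y \<in> V \<Longrightarrow> \<sigma> x' y \<in> U"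
    "\<And>x' y c. x' \<in> U \<Longrightarrow> y \<in> V \<Longrightarrow> c \<in> coords M \<Longrightarrow> c \<notin> e ` coords N \<Longrightarrow> \<phi> (\<sigma> x' y) c = \<phi> x' c"
    by (rule chartE[OF x1(1) V(1) x1(2)]) (rule that; assumption)
  have ov: "over (\<phi> x1) (\<psi> y') = \<phi> (\<sigma> x y')" and ovU: "\<sigma> x y' \<in> U" if y': "y' \<in> V" for y'
    using over_chart[OF V(1) U(1,2) y' U(3) U(4)[OF U(2) y'] U(5)[OF U(2) y']] U(4)[OF U(2) y']
    by (simp_all add: x1_def sl_sl)
  have "smooth_on (coords N) (\<psi> ` V) (\<lambda>z. (\<lambda>w. f (inv_into U \<phi> w)) (over (\<phi> x1) z))"
  proof (rule smooth_on_compose[OF M.finite_coords M.chart_image[OF U(1)] N.chart_image[OF V(1)] _ _ M.C_infD[OF f U(1)]])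
    show "over (\<phi> x1) z \<in> \<phi> ` U" if "z \<in> \<psi> ` V" for z using that ov ovU by auto
    show "smooth_on (coords N) (\<psi> ` V) (\<lambda>z. over (\<phi> x1) z c)" if c: "c \<in> coords M" for c
    proof (cases "c \<in> e ` coords N")
      case True
      then obtain i where i: "i \<in> coords N" "c = e i" by blast
      then show ?thesis using smooth_on_coord[OF N.chart_image[OF V(1)] i(1)] by (simp add: over_e)
    next
      case False
      then show ?thesis using c by (simp add: over_def N.chart_image[OF V(1)])
    qed
  qed
  moreover have eq: "f (inv_into U \<phi> (over (\<phi> x1) z)) = f (\<sigma> x (inv_into V \<psi> z))" if "z \<in> \<psi> ` V" for z
    using that ov ovU U(1) V(1) by auto
  ultimately have "smooth_on (coords N) (\<psi> ` V) (\<lambda>z. f (\<sigma> x (inv_into V \<psi> z)))"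
    using smooth_on_cong[OF N.chart_image[OF V(1)] eq] by simp
  then show "\<exists>V \<psi> W. (V, \<psi>) \<in> atlas N \<and> openin (mtop N) W \<and> y \<in> W \<and> W \<subseteq> V \<and>
    smooth_on (coords N) (\<psi> ` W) (\<lambda>z. f (\<sigma> x (inv_into V \<psi> z)))"
    using V N.chart_open[OF V(1)] by (intro exI[of _ V] exI[of _ \<psi>]) simp
qed

text \<open>Moving along the slice in coordinate \<open>i\<close> changes exactly the coordinate
  \<open>e i\<close> of the adapted chart, so both sides differentiate the same one-variable
  function near the point.\<close>

lemma pd_slice:
  assumes f: "f \<in> C_inf M" and V: "(V, \<psi>) \<in> atlas N" and U: "(U, \<phi>) \<in> atlas M" and x: "x \<in> U"
    and c: "\<And>x'. x' \<in> U \<Longrightarrow> \<pi> x' \<in> V" "\<And>x' i. x' \<in> U \<Longrightarrow> i \<in> coords N \<Longrightarrow> \<psi> (\<pi> x') i = \<phi> x' (e i)"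
    "\<And>x' y. x' \<in> U \<Longrightarrow> y \<in> V \<Longrightarrow> \<sigma> x' y \<in> U"
    "\<And>x' y c. x' \<in> U \<Longrightarrow> y \<in> V \<Longrightarrow> c \<in> coords M \<Longrightarrow> c \<notin> e ` coords N \<Longrightarrow> \<phi> (\<sigma> x' y) c = \<phi> x' c"
    and i: "i \<in> coords N"
  shows "pd i (\<lambda>z. f (\<sigma> x (inv_into V \<psi> z))) (\<psi> (\<pi> x)) = pd (e i) (\<lambda>z. f (inv_into U \<phi> z)) (\<phi> x)"
  unfolding pd_def
proof (rule deriv_cong_ev)
  have xi: "\<psi> (\<pi> x) i = \<phi> x (e i)" by (rule c(2)[OF x i])
  then show "\<psi> (\<pi> x) i = \<phi> x (e i)" .
  have a: "\<psi> (\<pi> x) \<in> \<psi> ` V" using c(1)[OF x] by blast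
  show "\<forall>\<^sub>F t in nhds (\<psi> (\<pi> x) i). f (\<sigma> x (inv_into V \<psi> ((\<psi> (\<pi> x))(i := t)))) = f (inv_into U \<phi> ((\<phi> x)(e i := t)))"
  proof (rule eventually_mono[OF eventually_upd_in[OF N.chart_image[OF V] a i]])
    fix t assume "(\<psi> (\<pi> x))(i := t) \<in> \<psi> ` V"
    then obtain y where y: "y \<in> V" "(\<psi> (\<pi> x))(i := t) = \<psi> y" by blast
    have o: "over (\<phi> x) (\<psi> y) = \<phi> (\<sigma> x y)"
      by (rule over_chart[OF V U x y(1) c(2) c(3)[OF x y(1)] c(4)[OF x y(1)]])
    have "(\<phi> x)(e i := t) = over (\<phi> x) (\<psi> y)"
    proof (rule extensionalityI)
      show "(\<phi> x)(e i := t) \<in> extensional (coords M)" using chart_ext[OF U x] e_in[OF i] by simp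
      show "over (\<phi> x) (\<psi> y) \<in> extensional (coords M)" by (simp add: over_def)
      fix k assume k: "k \<in> coords M"
      show "((\<phi> x)(e i := t)) k = over (\<phi> x) (\<psi> y) k"
      proof (cases "k \<in> e ` coords N")
        case True
        then obtain j where j: "j \<in> coords N" "k = e j" by blast
        have "over (\<phi> x) (\<psi> y) k = ((\<psi> (\<pi> x))(i := t)) j" using over_e[OF j(1)] j(2) y(2) by simp
        also have "\<dots> = ((\<phi> x)(e i := t)) k"
          using j c(2)[OF x j(1)] inj_onD[OF e_inj, of i j] i by auto
        finally show ?thesis by simp
      next
        case False
        then have "k \<noteq> e i" using i by blast
        then show ?thesis using False k by (simp add: over_def)
      qed
    qed
    then show "f (\<sigma> x (inv_into V \<psi> ((\<psi> (\<pi> x))(i := t)))) = f (inv_into U \<phi> ((\<phi> x)(e i := t)))"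
      using o y V U c(3)[OF x y(1)] by simp
  qed
qed

text \<open>For each \<open>x\<close> a different slice function is differentiated, so smoothness in
  \<open>x\<close> does not follow from that of \<open>X \<rhd> h\<close> for a fixed
  \<open>h\<close>. In charts the expression is a sum of coefficients of \<open>X\<close> times
  partial derivatives of \<open>f\<close> on the product, which are smooth in all
  coordinates.\<close>

lemma lift_smooth:
  assumes X: "X \<in> \<Gamma> N" and f: "f \<in> C_inf M"
  shows "(\<lambda>x. X (\<pi> x) (\<lambda>y. f (\<sigma> x y))) \<in> C_inf M"
proof (rule M.C_inf_localI)
  fix x0 assume x0: "x0 \<in> points M"
  obtain V \<psi> where V: "(V, \<psi>) \<in> atlas N" "\<pi> x0 \<in> V" by (rule N.chart_at[OF pr_in[OF x0]])
  obtain U \<phi> where U: "(U, \<phi>) \<in> atlas M" "x0 \<in> U" "\<And>x'. x' \<in> U \<Longrightarrow> \<pi> x' \<in> V"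
    "\<And>x' i. x' \<in> U \<Longrightarrow> i \<in> coords N \<Longrightarrow> \<psi> (\<pi> x') i = \<phi> x' (e i)"
    "\<And>x' y. x' \<in> U \<Longrightarrow> y \<in> V \<Longrightarrow> \<sigma> x' y \<in> U"
    "\<And>x' y c. x' \<in> U \<Longrightarrow> y \<in> V \<Longrightarrow> c \<in> coords M \<Longrightarrow> c \<notin> e ` coords N \<Longrightarrow> \<phi> (\<sigma> x' y) c = \<phi> x' c"
    by (rule chartE[OF x0 V]) (rule that; assumption)
  obtain \<xi> N0 where \<xi>: "openin (mtop N) N0" "\<pi> x0 \<in> N0" "N0 \<subseteq> V" "\<And>i. i \<in> coords N \<Longrightarrow> \<xi> i \<in> C_inf N"
    "\<And>i q. i \<in> coords N \<Longrightarrow> q \<in> N0 \<Longrightarrow> \<xi> i q = \<psi> q i"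
    by (rule N.chart_coordinates[OF V]) (rule that; assumption)
  define W where "W = {x \<in> points M. \<pi> x \<in> N0} \<inter> U"
  have W: "openin (mtop M) W" "x0 \<in> W" "W \<subseteq> U"
    using openin_continuous_map_preimage[OF pr_cont \<xi>(1)] M.chart_open[OF U(1)] x0 \<xi>(2) U(2)
    by (auto simp: W_def)
  note oW = M.chart_image_open[OF U(1) W(1,3)]
  have "smooth_on (coords M) (\<phi> ` W) (\<lambda>z. \<Sum>i\<in>coords N. X (\<pi> (inv_into U \<phi> z)) (\<xi> i) * pd (e i) (\<lambda>z. f (inv_into U \<phi> z)) z)"
    by (rule smooth_on_subset[OF M.chart_image[OF U(1)] oW image_mono[OF W(3)]],
        rule smooth_on_sum[OF M.chart_image[OF U(1)] smooth_on_mult[OF M.chart_image[OF U(1)]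
          M.C_infD[OF C_inf_pull[OF N.vfield_smooth'[OF X \<xi>(4)]] U(1)]
          smooth_on_pd[OF M.chart_image[OF U(1)] M.C_infD[OF f U(1)] e_in]]])
  moreover have eq: "(\<Sum>i\<in>coords N. X (\<pi> (inv_into U \<phi> z)) (\<xi> i) * pd (e i) (\<lambda>z. f (inv_into U \<phi> z)) z) =
    X (\<pi> (inv_into U \<phi> z)) (\<lambda>y. f (\<sigma> (inv_into U \<phi> z) y))" if "z \<in> \<phi> ` W" for z
  proof -
    obtain x where x: "x \<in> W" "z = \<phi> x" using \<open>z \<in> \<phi> ` W\<close> by blast
    have xU: "x \<in> U" "\<pi> x \<in> N0" "x \<in> points M" using x by (auto simp: W_def)
    have "X (\<pi> x) (\<lambda>y. f (\<sigma> x y)) = (\<Sum>i\<in>coords N. X (\<pi> x) (\<xi> i) * pd i (\<lambda>z. f (\<sigma> x (inv_into V \<psi> z))) (\<psi> (\<pi> x)))"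
      by (rule N.coordinate_formula[OF V(1) \<xi>(1,3) xU(2) \<xi>(4,5) N.vfield_tangent[OF X pr_in[OF xU(3)]] C_inf_slice[OF f xU(3)]])
    also have "\<dots> = (\<Sum>i\<in>coords N. X (\<pi> x) (\<xi> i) * pd (e i) (\<lambda>z. f (inv_into U \<phi> z)) (\<phi> x))"
    proof (rule sum.cong[OF refl])
      fix i assume i: "i \<in> coords N"
      show "X (\<pi> x) (\<xi> i) * pd i (\<lambda>z. f (\<sigma> x (inv_into V \<psi> z))) (\<psi> (\<pi> x)) =
          X (\<pi> x) (\<xi> i) * pd (e i) (\<lambda>z. f (inv_into U \<phi> z)) (\<phi> x)"
        by (rule arg_cong[OF pd_slice[OF f V(1) U(1) xU(1) U(3) U(4) U(5) U(6) i]])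
    qed
    finally show ?thesis using x(2) U(1) xU(1) by simp
  qed
  ultimately have "smooth_on (coords M) (\<phi> ` W) (\<lambda>z. X (\<pi> (inv_into U \<phi> z)) (\<lambda>y. f (\<sigma> (inv_into U \<phi> z) y)))"
    using smooth_on_cong[OF oW eq] by simp
  then show "\<exists>U \<phi> W. (U, \<phi>) \<in> atlas M \<and> openin (mtop M) W \<and> x0 \<in> W \<and> W \<subseteq> U \<and>
    smooth_on (coords M) (\<phi> ` W) (\<lambda>z. X (\<pi> (inv_into U \<phi> z)) (\<lambda>y. f (\<sigma> (inv_into U \<phi> z) y)))"
    using U(1) W by (intro exI[of _ U] exI[of _ \<phi>] exI[of _ W]) simp
qed

abbreviation push :: "'a \<Rightarrow> 'b tangent \<Rightarrow> 'a tangent" where "push x u \<equiv> pushforward M (\<sigma> x) u"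
abbreviation proj :: "'a tangent \<Rightarrow> 'b tangent" where "proj v \<equiv> pushforward N \<pi> v"

lemma push_app: "f \<in> C_inf M \<Longrightarrow> push x u f = u (\<lambda>y. f (\<sigma> x y))"
  by (simp add: pushforward_def comp_def)

lemma push_off: "f \<notin> C_inf M \<Longrightarrow> push x u f = 0"
  by (simp add: pushforward_def)

lemma proj_app: "h \<in> C_inf N \<Longrightarrow> proj v h = v (\<lambda>x. h (\<pi> x))"
  by (simp add: pushforward_def comp_def)

lemma proj_off: "h \<notin> C_inf N \<Longrightarrow> proj v h = 0"
  by (simp add: pushforward_def)

lemma push_in:
  assumes x: "x \<in> points M" and u: "u \<in> tangent_space N (\<pi> x)"
  shows "push x u \<in> tangent_space M x"
  unfolding tangent_space_def
proof (intro CollectI conjI ballI allI impI)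
  fix f h a c assume fh: "f \<in> C_inf M" "h \<in> C_inf M"
  note s = C_inf_slice[OF fh(1) x] C_inf_slice[OF fh(2) x]
  show "push x u (\<lambda>x. a * f x + c * h x) = a * push x u f + c * push x u h"
    by (simp only: push_app[OF M.C_inf_add[OF M.C_inf_cmult[OF fh(1)] M.C_inf_cmult[OF fh(2)]]]
        push_app[OF fh(1)] push_app[OF fh(2)] N.tangent_lin[OF u s])
next
  fix f h assume fh: "f \<in> C_inf M" "h \<in> C_inf M"
  note s = C_inf_slice[OF fh(1) x] C_inf_slice[OF fh(2) x]
  show "push x u (\<lambda>x. f x * h x) = f x * push x u h + h x * push x u f"
    by (simp only: push_app[OF M.C_inf_mult[OF fh]] push_app[OF fh(1)] push_app[OF fh(2)]
        N.tangent_mult[OF u s] sl_pr[OF x])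
qed (rule push_off)

lemma proj_in:
  assumes x: "x \<in> points M" and v: "v \<in> tangent_space M x"
  shows "proj v \<in> tangent_space N (\<pi> x)"
  unfolding tangent_space_def
proof (intro CollectI conjI ballI allI impI)
  fix f h a c assume fh: "f \<in> C_inf N" "h \<in> C_inf N"
  note s = C_inf_pull[OF fh(1)] C_inf_pull[OF fh(2)]
  show "proj v (\<lambda>x. a * f x + c * h x) = a * proj v f + c * proj v h"
    by (simp only: proj_app[OF N.C_inf_add[OF N.C_inf_cmult[OF fh(1)] N.C_inf_cmult[OF fh(2)]]]
        proj_app[OF fh(1)] proj_app[OF fh(2)] M.tangent_lin[OF v s])
next
  fix f h assume fh: "f \<in> C_inf N" "h \<in> C_inf N"
  note s = C_inf_pull[OF fh(1)] C_inf_pull[OF fh(2)]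
  show "proj v (\<lambda>x. f x * h x) = f (\<pi> x) * proj v h + h (\<pi> x) * proj v f"
    by (simp only: proj_app[OF N.C_inf_mult[OF fh]] proj_app[OF fh(1)] proj_app[OF fh(2)]
        M.tangent_mult[OF v s])
qed (rule proj_off)

lemma push_pull:
  assumes x: "x \<in> points M" and u: "u \<in> tangent_space N (\<pi> x)" and h: "h \<in> C_inf N"
  shows "push x u (\<lambda>x. h (\<pi> x)) = u h"
  unfolding push_app[OF C_inf_pull[OF h]]
  by (rule N.tangent_cong[OF u pr_in[OF x]]) (simp add: pr_sl x)

lemma proj_push:
  assumes x: "x \<in> points M" and u: "u \<in> tangent_space N (\<pi> x)"
  shows "proj (push x u) = u"
proof
  fix h show "proj (push x u) h = u h"
    by (cases "h \<in> C_inf N") (simp_all add: proj_app proj_off push_pull[OF x u] N.tangent_off[OF u])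
qed

lemma push_sum: "push x (\<lambda>f. \<Sum>s\<in>S. c s * v s f) = (\<lambda>f. \<Sum>s\<in>S. c s * push x (v s) f)"
  by (simp add: pushforward_def fun_eq_iff)

definition lift :: "'b vfield \<Rightarrow> 'a vfield" where
  "lift X = (\<lambda>x. push x (X (\<pi> x)))"

lemma lift_vfield:
  assumes X: "X \<in> \<Gamma> N" shows "lift X \<in> \<Gamma> M"
proof (rule M.vfieldI)
  show "lift X x \<in> tangent_space M x" if x: "x \<in> points M" for x
    unfolding lift_def by (rule push_in[OF x N.vfield_tangent[OF X pr_in[OF x]]])
  show "(\<lambda>x. lift X x f) \<in> C_inf M" if f: "f \<in> C_inf M" for f
    unfolding lift_def push_app[OF f] by (rule lift_smooth[OF X f])
qed

lemma proj_expansion: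
  assumes F: "N.local_frame N0 \<xi> E" and x: "x \<in> points M" "\<pi> x \<in> N0" and v: "v \<in> tangent_space M x"
  shows "proj v = (\<lambda>f. \<Sum>i\<in>coords N. v (\<lambda>x. \<xi> i (\<pi> x)) * E i (\<pi> x) f)"
proof -
  have "proj v = (\<lambda>f. \<Sum>i\<in>coords N. proj v (\<xi> i) * E i (\<pi> x) f)"
    by (rule N.frame_expansion[OF F x(2) proj_in[OF x(1) v]])
  also have "\<dots> = (\<lambda>f. \<Sum>i\<in>coords N. v (\<lambda>x. \<xi> i (\<pi> x)) * E i (\<pi> x) f)"
    by (intro ext sum.cong refl) (simp add: proj_app N.local_frameD(2)[OF F])
  finally show ?thesis .
qed

lemma frame_preimage_open:
  assumes F: "N.local_frame N0 \<xi> E"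
  shows "openin (mtop M) {x \<in> points M. \<pi> x \<in> N0}"
  by (rule openin_continuous_map_preimage[OF pr_cont N.local_frameD(1)[OF F]])

end

locale ap_factor = factor N M \<pi> \<sigma> e + N: ap_mfd N
  for N :: "('b, 'j) almost_product" and M :: "('a, 'i, 'z) manifold_scheme" and \<pi> \<sigma> e
begin

text \<open>The vector \<open>proj (A x)\<close> depends on all of \<open>x\<close>, so it is not
  given by a field on \<open>N\<close>. Over a frame of \<open>N\<close> its coefficients are the
  smooth functions obtained by applying \<open>A\<close> to pulled-back coordinates.\<close>

lemma proj_metric_smooth:
  assumes A: "A \<in> \<Gamma> M" and C: "C \<in> \<Gamma> M"
  shows "(\<lambda>x. metric N (\<pi> x) (proj (A x)) (proj (C x))) \<in> C_inf M"
proof (rule M.C_inf_local)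
  fix x0 assume x0: "x0 \<in> points M"
  obtain N0 \<xi> E where F: "\<pi> x0 \<in> N0" "N.local_frame N0 \<xi> E" by (rule N.frame_exists[OF pr_in[OF x0]])
  note FD = N.local_frameD[OF F(2)]
  let ?W = "{x \<in> points M. \<pi> x \<in> N0}"
  let ?h = "\<lambda>x. \<Sum>i\<in>coords N. A x (\<lambda>x. \<xi> i (\<pi> x)) * (\<Sum>j\<in>coords N. C x (\<lambda>x. \<xi> j (\<pi> x)) * inner_vf N (E i) (E j) (\<pi> x))"
  have "?h \<in> C_inf M"
    by (rule M.C_inf_sum[OF M.C_inf_mult[OF M.vfield_smooth'[OF A C_inf_pull[OF FD(2)]]
        M.C_inf_sum[OF M.C_inf_mult[OF M.vfield_smooth'[OF C C_inf_pull[OF FD(2)]]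
          C_inf_pull[OF N.inner_smooth[OF FD(3) FD(3)]]]]]])
  moreover have "metric N (\<pi> x) (proj (A x)) (proj (C x)) = ?h x" if x: "x \<in> ?W" for x
  proof -
    have xM: "x \<in> points M" "\<pi> x \<in> N0" using x by simp_all
    note px = pr_in[OF xM(1)]
    note Ex = N.vfield_tangent[OF FD(3) px]
    have "metric N (\<pi> x) (\<lambda>f. \<Sum>i\<in>coords N. A x (\<lambda>x. \<xi> i (\<pi> x)) * E i (\<pi> x) f) (proj (C x)) =
        (\<Sum>i\<in>coords N. A x (\<lambda>x. \<xi> i (\<pi> x)) * metric N (\<pi> x) (E i (\<pi> x)) (proj (C x)))"
      by (rule N.metric_sum[OF px Ex proj_in[OF xM(1) M.vfield_tangent[OF C xM(1)]]])
    also have "\<dots> = ?h x"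
    proof (rule sum.cong[OF refl])
      fix i assume i: "i \<in> coords N"
      have "metric N (\<pi> x) (E i (\<pi> x)) (\<lambda>f. \<Sum>j\<in>coords N. C x (\<lambda>x. \<xi> j (\<pi> x)) * E j (\<pi> x) f) =
          (\<Sum>j\<in>coords N. C x (\<lambda>x. \<xi> j (\<pi> x)) * inner_vf N (E i) (E j) (\<pi> x))"
        unfolding inner_vf_def by (rule N.metric_sum_right[OF px Ex Ex[OF i]])
      then show "A x (\<lambda>x. \<xi> i (\<pi> x)) * metric N (\<pi> x) (E i (\<pi> x)) (proj (C x)) =
        A x (\<lambda>x. \<xi> i (\<pi> x)) * (\<Sum>j\<in>coords N. C x (\<lambda>x. \<xi> j (\<pi> x)) * inner_vf N (E i) (E j) (\<pi> x))"
        by (simp only: proj_expansion[OF F(2) xM M.vfield_tangent[OF C xM(1)]])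
    qed
    finally show ?thesis by (simp only: proj_expansion[OF F(2) xM M.vfield_tangent[OF A xM(1)]])
  qed
  ultimately show "\<exists>W h. openin (mtop M) W \<and> x0 \<in> W \<and> h \<in> C_inf M \<and>
      (\<forall>x\<in>W. metric N (\<pi> x) (proj (A x)) (proj (C x)) = h x)"
    using frame_preimage_open[OF F(2)] x0 F(1) by (intro exI[of _ ?W] exI[of _ ?h]) simp
qed

lemma push_endo_proj_smooth:
  assumes A: "A \<in> \<Gamma> M" and f: "f \<in> C_inf M"
  shows "(\<lambda>x. push x (endo N (\<pi> x) (proj (A x))) f) \<in> C_inf M"
proof (rule M.C_inf_local)
  fix x0 assume x0: "x0 \<in> points M"
  obtain N0 \<xi> E where F: "\<pi> x0 \<in> N0" "N.local_frame N0 \<xi> E" by (rule N.frame_exists[OF pr_in[OF x0]])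
  note FD = N.local_frameD[OF F(2)]
  let ?W = "{x \<in> points M. \<pi> x \<in> N0}"
  let ?h = "\<lambda>x. \<Sum>i\<in>coords N. A x (\<lambda>x. \<xi> i (\<pi> x)) * lift (endo_vf N (E i)) x f"
  have "?h \<in> C_inf M"
    by (rule M.C_inf_sum[OF M.C_inf_mult[OF M.vfield_smooth'[OF A C_inf_pull[OF FD(2)]]
        M.vfield_smooth'[OF lift_vfield[OF N.endo_smooth[OF FD(3)]] f]]])
  moreover have "push x (endo N (\<pi> x) (proj (A x))) f = ?h x" if x: "x \<in> ?W" for x
  proof -
    have xM: "x \<in> points M" "\<pi> x \<in> N0" using x by simp_all
    note px = pr_in[OF xM(1)]
    have "endo N (\<pi> x) (proj (A x)) = (\<lambda>f. \<Sum>i\<in>coords N. A x (\<lambda>x. \<xi> i (\<pi> x)) * endo N (\<pi> x) (E i (\<pi> x)) f)"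
      unfolding proj_expansion[OF F(2) xM M.vfield_tangent[OF A xM(1)]]
      by (rule N.endo_sum[OF px N.vfield_tangent[OF FD(3) px]])
    then show ?thesis by (simp only: push_sum lift_def endo_vf_def)
  qed
  ultimately show "\<exists>W h. openin (mtop M) W \<and> x0 \<in> W \<and> h \<in> C_inf M \<and>
      (\<forall>x\<in>W. push x (endo N (\<pi> x) (proj (A x))) f = h x)"
    using frame_preimage_open[OF F(2)] x0 F(1) by (intro exI[of _ ?W] exI[of _ ?h]) simp
qed

end

context charted
begin

lemma chart_coord_cont:
  assumes "(U, \<phi>) \<in> atlas M"
  shows "continuous_map (subtopology (mtop M) U) euclideanreal (\<lambda>p. \<phi> p i)"
proof -
  have "continuous_map (top_of_set (\<phi> ` U)) euclideanreal (\<lambda>z. z i)"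
    unfolding continuous_map_iff_continuous by (rule continuous_on_coord)
  from continuous_map_compose[OF homeomorphic_imp_continuous_map[OF chart_homeo[OF assms]] this]
  show ?thesis by (simp add: comp_def)
qed

lemma chart_inv_cont:
  assumes U: "(U, \<phi>) \<in> atlas M"
  shows "continuous_map (top_of_set (\<phi> ` U)) (subtopology (mtop M) U) (inv_into U \<phi>)"
proof -
  obtain g where g: "homeomorphic_maps (subtopology (mtop M) U) (top_of_set (\<phi> ` U)) \<phi> g"
    using iffD1[OF homeomorphic_map_maps chart_homeo[OF U]] by (rule exE)
  show ?thesis
  proof (rule continuous_map_eq[of _ _ g])
    show "continuous_map (top_of_set (\<phi> ` U)) (subtopology (mtop M) U) g"
      using g by (simp add: homeomorphic_maps_def)
    fix x assume "x \<in> topspace (top_of_set (\<phi> ` U))"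
    then obtain p where p: "p \<in> U" "x = \<phi> p" by auto
    then show "g x = inv_into U \<phi> x"
      using g U chart_subset[OF U] by (auto simp: homeomorphic_maps_def)
  qed
qed

end

lemma open_ext_preimage:
  assumes "continuous_on (extensional C) T" "\<And>z. z \<in> extensional C \<Longrightarrow> T z \<in> extensional I" "open_ext I S"
  shows "open_ext C {z \<in> extensional C. T z \<in> S}"
proof -
  obtain O' where O': "open O'" "S = extensional I \<inter> O'" using assms(3) by (auto simp: openin_open)
  have "open_ext C (extensional C \<inter> T -` O')" by (rule continuous_openin_preimage_gen[OF assms(1) O'(1)])
  moreover have "extensional C \<inter> T -` O' = {z \<in> extensional C. T z \<in> S}" using O'(2) assms(2) by auto
  ultimately show ?thesis by simp
qed

section \<open>Product manifolds\<close>

text \<open>\<open>M\<close> may carry further structure on top of the product manifold.\<close>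

locale charted_product =
  fixes m :: nat and B :: "('b, 'i, 'y) manifold_scheme" and F :: "nat \<Rightarrow> ('f, 'j, 'x) manifold_scheme"
    and M :: "('b \<times> (nat \<Rightarrow> 'f), 'i + nat \<times> 'j, 'z) manifold_scheme"
  assumes B: "charted B" and F: "j \<in> {1..m} \<Longrightarrow> charted (F j)"
    and mtop_M: "mtop M = mtop (product_manifold m B F)"
    and coords_M: "coords M = coords (product_manifold m B F)"
    and atlas_M: "atlas M = atlas (product_manifold m B F)"
begin

definition pchart :: "('b \<Rightarrow> 'i \<Rightarrow> real) \<Rightarrow> (nat \<Rightarrow> 'f \<Rightarrow> 'j \<Rightarrow> real) \<Rightarrow> 'b \<times> (nat \<Rightarrow> 'f) \<Rightarrow> 'i + nat \<times> 'j \<Rightarrow> real" where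
  "pchart \<phi> \<psi> = (\<lambda>(p, q). restrict (case_sum (\<phi> p) (\<lambda>(j, k). \<psi> j (q j) k)) (coords M))"

lemma coords_eq: "coords M = coords B <+> (SIGMA j:{1..m}. coords (F j))"
  by (simp add: coords_M product_manifold_def)

lemma coords_Inl [simp]: "Inl i \<in> coords M \<longleftrightarrow> i \<in> coords B"
  and coords_Inr [simp]: "Inr (j, k) \<in> coords M \<longleftrightarrow> j \<in> {1..m} \<and> k \<in> coords (F j)"
  by (auto simp: coords_eq)

lemma points_eq: "points M = points B \<times> (\<Pi>\<^sub>E j\<in>{1..m}. points (F j))"
  by (simp add: mtop_M product_manifold_def)

lemma mtop_eq: "mtop M = prod_topology (mtop B) (product_topology (\<lambda>j. mtop (F j)) {1..m})"
  by (simp add: mtop_M product_manifold_def)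

lemma atlasI:
  "(U, \<phi>) \<in> atlas B \<Longrightarrow> (\<And>j. j \<in> {1..m} \<Longrightarrow> (V j, \<psi> j) \<in> atlas (F j)) \<Longrightarrow>
    (U \<times> (\<Pi>\<^sub>E j\<in>{1..m}. V j), pchart \<phi> \<psi>) \<in> atlas M"
  unfolding atlas_M pchart_def coords_eq product_manifold_def manifold.simps
  by (rule CollectI, intro exI[of _ U] exI[of _ \<phi>] exI[of _ V] exI[of _ \<psi>]) simp

lemma atlasE:
  assumes "(D, \<Phi>) \<in> atlas M"
  obtains U \<phi> V \<psi> where "(U, \<phi>) \<in> atlas B" "\<And>j. j \<in> {1..m} \<Longrightarrow> (V j, \<psi> j) \<in> atlas (F j)"
    "D = U \<times> (\<Pi>\<^sub>E j\<in>{1..m}. V j)" "\<Phi> = pchart \<phi> \<psi>"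
proof -
  have "\<exists>U \<phi> V \<psi>. (D, \<Phi>) = (U \<times> (\<Pi>\<^sub>E j\<in>{1..m}. V j), pchart \<phi> \<psi>) \<and>
      (U, \<phi>) \<in> atlas B \<and> (\<forall>j\<in>{1..m}. (V j, \<psi> j) \<in> atlas (F j))"
    using assms unfolding atlas_M pchart_def coords_eq by (simp add: product_manifold_def)
  then obtain U \<phi> V \<psi> where *: "(D, \<Phi>) = (U \<times> (\<Pi>\<^sub>E j\<in>{1..m}. V j), pchart \<phi> \<psi>) \<and>
      (U, \<phi>) \<in> atlas B \<and> (\<forall>j\<in>{1..m}. (V j, \<psi> j) \<in> atlas (F j))" by (elim exE)
  show thesis by (rule that[of U \<phi> V \<psi>]) (use * in simp_all)
qed

lemma pchart_Inl: "i \<in> coords B \<Longrightarrow> pchart \<phi> \<psi> x (Inl i) = \<phi> (fst x) i"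
  and pchart_Inr: "j \<in> {1..m} \<Longrightarrow> k \<in> coords (F j) \<Longrightarrow> pchart \<phi> \<psi> x (Inr (j, k)) = \<psi> j (snd x j) k"
  by (simp_all add: pchart_def split_beta)

lemma pchart_ext: "pchart \<phi> \<psi> x \<in> extensional (coords M)"
  by (simp add: pchart_def split_beta)

definition TB :: "('i + nat \<times> 'j \<Rightarrow> real) \<Rightarrow> 'i \<Rightarrow> real" where
  "TB z = (\<lambda>i\<in>coords B. z (Inl i))"
definition TF :: "nat \<Rightarrow> ('i + nat \<times> 'j \<Rightarrow> real) \<Rightarrow> 'j \<Rightarrow> real" where
  "TF j z = (\<lambda>k\<in>coords (F j). z (Inr (j, k)))"

lemma TB_cont: "continuous_on S TB" and TF_cont: "continuous_on S (TF j)"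
  by (rule continuous_on_ext_map[where I="coords B"] continuous_on_ext_map[where I="coords (F j)"];
      simp add: TB_def TF_def continuous_on_coord)+

text \<open>An inverse of the product chart given block by block, so that continuity and smoothness
  can be checked on each factor, which \<open>inv_into\<close> of the whole chart does not allow
  directly.\<close>

definition product_inv :: "'b set \<Rightarrow> ('b \<Rightarrow> 'i \<Rightarrow> real) \<Rightarrow> (nat \<Rightarrow> 'f set) \<Rightarrow> (nat \<Rightarrow> 'f \<Rightarrow> 'j \<Rightarrow> real) \<Rightarrow>
    ('i + nat \<times> 'j \<Rightarrow> real) \<Rightarrow> 'b \<times> (nat \<Rightarrow> 'f)" where
  "product_inv U \<phi> V \<psi> z = (inv_into U \<phi> (TB z), \<lambda>j\<in>{1..m}. inv_into (V j) (\<psi> j) (TF j z))"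

context
  fixes U \<phi> V \<psi>
  assumes U: "(U, \<phi>) \<in> atlas B" and V: "\<And>j. j \<in> {1..m} \<Longrightarrow> (V j, \<psi> j) \<in> atlas (F j)"
begin

lemma TB_pchart: "p \<in> U \<Longrightarrow> TB (pchart \<phi> \<psi> (p, q)) = \<phi> p"
  by (rule extensionalityI[of _ "coords B"])
     (use open_ext_subset[OF charted.chart_image[OF B U]] in \<open>auto simp: TB_def pchart_Inl\<close>)

lemma TF_pchart: "j \<in> {1..m} \<Longrightarrow> q j \<in> V j \<Longrightarrow> TF j (pchart \<phi> \<psi> (p, q)) = \<psi> j (q j)"
  by (rule extensionalityI[of _ "coords (F j)"])
     (use open_ext_subset[OF charted.chart_image[OF F V]] in \<open>auto simp: TF_def pchart_Inr\<close>)

abbreviation "pinv \<equiv> product_inv U \<phi> V \<psi>"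

lemma pinv_pchart:
  assumes "x \<in> U \<times> (\<Pi>\<^sub>E j\<in>{1..m}. V j)"
  shows "pinv (pchart \<phi> \<psi> x) = x"
proof (rule prod_eqI)
  obtain p q where x: "x = (p, q)" by (cases x)
  have p: "p \<in> U" and q: "q \<in> (\<Pi>\<^sub>E j\<in>{1..m}. V j)" using assms by (simp_all add: x)
  show "fst (pinv (pchart \<phi> \<psi> x)) = fst x"
    using p by (simp add: x product_inv_def TB_pchart charted.chart_inv[OF B U])
  show "snd (pinv (pchart \<phi> \<psi> x)) = snd x"
  proof (rule extensionalityI[of _ "{1..m}"])
    show "snd (pinv (pchart \<phi> \<psi> x)) \<in> extensional {1..m}" "snd x \<in> extensional {1..m}"
      using q by (simp_all add: x product_inv_def PiE_def)
    fix j assume j: "j \<in> {1..m}"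
    have qj: "q j \<in> V j" using q j by (rule PiE_mem)
    show "snd (pinv (pchart \<phi> \<psi> x)) j = snd x j"
      using j by (simp add: x product_inv_def TF_pchart[where j=j and q=q, OF j qj] charted.chart_inv[OF F[OF j] V[OF j] qj])
  qed
qed

text \<open>The image is cut out by conditions on the blocks, so its openness follows from
  continuity of the block maps. The extra \<open>extensional (coords M)\<close> matters for
  \<open>m = 0\<close>, where the intersection over \<open>j\<close> is the whole type.\<close>

lemma pchart_image:
  assumes "U1 \<subseteq> U" "\<And>j. j \<in> {1..m} \<Longrightarrow> V1 j \<subseteq> V j"
  shows "pchart \<phi> \<psi> ` (U1 \<times> (\<Pi>\<^sub>E j\<in>{1..m}. V1 j)) =
    {z \<in> extensional (coords M). TB z \<in> \<phi> ` U1} \<inter> (extensional (coords M) \<inter> (\<Inter>j\<in>{1..m}. {z \<in> extensional (coords M). TF j z \<in> \<psi> j ` V1 j}))"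
    (is "?L = ?R")
proof
  show "?L \<subseteq> ?R"
  proof
    fix z assume "z \<in> ?L"
    then obtain p q where pq: "p \<in> U1" "q \<in> (\<Pi>\<^sub>E j\<in>{1..m}. V1 j)" "z = pchart \<phi> \<psi> (p, q)" by auto
    have "TB z \<in> \<phi> ` U1" using pq assms(1) TB_pchart by (metis image_eqI subsetD)
    moreover have "TF j z \<in> \<psi> j ` V1 j" if j: "j \<in> {1..m}" for j
    proof -
      have "q j \<in> V1 j" using pq(2) j by (rule PiE_mem)
      then show ?thesis using assms(2)[OF j] TF_pchart[OF j] pq(3) by (metis image_eqI subsetD)
    qed
    ultimately show "z \<in> ?R" using pq(3) pchart_ext by simp
  qed
  show "?R \<subseteq> ?L"
  proof
    fix z assume z: "z \<in> ?R"
    then have ze: "z \<in> extensional (coords M)" by simp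
    obtain p where p: "p \<in> U1" "TB z = \<phi> p" using z by blast
    have "\<exists>y. y \<in> V1 j \<and> TF j z = \<psi> j y" if "j \<in> {1..m}" for j using z that by blast
    then obtain y where y: "\<And>j. j \<in> {1..m} \<Longrightarrow> y j \<in> V1 j \<and> TF j z = \<psi> j (y j)" by metis
    define q where "q = restrict y {1..m}"
    have q: "q \<in> (\<Pi>\<^sub>E j\<in>{1..m}. V1 j)" using y by (simp add: q_def)
    have "z = pchart \<phi> \<psi> (p, q)"
    proof (rule extensionalityI[OF ze pchart_ext])
      fix c assume c: "c \<in> coords M"
      show "z c = pchart \<phi> \<psi> (p, q) c"
      proof (cases c)
        case (Inl i)
        then have i: "i \<in> coords B" using c by simp
        have "z c = TB z i" using i by (simp add: TB_def Inl)
        then show ?thesis using p(2) i by (simp add: Inl pchart_Inl)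
      next
        case (Inr jk)
        obtain j k where jk: "jk = (j, k)" by (cases jk)
        have j: "j \<in> {1..m}" and k: "k \<in> coords (F j)" using c by (simp_all add: Inr jk)
        have "z c = TF j z k" using k by (simp add: TF_def Inr jk)
        then show ?thesis using y[OF j] j k by (simp add: Inr jk pchart_Inr q_def)
      qed
    qed
    then show "z \<in> ?L" using p(1) q by blast
  qed
qed

lemma pchart_image_open:
  assumes "U1 \<subseteq> U" "\<And>j. j \<in> {1..m} \<Longrightarrow> V1 j \<subseteq> V j"
    "openin (mtop B) U1" "\<And>j. j \<in> {1..m} \<Longrightarrow> openin (mtop (F j)) (V1 j)"
  shows "open_ext (coords M) (pchart \<phi> \<psi> ` (U1 \<times> (\<Pi>\<^sub>E j\<in>{1..m}. V1 j)))"
proof (subst pchart_image)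
  show "U1 \<subseteq> U" "\<And>j. j \<in> {1..m} \<Longrightarrow> V1 j \<subseteq> V j" by (fact assms)+
  show "open_ext (coords M) ({z \<in> extensional (coords M). TB z \<in> \<phi> ` U1} \<inter>
    (extensional (coords M) \<inter> (\<Inter>j\<in>{1..m}. {z \<in> extensional (coords M). TF j z \<in> \<psi> j ` V1 j})))"
  proof (rule openin_Int)
  show "open_ext (coords M) {z \<in> extensional (coords M). TB z \<in> \<phi> ` U1}"
    by (rule open_ext_preimage[OF TB_cont _ charted.chart_image_open[OF B U assms(3,1)]]) (simp add: TB_def)
  have "open_ext (coords M) {z \<in> extensional (coords M). TF j z \<in> \<psi> j ` V1 j}" if j: "j \<in> {1..m}" for j
    by (rule open_ext_preimage[OF TF_cont _ charted.chart_image_open[OF F[OF j] V[OF j] assms(4)[OF j] assms(2)[OF j]]])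
       (simp add: TF_def)
  moreover have "extensional (coords M) \<inter> (\<Inter>j\<in>{1..m}. {z \<in> extensional (coords M). TF j z \<in> \<psi> j ` V1 j}) =
    \<Inter>(insert (extensional (coords M)) ((\<lambda>j. {z \<in> extensional (coords M). TF j z \<in> \<psi> j ` V1 j}) ` {1..m}))" by simp
  moreover have "open_ext (coords M) (extensional (coords M))" by simp
  ultimately show "open_ext (coords M) (extensional (coords M) \<inter> (\<Inter>j\<in>{1..m}. {z \<in> extensional (coords M). TF j z \<in> \<psi> j ` V1 j}))"
    by (simp only:) (rule openin_Inter, auto)
  qed
qed

lemma subtopology_D: "subtopology (mtop M) (U \<times> (\<Pi>\<^sub>E j\<in>{1..m}. V j)) =
   prod_topology (subtopology (mtop B) U) (product_topology (\<lambda>j. subtopology (mtop (F j)) (V j)) {1..m})"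
  by (simp add: mtop_eq subtopology_Times subtopology_product_topology)

lemma pchart_homeo:
  "homeomorphic_maps (subtopology (mtop M) (U \<times> (\<Pi>\<^sub>E j\<in>{1..m}. V j)))
     (top_of_set (pchart \<phi> \<psi> ` (U \<times> (\<Pi>\<^sub>E j\<in>{1..m}. V j)))) (pchart \<phi> \<psi>) pinv"
  unfolding homeomorphic_maps_def
proof (intro conjI ballI)
  let ?D = "U \<times> (\<Pi>\<^sub>E j\<in>{1..m}. V j)"
  let ?S = "pchart \<phi> \<psi> ` ?D"
  let ?X = "prod_topology (subtopology (mtop B) U) (product_topology (\<lambda>j. subtopology (mtop (F j)) (V j)) {1..m})"
  have SE: "?S \<subseteq> extensional (coords M)" using pchart_ext by blast
  have top: "topspace (subtopology (mtop M) ?D) \<subseteq> ?D" by simp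
  have pc: "continuous_map (subtopology (mtop M) ?D) (powertop_real (coords M)) (pchart \<phi> \<psi>)"
    unfolding continuous_map_componentwise
  proof (intro conjI ballI)
    show "pchart \<phi> \<psi> ` topspace (subtopology (mtop M) ?D) \<subseteq> extensional (coords M)" using pchart_ext by blast
    fix c assume c: "c \<in> coords M"
    show "continuous_map (subtopology (mtop M) ?D) euclideanreal (\<lambda>x. pchart \<phi> \<psi> x c)"
    proof (cases c)
      case (Inl i)
      then have i: "i \<in> coords B" using c by simp
      show ?thesis unfolding Inl pchart_Inl[OF i] subtopology_D
        using continuous_map_compose[OF continuous_map_fst charted.chart_coord_cont[OF B U]] by (simp add: comp_def)
    next
      case (Inr jk)
      obtain j k where jk: "jk = (j, k)" by (cases jk)
      have j: "j \<in> {1..m}" and k: "k \<in> coords (F j)" using c by (simp_all add: Inr jk)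
      show ?thesis unfolding Inr jk pchart_Inr[OF j k] subtopology_D
      proof -
        have "continuous_map ?X (subtopology (mtop (F j)) (V j)) ((\<lambda>q. q j) \<circ> snd)"
        proof (rule continuous_map_compose[OF continuous_map_snd])
          show "continuous_map (product_topology (\<lambda>j. subtopology (mtop (F j)) (V j)) {1..m})
              (subtopology (mtop (F j)) (V j)) (\<lambda>q. q j)"
            by (rule continuous_map_product_projection[OF j])
        qed
        from continuous_map_compose[OF this charted.chart_coord_cont[OF F[OF j] V[OF j], of k]]
        show "continuous_map ?X euclideanreal (\<lambda>x. \<psi> j (snd x j) k)" by (simp add: comp_def)
      qed
    qed
  qed
  have "continuous_map (subtopology (mtop M) ?D) (subtopology (powertop_real (coords M)) ?S) (pchart \<phi> \<psi>)"
    unfolding continuous_map_in_subtopology using pc top by blast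
  then show "continuous_map (subtopology (mtop M) ?D) (top_of_set ?S) (pchart \<phi> \<psi>)"
    using SE by (simp add: powertop_real_eq subtopology_subtopology inf_absorb2)
  show "continuous_map (top_of_set ?S) (subtopology (mtop M) ?D) pinv"
    unfolding subtopology_D continuous_map_pairwise continuous_map_componentwise
  proof (intro conjI ballI)
    have "continuous_map (top_of_set ?S) (top_of_set (\<phi> ` U)) TB"
      unfolding continuous_map_in_subtopology continuous_map_iff_continuous
      using TB_cont pchart_image[of U V, simplified] by auto
    from continuous_map_compose[OF this charted.chart_inv_cont[OF B U]]
    show "continuous_map (top_of_set ?S) (subtopology (mtop B) U) (fst \<circ> pinv)" by (simp add: comp_def product_inv_def)
    show "(snd \<circ> pinv) ` topspace (top_of_set ?S) \<subseteq> extensional {1..m}" by (auto simp: product_inv_def)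
    fix j assume j: "j \<in> {1..m}"
    have "continuous_map (top_of_set ?S) (top_of_set (\<psi> j ` V j)) (TF j)"
      unfolding continuous_map_in_subtopology continuous_map_iff_continuous
      using TF_cont pchart_image[of U V, simplified] j by auto
    from continuous_map_compose[OF this charted.chart_inv_cont[OF F[OF j] V[OF j]]]
    show "continuous_map (top_of_set ?S) (subtopology (mtop (F j)) (V j)) (\<lambda>x. (snd \<circ> pinv) x j)"
      using j by (simp add: comp_def product_inv_def)
  qed
  show "pinv (pchart \<phi> \<psi> x) = x" if "x \<in> topspace (subtopology (mtop M) ?D)" for x
    using that top by (intro pinv_pchart) blast
  show "pchart \<phi> \<psi> (pinv y) = y" if "y \<in> topspace (top_of_set ?S)" for y
    using that pinv_pchart by auto
qed

lemma inv_pchart: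
  assumes "z \<in> pchart \<phi> \<psi> ` (U \<times> (\<Pi>\<^sub>E j\<in>{1..m}. V j))"
  shows "inv_into (U \<times> (\<Pi>\<^sub>E j\<in>{1..m}. V j)) (pchart \<phi> \<psi>) z = pinv z"
proof -
  have "inj_on (pchart \<phi> \<psi>) (U \<times> (\<Pi>\<^sub>E j\<in>{1..m}. V j))"
    by (rule inj_on_inverseI[where g=pinv]) (rule pinv_pchart)
  then show ?thesis using assms by (auto simp: pinv_pchart)
qed

end

lemma charted_M: "charted M"
proof
  show "Hausdorff_space (mtop M)"
    unfolding mtop_eq Hausdorff_space_prod_topology Hausdorff_space_product_topology
    using charted.Hausdorff[OF B] charted.Hausdorff[OF F] by blast
  show "finite (coords M)"
    unfolding coords_eq
    by (intro finite_Plus finite_SigmaI finite_atLeastAtMost charted.finite_coords[OF B] charted.finite_coords[OF F])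
  show "(\<Union>(U, \<phi>)\<in>atlas M. U) = points M"
  proof (intro equalityI subsetI)
    fix x assume "x \<in> (\<Union>(U, \<phi>)\<in>atlas M. U)"
    then obtain D \<Phi> where D: "(D, \<Phi>) \<in> atlas M" "x \<in> D" by blast
    obtain U \<phi> V \<psi> where U: "(U, \<phi>) \<in> atlas B" "\<And>j. j \<in> {1..m} \<Longrightarrow> (V j, \<psi> j) \<in> atlas (F j)"
      "D = U \<times> (\<Pi>\<^sub>E j\<in>{1..m}. V j)" by (rule atlasE[OF D(1)]) (rule that; assumption)
    have "U \<times> (\<Pi>\<^sub>E j\<in>{1..m}. V j) \<subseteq> points M"
      unfolding points_eq
      by (rule Sigma_mono[OF charted.chart_subset[OF B U(1)] PiE_mono]) (rule charted.chart_subset[OF F U(2)])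
    then show "x \<in> points M" using D(2) U(3) by blast
  next
    fix x assume "x \<in> points M"
    then obtain p q where x: "x = (p, q)" "p \<in> points B" "q \<in> (\<Pi>\<^sub>E j\<in>{1..m}. points (F j))"
      unfolding points_eq by auto
    obtain U \<phi> where U: "(U, \<phi>) \<in> atlas B" "p \<in> U" by (rule charted.chart_at[OF B x(2)])
    have "\<exists>V \<psi>. (V, \<psi>) \<in> atlas (F j) \<and> q j \<in> V" if j: "j \<in> {1..m}" for j
      by (rule charted.chart_at[OF F[OF j] PiE_mem[OF x(3) j]]) blast
    then obtain V \<psi> where V: "\<And>j. j \<in> {1..m} \<Longrightarrow> (V j, \<psi> j) \<in> atlas (F j) \<and> q j \<in> V j" by metis
    have "x \<in> U \<times> (\<Pi>\<^sub>E j\<in>{1..m}. V j)" using x U V by (auto simp: PiE_def)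
    moreover have "(U \<times> (\<Pi>\<^sub>E j\<in>{1..m}. V j), pchart \<phi> \<psi>) \<in> atlas M"
      by (rule atlasI[OF U(1)]) (use V in blast)
    ultimately show "x \<in> (\<Union>(U, \<phi>)\<in>atlas M. U)" by blast
  qed
next
  fix D \<Phi> assume D: "(D, \<Phi>) \<in> atlas M"
  obtain U \<phi> V \<psi> where U: "(U, \<phi>) \<in> atlas B" and V: "\<And>j. j \<in> {1..m} \<Longrightarrow> (V j, \<psi> j) \<in> atlas (F j)"
    and D': "D = U \<times> (\<Pi>\<^sub>E j\<in>{1..m}. V j)" "\<Phi> = pchart \<phi> \<psi>"
    by (rule atlasE[OF D]) (rule that; assumption)
  note oU = charted.chart_open[OF B U] and oV = charted.chart_open[OF F V]
  show "openin (mtop M) D"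
    unfolding mtop_eq D'(1) openin_prod_Times_iff
    using oU oV by (auto simp: openin_PiE_gen)
  show "open_ext (coords M) (\<Phi> ` D)"
    unfolding D' by (rule pchart_image_open[OF U V subset_refl subset_refl oU oV])
  show "homeomorphic_map (subtopology (mtop M) D) (top_of_set (\<Phi> ` D)) \<Phi>"
    unfolding D' by (rule homeomorphic_maps_imp_map[OF pchart_homeo[OF U V]])
  fix D2 \<Phi>2 c assume D2: "(D2, \<Phi>2) \<in> atlas M" and c: "c \<in> coords M"
  obtain U2 \<phi>2 V2 \<psi>2 where U2: "(U2, \<phi>2) \<in> atlas B" and V2: "\<And>j. j \<in> {1..m} \<Longrightarrow> (V2 j, \<psi>2 j) \<in> atlas (F j)"
    and D2': "D2 = U2 \<times> (\<Pi>\<^sub>E j\<in>{1..m}. V2 j)" "\<Phi>2 = pchart \<phi>2 \<psi>2"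
    by (rule atlasE[OF D2]) (rule that; assumption)
  note oU2 = charted.chart_open[OF B U2] and oV2 = charted.chart_open[OF F V2]
  have DD: "D \<inter> D2 = (U \<inter> U2) \<times> (\<Pi>\<^sub>E j\<in>{1..m}. V j \<inter> V2 j)"
    unfolding D' D2' by (auto simp: PiE_def)
  have im: "\<Phi> ` (D \<inter> D2) = {z \<in> extensional (coords M). TB z \<in> \<phi> ` (U \<inter> U2)} \<inter>
      (extensional (coords M) \<inter> (\<Inter>j\<in>{1..m}. {z \<in> extensional (coords M). TF j z \<in> \<psi> j ` (V j \<inter> V2 j)}))"
    unfolding DD D'(2) by (rule pchart_image[OF U V]) auto
  have o: "open_ext (coords M) (\<Phi> ` (D \<inter> D2))"
    unfolding DD D'(2) by (rule pchart_image_open[OF U V]) (use oU oU2 oV oV2 in auto)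
  have inv: "inv_into D \<Phi> z = product_inv U \<phi> V \<psi> z" if "z \<in> \<Phi> ` (D \<inter> D2)" for z
    unfolding D' by (rule inv_pchart[OF U V]) (use that in \<open>auto simp: D'\<close>)
  show "smooth_on (coords M) (\<Phi> ` (D \<inter> D2)) (\<lambda>z. \<Phi>2 (inv_into D \<Phi> z) c)"
  \<comment> \<open>Each coordinate of the transition map depends on the block of a single factor
    and is a coordinate of a transition map there.\<close>
  proof (cases c)
    case (Inl i)
    then have i: "i \<in> coords B" using c by simp
    have "smooth_on (coords M) (\<Phi> ` (D \<inter> D2)) (\<lambda>z. (\<lambda>y. \<phi>2 (inv_into U \<phi> y) i) (TB z))"
    proof (rule smooth_on_compose[OF charted.finite_coords[OF B] charted.chart_image_open[OF B U] o _ _ charted.transition[OF B U U2 i]])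
      show "openin (mtop B) (U \<inter> U2)" using oU oU2 by blast
      show "TB z \<in> \<phi> ` (U \<inter> U2)" if "z \<in> \<Phi> ` (D \<inter> D2)" for z using that unfolding im by blast
      show "smooth_on (coords M) (\<Phi> ` (D \<inter> D2)) (\<lambda>z. TB z k)" if "k \<in> coords B" for k
        using smooth_on_coord[OF o, of "Inl k"] that by (simp add: TB_def)
    qed simp
    then show ?thesis
      by (subst smooth_on_cong[OF o, where h="\<lambda>z. \<phi>2 (inv_into U \<phi> (TB z)) i"])
         (simp_all add: inv Inl D2' pchart_Inl[OF i] product_inv_def)
  next
    case (Inr jk)
    obtain j k where jk: "jk = (j, k)" by (cases jk)
    have j: "j \<in> {1..m}" and k: "k \<in> coords (F j)" using c by (simp_all add: Inr jk)
    have "smooth_on (coords M) (\<Phi> ` (D \<inter> D2)) (\<lambda>z. (\<lambda>y. \<psi>2 j (inv_into (V j) (\<psi> j) y) k) (TF j z))"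
    proof (rule smooth_on_compose[OF charted.finite_coords[OF F[OF j]] charted.chart_image_open[OF F[OF j] V[OF j]] o _ _
          charted.transition[OF F[OF j] V[OF j] V2[OF j] k]])
      show "openin (mtop (F j)) (V j \<inter> V2 j)" by (rule openin_Int[OF oV[OF j j] oV2[OF j j]])
      show "TF j z \<in> \<psi> j ` (V j \<inter> V2 j)" if "z \<in> \<Phi> ` (D \<inter> D2)" for z using that j unfolding im by blast
      show "smooth_on (coords M) (\<Phi> ` (D \<inter> D2)) (\<lambda>z. TF j z l)" if "l \<in> coords (F j)" for l
        using smooth_on_coord[OF o, of "Inr (j, l)"] that j by (simp add: TF_def)
    qed simp
    then show ?thesis
      using j by (subst smooth_on_cong[OF o, where h="\<lambda>z. \<psi>2 j (inv_into (V j) (\<psi> j) (TF j z)) k"])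
         (simp_all add: inv Inr jk D2' pchart_Inr[OF j k] product_inv_def)
  qed
qed

sublocale M: charted M by (rule charted_M)

lemma product_chart_at:
  assumes x: "(p, q) \<in> points M"
  obtains U \<phi> V \<psi> where "(U, \<phi>) \<in> atlas B" "p \<in> U" "\<And>j. j \<in> {1..m} \<Longrightarrow> (V j, \<psi> j) \<in> atlas (F j)"
    "\<And>j. j \<in> {1..m} \<Longrightarrow> q j \<in> V j"
proof -
  have pq: "p \<in> points B" "q \<in> (\<Pi>\<^sub>E j\<in>{1..m}. points (F j))" using x by (simp_all add: points_eq)
  obtain U \<phi> where U: "(U, \<phi>) \<in> atlas B" "p \<in> U" by (rule charted.chart_at[OF B pq(1)])
  have "\<exists>V \<psi>. (V, \<psi>) \<in> atlas (F j) \<and> q j \<in> V" if j: "j \<in> {1..m}" for j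
    by (rule charted.chart_at[OF F[OF j] PiE_mem[OF pq(2) j]]) blast
  then obtain V \<psi> where V: "\<And>j. j \<in> {1..m} \<Longrightarrow> (V j, \<psi> j) \<in> atlas (F j) \<and> q j \<in> V j" by metis
  show thesis by (rule that[where V=V and \<psi>=\<psi>, OF U]) (use V in simp_all)
qed

lemma factor_base: "factor B M fst (\<lambda>x p'. (p', snd x)) Inl"
proof (intro factor.intro factor_axioms.intro B charted_M)
  show "continuous_map (mtop M) (mtop B) fst" unfolding mtop_eq by (rule continuous_map_fst)
  show "(y, snd x) \<in> points M" if "x \<in> points M" "y \<in> points B" for x y using that by (auto simp: points_eq)
  fix x V \<psi> assume x: "x \<in> points M" and V: "(V, \<psi>) \<in> atlas B" "fst x \<in> V"
  have "(fst x, snd x) \<in> points M" using x by simp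
  then obtain W \<omega> where W: "\<And>j. j \<in> {1..m} \<Longrightarrow> (W j, \<omega> j) \<in> atlas (F j)" "\<And>j. j \<in> {1..m} \<Longrightarrow> snd x j \<in> W j"
    by (rule product_chart_at) (rule that; assumption)
  have x': "x \<in> V \<times> (\<Pi>\<^sub>E j\<in>{1..m}. W j)" using x V(2) W(2) by (auto simp: points_eq PiE_def)
  show "\<exists>U \<phi>. (U, \<phi>) \<in> atlas M \<and> x \<in> U \<and> (\<forall>x'\<in>U. fst x' \<in> V \<and> (\<forall>i\<in>coords B. \<psi> (fst x') i = \<phi> x' (Inl i))) \<and>
     (\<forall>x'\<in>U. \<forall>y\<in>V. (y, snd x') \<in> U \<and> (\<forall>c\<in>coords M - Inl ` coords B. \<phi> (y, snd x') c = \<phi> x' c))"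
  proof (intro exI[of _ "V \<times> (\<Pi>\<^sub>E j\<in>{1..m}. W j)"] exI[of _ "pchart \<psi> \<omega>"] conjI ballI)
    show "(V \<times> (\<Pi>\<^sub>E j\<in>{1..m}. W j), pchart \<psi> \<omega>) \<in> atlas M" by (rule atlasI[OF V(1) W(1)])
    fix x' y c assume "c \<in> coords M - Inl ` coords B"
    then show "pchart \<psi> \<omega> (y, snd x') c = pchart \<psi> \<omega> x' c"
      by (cases c) (auto simp: pchart_def split_beta)
  qed (use x' in \<open>auto simp: pchart_Inl\<close>)
qed auto

lemma factor_fibre:
  assumes j: "j \<in> {1..m}"
  shows "factor (F j) M (\<lambda>x. snd x j) (\<lambda>x y. (fst x, (snd x)(j := y))) (\<lambda>k. Inr (j, k))"
proof (intro factor.intro factor_axioms.intro F[OF j] charted_M)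
  have "continuous_map (mtop M) (mtop (F j)) ((\<lambda>q. q j) \<circ> snd)"
    unfolding mtop_eq by (rule continuous_map_compose[OF continuous_map_snd continuous_map_product_projection[OF j]])
  then show "continuous_map (mtop M) (mtop (F j)) (\<lambda>x. snd x j)" by (simp add: comp_def)
  have upd: "q(j := y) \<in> Pi\<^sub>E {1..m} S" if "q \<in> Pi\<^sub>E {1..m} S" "y \<in> S j" for q y and S :: "nat \<Rightarrow> 'f set"
    using that j by (auto simp: PiE_def Pi_def extensional_def)
  show "(fst x, (snd x)(j := y)) \<in> points M" if "x \<in> points M" "y \<in> points (F j)" for x y
    using that upd[of "snd x" "\<lambda>j. points (F j)" y] by (simp add: points_eq mem_Times_iff)
  fix x V \<psi> assume x: "x \<in> points M" and V: "(V, \<psi>) \<in> atlas (F j)" "snd x j \<in> V"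
  have "(fst x, snd x) \<in> points M" using x by simp
  then obtain U \<phi> W0 \<omega>0 where U: "(U, \<phi>) \<in> atlas B" "fst x \<in> U"
    and W0: "\<And>j. j \<in> {1..m} \<Longrightarrow> (W0 j, \<omega>0 j) \<in> atlas (F j)" "\<And>j. j \<in> {1..m} \<Longrightarrow> snd x j \<in> W0 j"
    by (rule product_chart_at) (rule that; assumption)
  \<comment> \<open>The given chart replaces the arbitrary one at index \<open>j\<close>; the other
    factors keep any charts around their points.\<close>
  define W where "W = W0(j := V)"
  define \<omega> where "\<omega> = \<omega>0(j := \<psi>)"
  have W: "(W i, \<omega> i) \<in> atlas (F i)" "snd x i \<in> W i" if "i \<in> {1..m}" for i
    using W0[OF that] V by (simp_all add: W_def \<omega>_def)
  have Wj: "W j = V" "\<omega> j = \<psi>" by (simp_all add: W_def \<omega>_def)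
  have x': "x \<in> U \<times> (\<Pi>\<^sub>E j\<in>{1..m}. W j)" using x U(2) W(2) by (auto simp: points_eq PiE_def)
  show "\<exists>U \<phi>. (U, \<phi>) \<in> atlas M \<and> x \<in> U \<and> (\<forall>x'\<in>U. snd x' j \<in> V \<and> (\<forall>i\<in>coords (F j). \<psi> (snd x' j) i = \<phi> x' (Inr (j, i)))) \<and>
     (\<forall>x'\<in>U. \<forall>y\<in>V. (fst x', (snd x')(j := y)) \<in> U \<and>
       (\<forall>c\<in>coords M - (\<lambda>k. Inr (j, k)) ` coords (F j). \<phi> (fst x', (snd x')(j := y)) c = \<phi> x' c))"
  proof (intro exI[of _ "U \<times> (\<Pi>\<^sub>E j\<in>{1..m}. W j)"] exI[of _ "pchart \<phi> \<omega>"] conjI ballI)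
    show "(U \<times> (\<Pi>\<^sub>E j\<in>{1..m}. W j), pchart \<phi> \<omega>) \<in> atlas M" by (rule atlasI[OF U(1) W(1)])
    show "snd x' j \<in> V" if "x' \<in> U \<times> (\<Pi>\<^sub>E j\<in>{1..m}. W j)" for x'
      using that PiE_mem[of "snd x'" "{1..m}" W j] j by (simp add: mem_Times_iff Wj)
    show "\<psi> (snd x' j) i = pchart \<phi> \<omega> x' (Inr (j, i))" if "i \<in> coords (F j)" for x' i
      by (simp add: pchart_Inr[OF j that] Wj)
    show "(fst x', (snd x')(j := y)) \<in> U \<times> (\<Pi>\<^sub>E j\<in>{1..m}. W j)"
      if "x' \<in> U \<times> (\<Pi>\<^sub>E j\<in>{1..m}. W j)" "y \<in> V" for x' y
      using that upd[of "snd x'" W y] by (simp add: mem_Times_iff Wj)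
    fix x' y c assume c: "c \<in> coords M - (\<lambda>k. Inr (j, k)) ` coords (F j)"
    show "pchart \<phi> \<omega> (fst x', (snd x')(j := y)) c = pchart \<phi> \<omega> x' c"
    proof (cases c)
      case (Inr jk)
      obtain i k where "jk = (i, k)" by (cases jk)
      then show ?thesis using c Inr by (auto simp: pchart_def split_beta)
    qed (simp add: pchart_def split_beta)
  qed (rule x')
qed (use j in \<open>auto simp: inj_on_def points_eq\<close>)

sublocale B: factor B M fst "\<lambda>x p'. (p', snd x)" Inl by (rule factor_base)

text \<open>Near \<open>x\<close> every coordinate function of a product chart is a pulled-back
  coordinate function of one factor. So pulled-back functions fix the coordinates of a tangent
  vector and with them the vector. Brackets of lifts are computed through this criterion.\<close>

lemma tangent_eqI:
  assumes x: "x \<in> points M" and v: "v \<in> tangent_space M x" and v': "v' \<in> tangent_space M x"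
    and eqB: "\<And>h. h \<in> C_inf B \<Longrightarrow> v (\<lambda>x. h (fst x)) = v' (\<lambda>x. h (fst x))"
    and eqF: "\<And>j h. j \<in> {1..m} \<Longrightarrow> h \<in> C_inf (F j) \<Longrightarrow> v (\<lambda>x. h (snd x j)) = v' (\<lambda>x. h (snd x j))"
  shows "v = v'"
proof
  fix f
  obtain p q where pq: "x = (p, q)" by (cases x)
  obtain U \<phi> V \<psi> where U: "(U, \<phi>) \<in> atlas B" "p \<in> U" and V: "\<And>j. j \<in> {1..m} \<Longrightarrow> (V j, \<psi> j) \<in> atlas (F j)"
    "\<And>j. j \<in> {1..m} \<Longrightarrow> q j \<in> V j"
    by (rule product_chart_at[OF x[unfolded pq]]) (rule that; assumption)
  let ?D = "U \<times> (\<Pi>\<^sub>E j\<in>{1..m}. V j)"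
  have D: "(?D, pchart \<phi> \<psi>) \<in> atlas M" by (rule atlasI[OF U(1) V(1)])
  have xD: "x \<in> ?D" using x U(2) V(2) by (auto simp: points_eq pq PiE_def)
  obtain \<xi> N where \<xi>: "openin (mtop M) N" "x \<in> N" "N \<subseteq> ?D" "\<And>c. c \<in> coords M \<Longrightarrow> \<xi> c \<in> C_inf M"
    "\<And>c y. c \<in> coords M \<Longrightarrow> y \<in> N \<Longrightarrow> \<xi> c y = pchart \<phi> \<psi> y c"
    by (rule M.chart_coordinates[OF D xD]) (rule that; assumption)
  have coord: "v (\<xi> c) = v' (\<xi> c)" if c: "c \<in> coords M" for c
  proof (cases c)
    case (Inl i)
    then have i: "i \<in> coords B" using c by simp
    obtain \<zeta> N' where \<zeta>: "openin (mtop B) N'" "p \<in> N'" "\<And>i. i \<in> coords B \<Longrightarrow> \<zeta> i \<in> C_inf B"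
      "\<And>i y. i \<in> coords B \<Longrightarrow> y \<in> N' \<Longrightarrow> \<zeta> i y = \<phi> y i"
      by (rule charted.chart_coordinates[OF B U]) (rule that; assumption)
    have o: "openin (mtop M) ({y \<in> points M. fst y \<in> N'} \<inter> N)"
      by (rule openin_Int[OF openin_continuous_map_preimage[OF B.pr_cont \<zeta>(1)] \<xi>(1)])
    have *: "w (\<xi> c) = w (\<lambda>y. \<zeta> i (fst y))" if w: "w \<in> tangent_space M x" for w
    proof (rule M.tangent_local[OF w o _ \<xi>(4)[OF c] B.C_inf_pull[OF \<zeta>(3)[OF i]]])
      show "x \<in> {y \<in> points M. fst y \<in> N'} \<inter> N" using x \<xi>(2) \<zeta>(2) by (simp add: pq)
      fix y assume "y \<in> {y \<in> points M. fst y \<in> N'} \<inter> N"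
      then show "\<xi> c y = \<zeta> i (fst y)" using \<xi>(5)[OF c, of y] \<zeta>(4)[OF i, of "fst y"] by (simp add: Inl pchart_Inl[OF i])
    qed
    show ?thesis using *[OF v] *[OF v'] eqB[OF \<zeta>(3)[OF i]] by simp
  next
    case (Inr jk)
    obtain j k where jk: "jk = (j, k)" by (cases jk)
    have j: "j \<in> {1..m}" and k: "k \<in> coords (F j)" using c by (simp_all add: Inr jk)
    interpret Fj: factor "F j" M "\<lambda>x. snd x j" "\<lambda>x y. (fst x, (snd x)(j := y))" "\<lambda>k. Inr (j, k)" by (rule factor_fibre[OF j])
    obtain \<zeta> N' where \<zeta>: "openin (mtop (F j)) N'" "q j \<in> N'" "\<And>i. i \<in> coords (F j) \<Longrightarrow> \<zeta> i \<in> C_inf (F j)"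
      "\<And>i y. i \<in> coords (F j) \<Longrightarrow> y \<in> N' \<Longrightarrow> \<zeta> i y = \<psi> j y i"
      by (rule charted.chart_coordinates[OF F[OF j] V(1)[OF j] V(2)[OF j]]) (rule that; assumption)
    have o: "openin (mtop M) ({y \<in> points M. snd y j \<in> N'} \<inter> N)"
      by (rule openin_Int[OF openin_continuous_map_preimage[OF Fj.pr_cont \<zeta>(1)] \<xi>(1)])
    have *: "w (\<xi> c) = w (\<lambda>y. \<zeta> k (snd y j))" if w: "w \<in> tangent_space M x" for w
    proof (rule M.tangent_local[OF w o _ \<xi>(4)[OF c] Fj.C_inf_pull[OF \<zeta>(3)[OF k]]])
      show "x \<in> {y \<in> points M. snd y j \<in> N'} \<inter> N" using x \<xi>(2) \<zeta>(2) by (simp add: pq)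
      fix y assume "y \<in> {y \<in> points M. snd y j \<in> N'} \<inter> N"
      then show "\<xi> c y = \<zeta> k (snd y j)"
        using \<xi>(5)[OF c, of y] \<zeta>(4)[OF k, of "snd y j"] by (simp add: Inr jk pchart_Inr[OF j k])
    qed
    show ?thesis using *[OF v] *[OF v'] eqF[OF j \<zeta>(3)[OF k]] by simp
  qed
  show "v f = v' f"
  proof (cases "f \<in> C_inf M")
    case True
    have "w f = (\<Sum>c\<in>coords M. w (\<xi> c) * pd c (\<lambda>y. f (inv_into ?D (pchart \<phi> \<psi>) y)) (pchart \<phi> \<psi> x))"
      if "w \<in> tangent_space M x" for w
      by (rule M.coordinate_formula[OF D \<xi>(1,3,2,4,5) that True])
    from this[OF v] this[OF v'] show ?thesis by (simp add: coord)
  next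
    case False
    then show ?thesis using M.tangent_off[OF v] M.tangent_off[OF v'] by simp
  qed
qed

end

lemma multiply_warped_product_simps:
  "mtop (multiply_warped_product m B b F) = mtop (product_manifold m B F)"
  "coords (multiply_warped_product m B b F) = coords (product_manifold m B F)"
  "atlas (multiply_warped_product m B b F) = atlas (product_manifold m B F)"
  by (simp_all add: multiply_warped_product_def manifold.defs)

section \<open>Lifts to the warped product\<close>

locale warped =
  fixes m :: nat and B :: "('b, 'i) almost_product" and b :: "nat \<Rightarrow> 'b \<Rightarrow> real"
    and F :: "nat \<Rightarrow> ('f, 'j) almost_product"
  assumes apB: "ap_mfd B" and apF: "j \<in> {1..m} \<Longrightarrow> ap_mfd (F j)" and b_smooth: "j \<in> {1..m} \<Longrightarrow> b j \<in> C_inf B"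
begin

abbreviation M where "M \<equiv> multiply_warped_product m B b F"

sublocale charted_product m B F M
  by (rule charted_product.intro) (use apB apF in \<open>simp_all add: ap_mfd_def multiply_warped_product_simps\<close>)

sublocale BF: ap_factor B M fst "\<lambda>x p'. (p', snd x)" Inl
  by (rule ap_factor.intro[OF factor_base apB])

lemma fib: "j \<in> {1..m} \<Longrightarrow> ap_factor (F j) M (\<lambda>x. snd x j) (\<lambda>x y. (fst x, (snd x)(j := y))) (\<lambda>k. Inr (j, k))"
  by (rule ap_factor.intro[OF factor_fibre apF])

abbreviation iB :: "'b \<times> (nat \<Rightarrow> 'f) \<Rightarrow> 'b tangent \<Rightarrow> ('b \<times> (nat \<Rightarrow> 'f)) tangent" where
  "iB x u \<equiv> pushforward M (\<lambda>p'. (p', snd x)) u"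
abbreviation iF :: "nat \<Rightarrow> 'b \<times> (nat \<Rightarrow> 'f) \<Rightarrow> 'f tangent \<Rightarrow> ('b \<times> (nat \<Rightarrow> 'f)) tangent" where
  "iF j x u \<equiv> pushforward M (\<lambda>y. (fst x, (snd x)(j := y))) u"
abbreviation dB :: "('b \<times> (nat \<Rightarrow> 'f)) tangent \<Rightarrow> 'b tangent" where "dB v \<equiv> pushforward B fst v"
abbreviation dF :: "nat \<Rightarrow> ('b \<times> (nat \<Rightarrow> 'f)) tangent \<Rightarrow> 'f tangent" where
  "dF j v \<equiv> pushforward (F j) (\<lambda>x. snd x j) v"

lemma C_inf_product: "C_inf (product_manifold m B F) = C_inf M"
  by (simp add: C_inf_def multiply_warped_product_simps)

lemma pushforward_product: "pushforward (product_manifold m B F) h v = pushforward M h v"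
  by (simp add: pushforward_def C_inf_product)

lemma metric_M: "metric M x v w = metric B (fst x) (dB v) (dB w) +
    (\<Sum>j\<in>{1..m}. (b j (fst x))\<^sup>2 * metric (F j) (snd x j) (dF j v) (dF j w))"
  by (cases x) (simp add: multiply_warped_product_def manifold.defs case_prod_beta')

lemma endo_M: "endo M x v = (\<lambda>f. iB x (endo B (fst x) (dB v)) f + (\<Sum>j\<in>{1..m}. iF j x (endo (F j) (snd x j) (dF j v)) f))"
proof -
  have "endo M x v = (\<lambda>f. pushforward (product_manifold m B F) (\<lambda>p'. (p', snd x)) (endo B (fst x) (dB v)) f +
      (\<Sum>j\<in>{1..m}. pushforward (product_manifold m B F) (\<lambda>y. (fst x, (snd x)(j := y))) (endo (F j) (snd x j) (dF j v)) f))"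
    by (cases x) (simp add: multiply_warped_product_def manifold.defs case_prod_beta')
  then show ?thesis by (simp only: pushforward_product)
qed

lemmas F_pull = factor.C_inf_pull[OF factor_fibre]
lemmas F_pr_in = factor.pr_in[OF factor_fibre]
lemmas F_push_in = factor.push_in[OF factor_fibre]
lemmas F_proj_in = factor.proj_in[OF factor_fibre]
lemmas F_push_pull = factor.push_pull[OF factor_fibre]
lemmas F_push_app = factor.push_app[OF factor_fibre]
lemmas F_proj_app = factor.proj_app[OF factor_fibre]
lemmas F_proj_push = factor.proj_push[OF factor_fibre]
lemmas B_pull = B.C_inf_pull
lemmas B_pr_in = B.pr_in
lemmas B_push_in = B.push_in
lemmas B_proj_in = B.proj_in
lemmas B_push_pull = B.push_pull
lemmas B_proj_push = B.proj_push

lemma dB_sum: "dB (\<lambda>f. u f + (\<Sum>j\<in>S. w j f)) = (\<lambda>f. dB u f + (\<Sum>j\<in>S. dB (w j) f))"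
  and dF_sum: "dF k (\<lambda>f. u f + (\<Sum>j\<in>S. w j f)) = (\<lambda>f. dF k u f + (\<Sum>j\<in>S. dF k (w j) f))"
  and dB_lin: "dB (\<lambda>f. a * u f + c * u' f) = (\<lambda>f. a * dB u f + c * dB u' f)"
  and dF_lin: "dF k (\<lambda>f. a * u f + c * u' f) = (\<lambda>f. a * dF k u f + c * dF k u' f)"
  and iB_lin: "iB x (\<lambda>f. a * v f + c * v' f) = (\<lambda>f. a * iB x v f + c * iB x v' f)"
  and iF_lin: "iF k x (\<lambda>f. a * y f + c * y' f) = (\<lambda>f. a * iF k x y f + c * iF k x y' f)"
  by (simp_all add: pushforward_def fun_eq_iff)

lemma dF_iB: assumes j: "j \<in> {1..m}" and x: "x \<in> points M" and u: "u \<in> tangent_space B (fst x)"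
  shows "dF j (iB x u) = (\<lambda>f. 0)"
proof
  fix h show "dF j (iB x u) h = 0"
  proof (cases "h \<in> C_inf (F j)")
    case True
    then show ?thesis
      using B.push_app[OF F_pull[OF j True], of x u] charted.tangent_const[OF B u]
      by (simp add: F_proj_app[OF j])
  qed (simp add: pushforward_def)
qed

lemma dB_iF: assumes j: "j \<in> {1..m}" and x: "x \<in> points M" and u: "u \<in> tangent_space (F j) (snd x j)"
  shows "dB (iF j x u) = (\<lambda>f. 0)"
proof
  fix h show "dB (iF j x u) h = 0"
  proof (cases "h \<in> C_inf B")
    case True
    then show ?thesis
      using F_push_app[OF j B_pull[OF True], of x u] charted.tangent_const[OF F[OF j] u]
      by (simp add: B.proj_app)
  qed (simp add: pushforward_def)
qed

lemma dF_iF: assumes j: "j \<in> {1..m}" and i: "i \<in> {1..m}" and x: "x \<in> points M" and u: "u \<in> tangent_space (F j) (snd x j)"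
  shows "dF i (iF j x u) = (if i = j then u else (\<lambda>f. 0))"
proof (cases "i = j")
  case True
  then show ?thesis using F_proj_push[OF j x u] by simp
next
  case False
  have "dF i (iF j x u) h = 0" for h
  proof (cases "h \<in> C_inf (F i)")
    case True
    then show ?thesis
      using F_push_app[OF j F_pull[OF i True], of x u] charted.tangent_const[OF F[OF j] u] False
      by (simp add: F_proj_app[OF i])
  qed (simp add: pushforward_def)
  then show ?thesis using False by (simp add: fun_eq_iff)
qed

lemma dB_iB: "x \<in> points M \<Longrightarrow> u \<in> tangent_space B (fst x) \<Longrightarrow> dB (iB x u) = u"
  by (rule B_proj_push)

lemma tangent_add_sum:
  assumes "u \<in> tangent_space M x" "\<And>j. j \<in> S \<Longrightarrow> w j \<in> tangent_space M x"
  shows "(\<lambda>f. u f + (\<Sum>j\<in>S. w j f)) \<in> tangent_space M x"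
  using M.tangent_plus[OF assms(1) M.tangent_setsum[of S w x "\<lambda>_. 1"]] assms(2) by simp

text \<open>The inverse of the isomorphism, given by the differentials of the projections, from the
  tangent space of the product onto the sum of those of the factors.\<close>

definition join :: "'b \<times> (nat \<Rightarrow> 'f) \<Rightarrow> 'b tangent \<Rightarrow> (nat \<Rightarrow> 'f tangent) \<Rightarrow> ('b \<times> (nat \<Rightarrow> 'f)) tangent" where
  "join x u w = (\<lambda>f. iB x u f + (\<Sum>j\<in>{1..m}. iF j x (w j) f))"

context
  fixes x u w
  assumes x: "x \<in> points M" and u: "u \<in> tangent_space B (fst x)"
    and w: "\<And>j. j \<in> {1..m} \<Longrightarrow> w j \<in> tangent_space (F j) (snd x j)"
begin

lemma join_in: "join x u w \<in> tangent_space M x"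
  unfolding join_def by (rule tangent_add_sum[OF B_push_in[OF x u]]) (rule F_push_in[OF _ x w])

lemma dB_join: "dB (join x u w) = u"
proof
  fix h
  have "(\<Sum>j\<in>{1..m}. dB (iF j x (w j)) h) = 0"
    by (rule sum.neutral) (use dB_iF[OF _ x w] in simp)
  then show "dB (join x u w) h = u h"
    unfolding join_def dB_sum dB_iB[OF x u] by simp
qed

lemma dF_join:
  assumes j: "j \<in> {1..m}"
  shows "dF j (join x u w) = w j"
proof
  fix h
  have "(\<Sum>i\<in>{1..m}. dF j (iF i x (w i)) h) = (\<Sum>i\<in>{1..m}. if i = j then w i h else 0)"
    by (rule sum.cong[OF refl]) (use dF_iF[OF _ j x w] in auto)
  also have "\<dots> = w j h" using j by simp
  finally show "dF j (join x u w) h = w j h"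
    unfolding join_def dF_sum dF_iB[OF j x u] by simp
qed

end

lemma tangent_eqI':
  assumes x: "x \<in> points M" and v: "v \<in> tangent_space M x" "v' \<in> tangent_space M x"
    and "dB v = dB v'" "\<And>j. j \<in> {1..m} \<Longrightarrow> dF j v = dF j v'"
  shows "v = v'"
proof (rule tangent_eqI[OF x v])
  fix h assume "h \<in> C_inf B"
  then show "v (\<lambda>x. h (fst x)) = v' (\<lambda>x. h (fst x))" using fun_cong[OF assms(4), of h] by (simp add: B.proj_app)
next
  fix j h assume j: "j \<in> {1..m}" and h: "h \<in> C_inf (F j)"
  then show "v (\<lambda>x. h (snd x j)) = v' (\<lambda>x. h (snd x j))"
    using fun_cong[OF assms(5)[OF j], of h] by (simp add: F_proj_app[OF j])
qed

lemma join_split: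
  assumes x: "x \<in> points M" and v: "v \<in> tangent_space M x"
  shows "v = join x (dB v) (\<lambda>j. dF j v)"
proof (rule tangent_eqI'[OF x v])
  note J = x B_proj_in[OF x v] F_proj_in[OF _ x v]
  show "join x (dB v) (\<lambda>j. dF j v) \<in> tangent_space M x" by (rule join_in[OF J])
  show "dB v = dB (join x (dB v) (\<lambda>j. dF j v))" by (rule dB_join[OF J, symmetric])
  show "dF j v = dF j (join x (dB v) (\<lambda>j. dF j v))" if "j \<in> {1..m}" for j by (rule dF_join[OF J that, symmetric])
qed

lemma endo_join: "endo M x v = join x (endo B (fst x) (dB v)) (\<lambda>j. endo (F j) (snd x j) (dF j v))"
  unfolding endo_M join_def ..

context
  fixes x v
  assumes x: "x \<in> points M" and v: "v \<in> tangent_space M x"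
begin

lemma endo_parts:
  "endo B (fst x) (dB v) \<in> tangent_space B (fst x)"
  "j \<in> {1..m} \<Longrightarrow> endo (F j) (snd x j) (dF j v) \<in> tangent_space (F j) (snd x j)"
  using ap_mfd.endo_in[OF apB B_pr_in[OF x] B_proj_in[OF x v]]
    ap_mfd.endo_in[OF apF F_pr_in[OF _ x] F_proj_in[OF _ x v]] by auto

lemma dB_endo: "dB (endo M x v) = endo B (fst x) (dB v)"
  and dF_endo: "j \<in> {1..m} \<Longrightarrow> dF j (endo M x v) = endo (F j) (snd x j) (dF j v)"
  and endo_M_in: "endo M x v \<in> tangent_space M x"
  unfolding endo_join
  using dB_join[OF x endo_parts(1)] dF_join[OF x endo_parts(1)] join_in[OF x endo_parts(1)] endo_parts(2) by simp_all

end

text \<open>Pointwise axioms are checked on the components \<open>dB\<close> and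
  \<open>dF j\<close>, where each is the axiom of a factor. Smoothness is that of the projected
  metrics and endomorphisms.\<close>

lemma ap_mfd_M: "ap_mfd M"
proof (intro ap_mfd.intro ap_mfd_axioms.intro charted_M)
  fix x u v assume x: "x \<in> points M" and u: "u \<in> tangent_space M x" and v: "v \<in> tangent_space M x"
  note up = B_proj_in[OF x u] F_proj_in[OF _ x u] and vp = B_proj_in[OF x v] F_proj_in[OF _ x v]
  show "metric M x u v = metric M x v u"
    unfolding metric_M
    by (intro arg_cong2[where f="(+)"] sum.cong refl arg_cong2[where f="(*)"]
        ap_mfd.metric_sym[OF apB B_pr_in[OF x] up(1) vp(1)])
       (rule ap_mfd.metric_sym[OF apF F_pr_in[OF _ x] up(2) vp(2)])
  show "endo M x v \<in> tangent_space M x" by (rule endo_M_in[OF x v])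
  show "endo M x (endo M x v) = v"
  proof (rule tangent_eqI'[OF x endo_M_in[OF x endo_M_in[OF x v]] v])
    show "dB (endo M x (endo M x v)) = dB v"
      by (simp only: dB_endo[OF x endo_M_in[OF x v]] dB_endo[OF x v] ap_mfd.endo_invol[OF apB B_pr_in[OF x] vp(1)])
    show "dF j (endo M x (endo M x v)) = dF j v" if j: "j \<in> {1..m}" for j
      by (simp only: dF_endo[OF x endo_M_in[OF x v] j] dF_endo[OF x v j] ap_mfd.endo_invol[OF apF[OF j] F_pr_in[OF j x] vp(2)[OF j]])
  qed
  show "metric M x (endo M x u) (endo M x v) = metric M x u v"
    unfolding metric_M dB_endo[OF x u] dB_endo[OF x v] ap_mfd.endo_isom[OF apB B_pr_in[OF x] up(1) vp(1)]
    by (rule arg_cong2[where f="(+)", OF refl], rule sum.cong[OF refl])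
       (simp only: dF_endo[OF x u] dF_endo[OF x v] ap_mfd.endo_isom[OF apF F_pr_in[OF _ x] up(2) vp(2)])
  fix a c
  have uv: "(\<lambda>f. a * u f + c * v f) \<in> tangent_space M x" by (rule M.tangent_comb[OF u v])
  show "endo M x (\<lambda>f. a * u f + c * v f) = (\<lambda>f. a * endo M x u f + c * endo M x v f)"
  proof (rule tangent_eqI'[OF x endo_M_in[OF x uv] M.tangent_comb[OF endo_M_in[OF x u] endo_M_in[OF x v]]])
    show "dB (endo M x (\<lambda>f. a * u f + c * v f)) = dB (\<lambda>f. a * endo M x u f + c * endo M x v f)"
      by (simp only: dB_endo[OF x uv] dB_lin dB_endo[OF x u] dB_endo[OF x v]
          ap_mfd.endo_lin[OF apB B_pr_in[OF x] up(1) vp(1)])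
    show "dF j (endo M x (\<lambda>f. a * u f + c * v f)) = dF j (\<lambda>f. a * endo M x u f + c * endo M x v f)" if j: "j \<in> {1..m}" for j
      by (simp only: dF_endo[OF x uv j] dF_lin dF_endo[OF x u j] dF_endo[OF x v j]
          ap_mfd.endo_lin[OF apF[OF j] F_pr_in[OF j x] up(2)[OF j] vp(2)[OF j]])
  qed
  fix w assume w: "w \<in> tangent_space M x"
  note wp = B_proj_in[OF x w] F_proj_in[OF _ x w]
  have "(\<Sum>j\<in>{1..m}. (b j (fst x))\<^sup>2 * metric (F j) (snd x j) (dF j (\<lambda>f. a * u f + c * v f)) (dF j w)) =
    (\<Sum>j\<in>{1..m}. a * ((b j (fst x))\<^sup>2 * metric (F j) (snd x j) (dF j u) (dF j w)) +
      c * ((b j (fst x))\<^sup>2 * metric (F j) (snd x j) (dF j v) (dF j w)))"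
  proof (rule sum.cong[OF refl])
    fix j assume j: "j \<in> {1..m}"
    show "(b j (fst x))\<^sup>2 * metric (F j) (snd x j) (dF j (\<lambda>f. a * u f + c * v f)) (dF j w) =
      a * ((b j (fst x))\<^sup>2 * metric (F j) (snd x j) (dF j u) (dF j w)) +
      c * ((b j (fst x))\<^sup>2 * metric (F j) (snd x j) (dF j v) (dF j w))"
      unfolding dF_lin ap_mfd.metric_lin[OF apF[OF j] F_pr_in[OF j x] up(2)[OF j] vp(2)[OF j] wp(2)[OF j]]
      by (simp add: algebra_simps)
  qed
  then show "metric M x (\<lambda>f. a * u f + c * v f) w = a * metric M x u w + c * metric M x v w"
    unfolding metric_M dB_lin ap_mfd.metric_lin[OF apB B_pr_in[OF x] up(1) vp(1) wp(1)]
    by (simp add: sum.distrib sum_distrib_left algebra_simps)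
next
  fix X Y assume X: "X \<in> \<Gamma> M" and Y: "Y \<in> \<Gamma> M"
  show "inner_vf M X Y \<in> C_inf M"
    unfolding inner_vf_def metric_M
    by (rule M.C_inf_add[OF BF.proj_metric_smooth[OF X Y] M.C_inf_sum[OF M.C_inf_mult[OF
          M.C_inf_power[OF B_pull[OF b_smooth]] ap_factor.proj_metric_smooth[OF fib X Y]]]])
next
  fix X assume X: "X \<in> \<Gamma> M"
  show "endo_vf M X \<in> \<Gamma> M"
  proof (rule M.vfieldI)
    show "endo_vf M X x \<in> tangent_space M x" if "x \<in> points M" for x
      unfolding endo_vf_def by (rule endo_M_in[OF that M.vfield_tangent[OF X that]])
    show "(\<lambda>x. endo_vf M X x f) \<in> C_inf M" if f: "f \<in> C_inf M" for f
      unfolding endo_vf_def endo_M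
      by (rule M.C_inf_add[OF BF.push_endo_proj_smooth[OF X f] M.C_inf_sum[OF ap_factor.push_endo_proj_smooth[OF fib X f]]])
  qed
qed

sublocale M: ap_mfd M by (rule ap_mfd_M)

section \<open>Lifted vector fields and their brackets\<close>

abbreviation LB where "LB \<equiv> lift_base M"
abbreviation LF where "LF \<equiv> lift_fibre M"

lemma LB_eq: "LB X x = iB x (X (fst x))"
  by (cases x) (simp add: lift_base_def)

lemma LF_eq: "LF j V x = iF j x (V (snd x j))"
  by (cases x) (simp add: lift_fibre_def)

lemma LB_vfield: "X \<in> \<Gamma> B \<Longrightarrow> LB X \<in> \<Gamma> M"
proof -
  assume "X \<in> \<Gamma> B"
  moreover have "LB X = B.lift X" by (rule ext) (simp add: LB_eq B.lift_def)
  ultimately show ?thesis using B.lift_vfield by simp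
qed

lemma LF_vfield: "j \<in> {1..m} \<Longrightarrow> V \<in> \<Gamma> (F j) \<Longrightarrow> LF j V \<in> \<Gamma> M"
proof -
  assume j: "j \<in> {1..m}" and V: "V \<in> \<Gamma> (F j)"
  have "LF j V = factor.lift M (\<lambda>x. snd x j) (\<lambda>x y. (fst x, (snd x)(j := y))) V"
    by (rule ext) (simp add: LF_eq factor.lift_def[OF factor_fibre[OF j]])
  then show ?thesis using factor.lift_vfield[OF factor_fibre[OF j] V] by simp
qed

lemma B_vt: "X \<in> \<Gamma> B \<Longrightarrow> x \<in> points M \<Longrightarrow> X (fst x) \<in> tangent_space B (fst x)"
  by (rule charted.vfield_tangent[OF B _ B_pr_in])

lemma F_vt: "j \<in> {1..m} \<Longrightarrow> V \<in> \<Gamma> (F j) \<Longrightarrow> x \<in> points M \<Longrightarrow> V (snd x j) \<in> tangent_space (F j) (snd x j)"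
  by (rule charted.vfield_tangent[OF F _ F_pr_in])

lemma LB_B: "X \<in> \<Gamma> B \<Longrightarrow> x \<in> points M \<Longrightarrow> h \<in> C_inf B \<Longrightarrow> LB X x (\<lambda>x. h (fst x)) = X (fst x) h"
  unfolding LB_eq by (rule B_push_pull[OF _ B_vt])

lemma LB_F: "X \<in> \<Gamma> B \<Longrightarrow> x \<in> points M \<Longrightarrow> j \<in> {1..m} \<Longrightarrow> h \<in> C_inf (F j) \<Longrightarrow> LB X x (\<lambda>x. h (snd x j)) = 0"
  unfolding LB_eq by (simp add: B.push_app[OF F_pull] charted.tangent_const[OF B B_vt])

lemma LF_B: "j \<in> {1..m} \<Longrightarrow> V \<in> \<Gamma> (F j) \<Longrightarrow> x \<in> points M \<Longrightarrow> h \<in> C_inf B \<Longrightarrow> LF j V x (\<lambda>x. h (fst x)) = 0"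
  unfolding LF_eq by (simp add: F_push_app[OF _ B_pull] charted.tangent_const[OF F F_vt])

lemma LF_F: "j \<in> {1..m} \<Longrightarrow> V \<in> \<Gamma> (F j) \<Longrightarrow> x \<in> points M \<Longrightarrow> i \<in> {1..m} \<Longrightarrow> h \<in> C_inf (F i) \<Longrightarrow>
    LF j V x (\<lambda>x. h (snd x i)) = (if i = j then V (snd x j) h else 0)"
proof (cases "i = j")
  case False
  assume "j \<in> {1..m}" "V \<in> \<Gamma> (F j)" "x \<in> points M" "i \<in> {1..m}" "h \<in> C_inf (F i)"
  then show ?thesis using False unfolding LF_eq
    by (simp add: F_push_app[OF _ F_pull] charted.tangent_const[OF F F_vt])
next
  case True
  assume "j \<in> {1..m}" "V \<in> \<Gamma> (F j)" "x \<in> points M" "i \<in> {1..m}" "h \<in> C_inf (F i)"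
  then show ?thesis using True F_push_pull[of j x "V (snd x j)" h] F_vt unfolding LF_eq by simp
qed

lemma LB_endo: assumes X: "X \<in> \<Gamma> B" and x: "x \<in> points M" shows "endo_vf M (LB X) x = LB (endo_vf B X) x"
proof (rule tangent_eqI'[OF x])
  note JX = ap_mfd.endo_smooth[OF apB X]
  note t = M.vfield_tangent[OF LB_vfield[OF X] x]
  show "endo_vf M (LB X) x \<in> tangent_space M x" "LB (endo_vf B X) x \<in> tangent_space M x"
    using M.vfield_tangent[OF M.endo_smooth[OF LB_vfield[OF X]] x] M.vfield_tangent[OF LB_vfield[OF JX] x] .
  show "dB (endo_vf M (LB X) x) = dB (LB (endo_vf B X) x)"
    unfolding endo_vf_def[of M] dB_endo[OF x t] unfolding LB_eq
    by (simp only: dB_iB[OF x B_vt[OF X x]] dB_iB[OF x B_vt[OF JX x]]) (simp add: endo_vf_def)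
  show "dF j (endo_vf M (LB X) x) = dF j (LB (endo_vf B X) x)" if j: "j \<in> {1..m}" for j
    unfolding endo_vf_def[of M] dF_endo[OF x t j] unfolding LB_eq
    by (simp only: dF_iB[OF j x B_vt[OF X x]] dF_iB[OF j x B_vt[OF JX x]] ap_mfd.endo_zero[OF apF[OF j] F_pr_in[OF j x]])
qed

lemma LF_endo: assumes j: "j \<in> {1..m}" and V: "V \<in> \<Gamma> (F j)" and x: "x \<in> points M"
  shows "endo_vf M (LF j V) x = LF j (endo_vf (F j) V) x"
proof (rule tangent_eqI'[OF x])
  note JV = ap_mfd.endo_smooth[OF apF[OF j] V]
  note t = M.vfield_tangent[OF LF_vfield[OF j V] x]
  show "endo_vf M (LF j V) x \<in> tangent_space M x" "LF j (endo_vf (F j) V) x \<in> tangent_space M x"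
    using M.vfield_tangent[OF M.endo_smooth[OF LF_vfield[OF j V]] x] M.vfield_tangent[OF LF_vfield[OF j JV] x] .
  show "dB (endo_vf M (LF j V) x) = dB (LF j (endo_vf (F j) V) x)"
    unfolding endo_vf_def[of M] dB_endo[OF x t] unfolding LF_eq
    by (simp only: dB_iF[OF j x F_vt[OF j V x]] dB_iF[OF j x F_vt[OF j JV x]] ap_mfd.endo_zero[OF apB B_pr_in[OF x]])
  show "dF i (endo_vf M (LF j V) x) = dF i (LF j (endo_vf (F j) V) x)" if i: "i \<in> {1..m}" for i
    unfolding endo_vf_def[of M] dF_endo[OF x t i] unfolding LF_eq
    by (simp only: dF_iF[OF j i x F_vt[OF j V x]] dF_iF[OF j i x F_vt[OF j JV x]])
       (simp add: endo_vf_def ap_mfd.endo_zero[OF apF[OF i] F_pr_in[OF i x]])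
qed

text \<open>Both sides are compared on functions pulled back from the factors. On those of
  \<open>B\<close> a lift acts as the original field, on those of a fibre as
  \<open>0\<close>.\<close>

lemma bracket_BB: assumes X: "X \<in> \<Gamma> B" and Y: "Y \<in> \<Gamma> B" and x: "x \<in> points M"
  shows "bracket (LB X) (LB Y) x = LB (bracket X Y) x"
proof (rule tangent_eqI[OF x])
  note XY = charted.bracket_vfield[OF B X Y]
  show "bracket (LB X) (LB Y) x \<in> tangent_space M x" "LB (bracket X Y) x \<in> tangent_space M x"
    using M.vfield_tangent[OF M.bracket_vfield[OF LB_vfield[OF X] LB_vfield[OF Y]] x] M.vfield_tangent[OF LB_vfield[OF XY] x] .
  fix h assume h: "h \<in> C_inf B"
  have *: "LB X x (LB Y \<rhd> (\<lambda>x. h (fst x))) = X (fst x) (Y \<rhd> h)" if X: "X \<in> \<Gamma> B" and Y: "Y \<in> \<Gamma> B" for X Y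
  proof -
    have "LB X x (LB Y \<rhd> (\<lambda>x. h (fst x))) = LB X x (\<lambda>x. (Y \<rhd> h) (fst x))"
      by (rule M.tangent_cong[OF M.vfield_tangent[OF LB_vfield[OF X] x] x]) (simp add: vfield_app_def LB_B[OF Y _ h])
    then show ?thesis by (simp add: LB_B[OF X x charted.vfield_smooth[OF B Y h]])
  qed
  show "bracket (LB X) (LB Y) x (\<lambda>x. h (fst x)) = LB (bracket X Y) x (\<lambda>x. h (fst x))"
    unfolding LB_B[OF XY x h] by (simp add: bracket_def *[OF X Y] *[OF Y X])
next
  note XY = charted.bracket_vfield[OF B X Y]
  fix j h assume j: "j \<in> {1..m}" and h: "h \<in> C_inf (F j)"
  have *: "LB X x (LB Y \<rhd> (\<lambda>x. h (snd x j))) = 0" if X: "X \<in> \<Gamma> B" and Y: "Y \<in> \<Gamma> B" for X Y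
  proof -
    have "LB X x (LB Y \<rhd> (\<lambda>x. h (snd x j))) = LB X x (\<lambda>x. 0)"
      by (rule M.tangent_cong[OF M.vfield_tangent[OF LB_vfield[OF X] x] x]) (simp add: vfield_app_def LB_F[OF Y _ j h])
    then show ?thesis by (simp add: M.tangent_const[OF M.vfield_tangent[OF LB_vfield[OF X] x]])
  qed
  show "bracket (LB X) (LB Y) x (\<lambda>x. h (snd x j)) = LB (bracket X Y) x (\<lambda>x. h (snd x j))"
    unfolding LB_F[OF XY x j h] by (simp add: bracket_def *[OF X Y] *[OF Y X])
qed

text \<open>A field keeps the functions of its own factor within that factor and kills those of the
  others. So on each pulled-back function both orders of the two fields give
  \<open>0\<close>.\<close>

lemma bracket_BF: assumes X: "X \<in> \<Gamma> B" and j: "j \<in> {1..m}" and V: "V \<in> \<Gamma> (F j)" and x: "x \<in> points M"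
  shows "bracket (LB X) (LF j V) x = (\<lambda>f. 0)"
proof (rule tangent_eqI[OF x M.vfield_tangent[OF M.bracket_vfield[OF LB_vfield[OF X] LF_vfield[OF j V]] x] M.tangent_zero])
  note t = M.vfield_tangent[OF LB_vfield[OF X] x] M.vfield_tangent[OF LF_vfield[OF j V] x]
  fix h assume h: "h \<in> C_inf B"
  have 1: "LB X x (LF j V \<rhd> (\<lambda>x. h (fst x))) = LB X x (\<lambda>x. 0)"
    by (rule M.tangent_cong[OF t(1) x]) (simp add: vfield_app_def LF_B[OF j V _ h])
  have 2: "LF j V x (LB X \<rhd> (\<lambda>x. h (fst x))) = LF j V x (\<lambda>x. (X \<rhd> h) (fst x))"
    by (rule M.tangent_cong[OF t(2) x]) (simp add: vfield_app_def LB_B[OF X _ h])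
  show "bracket (LB X) (LF j V) x (\<lambda>x. h (fst x)) = 0"
    by (simp add: bracket_def 1 2 M.tangent_const[OF t(1)] LF_B[OF j V x charted.vfield_smooth[OF B X h]])
next
  note t = M.vfield_tangent[OF LB_vfield[OF X] x] M.vfield_tangent[OF LF_vfield[OF j V] x]
  fix i h assume i: "i \<in> {1..m}" and h: "h \<in> C_inf (F i)"
  have 1: "LF j V x (LB X \<rhd> (\<lambda>x. h (snd x i))) = LF j V x (\<lambda>x. 0)"
    by (rule M.tangent_cong[OF t(2) x]) (simp add: vfield_app_def LB_F[OF X _ i h])
  have 2: "LB X x (LF j V \<rhd> (\<lambda>x. h (snd x i))) = 0"
  proof (cases "i = j")
    case True
    have "LB X x (LF j V \<rhd> (\<lambda>x. h (snd x i))) = LB X x (\<lambda>x. (V \<rhd> h) (snd x j))"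
      by (rule M.tangent_cong[OF t(1) x]) (use LF_F[OF j V _ i h] True in \<open>simp add: vfield_app_def\<close>)
    then show ?thesis using LB_F[OF X x j charted.vfield_smooth[OF F[OF j] V]] h True by simp
  next
    case False
    have "LB X x (LF j V \<rhd> (\<lambda>x. h (snd x i))) = LB X x (\<lambda>x. 0)"
      by (rule M.tangent_cong[OF t(1) x]) (simp add: vfield_app_def LF_F[OF j V _ i h] False)
    then show ?thesis by (simp add: M.tangent_const[OF t(1)])
  qed
  show "bracket (LB X) (LF j V) x (\<lambda>x. h (snd x i)) = 0"
    by (simp add: bracket_def 1 2 M.tangent_const[OF t(2)])
qed

lemma bracket_FB: assumes X: "X \<in> \<Gamma> B" and j: "j \<in> {1..m}" and V: "V \<in> \<Gamma> (F j)" and x: "x \<in> points M"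
  shows "bracket (LF j V) (LB X) x = (\<lambda>f. 0)"
  using bracket_BF[OF assms] by (simp add: bracket_def fun_eq_iff)

lemma bracket_FF: assumes i: "i \<in> {1..m}" and V: "V \<in> \<Gamma> (F i)" and j: "j \<in> {1..m}" and W: "W \<in> \<Gamma> (F j)" and x: "x \<in> points M"
  shows "bracket (LF i V) (LF j W) x = (if i = j then LF j (bracket V W) x else (\<lambda>f. 0))"
proof (rule tangent_eqI[OF x])
  note VW = charted.bracket_vfield[OF F[OF j] _ W]
  show "bracket (LF i V) (LF j W) x \<in> tangent_space M x"
    by (rule M.vfield_tangent[OF M.bracket_vfield[OF LF_vfield[OF i V] LF_vfield[OF j W]] x])
  show "(if i = j then LF j (bracket V W) x else (\<lambda>f. 0)) \<in> tangent_space M x"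
    using M.vfield_tangent[OF LF_vfield[OF j VW] x] V by (auto simp: M.tangent_zero)
  fix h assume h: "h \<in> C_inf B"
  have *: "LF i V x (LF j W \<rhd> (\<lambda>x. h (fst x))) = 0"
    if i: "i \<in> {1..m}" and V: "V \<in> \<Gamma> (F i)" and j: "j \<in> {1..m}" and W: "W \<in> \<Gamma> (F j)" for i V j W
  proof -
    have "LF i V x (LF j W \<rhd> (\<lambda>x. h (fst x))) = LF i V x (\<lambda>x. 0)"
      by (rule M.tangent_cong[OF M.vfield_tangent[OF LF_vfield[OF i V] x] x]) (simp add: vfield_app_def LF_B[OF j W _ h])
    then show ?thesis by (simp add: M.tangent_const[OF M.vfield_tangent[OF LF_vfield[OF i V] x]])
  qed
  show "bracket (LF i V) (LF j W) x (\<lambda>x. h (fst x)) = (if i = j then LF j (bracket V W) x else (\<lambda>f. 0)) (\<lambda>x. h (fst x))"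
    using LF_B[OF j VW x h] V unfolding bracket_def *[OF i V j W] *[OF j W i V] by (auto simp: bracket_def)
next
  note VW = charted.bracket_vfield[OF F[OF j] _ W]
  fix k h assume k: "k \<in> {1..m}" and h: "h \<in> C_inf (F k)"
  have *: "LF i V x (LF j W \<rhd> (\<lambda>x. h (snd x k))) = (if k = j \<and> i = j then V (snd x j) (W \<rhd> h) else 0)"
    if i: "i \<in> {1..m}" and V: "V \<in> \<Gamma> (F i)" and j: "j \<in> {1..m}" and W: "W \<in> \<Gamma> (F j)" for i V j W
  proof (cases "k = j")
    case True
    have "LF i V x (LF j W \<rhd> (\<lambda>x. h (snd x k))) = LF i V x (\<lambda>x. (W \<rhd> h) (snd x j))"
      by (rule M.tangent_cong[OF M.vfield_tangent[OF LF_vfield[OF i V] x] x])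
         (use LF_F[OF j W _ k h] True in \<open>simp add: vfield_app_def\<close>)
    also have "\<dots> = (if j = i then V (snd x i) (W \<rhd> h) else 0)"
      by (rule LF_F[OF i V x j charted.vfield_smooth[OF F[OF j] W]]) (use h True in simp)
    finally show ?thesis using True by auto
  next
    case False
    have "LF i V x (LF j W \<rhd> (\<lambda>x. h (snd x k))) = LF i V x (\<lambda>x. 0)"
      by (rule M.tangent_cong[OF M.vfield_tangent[OF LF_vfield[OF i V] x] x])
         (simp add: vfield_app_def LF_F[OF j W _ k h] False)
    then show ?thesis using False by (simp add: M.tangent_const[OF M.vfield_tangent[OF LF_vfield[OF i V] x]])
  qed
  show "bracket (LF i V) (LF j W) x (\<lambda>x. h (snd x k)) = (if i = j then LF j (bracket V W) x else (\<lambda>f. 0)) (\<lambda>x. h (snd x k))"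
    using LF_F[OF j VW x k h] V unfolding bracket_def *[OF i V j W] *[OF j W i V] by (auto simp: bracket_def)
qed

lemma metric_iB_iB: "x \<in> points M \<Longrightarrow> u \<in> tangent_space B (fst x) \<Longrightarrow> v \<in> tangent_space M x \<Longrightarrow>
    metric M x (iB x u) v = metric B (fst x) u (dB v)"
  unfolding metric_M
  by (simp add: dB_iB dF_iB ap_mfd.metric_zero[OF apF F_pr_in F_proj_in])

lemma metric_iF: 
  assumes j: "j \<in> {1..m}" and x: "x \<in> points M" and u: "u \<in> tangent_space (F j) (snd x j)" and v: "v \<in> tangent_space M x"
  shows "metric M x (iF j x u) v = (b j (fst x))\<^sup>2 * metric (F j) (snd x j) u (dF j v)"
proof -
  have "(\<Sum>i\<in>{1..m}. (b i (fst x))\<^sup>2 * metric (F i) (snd x i) (dF i (iF j x u)) (dF i v)) =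
    (\<Sum>i\<in>{1..m}. if i = j then (b i (fst x))\<^sup>2 * metric (F i) (snd x i) u (dF i v) else 0)"
    by (rule sum.cong[OF refl])
       (simp only: dF_iF[OF j _ x u] split: if_split, simp add: ap_mfd.metric_zero[OF apF F_pr_in[OF _ x] F_proj_in[OF _ x v]])
  then show ?thesis unfolding metric_M dB_iF[OF j x u] using j
    by (simp add: ap_mfd.metric_zero[OF apB B_pr_in[OF x] B_proj_in[OF x v]])
qed

section \<open>Koszul forms of lifts\<close>

lemma B_endo: "X \<in> \<Gamma> B \<Longrightarrow> endo_vf B X \<in> \<Gamma> B"
  by (rule ap_mfd.endo_smooth[OF apB])

lemma F_endo: "j \<in> {1..m} \<Longrightarrow> V \<in> \<Gamma> (F j) \<Longrightarrow> endo_vf (F j) V \<in> \<Gamma> (F j)"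
  by (rule ap_mfd.endo_smooth[OF apF])

lemma B_inner_smooth: "X \<in> \<Gamma> B \<Longrightarrow> Y \<in> \<Gamma> B \<Longrightarrow> inner_vf B X Y \<in> C_inf B"
  by (rule ap_mfd.inner_smooth[OF apB])

lemma F_inner_smooth: "j \<in> {1..m} \<Longrightarrow> V \<in> \<Gamma> (F j) \<Longrightarrow> W \<in> \<Gamma> (F j) \<Longrightarrow> inner_vf (F j) V W \<in> C_inf (F j)"
  by (rule ap_mfd.inner_smooth[OF apF])

lemma LB_t: "X \<in> \<Gamma> B \<Longrightarrow> x \<in> points M \<Longrightarrow> LB X x \<in> tangent_space M x"
  by (rule M.vfield_tangent[OF LB_vfield])

lemma LF_t: "j \<in> {1..m} \<Longrightarrow> V \<in> \<Gamma> (F j) \<Longrightarrow> x \<in> points M \<Longrightarrow> LF j V x \<in> tangent_space M x"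
  by (rule M.vfield_tangent[OF LF_vfield])

lemma inner_BB: "X \<in> \<Gamma> B \<Longrightarrow> Y \<in> \<Gamma> B \<Longrightarrow> x \<in> points M \<Longrightarrow>
    inner_vf M (LB X) (LB Y) x = inner_vf B X Y (fst x)"
  unfolding inner_vf_def using metric_iB_iB[of x "X (fst x)" "LB Y x"] B_vt LB_t by (simp add: LB_eq dB_iB)

lemma inner_BF: "X \<in> \<Gamma> B \<Longrightarrow> j \<in> {1..m} \<Longrightarrow> V \<in> \<Gamma> (F j) \<Longrightarrow> x \<in> points M \<Longrightarrow>
    inner_vf M (LB X) (LF j V) x = 0"
  unfolding inner_vf_def LB_eq[of X] using metric_iB_iB[of x "X (fst x)" "LF j V x"] B_vt LF_t[of j V x] F_vt[of j V x]
    ap_mfd.metric_sym[OF apB B_pr_in, of x "X (fst x)" "\<lambda>f. 0"] ap_mfd.metric_zero[OF apB B_pr_in, of x "X (fst x)"]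
    charted.tangent_zero[OF B, of "fst x"]
  by (simp add: LF_eq dB_iF)

lemma inner_FB: "X \<in> \<Gamma> B \<Longrightarrow> j \<in> {1..m} \<Longrightarrow> V \<in> \<Gamma> (F j) \<Longrightarrow> x \<in> points M \<Longrightarrow>
    inner_vf M (LF j V) (LB X) x = 0"
  using inner_BF M.inner_sym[OF LF_vfield LB_vfield] by simp

lemma F_metric_zero_right: "j \<in> {1..m} \<Longrightarrow> x \<in> points M \<Longrightarrow> u \<in> tangent_space (F j) (snd x j) \<Longrightarrow>
    metric (F j) (snd x j) u (\<lambda>f. 0) = 0"
  using ap_mfd.metric_sym[OF apF F_pr_in, of j x u "\<lambda>f. 0"] ap_mfd.metric_zero[OF apF F_pr_in, of j x u]
    charted.tangent_zero[OF F, of j "snd x j"] by simp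

lemma B_metric_zero_right: "x \<in> points M \<Longrightarrow> u \<in> tangent_space B (fst x) \<Longrightarrow> metric B (fst x) u (\<lambda>f. 0) = 0"
  using ap_mfd.metric_sym[OF apB B_pr_in, of x u "\<lambda>f. 0"] ap_mfd.metric_zero[OF apB B_pr_in, of x u]
    charted.tangent_zero[OF B, of "fst x"] by simp

lemma inner_FF: "i \<in> {1..m} \<Longrightarrow> V \<in> \<Gamma> (F i) \<Longrightarrow> j \<in> {1..m} \<Longrightarrow> W \<in> \<Gamma> (F j) \<Longrightarrow> x \<in> points M \<Longrightarrow>
    inner_vf M (LF i V) (LF j W) x = (if i = j then (b j (fst x))\<^sup>2 * inner_vf (F j) V W (snd x j) else 0)"
  unfolding inner_vf_def LF_eq[of i V] using metric_iF[of i x "V (snd x i)" "LF j W x"] F_vt[of i V x] LF_t[of j W x] F_vt[of j W x]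
  by (simp add: LF_eq dF_iF F_metric_zero_right)

lemma inner_bracket_BB: "X \<in> \<Gamma> B \<Longrightarrow> Y \<in> \<Gamma> B \<Longrightarrow> x \<in> points M \<Longrightarrow>
    inner_vf M A (bracket (LB X) (LB Y)) x = inner_vf M A (LB (bracket X Y)) x"
  by (simp add: inner_vf_def bracket_BB)

lemma M_metric_zero_right: "A \<in> \<Gamma> M \<Longrightarrow> x \<in> points M \<Longrightarrow> metric M x (A x) (\<lambda>f. 0) = 0"
  using M.metric_sym[of x "A x" "\<lambda>f. 0"] M.metric_zero[of x "A x"] M.vfield_tangent[of A x] M.tangent_zero by simp

lemma inner_bracket_BF: "A \<in> \<Gamma> M \<Longrightarrow> X \<in> \<Gamma> B \<Longrightarrow> j \<in> {1..m} \<Longrightarrow> V \<in> \<Gamma> (F j) \<Longrightarrow> x \<in> points M \<Longrightarrow>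
    inner_vf M A (bracket (LB X) (LF j V)) x = 0"
  and inner_bracket_FB: "A \<in> \<Gamma> M \<Longrightarrow> X \<in> \<Gamma> B \<Longrightarrow> j \<in> {1..m} \<Longrightarrow> V \<in> \<Gamma> (F j) \<Longrightarrow> x \<in> points M \<Longrightarrow>
    inner_vf M A (bracket (LF j V) (LB X)) x = 0"
  by (simp_all add: inner_vf_def bracket_BF bracket_FB M_metric_zero_right)

lemma inner_bracket_FF: "A \<in> \<Gamma> M \<Longrightarrow> i \<in> {1..m} \<Longrightarrow> V \<in> \<Gamma> (F i) \<Longrightarrow> j \<in> {1..m} \<Longrightarrow> W \<in> \<Gamma> (F j) \<Longrightarrow> x \<in> points M \<Longrightarrow>
    inner_vf M A (bracket (LF i V) (LF j W)) x = (if i = j then inner_vf M A (LF j (bracket V W)) x else 0)"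
  by (simp add: inner_vf_def bracket_FF M_metric_zero_right)

text \<open>Inner products and Koszul forms of lifts are sums of functions on \<open>B\<close> times
  functions on one fibre; they are differentiated through this rule and the next.\<close>

lemma LB_prod:
  assumes X: "X \<in> \<Gamma> B" and x: "x \<in> points M" and j: "j \<in> {1..m}" and h: "h \<in> C_inf B" and g: "g \<in> C_inf (F j)"
  shows "LB X x (\<lambda>x. h (fst x) * g (snd x j)) = g (snd x j) * X (fst x) h"
  using M.tangent_mult[OF LB_t[OF X x] B_pull[OF h] F_pull[OF j g]] LB_B[OF X x h] LB_F[OF X x j g] by simp

lemma LF_prod:
  assumes k: "k \<in> {1..m}" and U: "U \<in> \<Gamma> (F k)" and x: "x \<in> points M" and j: "j \<in> {1..m}" and h: "h \<in> C_inf B" and g: "g \<in> C_inf (F j)"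
  shows "LF k U x (\<lambda>x. h (fst x) * g (snd x j)) = (if j = k then h (fst x) * U (snd x k) g else 0)"
  using M.tangent_mult[OF LF_t[OF k U x] B_pull[OF h] F_pull[OF j g]] LF_B[OF k U x h] LF_F[OF k U x j g] by simp

lemma b2_smooth: "j \<in> {1..m} \<Longrightarrow> (\<lambda>p. (b j p)\<^sup>2) \<in> C_inf B"
  by (rule charted.C_inf_power[OF B b_smooth])

lemma M_deriv_zero:
  assumes "v \<in> tangent_space M x" "x \<in> points M" "\<And>y. y \<in> points M \<Longrightarrow> f y = 0"
  shows "v f = 0"
  using M.tangent_cong[OF assms] M.tangent_const[OF assms(1)] by simp

lemma d_BB:
  assumes Y: "Y \<in> \<Gamma> B" and Z: "Z \<in> \<Gamma> B" and x: "x \<in> points M"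
  shows "X \<in> \<Gamma> B \<Longrightarrow> LB X x (inner_vf M (LB Y) (LB Z)) = X (fst x) (inner_vf B Y Z)"
    and "k \<in> {1..m} \<Longrightarrow> U \<in> \<Gamma> (F k) \<Longrightarrow> LF k U x (inner_vf M (LB Y) (LB Z)) = 0"
  using M.tangent_cong[OF LB_t x inner_BB[OF Y Z], of X] LB_B[OF _ x B_inner_smooth[OF Y Z], of X]
    M.tangent_cong[OF LF_t x inner_BB[OF Y Z], of k U] LF_B[OF _ _ x B_inner_smooth[OF Y Z], of k U]
  by (simp_all add: x)

lemma d_BF:
  assumes Y: "Y \<in> \<Gamma> B" and j: "j \<in> {1..m}" and V: "V \<in> \<Gamma> (F j)" and x: "x \<in> points M" and v: "v \<in> tangent_space M x"
  shows "v (inner_vf M (LB Y) (LF j V)) = 0" and "v (inner_vf M (LF j V) (LB Y)) = 0"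
proof -
  show "v (inner_vf M (LB Y) (LF j V)) = 0" by (rule M_deriv_zero[OF v x]) (rule inner_BF[OF Y j V])
  show "v (inner_vf M (LF j V) (LB Y)) = 0" by (rule M_deriv_zero[OF v x]) (rule inner_FB[OF Y j V])
qed

lemma d_FF:
  assumes i: "i \<in> {1..m}" and V: "V \<in> \<Gamma> (F i)" and j: "j \<in> {1..m}" and W: "W \<in> \<Gamma> (F j)" and x: "x \<in> points M"
  shows "X \<in> \<Gamma> B \<Longrightarrow> LB X x (inner_vf M (LF i V) (LF j W)) =
      (if i = j then inner_vf (F j) V W (snd x j) * (2 * b j (fst x) * X (fst x) (b j)) else 0)" (is "_ \<Longrightarrow> ?B")
    and "k \<in> {1..m} \<Longrightarrow> U \<in> \<Gamma> (F k) \<Longrightarrow> LF k U x (inner_vf M (LF i V) (LF j W)) =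
      (if i = j \<and> j = k then (b j (fst x))\<^sup>2 * U (snd x k) (inner_vf (F j) V W) else 0)" (is "_ \<Longrightarrow> _ \<Longrightarrow> ?F")
proof -
  have *: "v (inner_vf M (LF i V) (LF j W)) = (if i = j then v (\<lambda>x. (b j (fst x))\<^sup>2 * inner_vf (F j) V W (snd x j)) else 0)"
    if v: "v \<in> tangent_space M x" for v
  proof (cases "i = j")
    case True
    then show ?thesis using M.tangent_cong[OF v x inner_FF[OF i V j W]] by simp
  next
    case False
    then show ?thesis using M_deriv_zero[OF v x] inner_FF[OF i V j W] by simp
  qed
  show ?B if X: "X \<in> \<Gamma> B"
    using LB_prod[OF X x j b2_smooth[OF j], of "inner_vf (F j) V W"] F_inner_smooth[OF j _ W, of V] V
      charted.tangent_power2[OF B B_vt[OF X x] b_smooth[OF j]]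
    unfolding *[OF LB_t[OF X x]] by auto
  show ?F if k: "k \<in> {1..m}" and U: "U \<in> \<Gamma> (F k)"
    using LF_prod[OF k U x j b2_smooth[OF j], of "inner_vf (F j) V W"] F_inner_smooth[OF j _ W, of V] V
    unfolding *[OF LF_t[OF k U x]] by auto
qed

lemma F_bracket: "j \<in> {1..m} \<Longrightarrow> V \<in> \<Gamma> (F j) \<Longrightarrow> W \<in> \<Gamma> (F j) \<Longrightarrow> bracket V W \<in> \<Gamma> (F j)"
  by (rule charted.bracket_vfield[OF F])

lemma B_bracket: "X \<in> \<Gamma> B \<Longrightarrow> Y \<in> \<Gamma> B \<Longrightarrow> bracket X Y \<in> \<Gamma> B"
  by (rule charted.bracket_vfield[OF B])

context
  fixes x assumes x: "x \<in> points M"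
begin

text \<open>With these rules the six terms of a Koszul form of lifts simplify directly to the values
  listed below.\<close>

lemmas tables = x inner_BB inner_BF inner_FB inner_FF inner_bracket_BB inner_bracket_BF inner_bracket_FB inner_bracket_FF
  d_BB d_BF[OF _ _ _ x] d_FF LB_t LF_t LB_vfield LF_vfield B_bracket

lemma koszul_BBB:
  "X \<in> \<Gamma> B \<Longrightarrow> Y \<in> \<Gamma> B \<Longrightarrow> Z \<in> \<Gamma> B \<Longrightarrow> koszul M (LB X) (LB Y) (LB Z) x = koszul B X Y Z (fst x)"
  unfolding koszul_def vfield_app_def by (simp add: tables)

lemma koszul_BBF:
  assumes "X \<in> \<Gamma> B" "Y \<in> \<Gamma> B" "j \<in> {1..m}" "W \<in> \<Gamma> (F j)"
  shows "koszul M (LB X) (LB Y) (LF j W) x = 0" "koszul M (LB X) (LF j W) (LB Y) x = 0" "koszul M (LF j W) (LB X) (LB Y) x = 0"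
  unfolding koszul_def vfield_app_def using assms by (simp_all add: tables)

text \<open>All bracket terms vanish. What survives is half of \<open>X\<close> applied to
  \<open>b j ^ 2\<close> times the fibre metric, with negative sign when \<open>X\<close> is the
  third argument.\<close>

lemma koszul_BFF:
  assumes X: "X \<in> \<Gamma> B" and i: "i \<in> {1..m}" and V: "V \<in> \<Gamma> (F i)" and j: "j \<in> {1..m}" and W: "W \<in> \<Gamma> (F j)"
  shows "koszul M (LB X) (LF i V) (LF j W) x =
      (if i = j then b j (fst x) * X (fst x) (b j) * inner_vf (F j) V W (snd x j) else 0)"
    and "koszul M (LF i V) (LB X) (LF j W) x =
      (if i = j then b j (fst x) * X (fst x) (b j) * inner_vf (F j) V W (snd x j) else 0)"
    and "koszul M (LF i V) (LF j W) (LB X) x =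
      (if i = j then - b j (fst x) * X (fst x) (b j) * inner_vf (F j) V W (snd x j) else 0)"
proof -
  have s: "inner_vf (F j) W V (snd x j) = inner_vf (F j) V W (snd x j)" if "i = j"
    using ap_mfd.inner_sym[OF apF[OF j] W _ F_pr_in[OF j x], of V] V that by simp
  have fb: "bracket V W \<in> \<Gamma> (F j)" "bracket W V \<in> \<Gamma> (F j)" if "i = j"
    using F_bracket[OF j] V W that by simp_all
  show "koszul M (LB X) (LF i V) (LF j W) x =
      (if i = j then b j (fst x) * X (fst x) (b j) * inner_vf (F j) V W (snd x j) else 0)"
    "koszul M (LF i V) (LB X) (LF j W) x =
      (if i = j then b j (fst x) * X (fst x) (b j) * inner_vf (F j) V W (snd x j) else 0)"
    "koszul M (LF i V) (LF j W) (LB X) x =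
      (if i = j then - b j (fst x) * X (fst x) (b j) * inner_vf (F j) V W (snd x j) else 0)"
    unfolding koszul_def vfield_app_def using X i V j W s fb
    by (cases "i = j"; simp add: tables)+
qed

text \<open>If the fibres are not all equal, at most one pair of fields interacts. Its inner product
  is constant along the third field, and its bracket lies in a fibre orthogonal to that
  field.\<close>

lemma koszul_FFF:
  assumes i: "i \<in> {1..m}" and U: "U \<in> \<Gamma> (F i)" and j: "j \<in> {1..m}" and V: "V \<in> \<Gamma> (F j)" and k: "k \<in> {1..m}" and W: "W \<in> \<Gamma> (F k)"
  shows "koszul M (LF i U) (LF j V) (LF k W) x =
    (if i = j \<and> j = k then (b j (fst x))\<^sup>2 * koszul (F j) U V W (snd x j) else 0)"
proof -
  have fb: "bracket U V \<in> \<Gamma> (F j)" if "i = j" using F_bracket[OF j] U V that by simp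
  have fb': "bracket V W \<in> \<Gamma> (F k)" if "j = k" using F_bracket[OF k] W V that by simp
  have fb'': "bracket W U \<in> \<Gamma> (F i)" if "k = i" using F_bracket[OF i] W U that by simp
  show ?thesis
  proof (cases "i = j \<and> j = k")
    case True
    then have e: "i = k" "j = k" by simp_all
    have "koszul M (LF k U) (LF k V) (LF k W) x = (b k (fst x))\<^sup>2 * koszul (F k) U V W (snd x k)"
      unfolding koszul_def vfield_app_def using k U V W fb fb' fb'' unfolding e
      by (simp add: tables) (simp add: algebra_simps)
    then show ?thesis by (simp add: e)
  next
    case False
    then consider "i = j" "j \<noteq> k" | "j = k" "i \<noteq> k" | "k = i" "i \<noteq> j" | "i \<noteq> j" "j \<noteq> k" "k \<noteq> i" by blast
    then have "koszul M (LF i U) (LF j V) (LF k W) x = 0"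
    proof cases
      case 1
      have "koszul M (LF j U) (LF j V) (LF k W) x = 0"
        unfolding koszul_def vfield_app_def using 1(2) j k U V W fb unfolding 1(1) by (simp add: tables)
      then show ?thesis by (simp only: 1(1))
    next
      case 2
      have "koszul M (LF i U) (LF k V) (LF k W) x = 0"
        unfolding koszul_def vfield_app_def using 2(2) i k U V W fb' unfolding 2(1) by (simp add: tables)
      then show ?thesis by (simp only: 2(1))
    next
      case 3
      have "koszul M (LF i U) (LF j V) (LF i W) x = 0"
        unfolding koszul_def vfield_app_def using 3(2) i j U V W fb'' unfolding 3(1) by (simp add: tables)
      then show ?thesis by (simp only: 3(1))
    next
      case 4
      then show ?thesis
        unfolding koszul_def vfield_app_def using i j k U V W by (simp add: tables)
    qed
    then show ?thesis using False by (simp only: if_False)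
  qed
qed

text \<open>Only the values at points of the manifold count, so the images under the endomorphism
  may be replaced by lifts.\<close>

lemma ap_koszul_endo:
  assumes "A \<in> \<Gamma> M" "C \<in> \<Gamma> M" "D \<in> \<Gamma> M" "\<And>q. q \<in> points M \<Longrightarrow> endo_vf M C q = C' q" "\<And>q. q \<in> points M \<Longrightarrow> endo_vf M D q = D' q"
  shows "ap_koszul M A C D x = 1/2 * (koszul M A C D x + koszul M A C' D' x)"
  unfolding ap_koszul_def
  by (subst M.koszul_cong[OF assms(1) M.endo_smooth[OF assms(2)] M.endo_smooth[OF assms(3)] refl assms(4,5) x]) simp_all

lemma ap_koszul_BBB:
  "X \<in> \<Gamma> B \<Longrightarrow> Y \<in> \<Gamma> B \<Longrightarrow> Z \<in> \<Gamma> B \<Longrightarrow> ap_koszul M (LB X) (LB Y) (LB Z) x = ap_koszul B X Y Z (fst x)"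
  by (simp add: ap_koszul_endo[OF LB_vfield LB_vfield LB_vfield LB_endo LB_endo] koszul_BBB B_endo ap_koszul_def[of B])

lemma ap_koszul_BBF:
  assumes "X \<in> \<Gamma> B" "Y \<in> \<Gamma> B" "j \<in> {1..m}" "W \<in> \<Gamma> (F j)"
  shows "ap_koszul M (LB X) (LB Y) (LF j W) x = 0" "ap_koszul M (LB X) (LF j W) (LB Y) x = 0" "ap_koszul M (LF j W) (LB X) (LB Y) x = 0"
  using assms
  by (simp_all add: ap_koszul_endo[OF LB_vfield LB_vfield LF_vfield LB_endo LF_endo]
    ap_koszul_endo[OF LB_vfield LF_vfield LB_vfield LF_endo LB_endo]
    ap_koszul_endo[OF LF_vfield LB_vfield LB_vfield LB_endo LB_endo] koszul_BBF B_endo F_endo)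

text \<open>In the first formula \<open>J\<close> acts on two fibre arguments and is an isometry, so
  both halves are equal. In the others it acts on the base field and on one fibre field, which pairs
  \<open>X b\<close> with \<open>g(V, W)\<close> and \<open>(J X) b\<close> with
  \<open>g(V, J W)\<close>.\<close>

lemma ap_koszul_BFF:
  assumes X: "X \<in> \<Gamma> B" and i: "i \<in> {1..m}" and V: "V \<in> \<Gamma> (F i)" and j: "j \<in> {1..m}" and W: "W \<in> \<Gamma> (F j)"
  shows "ap_koszul M (LB X) (LF i V) (LF j W) x =
      (if i = j then b j (fst x) * X (fst x) (b j) * inner_vf (F j) V W (snd x j) else 0)"
    and "ap_koszul M (LF i V) (LB X) (LF j W) x = (if i = j then 1/2 * b j (fst x) *
      (X (fst x) (b j) * inner_vf (F j) V W (snd x j) + endo_vf B X (fst x) (b j) * inner_vf (F j) V (endo_vf (F j) W) (snd x j)) else 0)"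
    and "ap_koszul M (LF i V) (LF j W) (LB X) x = (if i = j then - 1/2 * b j (fst x) *
      (X (fst x) (b j) * inner_vf (F j) V W (snd x j) + endo_vf B X (fst x) (b j) * inner_vf (F j) V (endo_vf (F j) W) (snd x j)) else 0)"
proof -
  have iso: "inner_vf (F j) (endo_vf (F i) V) (endo_vf (F j) W) (snd x j) = inner_vf (F j) V W (snd x j)" if "i = j"
    using ap_mfd.inner_isom[OF apF[OF j] _ W F_pr_in[OF j x], of V] V that by simp
  show "ap_koszul M (LB X) (LF i V) (LF j W) x =
      (if i = j then b j (fst x) * X (fst x) (b j) * inner_vf (F j) V W (snd x j) else 0)"
    using ap_koszul_endo[OF LB_vfield[OF X] LF_vfield[OF i V] LF_vfield[OF j W] LF_endo[OF i V] LF_endo[OF j W]]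
      koszul_BFF(1)[OF X i V j W] koszul_BFF(1)[OF X i F_endo[OF i V] j F_endo[OF j W]] iso
    by (cases "i = j") (simp_all add: field_simps)
  show "ap_koszul M (LF i V) (LB X) (LF j W) x = (if i = j then 1/2 * b j (fst x) *
      (X (fst x) (b j) * inner_vf (F j) V W (snd x j) + endo_vf B X (fst x) (b j) * inner_vf (F j) V (endo_vf (F j) W) (snd x j)) else 0)"
    using ap_koszul_endo[OF LF_vfield[OF i V] LB_vfield[OF X] LF_vfield[OF j W] LB_endo[OF X] LF_endo[OF j W]]
      koszul_BFF(2)[OF X i V j W] koszul_BFF(2)[OF B_endo[OF X] i V j F_endo[OF j W]]
    by (cases "i = j") (simp_all add: field_simps)
  show "ap_koszul M (LF i V) (LF j W) (LB X) x = (if i = j then - 1/2 * b j (fst x) *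
      (X (fst x) (b j) * inner_vf (F j) V W (snd x j) + endo_vf B X (fst x) (b j) * inner_vf (F j) V (endo_vf (F j) W) (snd x j)) else 0)"
    using ap_koszul_endo[OF LF_vfield[OF i V] LF_vfield[OF j W] LB_vfield[OF X] LF_endo[OF j W] LB_endo[OF X]]
      koszul_BFF(3)[OF X i V j W] koszul_BFF(3)[OF B_endo[OF X] i V j F_endo[OF j W]]
    by (cases "i = j") (simp_all add: field_simps)
qed

lemma ap_koszul_FFF:
  assumes i: "i \<in> {1..m}" and U: "U \<in> \<Gamma> (F i)" and j: "j \<in> {1..m}" and V: "V \<in> \<Gamma> (F j)" and k: "k \<in> {1..m}" and W: "W \<in> \<Gamma> (F k)"
  shows "ap_koszul M (LF i U) (LF j V) (LF k W) x =
    (if i = j \<and> j = k then (b j (fst x))\<^sup>2 * ap_koszul (F j) U V W (snd x j) else 0)"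
  using ap_koszul_endo[OF LF_vfield[OF i U] LF_vfield[OF j V] LF_vfield[OF k W] LF_endo[OF j V] LF_endo[OF k W]]
    koszul_FFF[OF i U j V k W] koszul_FFF[OF i U j F_endo[OF j V] k F_endo[OF k W]]
  by (auto simp: ap_koszul_def[of "F _"] algebra_simps)

end

section \<open>Regular points of the warped product\<close>

lemma metric_iB_right: "x \<in> points M \<Longrightarrow> u \<in> tangent_space B (fst x) \<Longrightarrow> v \<in> tangent_space M x \<Longrightarrow>
    metric M x v (iB x u) = metric B (fst x) (dB v) u"
  using metric_iB_iB[of x u v] M.metric_sym[of x v "iB x u"] B_push_in[of x u]
    ap_mfd.metric_sym[OF apB B_pr_in, of x u "dB v"] B_proj_in[of x v] by simp

lemma metric_iF_right: "j \<in> {1..m} \<Longrightarrow> x \<in> points M \<Longrightarrow> u \<in> tangent_space (F j) (snd x j) \<Longrightarrow> v \<in> tangent_space M x \<Longrightarrow>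
    metric M x v (iF j x u) = (b j (fst x))\<^sup>2 * metric (F j) (snd x j) (dF j v) u"
  using metric_iF[of j x u v] M.metric_sym[of x v "iF j x u"] F_push_in[of j x u]
    ap_mfd.metric_sym[OF apF F_pr_in, of j x u "dF j v"] F_proj_in[of j x v] by simp

text \<open>Complete systems of \<open>B\<close> and of the fibres with
  \<open>b j \<noteq> 0\<close> are put together. A fibre whose warping function vanishes at the
  point contributes nothing to the metric there.\<close>

lemma metric_rank_M:
  assumes x: "x \<in> points M"
  shows "metric_rank M x = metric_rank B (fst x) +
    (\<Sum>j\<in>{j\<in>{1..m}. b j (fst x) \<noteq> 0}. metric_rank (F j) (snd x j))"
proof -
  define J where "J = {j\<in>{1..m}. b j (fst x) \<noteq> 0}"
  have J: "finite J" "\<And>j. j \<in> J \<Longrightarrow> j \<in> {1..m}" "\<And>j. j \<in> J \<Longrightarrow> b j (fst x) \<noteq> 0" by (auto simp: J_def)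
  let ?rB = "metric_rank B (fst x)" and ?r = "\<lambda>j. metric_rank (F j) (snd x j)"
  obtain vB wB where CB: "ap_mfd.complete_system B (fst x) {..<?rB} vB wB"
    by (rule ap_mfd.complete_system_exists[OF apB B_pr_in[OF x]])
  have "\<exists>v w. ap_mfd.complete_system (F j) (snd x j) {..<?r j} v w" if j: "j \<in> J" for j
    by (rule ap_mfd.complete_system_exists[OF apF[OF J(2)[OF j]] F_pr_in[OF J(2)[OF j] x]]) blast
  then obtain vF wF where CF: "\<And>j. j \<in> J \<Longrightarrow> ap_mfd.complete_system (F j) (snd x j) {..<?r j} (vF j) (wF j)" by metis
  have cB: "metric B (fst x) u y = (\<Sum>s<?rB. metric B (fst x) u (wB s) * metric B (fst x) (vB s) y)"
    if "u \<in> tangent_space B (fst x)" "y \<in> tangent_space B (fst x)" for u y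
    using CB that by (simp add: ap_mfd.complete_system_def[OF apB])
  have cF: "metric (F j) (snd x j) u y = (\<Sum>s<?r j. metric (F j) (snd x j) u (wF j s) * metric (F j) (snd x j) (vF j s) y)"
    if "j \<in> J" "u \<in> tangent_space (F j) (snd x j)" "y \<in> tangent_space (F j) (snd x j)" for j u y
    using CF[OF that(1)] that by (simp add: ap_mfd.complete_system_def[OF apF[OF J(2)]])
  have "ap_mfd.dual_system B (fst x) {..<?rB} vB wB" using CB by (simp add: ap_mfd.complete_system_def[OF apB])
  note dB = ap_mfd.dual_systemD[OF apB this]
  have "ap_mfd.dual_system (F j) (snd x j) {..<?r j} (vF j) (wF j)" if "j \<in> J" for j
    using CF[OF that] that by (simp add: ap_mfd.complete_system_def[OF apF[OF J(2)]])
  note dF = ap_mfd.dual_systemD[OF apF[OF J(2)] this]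
  define S where "S = {..<?rB} <+> (SIGMA j:J. {..<?r j})"
  define v where "v = case_sum (\<lambda>s. iB x (vB s)) (\<lambda>(j, s). iF j x (vF j s))"
  \<comment> \<open>The product carries the fibre metric times \<open>b j ^ 2\<close>, so one member
    of each dual pair is divided by that factor.\<close>
  define w where "w = case_sum (\<lambda>s. iB x (wB s)) (\<lambda>(j, s). (\<lambda>f. inverse ((b j (fst x))\<^sup>2) * iF j x (wF j s) f))"
  have vB: "v (Inl s) = iB x (vB s)" "w (Inl s) = iB x (wB s)" for s by (simp_all add: v_def w_def)
  have vF: "v (Inr (j, s)) = iF j x (vF j s)" "w (Inr (j, s)) = (\<lambda>f. inverse ((b j (fst x))\<^sup>2) * iF j x (wF j s) f)" for j s
    by (simp_all add: v_def w_def)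
  have tB: "iB x (vB s) \<in> tangent_space M x" "iB x (wB s) \<in> tangent_space M x" if "s < ?rB" for s
    using B_push_in[OF x dB(2)] B_push_in[OF x dB(3)] that by simp_all
  have tF: "iF j x (vF j s) \<in> tangent_space M x" "iF j x (wF j s) \<in> tangent_space M x"
    if "j \<in> J" "s < ?r j" for j s
    using F_push_in[OF J(2)[OF that(1)] x dF(2)[OF that(1) that(1)]] F_push_in[OF J(2)[OF that(1)] x dF(3)[OF that(1) that(1)]] that(2) by simp_all
  have gB: "metric M x y (w (Inl s)) = metric B (fst x) (pushforward B fst y) (wB s)"
    if "s < ?rB" "y \<in> tangent_space M x" for s y
    unfolding vB by (rule metric_iB_right[OF x dB(3) that(2)]) (use that in simp)
  have gF: "metric M x y (w (Inr (j, s))) = metric (F j) (snd x j) (pushforward (F j) (\<lambda>x. snd x j) y) (wF j s)"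
    if "j \<in> J" "s < ?r j" "y \<in> tangent_space M x" for j s y
    unfolding vF
    using M.metric_scale_right[OF x tF(2)[OF that(1,2)] that(3), of "inverse ((b j (fst x))\<^sup>2)"]
      metric_iF_right[OF J(2)[OF that(1)] x dF(3)[OF that(1) that(1)] that(3)] that(2) J(3)[OF that(1)]
    by (simp add: field_simps)
  have vt: "v s \<in> tangent_space M x" "w s \<in> tangent_space M x" if s: "s \<in> S" for s
    using s tB tF M.tangent_scale[OF tF(2)] by (auto simp: S_def v_def w_def)
  have "M.complete_system x S v w"
    unfolding M.complete_system_def M.dual_system_def
  proof (intro conjI ballI)
    show "finite S" unfolding S_def using J(1) by auto
    show "v s \<in> tangent_space M x" "w s \<in> tangent_space M x" if "s \<in> S" for s using vt[OF that] .
    show "metric M x (v s) (w t) = (if s = t then 1 else 0)" if s: "s \<in> S" and t: "t \<in> S" for s t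
    proof (cases t)
      case (Inl t')
      then have t': "t' < ?rB" using t by (auto simp: S_def)
      note g = gB[OF t' vt(1)[OF s]]
      show ?thesis
      proof (cases s)
        case (Inl s')
        then have s': "s' < ?rB" using s by (auto simp: S_def)
        show ?thesis using g dB(2)[of s'] dB(4)[of s' t'] s' t' by (simp add: Inl \<open>t = Inl t'\<close> vB dB_iB[OF x])
      next
        case (Inr js)
        obtain j s' where js: "js = (j, s')" by (cases js)
        have s': "j \<in> J" "s' < ?r j" using s by (auto simp: S_def Inr js)
        show ?thesis
          using g dB_iF[OF J(2)[OF s'(1)] x dF(2)[OF s'(1) s'(1), of s']] s' ap_mfd.metric_zero[OF apB B_pr_in[OF x] dB(3)[of t']] t'
          by (simp add: Inr js \<open>t = Inl t'\<close> vF)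
      qed
    next
      case (Inr kt)
      obtain k t' where kt: "kt = (k, t')" by (cases kt)
      have t': "k \<in> J" "t' < ?r k" using t by (auto simp: S_def Inr kt)
      note g = gF[OF t' vt(1)[OF s]]
      have z: "metric (F k) (snd x k) (\<lambda>f. 0) (wF k t') = 0"
        using ap_mfd.metric_zero[OF apF[OF J(2)[OF t'(1)]] F_pr_in[OF J(2)[OF t'(1)] x] dF(3)[OF t'(1) t'(1)]] t'(2) by simp
      show ?thesis
      proof (cases s)
        case (Inl s')
        then have s': "s' < ?rB" using s by (auto simp: S_def)
        show ?thesis using g z dF_iB[OF J(2)[OF t'(1)] x dB(2)[of s']] s' by (simp add: Inl \<open>t = Inr kt\<close> kt vB)
      next
        case (Inr js)
        obtain j s' where js: "js = (j, s')" by (cases js)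
        have s': "j \<in> J" "s' < ?r j" using s by (auto simp: S_def Inr js)
        note d = dF_iF[OF J(2)[OF s'(1)] J(2)[OF t'(1)] x dF(2)[OF s'(1) s'(1), of s']]
        show ?thesis
        proof (cases "k = j")
          case True
          then show ?thesis using g d s' t' dF(4)[OF s'(1) s'(1), of s' t'] by (simp add: Inr js \<open>t = Inr kt\<close> kt vF(1))
        next
          case False
          then show ?thesis using g d s' z by (simp add: Inr js \<open>t = Inr kt\<close> kt vF(1))
        qed
      qed
    qed
  next
    fix u y assume u: "u \<in> tangent_space M x" and y: "y \<in> tangent_space M x"
    have "(\<Sum>s\<in>S. metric M x u (w s) * metric M x (v s) y) =
      (\<Sum>s<?rB. metric M x u (w (Inl s)) * metric M x (v (Inl s)) y) +
      (\<Sum>js\<in>(SIGMA j:J. {..<?r j}). metric M x u (w (Inr js)) * metric M x (v (Inr js)) y)"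
      unfolding S_def by (subst sum.Plus) (use J(1) in auto)
    also have "(\<Sum>s<?rB. metric M x u (w (Inl s)) * metric M x (v (Inl s)) y) =
        (\<Sum>s<?rB. metric B (fst x) (pushforward B fst u) (wB s) * metric B (fst x) (vB s) (pushforward B fst y))"
      by (rule sum.cong[OF refl]) (simp add: gB u vB(1) metric_iB_iB[OF x dB(2) y])
    also have "\<dots> = metric B (fst x) (pushforward B fst u) (pushforward B fst y)"
      by (rule cB[OF B_proj_in[OF x u] B_proj_in[OF x y], symmetric])
    also have "(\<Sum>js\<in>(SIGMA j:J. {..<?r j}). metric M x u (w (Inr js)) * metric M x (v (Inr js)) y) =
        (\<Sum>j\<in>J. \<Sum>s<?r j. metric M x u (w (Inr (j, s))) * metric M x (v (Inr (j, s))) y)"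
      using sum.Sigma[of J "\<lambda>j. {..<?r j}" "\<lambda>j s. metric M x u (w (Inr (j, s))) * metric M x (v (Inr (j, s))) y"] J(1)
      by (simp add: split_beta)
    also have "\<dots> = (\<Sum>j\<in>J. (b j (fst x))\<^sup>2 * metric (F j) (snd x j) (pushforward (F j) (\<lambda>x. snd x j) u) (pushforward (F j) (\<lambda>x. snd x j) y))"
    proof (rule sum.cong[OF refl])
      fix j assume j: "j \<in> J"
      have "(\<Sum>s<?r j. metric M x u (w (Inr (j, s))) * metric M x (v (Inr (j, s))) y) =
        (\<Sum>s<?r j. (b j (fst x))\<^sup>2 * (metric (F j) (snd x j) (pushforward (F j) (\<lambda>x. snd x j) u) (wF j s) *
          metric (F j) (snd x j) (vF j s) (pushforward (F j) (\<lambda>x. snd x j) y)))"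
      proof (rule sum.cong[OF refl])
        fix s assume "s \<in> {..<?r j}"
        then have s: "s < ?r j" by simp
        show "metric M x u (w (Inr (j, s))) * metric M x (v (Inr (j, s))) y =
          (b j (fst x))\<^sup>2 * (metric (F j) (snd x j) (pushforward (F j) (\<lambda>x. snd x j) u) (wF j s) *
          metric (F j) (snd x j) (vF j s) (pushforward (F j) (\<lambda>x. snd x j) y))"
          unfolding gF[OF j s u] vF(1)
          using metric_iF[OF J(2)[OF j] x dF(2)[OF j j, of s] y] s by (simp add: mult_ac)
      qed
      then show "(\<Sum>s<?r j. metric M x u (w (Inr (j, s))) * metric M x (v (Inr (j, s))) y) =
        (b j (fst x))\<^sup>2 * metric (F j) (snd x j) (pushforward (F j) (\<lambda>x. snd x j) u) (pushforward (F j) (\<lambda>x. snd x j) y)"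
        by (simp only: cF[OF j F_proj_in[OF J(2)[OF j] x u] F_proj_in[OF J(2)[OF j] x y]] sum_distrib_left)
    qed
    also have "\<dots> = (\<Sum>j\<in>{1..m}. (b j (fst x))\<^sup>2 * metric (F j) (snd x j) (pushforward (F j) (\<lambda>x. snd x j) u) (pushforward (F j) (\<lambda>x. snd x j) y))"
      by (rule sum.mono_neutral_left) (auto simp: J_def)
    finally show "metric M x u y = (\<Sum>s\<in>S. metric M x u (w s) * metric M x (v s) y)"
      by (simp only: metric_M)
  qed
  from M.complete_system_rank[OF this x] have "metric_rank M x = card S" .
  also have "\<dots> = ?rB + (\<Sum>j\<in>J. ?r j)" unfolding S_def using J(1) by (simp add: card_Plus)
  finally show ?thesis by (simp only: J_def)
qed

text \<open>Neighbourhoods in the product restrict to neighbourhoods in a single factor, on which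
  the rank of that factor can be examined.\<close>

lemma slice_cont:
  assumes x: "x \<in> points M"
  shows "continuous_map (mtop B) (mtop M) (\<lambda>p'. (p', snd x))"
    and "j \<in> {1..m} \<Longrightarrow> continuous_map (mtop (F j)) (mtop M) (\<lambda>y. (fst x, (snd x)(j := y)))"
proof -
  have px: "fst x \<in> points B" and qx: "snd x \<in> (\<Pi>\<^sub>E j\<in>{1..m}. points (F j))"
    using x by (simp_all add: points_eq mem_Times_iff)
  show "continuous_map (mtop B) (mtop M) (\<lambda>p'. (p', snd x))"
    unfolding mtop_eq continuous_map_pairwise using qx by (simp add: comp_def)
  show "continuous_map (mtop (F j)) (mtop M) (\<lambda>y. (fst x, (snd x)(j := y)))" if j: "j \<in> {1..m}"
    unfolding mtop_eq continuous_map_pairwise continuous_map_componentwise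
  proof (intro conjI ballI)
    show "continuous_map (mtop (F j)) (mtop B) (fst \<circ> (\<lambda>y. (fst x, (snd x)(j := y))))"
      using px by (simp add: comp_def)
    show "(snd \<circ> (\<lambda>y. (fst x, (snd x)(j := y)))) ` topspace (mtop (F j)) \<subseteq> extensional {1..m}"
      using qx j by (auto simp: PiE_def extensional_def)
    fix k assume k: "k \<in> {1..m}"
    show "continuous_map (mtop (F j)) (mtop (F k)) (\<lambda>y. (snd \<circ> (\<lambda>y. (fst x, (snd x)(j := y)))) y k)"
      using PiE_mem[OF qx k] by (cases "k = j") (simp_all add: comp_def)
  qed
qed

text \<open>Fibre \<open>j\<close> contributes to the rank of \<open>M\<close> exactly where \<open>b j\<close> does not vanish.\<close>

lemma regular_fibre:
  assumes x: "x \<in> regular_points M" and j: "j \<in> {1..m}"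
  shows "b j (fst x) \<noteq> 0 \<Longrightarrow> snd x j \<in> regular_points (F j)"
    and "b j (fst x) = 0 \<Longrightarrow> (\<forall>X\<in>\<Gamma> B. X (fst x) (b j) = 0) \<or>
      (\<forall>u\<in>tangent_space (F j) (snd x j). \<forall>v\<in>tangent_space (F j) (snd x j). metric (F j) (snd x j) u v = 0)"
proof -
  obtain U where xM: "x \<in> points M" and U: "openin (mtop M) U" "x \<in> U" "\<And>y. y \<in> U \<Longrightarrow> metric_rank M y = metric_rank M x"
    using x unfolding regular_points_def by blast
  have UM: "y \<in> points M" if "y \<in> U" for y using U(1) that openin_subset by blast
  note qj = F_pr_in[OF j xM] and px = B_pr_in[OF xM]
  define J where "J p = {k\<in>{1..m}. b k p \<noteq> 0}" for p
  have fin: "finite (J p)" for p by (simp add: J_def)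
  show "snd x j \<in> regular_points (F j)" if nz: "b j (fst x) \<noteq> 0"
  proof -
    let ?W = "{y \<in> points (F j). (fst x, (snd x)(j := y)) \<in> U}"
    have "openin (mtop (F j)) ?W" by (rule openin_continuous_map_preimage[OF slice_cont(2)[OF xM j] U(1)])
    moreover have "snd x j \<in> ?W" using qj U(2) by simp
    moreover have "metric_rank (F j) y = metric_rank (F j) (snd x j)" if y: "y \<in> ?W" for y
    proof -
      \<comment> \<open>Moving only the fibre coordinate \<open>j\<close> keeps the base point,
        hence the set of contributing fibres and all other summands of the rank.\<close>
      let ?x = "(fst x, (snd x)(j := y))"
      have yU: "?x \<in> U" using y by simp
      have jJ: "j \<in> J (fst x)" using j nz by (simp add: J_def)
      have "(\<Sum>k\<in>J (fst x). metric_rank (F k) (((snd x)(j := y)) k)) = (\<Sum>k\<in>J (fst x). metric_rank (F k) (snd x k))"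
        using U(3)[OF yU] metric_rank_M[OF UM[OF yU]] metric_rank_M[OF xM] by (simp add: J_def)
      then show ?thesis
        unfolding sum.remove[OF fin jJ] by (simp cong: sum.cong_simp)
    qed
    ultimately show ?thesis using qj unfolding regular_points_def by blast
  qed
  show "(\<forall>X\<in>\<Gamma> B. X (fst x) (b j) = 0) \<or>
      (\<forall>u\<in>tangent_space (F j) (snd x j). \<forall>v\<in>tangent_space (F j) (snd x j). metric (F j) (snd x j) u v = 0)"
    if z: "b j (fst x) = 0"
  \<comment> \<open>Either \<open>b j\<close> vanishes near the base point, and with it its
    derivatives there, or there are arbitrarily near points where it does not vanish.\<close>
  proof (cases "\<exists>N. openin (mtop B) N \<and> fst x \<in> N \<and> (\<forall>p\<in>N. b j p = 0)")
    case True
    then obtain N where N: "openin (mtop B) N" "fst x \<in> N" "\<And>p. p \<in> N \<Longrightarrow> b j p = 0" by blast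
    have "X (fst x) (b j) = 0" if X: "X \<in> \<Gamma> B" for X
      using charted.tangent_local[OF B B_vt[OF X xM] N(1,2) b_smooth[OF j] charted.C_inf_const[OF B, of 0] N(3)]
        charted.tangent_const[OF B B_vt[OF X xM]] by simp
    then show ?thesis by blast
  next
    case False
    let ?N1 = "{p \<in> points B. (p, snd x) \<in> U}"
    have N1: "openin (mtop B) ?N1" by (rule openin_continuous_map_preimage[OF slice_cont(1)[OF xM] U(1)])
    obtain N2 where N2: "openin (mtop B) N2" "fst x \<in> N2" "\<And>p. p \<in> N2 \<Longrightarrow> metric_rank B (fst x) \<le> metric_rank B p"
      by (rule ap_mfd.metric_rank_lower_semicontinuous[OF apB px]) blast
    \<comment> \<open>On this set the fibres that contribute at \<open>fst x\<close> go on
      contributing; \<open>points B\<close> covers the case that there are none.\<close>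
    let ?K = "insert (points B) ((\<lambda>k. {p \<in> points B. b k p \<in> - {0}}) ` J (fst x))"
    have ok: "openin (mtop B) {p \<in> points B. b k p \<in> - {0}}" if "k \<in> J (fst x)" for k
      by (rule charted.C_inf_preimage_open[OF B b_smooth]) (use that in \<open>auto simp: J_def open_Compl\<close>)
    have N3: "openin (mtop B) (\<Inter>?K)"
      by (rule openin_Inter) (use fin ok in auto)
    have x3: "fst x \<in> \<Inter>?K" using px by (auto simp: J_def)
    have oN: "openin (mtop B) (?N1 \<inter> (N2 \<inter> \<Inter>?K))" by (intro openin_Int N1 N2(1) N3)
    have xN: "fst x \<in> ?N1 \<inter> (N2 \<inter> \<Inter>?K)" using px U(2) N2(2) x3 by simp
    have "\<not> (\<forall>p\<in>?N1 \<inter> (N2 \<inter> \<Inter>?K). b j p = 0)"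
      by (rule notI, rule notE[OF False], rule exI, intro conjI, rule oN, rule xN)
    then obtain p where p: "p \<in> ?N1 \<inter> (N2 \<inter> \<Inter>?K)" "b j p \<noteq> 0" unfolding ball_simps(10) by (elim bexE)
    have pU: "(p, snd x) \<in> U" and p2: "p \<in> N2" using p(1) by simp_all
    have JJ: "insert j (J (fst x)) \<subseteq> J p" using p j by (auto simp: J_def)
    have jJ: "j \<notin> J (fst x)" using z by (simp add: J_def)
    have "(\<Sum>k\<in>insert j (J (fst x)). metric_rank (F k) (snd x k)) \<le> (\<Sum>k\<in>J p. metric_rank (F k) (snd x k))"
      by (rule sum_mono2[OF fin JJ]) simp
    then have "metric_rank (F j) (snd x j) + (\<Sum>k\<in>J (fst x). metric_rank (F k) (snd x k)) \<le> (\<Sum>k\<in>J p. metric_rank (F k) (snd x k))"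
      by (simp add: fin jJ)
    moreover have "metric_rank B p + (\<Sum>k\<in>J p. metric_rank (F k) (snd x k)) =
        metric_rank B (fst x) + (\<Sum>k\<in>J (fst x). metric_rank (F k) (snd x k))"
      using U(3)[OF pU] metric_rank_M[OF UM[OF pU]] metric_rank_M[OF xM] by (simp add: J_def)
    \<comment> \<open>Fibre \<open>j\<close> is a new summand, no old summand is lost and the rank
      of \<open>B\<close> does not drop. As the total is constant, the new summand is
      \<open>0\<close>.\<close>
    ultimately have "metric_rank (F j) (snd x j) = 0" using N2(3)[OF p2] by linarith
    then show ?thesis using ap_mfd.metric_rank_zero[OF apF[OF j] qj] by blast
  qed
qed

section \<open>Flats and contractions on the warped product\<close>

lemma linear_join:
  assumes x: "x \<in> points M" and v: "v \<in> tangent_space M x"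
    and L: "\<And>u v a c. u \<in> tangent_space M x \<Longrightarrow> v \<in> tangent_space M x \<Longrightarrow> L (\<lambda>f. a * u f + c * v f) = a * L u + c * (L v :: real)"
  shows "L v = L (iB x (dB v)) + (\<Sum>j\<in>{1..m}. L (iF j x (dF j v)))"
proof -
  note tB = B_push_in[OF x B_proj_in[OF x v]] and tF = F_push_in[OF _ x F_proj_in[OF _ x v]]
  have z: "L (\<lambda>f. 0) = 0" using L[OF M.tangent_zero M.tangent_zero, of 0 0] by simp
  have S: "(\<lambda>f. \<Sum>j\<in>S. iF j x (dF j v) f) \<in> tangent_space M x \<and> L (\<lambda>f. \<Sum>j\<in>S. iF j x (dF j v) f) = (\<Sum>j\<in>S. L (iF j x (dF j v)))"
    if "finite S" "S \<subseteq> {1..m}" for S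
    using that
  proof (induction S)
    case (insert k S)
    then have k: "k \<in> {1..m}" and S: "S \<subseteq> {1..m}" by simp_all
    note IH = conjunct1[OF insert.IH[OF S]] conjunct2[OF insert.IH[OF S]]
    have eq: "(\<lambda>f. \<Sum>j\<in>insert k S. iF j x (dF j v) f) = (\<lambda>f. 1 * iF k x (dF k v) f + 1 * (\<Sum>j\<in>S. iF j x (dF j v) f))"
      using insert.hyps by simp
    show ?case unfolding eq
    proof (rule conjI)
      show "(\<lambda>f. 1 * iF k x (dF k v) f + 1 * (\<Sum>j\<in>S. iF j x (dF j v) f)) \<in> tangent_space M x"
        by (rule M.tangent_comb[OF tF[OF k k] IH(1)])
      show "L (\<lambda>f. 1 * iF k x (dF k v) f + 1 * (\<Sum>j\<in>S. iF j x (dF j v) f)) = (\<Sum>j\<in>insert k S. L (iF j x (dF j v)))"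
        by (rule trans[OF L[OF tF[OF k k] IH(1)]]) (simp only: IH(2) sum.insert[OF insert.hyps] mult_1)
    qed
  qed (simp add: z M.tangent_zero)
  have S1: "(\<lambda>f. \<Sum>j\<in>{1..m}. iF j x (dF j v) f) \<in> tangent_space M x"
    "L (\<lambda>f. \<Sum>j\<in>{1..m}. iF j x (dF j v) f) = (\<Sum>j\<in>{1..m}. L (iF j x (dF j v)))"
    by (rule conjunct1[OF S[OF finite_atLeastAtMost subset_refl]], rule conjunct2[OF S[OF finite_atLeastAtMost subset_refl]])
  have "L v = L (\<lambda>f. 1 * iB x (dB v) f + 1 * (\<Sum>j\<in>{1..m}. iF j x (dF j v) f))"
    unfolding mult_1 join_def[symmetric] join_split[OF x v, symmetric] ..
  also have "\<dots> = 1 * L (iB x (dB v)) + 1 * L (\<lambda>f. \<Sum>j\<in>{1..m}. iF j x (dF j v) f)"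
    by (rule L[OF tB S1(1)])
  finally show ?thesis by (simp only: S1(2) mult_1)
qed

lemma nabla_flat_flatI:
  assumes x: "x \<in> points M" and A: "A \<in> \<Gamma> M" and C: "C \<in> \<Gamma> M" and u: "u \<in> tangent_space M x"
    and eqB: "\<And>Z. Z \<in> \<Gamma> B \<Longrightarrow> ap_koszul M A C (LB Z) x = metric M x u (LB Z x)"
    and eqF: "\<And>j W. j \<in> {1..m} \<Longrightarrow> W \<in> \<Gamma> (F j) \<Longrightarrow> ap_koszul M A C (LF j W) x = metric M x u (LF j W x)"
  shows "nabla_flat M A C x = flat M x u"
proof
  fix v
  show "nabla_flat M A C x v = flat M x u v"
  proof (cases "v \<in> tangent_space M x")
    case v: True
    note N = M.one_form_nabla_flat[OF A C]
    obtain Z where Z: "Z \<in> \<Gamma> B" "Z (fst x) = dB v"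
      by (rule charted.vfield_extension[OF B B_pr_in[OF x] B_proj_in[OF x v]])
    have 1: "nabla_flat M A C x (iB x (dB v)) = metric M x u (iB x (dB v))"
      using M.nabla_flat_eq[OF A C LB_vfield[OF Z(1)] x] eqB[OF Z(1)] by (simp add: LB_eq Z(2))
    have 2: "nabla_flat M A C x (iF j x (dF j v)) = metric M x u (iF j x (dF j v))" if j: "j \<in> {1..m}" for j
    proof -
      obtain W where W: "W \<in> \<Gamma> (F j)" "W (snd x j) = dF j v"
        by (rule charted.vfield_extension[OF F[OF j] F_pr_in[OF j x] F_proj_in[OF j x v]])
      show ?thesis
        using M.nabla_flat_eq[OF A C LF_vfield[OF j W(1)] x] eqF[OF j W(1)] by (simp add: LF_eq W(2))
    qed
    have "nabla_flat M A C x v = nabla_flat M A C x (iB x (dB v)) + (\<Sum>j\<in>{1..m}. nabla_flat M A C x (iF j x (dF j v)))"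
      by (rule linear_join[OF x v M.one_formD(2)[OF N x]])
    also have "\<dots> = metric M x u (iB x (dB v)) + (\<Sum>j\<in>{1..m}. metric M x u (iF j x (dF j v)))"
      by (simp only: 1, rule arg_cong[where f="\<lambda>z. _ + z"], rule sum.cong[OF refl]) (rule 2)
    also have "\<dots> = metric M x u v"
      by (rule linear_join[OF x v M.metric_lin_right[OF x _ _ u], symmetric])
    finally show ?thesis using v by (simp add: flat_def)
  qed (simp add: flat_def M.nabla_flat_off)
qed

text \<open>The criterion behind all evaluations of contractions below: a smooth candidate
  \<open>h\<close>, and at each regular point representing vectors whose product is
  \<open>h\<close>. At other points their product may differ from \<open>h\<close>.\<close>

lemma contraction_lift:
  assumes h: "h \<in> C_inf M"
    and reg: "\<And>x. x \<in> regular_points M \<Longrightarrow> \<exists>u\<in>tangent_space M x. \<exists>v\<in>tangent_space M x. \<omega> x = flat M x u \<and> \<tau> x = flat M x v \<and> metric M x u v = h x"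
    and x: "x \<in> points M"
  shows "contraction M \<omega> \<tau> x = h x" "contraction M \<tau> \<omega> x = h x"
proof -
  have *: "h y = bullet_inner M y (\<omega> y) (\<tau> y)" "h y = bullet_inner M y (\<tau> y) (\<omega> y)" if y: "y \<in> regular_points M" for y
  proof -
    have yM: "y \<in> points M" using y by (simp add: regular_points_def)
    obtain u v where uv: "u \<in> tangent_space M y" "v \<in> tangent_space M y" "\<omega> y = flat M y u" "\<tau> y = flat M y v" "metric M y u v = h y"
      using reg[OF y] by blast
    show "h y = bullet_inner M y (\<omega> y) (\<tau> y)" unfolding uv(3,4) M.bullet_inner_flat[OF yM uv(1,2)] uv(5) ..
    show "h y = bullet_inner M y (\<tau> y) (\<omega> y)" unfolding uv(3,4) M.bullet_inner_flat[OF yM uv(2,1)]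
      using uv(5) M.metric_sym[OF yM uv(1,2)] by simp
  qed
  show "contraction M \<omega> \<tau> x = h x" "contraction M \<tau> \<omega> x = h x"
    by (rule M.contraction_eq[OF _ x], unfold is_contraction_def, intro conjI ballI h *, assumption)+
qed

end

section \<open>Contractions of Koszul forms of lifts\<close>

locale warped_semi_regular = warped m B b F
  for m :: nat and B :: "('b, 'i) almost_product" and b :: "nat \<Rightarrow> 'b \<Rightarrow> real" and F :: "nat \<Rightarrow> ('f, 'j) almost_product" +
  assumes nd: "nondegenerate B" and sr: "j \<in> {1..m} \<Longrightarrow> ap_semi_regular (F j)"
begin

abbreviation db where "db j \<equiv> differential B (b j)"
abbreviation dbJ where "dbJ j \<equiv> form_endo B (differential B (b j))"
abbreviation G where "G \<omega> \<tau> x \<equiv> cometric B \<omega> \<tau> (fst x)"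
abbreviation one where "one \<equiv> ap_mfd.one_form B"
abbreviation sB where "sB \<omega> x \<equiv> sharp B (fst x) (\<omega> (fst x))"
abbreviation gF where "gF j V W x \<equiv> inner_vf (F j) V W (snd x j)"
abbreviation JF where "JF j \<equiv> endo_vf (F j)"
abbreviation JB where "JB \<equiv> endo_vf B"

lemma one_db: "j \<in> {1..m} \<Longrightarrow> one (db j)" and one_dbJ: "j \<in> {1..m} \<Longrightarrow> one (dbJ j)"
  by (rule ap_mfd.one_form_differential[OF apB b_smooth] ap_mfd.one_form_endo[OF apB ap_mfd.one_form_differential[OF apB b_smooth]], assumption)+

lemma one_nabla: "X \<in> \<Gamma> B \<Longrightarrow> Y \<in> \<Gamma> B \<Longrightarrow> one (nabla_flat B X Y)"
  by (rule ap_mfd.one_form_nabla_flat[OF apB])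

lemma sB_in: "one \<omega> \<Longrightarrow> x \<in> points M \<Longrightarrow> sB \<omega> x \<in> tangent_space B (fst x)"
  by (rule ap_mfd.sharp_in[OF apB nd _ B_pr_in])

lemma metric_sB: "one \<omega> \<Longrightarrow> x \<in> points M \<Longrightarrow> u \<in> tangent_space B (fst x) \<Longrightarrow> metric B (fst x) (sB \<omega> x) u = \<omega> (fst x) u"
  by (rule ap_mfd.metric_sharp[OF apB nd _ B_pr_in])

lemma db_app: "X \<in> \<Gamma> B \<Longrightarrow> x \<in> points M \<Longrightarrow> db j (fst x) (X (fst x)) = X (fst x) (b j)"
  by (simp add: differential_def B_vt)

lemma dbJ_app: "X \<in> \<Gamma> B \<Longrightarrow> x \<in> points M \<Longrightarrow> dbJ j (fst x) (X (fst x)) = JB X (fst x) (b j)"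
  using ap_mfd.endo_in[OF apB B_pr_in B_vt, of x X] by (simp add: differential_def form_endo_def B_vt endo_vf_def)

lemma dB_LB: "X \<in> \<Gamma> B \<Longrightarrow> x \<in> points M \<Longrightarrow> dB (LB X x) = X (fst x)"
  unfolding LB_eq by (rule dB_iB[OF _ B_vt])
lemma dF_LB: "j \<in> {1..m} \<Longrightarrow> X \<in> \<Gamma> B \<Longrightarrow> x \<in> points M \<Longrightarrow> dF j (LB X x) = (\<lambda>f. 0)"
  unfolding LB_eq by (rule dF_iB[OF _ _ B_vt])
lemma dB_LF: "j \<in> {1..m} \<Longrightarrow> V \<in> \<Gamma> (F j) \<Longrightarrow> x \<in> points M \<Longrightarrow> dB (LF j V x) = (\<lambda>f. 0)"
  unfolding LF_eq by (rule dB_iF[OF _ _ F_vt])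
lemma dF_LF: "j \<in> {1..m} \<Longrightarrow> V \<in> \<Gamma> (F j) \<Longrightarrow> i \<in> {1..m} \<Longrightarrow> x \<in> points M \<Longrightarrow>
    dF i (LF j V x) = (if i = j then V (snd x j) else (\<lambda>f. 0))"
  unfolding LF_eq by (rule dF_iF[OF _ _ _ F_vt])

text \<open>The factors \<open>1\<close> give the form of a linear combination to which
  \<open>metric_lin\<close> and \<open>tangent_comb\<close> apply.\<close>

definition mix :: "nat \<Rightarrow> 'b \<times> (nat \<Rightarrow> 'f) \<Rightarrow> 'b tangent \<Rightarrow> 'f tangent \<Rightarrow> ('b \<times> (nat \<Rightarrow> 'f)) tangent" where
  "mix j x s a = (\<lambda>f. 1 * iB x s f + 1 * iF j x a f)"

lemma mix_in: "j \<in> {1..m} \<Longrightarrow> x \<in> points M \<Longrightarrow> s \<in> tangent_space B (fst x) \<Longrightarrow> a \<in> tangent_space (F j) (snd x j) \<Longrightarrow>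
    mix j x s a \<in> tangent_space M x"
  unfolding mix_def by (intro M.tangent_comb B_push_in F_push_in)

lemma metric_mix:
  assumes j: "j \<in> {1..m}" and x: "x \<in> points M" and s: "s \<in> tangent_space B (fst x)" and a: "a \<in> tangent_space (F j) (snd x j)"
    and v: "v \<in> tangent_space M x"
  shows "metric M x (mix j x s a) v = metric B (fst x) s (dB v) + (b j (fst x))\<^sup>2 * metric (F j) (snd x j) a (dF j v)"
  unfolding mix_def M.metric_lin[OF x B_push_in[OF x s] F_push_in[OF j x a] v] metric_iB_iB[OF x s v] metric_iF[OF j x a v] by simp

lemma dB_mix: "j \<in> {1..m} \<Longrightarrow> x \<in> points M \<Longrightarrow> s \<in> tangent_space B (fst x) \<Longrightarrow> a \<in> tangent_space (F j) (snd x j) \<Longrightarrow>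
    dB (mix j x s a) = s"
  unfolding mix_def dB_lin by (simp add: dB_iB dB_iF)

lemma dF_mix: "j \<in> {1..m} \<Longrightarrow> i \<in> {1..m} \<Longrightarrow> x \<in> points M \<Longrightarrow> s \<in> tangent_space B (fst x) \<Longrightarrow> a \<in> tangent_space (F j) (snd x j) \<Longrightarrow>
    dF i (mix j x s a) = (if i = j then a else (\<lambda>f. 0))"
  unfolding mix_def dF_lin by (simp add: dF_iB dF_iF)

lemma metric_mix_mix:
  assumes i: "i \<in> {1..m}" and j: "j \<in> {1..m}" and x: "x \<in> points M"
    and s: "s \<in> tangent_space B (fst x)" "s' \<in> tangent_space B (fst x)"
    and a: "a \<in> tangent_space (F i) (snd x i)" "a' \<in> tangent_space (F j) (snd x j)"
  shows "metric M x (mix i x s a) (mix j x s' a') = metric B (fst x) s s' +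
    (if i = j then (b j (fst x))\<^sup>2 * metric (F j) (snd x j) a a' else 0)"
  using metric_mix[OF i x s(1) a(1) mix_in[OF j x s(2) a(2)]] dB_mix[OF j x s(2) a(2)] dF_mix[OF j i x s(2) a(2)]
    F_metric_zero_right[OF i x a(1)] by auto

lemma mix_vertical: "x \<in> points M \<Longrightarrow> mix j x (\<lambda>f. 0) a = iF j x a"
  and mix_horizontal: "x \<in> points M \<Longrightarrow> mix j x s (\<lambda>f. 0) = iB x s"
  by (simp_all add: mix_def pushforward_def fun_eq_iff)

lemmas B_zero = charted.tangent_zero[OF B]
lemmas F_zero = charted.tangent_zero[OF F]

text \<open>All covectors in the curvature of lifts are flats of vectors tangent to the base and one fibre.\<close>

lemma nabla_mixI:
  assumes j: "j \<in> {1..m}" and x: "x \<in> points M" and A: "A \<in> \<Gamma> M" and C: "C \<in> \<Gamma> M"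
    and s: "s \<in> tangent_space B (fst x)" and a: "a \<in> tangent_space (F j) (snd x j)"
    and eqB: "\<And>Z. Z \<in> \<Gamma> B \<Longrightarrow> ap_koszul M A C (LB Z) x = metric B (fst x) s (Z (fst x))"
    and eqF: "\<And>W. W \<in> \<Gamma> (F j) \<Longrightarrow> ap_koszul M A C (LF j W) x = (b j (fst x))\<^sup>2 * metric (F j) (snd x j) a (W (snd x j))"
    and eqO: "\<And>i W. i \<in> {1..m} \<Longrightarrow> i \<noteq> j \<Longrightarrow> W \<in> \<Gamma> (F i) \<Longrightarrow> ap_koszul M A C (LF i W) x = 0"
  shows "nabla_flat M A C x = flat M x (mix j x s a)"
proof (rule nabla_flat_flatI[OF x A C mix_in[OF j x s a]])
  fix Z assume Z: "Z \<in> \<Gamma> B"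
  show "ap_koszul M A C (LB Z) x = metric M x (mix j x s a) (LB Z x)"
    using metric_mix[OF j x s a LB_t[OF Z x]] eqB[OF Z] F_metric_zero_right[OF j x a] by (simp add: dB_LB[OF Z x] dF_LB[OF j Z x])
next
  fix i W assume i: "i \<in> {1..m}" and W: "W \<in> \<Gamma> (F i)"
  show "ap_koszul M A C (LF i W) x = metric M x (mix j x s a) (LF i W x)"
  proof (cases "i = j")
    case True
    then have W': "W \<in> \<Gamma> (F j)" using W by simp
    show ?thesis
      using metric_mix[OF j x s a LF_t[OF j W' x]] eqF[OF W'] B_metric_zero_right[OF x s] True
      by (simp add: dB_LF[OF j W' x] dF_LF[OF j W' j x])
  next
    case False
    then show ?thesis
      using metric_mix[OF j x s a LF_t[OF i W x]] eqO[OF i False W] B_metric_zero_right[OF x s] F_metric_zero_right[OF j x a]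
      by (simp add: dB_LF[OF i W x] dF_LF[OF i W j x])
  qed
qed

lemma nabla_BB:
  assumes X: "X \<in> \<Gamma> B" and Y: "Y \<in> \<Gamma> B" and x: "x \<in> points M"
  shows "nabla_flat M (LB X) (LB Y) x = flat M x (iB x (sB (nabla_flat B X Y) x))"
proof (rule nabla_flat_flatI[OF x LB_vfield[OF X] LB_vfield[OF Y] B_push_in[OF x sB_in[OF one_nabla[OF X Y] x]]])
  note s = sB_in[OF one_nabla[OF X Y] x]
  show "ap_koszul M (LB X) (LB Y) (LB Z) x = metric M x (iB x (sB (nabla_flat B X Y) x)) (LB Z x)" if Z: "Z \<in> \<Gamma> B" for Z
    unfolding metric_iB_iB[OF x s LB_t[OF Z x]] dB_LB[OF Z x] metric_sB[OF one_nabla[OF X Y] x B_vt[OF Z x]]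
      ap_mfd.nabla_flat_eq[OF apB X Y Z B_pr_in[OF x]] by (rule ap_koszul_BBB[OF x X Y Z])
  show "ap_koszul M (LB X) (LB Y) (LF j W) x = metric M x (iB x (sB (nabla_flat B X Y) x)) (LF j W x)"
    if j: "j \<in> {1..m}" and W: "W \<in> \<Gamma> (F j)" for j W
    unfolding metric_iB_iB[OF x s LF_t[OF j W x]] dB_LF[OF j W x] B_metric_zero_right[OF x s]
    by (rule ap_koszul_BBF(1)[OF x X Y j W])
qed

text \<open>Division by \<open>b j = 0\<close> yields \<open>0\<close>; by \<open>regular_cancel\<close> below this is the right value at regular points.\<close>

definition vBF :: "'b vfield \<Rightarrow> nat \<Rightarrow> 'f vfield \<Rightarrow> 'b \<times> (nat \<Rightarrow> 'f) \<Rightarrow> 'f tangent" where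
  "vBF X j V x = (\<lambda>f. (X (fst x) (b j) / b j (fst x)) * V (snd x j) f)"

definition vFB :: "nat \<Rightarrow> 'f vfield \<Rightarrow> 'b vfield \<Rightarrow> 'b \<times> (nat \<Rightarrow> 'f) \<Rightarrow> 'f tangent" where
  "vFB j V X x = (\<lambda>f. (X (fst x) (b j) / (2 * b j (fst x))) * V (snd x j) f +
     (JB X (fst x) (b j) / (2 * b j (fst x))) * JF j V (snd x j) f)"

text \<open>The horizontal part of the derivative of one fibre field along another. The gradient of
  \<open>b\<close> is weighted with \<open>g(V, W)\<close>, the sharp of \<open>db\<close> after
  \<open>J\<close> with \<open>g(V, J W)\<close>. The factor \<open>1/2\<close> is due to averaging
  with the \<open>J\<close>-twisted term; the Levi-Civita derivative has
  \<open>- b * g(V, W)\<close> times the gradient.\<close>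

definition sFF :: "nat \<Rightarrow> 'f vfield \<Rightarrow> 'f vfield \<Rightarrow> 'b \<times> (nat \<Rightarrow> 'f) \<Rightarrow> 'b tangent" where
  "sFF j V W x = (\<lambda>f. (- 1/2 * b j (fst x) * gF j V W x) * sB (db j) x f +
     (- 1/2 * b j (fst x) * gF j V (JF j W) x) * sB (dbJ j) x f)"

context
  fixes j assumes j: "j \<in> {1..m}"
begin

lemma vBF_in: "V \<in> \<Gamma> (F j) \<Longrightarrow> x \<in> points M \<Longrightarrow> vBF X j V x \<in> tangent_space (F j) (snd x j)"
  unfolding vBF_def by (rule charted.tangent_scale[OF F[OF j] F_vt[OF j]])

lemma vFB_in: "V \<in> \<Gamma> (F j) \<Longrightarrow> x \<in> points M \<Longrightarrow> vFB j V X x \<in> tangent_space (F j) (snd x j)"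
  unfolding vFB_def by (rule charted.tangent_comb[OF F[OF j] F_vt[OF j] F_vt[OF j F_endo[OF j]]])

lemma sFF_in: "x \<in> points M \<Longrightarrow> sFF j V W x \<in> tangent_space B (fst x)"
  unfolding sFF_def by (rule charted.tangent_comb[OF B sB_in[OF one_db[OF j]] sB_in[OF one_dbJ[OF j]]])

lemma metric_vBF: "V \<in> \<Gamma> (F j) \<Longrightarrow> x \<in> points M \<Longrightarrow> u \<in> tangent_space (F j) (snd x j) \<Longrightarrow>
    metric (F j) (snd x j) (vBF X j V x) u = (X (fst x) (b j) / b j (fst x)) * metric (F j) (snd x j) (V (snd x j)) u"
  unfolding vBF_def by (rule ap_mfd.metric_scale[OF apF[OF j] F_pr_in[OF j] F_vt[OF j]])

lemma metric_vFB: "V \<in> \<Gamma> (F j) \<Longrightarrow> x \<in> points M \<Longrightarrow> u \<in> tangent_space (F j) (snd x j) \<Longrightarrow>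
    metric (F j) (snd x j) (vFB j V X x) u = (X (fst x) (b j) / (2 * b j (fst x))) * metric (F j) (snd x j) (V (snd x j)) u +
     (JB X (fst x) (b j) / (2 * b j (fst x))) * metric (F j) (snd x j) (JF j V (snd x j)) u"
  unfolding vFB_def by (rule ap_mfd.metric_lin[OF apF[OF j] F_pr_in[OF j] F_vt[OF j] F_vt[OF j F_endo[OF j]]])

lemma metric_sFF: "x \<in> points M \<Longrightarrow> u \<in> tangent_space B (fst x) \<Longrightarrow>
    metric B (fst x) (sFF j V W x) u = (- 1/2 * b j (fst x) * gF j V W x) * db j (fst x) u +
     (- 1/2 * b j (fst x) * gF j V (JF j W) x) * dbJ j (fst x) u"
  unfolding sFF_def
  by (simp only: ap_mfd.metric_lin[OF apB B_pr_in sB_in[OF one_db[OF j]] sB_in[OF one_dbJ[OF j]]] metric_sB one_db[OF j] one_dbJ[OF j])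

text \<open>This equation of covectors holds at all points: where \<open>b j\<close> vanishes so do
  both sides, one through the factor \<open>b j\<close>, the other through the fibre part of the
  metric. Only products of two such vectors are sensitive to the zeros.\<close>

lemma nabla_BF:
  assumes X: "X \<in> \<Gamma> B" and V: "V \<in> \<Gamma> (F j)" and x: "x \<in> points M"
  shows "nabla_flat M (LB X) (LF j V) x = flat M x (mix j x (\<lambda>f. 0) (vBF X j V x))"
proof (rule nabla_mixI[OF j x LB_vfield[OF X] LF_vfield[OF j V] B_zero vBF_in[OF V x]])
  show "ap_koszul M (LB X) (LF j V) (LB Z) x = metric B (fst x) (\<lambda>f. 0) (Z (fst x))" if Z: "Z \<in> \<Gamma> B" for Z
    using ap_koszul_BBF(2)[OF x X Z j V] ap_mfd.metric_zero[OF apB B_pr_in[OF x] B_vt[OF Z x]] by simp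
  show "ap_koszul M (LB X) (LF j V) (LF j W) x = (b j (fst x))\<^sup>2 * metric (F j) (snd x j) (vBF X j V x) (W (snd x j))" if W: "W \<in> \<Gamma> (F j)" for W
    using ap_koszul_BFF(1)[OF x X j V j W] metric_vBF[OF V x F_vt[OF j W x], of X]
    by (simp add: inner_vf_def power2_eq_square)
  show "ap_koszul M (LB X) (LF j V) (LF i W) x = 0" if "i \<in> {1..m}" "i \<noteq> j" "W \<in> \<Gamma> (F i)" for i W
    using ap_koszul_BFF(1)[OF x X j V that(1,3)] that(2) by simp
qed

lemma nabla_FB:
  assumes X: "X \<in> \<Gamma> B" and V: "V \<in> \<Gamma> (F j)" and x: "x \<in> points M"
  shows "nabla_flat M (LF j V) (LB X) x = flat M x (mix j x (\<lambda>f. 0) (vFB j V X x))"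
proof (rule nabla_mixI[OF j x LF_vfield[OF j V] LB_vfield[OF X] B_zero vFB_in[OF V x]])
  show "ap_koszul M (LF j V) (LB X) (LB Z) x = metric B (fst x) (\<lambda>f. 0) (Z (fst x))" if Z: "Z \<in> \<Gamma> B" for Z
    using ap_koszul_BBF(3)[OF x X Z j V] ap_mfd.metric_zero[OF apB B_pr_in[OF x] B_vt[OF Z x]] by simp
  show "ap_koszul M (LF j V) (LB X) (LF j W) x = (b j (fst x))\<^sup>2 * metric (F j) (snd x j) (vFB j V X x) (W (snd x j))" if W: "W \<in> \<Gamma> (F j)" for W
    using ap_koszul_BFF(2)[OF x X j V j W] metric_vFB[OF V x F_vt[OF j W x], of X]
      ap_mfd.inner_adjoint[OF apF[OF j] V W F_pr_in[OF j x]]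
    by (simp add: inner_vf_def power2_eq_square distrib_left)
  show "ap_koszul M (LF j V) (LB X) (LF i W) x = 0" if "i \<in> {1..m}" "i \<noteq> j" "W \<in> \<Gamma> (F i)" for i W
    using ap_koszul_BFF(2)[OF x X j V that(1,3)] that(2) by simp
qed

text \<open>The fibre component is any representative \<open>a\<close> of the form on the fibre; the
  factor \<open>b j ^ 2\<close> of the Koszul form is supplied by the metric of the product.\<close>

lemma nabla_FF:
  assumes V: "V \<in> \<Gamma> (F j)" and W: "W \<in> \<Gamma> (F j)" and x: "x \<in> points M"
    and a: "a \<in> tangent_space (F j) (snd x j)" "nabla_flat (F j) V W (snd x j) = flat (F j) (snd x j) a"
  shows "nabla_flat M (LF j V) (LF j W) x = flat M x (mix j x (sFF j V W x) a)"
proof (rule nabla_mixI[OF j x LF_vfield[OF j V] LF_vfield[OF j W] sFF_in[OF x] a(1)])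
  show "ap_koszul M (LF j V) (LF j W) (LB Z) x = metric B (fst x) (sFF j V W x) (Z (fst x))" if Z: "Z \<in> \<Gamma> B" for Z
    using ap_koszul_BFF(3)[OF x Z j V j W] metric_sFF[OF x B_vt[OF Z x], of V W] db_app[OF Z x] dbJ_app[OF Z x]
    by (simp add: algebra_simps)
  show "ap_koszul M (LF j V) (LF j W) (LF j U) x = (b j (fst x))\<^sup>2 * metric (F j) (snd x j) a (U (snd x j))" if U: "U \<in> \<Gamma> (F j)" for U
    using ap_koszul_FFF[OF x j V j W j U] ap_mfd.nabla_flat_eq[OF apF[OF j] V W U F_pr_in[OF j x]] F_vt[OF j U x]
    by (simp add: a(2) flat_def)
  show "ap_koszul M (LF j V) (LF j W) (LF i U) x = 0" if "i \<in> {1..m}" "i \<noteq> j" "U \<in> \<Gamma> (F i)" for i U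
    using ap_koszul_FFF[OF x j V j W that(1,3)] that(2) by simp
qed

lemma F_nabla_flat:
  assumes V: "V \<in> \<Gamma> (F j)" and W: "W \<in> \<Gamma> (F j)" and x: "x \<in> points M"
  obtains a where "a \<in> tangent_space (F j) (snd x j)" "nabla_flat (F j) V W (snd x j) = flat (F j) (snd x j) a"
proof -
  have "nabla_flat (F j) V W (snd x j) \<in> radical_annihilator (F j) (snd x j)"
    using sr[OF j] V W F_pr_in[OF j x] unfolding ap_semi_regular_def ap_radical_stationary_def by simp
  then show thesis using that unfolding radical_annihilator_def by (elim imageE)
qed

lemma F_contraction:
  assumes V: "V \<in> \<Gamma> (F j)" and W: "W \<in> \<Gamma> (F j)" and U: "U \<in> \<Gamma> (F j)" and Q: "Q \<in> \<Gamma> (F j)"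
  shows "is_contraction (F j) (nabla_flat (F j) V W) (nabla_flat (F j) U Q) (contraction (F j) (nabla_flat (F j) V W) (nabla_flat (F j) U Q))"
proof -
  have "\<exists>h. is_contraction (F j) (nabla_flat (F j) V W) (nabla_flat (F j) U Q) h"
    using sr[OF j] V W U Q unfolding ap_semi_regular_def by simp
  then show ?thesis unfolding contraction_def by (rule someI_ex)
qed

text \<open>At a zero of \<open>b j\<close> the quotient \<open>X b / b\<close> is evaluated to
  \<open>0\<close>, which loses the factor \<open>X b * g(V, W)\<close>. At regular points this
  factor is \<open>0\<close> anyway, so the cancelled formulas remain correct.\<close>

lemma regular_cancel:
  assumes x: "x \<in> regular_points M" and z: "b j (fst x) = 0" and X: "X \<in> \<Gamma> B"
    and V: "V \<in> \<Gamma> (F j)" "W \<in> \<Gamma> (F j)"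
  shows "X (fst x) (b j) * gF j V W x = 0"
proof -
  have xM: "x \<in> points M" using x by (simp add: regular_points_def)
  show ?thesis using regular_fibre(2)[OF x j z] X F_vt[OF j V(1) xM] F_vt[OF j V(2) xM] unfolding inner_vf_def by auto
qed

end

text \<open>For different fibres every entry of the Koszul table is \<open>0\<close>. The zero
  vector is written as a \<open>mix\<close> so that the form falls under the predicate
  \<open>mixed\<close> below.\<close>

lemma nabla_FF_ne:
  assumes i: "i \<in> {1..m}" and V: "V \<in> \<Gamma> (F i)" and j: "j \<in> {1..m}" and W: "W \<in> \<Gamma> (F j)" and ne: "i \<noteq> j" and x: "x \<in> points M"
  shows "nabla_flat M (LF i V) (LF j W) x = flat M x (mix j x (\<lambda>f. 0) (\<lambda>f. 0))"
proof (rule nabla_mixI[OF j x LF_vfield[OF i V] LF_vfield[OF j W] B_zero F_zero[OF j]])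
  show "ap_koszul M (LF i V) (LF j W) (LB Z) x = metric B (fst x) (\<lambda>f. 0) (Z (fst x))" if Z: "Z \<in> \<Gamma> B" for Z
    using ap_koszul_BFF(3)[OF x Z i V j W] ne ap_mfd.metric_zero[OF apB B_pr_in[OF x] B_vt[OF Z x]] by simp
  show "ap_koszul M (LF i V) (LF j W) (LF j U) x = (b j (fst x))\<^sup>2 * metric (F j) (snd x j) (\<lambda>f. 0) (U (snd x j))" if U: "U \<in> \<Gamma> (F j)" for U
    using ap_koszul_FFF[OF x i V j W j U] ne ap_mfd.metric_zero[OF apF[OF j] F_pr_in[OF j x] F_vt[OF j U x]] by simp
  show "ap_koszul M (LF i V) (LF j W) (LF k U) x = 0" if "k \<in> {1..m}" "k \<noteq> j" "U \<in> \<Gamma> (F k)" for k U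
    using ap_koszul_FFF[OF x i V j W that(1,3)] that(2) ne by simp
qed

section \<open>Contractions that vanish by orthogonality\<close>

definition mixed :: "nat \<Rightarrow> (('b \<times> (nat \<Rightarrow> 'f)) \<Rightarrow> ('b \<times> (nat \<Rightarrow> 'f)) covector) \<Rightarrow> bool" where
  "mixed j \<omega> \<longleftrightarrow> (\<forall>x\<in>points M. \<exists>s\<in>tangent_space B (fst x). \<exists>a\<in>tangent_space (F j) (snd x j). \<omega> x = flat M x (mix j x s a))"
text \<open>A vector along fibre \<open>i\<close> is orthogonal to every vector along the base and
  another fibre. The two predicates record just the directions required for this, without the
  vectors themselves.\<close>

definition vertical :: "nat \<Rightarrow> (('b \<times> (nat \<Rightarrow> 'f)) \<Rightarrow> ('b \<times> (nat \<Rightarrow> 'f)) covector) \<Rightarrow> bool" where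
  "vertical j \<omega> \<longleftrightarrow> (\<forall>x\<in>points M. \<exists>a\<in>tangent_space (F j) (snd x j). \<omega> x = flat M x (mix j x (\<lambda>f. 0) a))"

lemma vertical_mixed: "vertical j \<omega> \<Longrightarrow> mixed j \<omega>"
  unfolding vertical_def mixed_def using B_zero by blast

lemma vertical_BF: "j \<in> {1..m} \<Longrightarrow> X \<in> \<Gamma> B \<Longrightarrow> V \<in> \<Gamma> (F j) \<Longrightarrow> vertical j (nabla_flat M (LB X) (LF j V))"
  unfolding vertical_def using nabla_BF vBF_in by blast

lemma vertical_FB: "j \<in> {1..m} \<Longrightarrow> X \<in> \<Gamma> B \<Longrightarrow> V \<in> \<Gamma> (F j) \<Longrightarrow> vertical j (nabla_flat M (LF j V) (LB X))"
  unfolding vertical_def using nabla_FB vFB_in by blast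

lemma mixed_BB: "j \<in> {1..m} \<Longrightarrow> X \<in> \<Gamma> B \<Longrightarrow> Y \<in> \<Gamma> B \<Longrightarrow> mixed j (nabla_flat M (LB X) (LB Y))"
  unfolding mixed_def
proof (intro ballI bexI)
  fix x assume "j \<in> {1..m}" "X \<in> \<Gamma> B" "Y \<in> \<Gamma> B" "x \<in> points M"
  then show "nabla_flat M (LB X) (LB Y) x = flat M x (mix j x (sB (nabla_flat B X Y) x) (\<lambda>f. 0))"
    using nabla_BB mix_horizontal by simp
qed (auto intro: sB_in one_nabla F_zero)

lemma mixed_FF: "i \<in> {1..m} \<Longrightarrow> j \<in> {1..m} \<Longrightarrow> V \<in> \<Gamma> (F i) \<Longrightarrow> W \<in> \<Gamma> (F j) \<Longrightarrow> mixed j (nabla_flat M (LF i V) (LF j W))"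
  unfolding mixed_def
proof (intro ballI)
  fix x assume i: "i \<in> {1..m}" and j: "j \<in> {1..m}" and V: "V \<in> \<Gamma> (F i)" and W: "W \<in> \<Gamma> (F j)" and x: "x \<in> points M"
  show "\<exists>s\<in>tangent_space B (fst x). \<exists>a\<in>tangent_space (F j) (snd x j). nabla_flat M (LF i V) (LF j W) x = flat M x (mix j x s a)"
  proof (cases "i = j")
    case True
    then have V': "V \<in> \<Gamma> (F j)" using V by simp
    obtain a where a: "a \<in> tangent_space (F j) (snd x j)" "nabla_flat (F j) V W (snd x j) = flat (F j) (snd x j) a"
      by (rule F_nabla_flat[OF j V' W x])
    show ?thesis using nabla_FF[OF j V' W x a] sFF_in[OF j x, of V W] a(1) True by blast
  next
    case False
    then show ?thesis using nabla_FF_ne[OF i V j W False x] B_zero F_zero[OF j] by blast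
  qed
qed

lemma contraction_zero:
  assumes "\<And>x. x \<in> points M \<Longrightarrow> \<exists>u\<in>tangent_space M x. \<exists>v\<in>tangent_space M x. \<omega> x = flat M x u \<and> \<tau> x = flat M x v \<and> metric M x u v = 0"
    and x: "x \<in> points M"
  shows "contraction M \<omega> \<tau> x = 0" "contraction M \<tau> \<omega> x = 0"
proof -
  have *: "\<exists>u\<in>tangent_space M x. \<exists>v\<in>tangent_space M x. \<omega> x = flat M x u \<and> \<tau> x = flat M x v \<and> metric M x u v = 0"
    if "x \<in> regular_points M" for x
    by (rule assms(1)) (use that in \<open>simp add: regular_points_def\<close>)
  show "contraction M \<omega> \<tau> x = 0" "contraction M \<tau> \<omega> x = 0"
    by (rule contraction_lift(1)[OF M.C_inf_const[of 0] _ x], rule *, assumption)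
       (rule contraction_lift(2)[OF M.C_inf_const[of 0] _ x], rule *, assumption)
qed

lemma contraction_vertical_mixed:
  assumes i: "i \<in> {1..m}" and j: "j \<in> {1..m}" and \<omega>: "vertical i \<omega>" and \<tau>: "mixed j \<tau>" and ne: "i \<noteq> j" and x: "x \<in> points M"
  shows "contraction M \<omega> \<tau> x = 0" "contraction M \<tau> \<omega> x = 0"
proof -
  have *: "\<exists>u\<in>tangent_space M x. \<exists>v\<in>tangent_space M x. \<omega> x = flat M x u \<and> \<tau> x = flat M x v \<and> metric M x u v = 0"
    if x: "x \<in> points M" for x
  proof -
    obtain a where a: "a \<in> tangent_space (F i) (snd x i)" "\<omega> x = flat M x (mix i x (\<lambda>f. 0) a)"
      using \<omega> x unfolding vertical_def by blast
    obtain s a' where a': "s \<in> tangent_space B (fst x)" "a' \<in> tangent_space (F j) (snd x j)" "\<tau> x = flat M x (mix j x s a')"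
      using \<tau> x unfolding mixed_def by blast
    have "metric M x (mix i x (\<lambda>f. 0) a) (mix j x s a') = 0"
      using metric_mix_mix[OF i j x B_zero a'(1) a(1) a'(2)] ne ap_mfd.metric_zero[OF apB B_pr_in[OF x] a'(1)] by simp
    then show ?thesis using a(2) a'(3) mix_in[OF i x B_zero a(1)] mix_in[OF j x a'(1,2)] by blast
  qed
  show "contraction M \<omega> \<tau> x = 0" by (rule contraction_zero(1)[OF _ x], rule *, assumption)
  show "contraction M \<tau> \<omega> x = 0" by (rule contraction_zero(2)[OF _ x], rule *, assumption)
qed

lemma contraction_BB_vertical:
  assumes j: "j \<in> {1..m}" and X: "X \<in> \<Gamma> B" and Y: "Y \<in> \<Gamma> B" and \<tau>: "vertical j \<tau>" and x: "x \<in> points M"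
  shows "contraction M (nabla_flat M (LB X) (LB Y)) \<tau> x = 0" "contraction M \<tau> (nabla_flat M (LB X) (LB Y)) x = 0"
proof -
  have *: "\<exists>u\<in>tangent_space M x. \<exists>v\<in>tangent_space M x. nabla_flat M (LB X) (LB Y) x = flat M x u \<and> \<tau> x = flat M x v \<and> metric M x u v = 0"
    if x: "x \<in> points M" for x
  proof -
    obtain a where a: "a \<in> tangent_space (F j) (snd x j)" "\<tau> x = flat M x (mix j x (\<lambda>f. 0) a)"
      using \<tau> x unfolding vertical_def by blast
    note s = sB_in[OF one_nabla[OF X Y] x]
    note t = mix_in[OF j x B_zero a(1)]
    have "metric M x (iB x (sB (nabla_flat B X Y) x)) (mix j x (\<lambda>f. 0) a) = 0"
      using metric_iB_iB[OF x s t] dB_mix[OF j x B_zero a(1)] B_metric_zero_right[OF x s] by simp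
    then show ?thesis using nabla_BB[OF X Y x] a(2) t B_push_in[OF x s] by blast
  qed
  show "contraction M (nabla_flat M (LB X) (LB Y)) \<tau> x = 0" by (rule contraction_zero(1)[OF _ x], rule *, assumption)
  show "contraction M \<tau> (nabla_flat M (LB X) (LB Y)) x = 0" by (rule contraction_zero(2)[OF _ x], rule *, assumption)
qed

lemma contraction_FF_ne:
  assumes i: "i \<in> {1..m}" and V: "V \<in> \<Gamma> (F i)" and j: "j \<in> {1..m}" and W: "W \<in> \<Gamma> (F j)" and ne: "i \<noteq> j"
    and k: "k \<in> {1..m}" and \<tau>: "mixed k \<tau>" and x: "x \<in> points M"
  shows "contraction M (nabla_flat M (LF i V) (LF j W)) \<tau> x = 0" "contraction M \<tau> (nabla_flat M (LF i V) (LF j W)) x = 0"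
proof -
  have *: "\<exists>u\<in>tangent_space M x. \<exists>v\<in>tangent_space M x. nabla_flat M (LF i V) (LF j W) x = flat M x u \<and> \<tau> x = flat M x v \<and> metric M x u v = 0"
    if x: "x \<in> points M" for x
  proof -
    obtain s a where a: "s \<in> tangent_space B (fst x)" "a \<in> tangent_space (F k) (snd x k)" "\<tau> x = flat M x (mix k x s a)"
      using \<tau> x unfolding mixed_def by blast
    have "metric M x (mix j x (\<lambda>f. 0) (\<lambda>f. 0)) (mix k x s a) = 0"
      using metric_mix_mix[OF j k x B_zero a(1) F_zero[OF j] a(2)] ap_mfd.metric_zero[OF apB B_pr_in[OF x] a(1)]
        ap_mfd.metric_zero[OF apF[OF k] F_pr_in[OF k x] a(2)] by simp
    then show ?thesis using nabla_FF_ne[OF i V j W ne x] a(3) mix_in[OF j x B_zero F_zero[OF j]] mix_in[OF k x a(1,2)] by blast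
  qed
  show "contraction M (nabla_flat M (LF i V) (LF j W)) \<tau> x = 0" by (rule contraction_zero(1)[OF _ x], rule *, assumption)
  show "contraction M \<tau> (nabla_flat M (LF i V) (LF j W)) x = 0" by (rule contraction_zero(2)[OF _ x], rule *, assumption)
qed

lemma contraction_BB_BB:
  assumes X: "X \<in> \<Gamma> B" and Y: "Y \<in> \<Gamma> B" and Z: "Z \<in> \<Gamma> B" and T: "T \<in> \<Gamma> B" and x: "x \<in> points M"
  shows "contraction M (nabla_flat M (LB X) (LB Y)) (nabla_flat M (LB Z) (LB T)) x = contraction B (nabla_flat B X Y) (nabla_flat B Z T) (fst x)"
proof -
  note o = one_nabla[OF X Y] one_nabla[OF Z T]
  have "contraction M (nabla_flat M (LB X) (LB Y)) (nabla_flat M (LB Z) (LB T)) x = G (nabla_flat B X Y) (nabla_flat B Z T) x"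
  proof (rule contraction_lift(1)[OF B_pull[OF ap_mfd.cometric_smooth[OF apB nd o]] _ x])
    fix x assume "x \<in> regular_points M"
    then have x: "x \<in> points M" by (simp add: regular_points_def)
    note s = sB_in[OF o(1) x] sB_in[OF o(2) x]
    have "metric M x (iB x (sB (nabla_flat B X Y) x)) (iB x (sB (nabla_flat B Z T) x)) = G (nabla_flat B X Y) (nabla_flat B Z T) x"
      using metric_iB_iB[OF x s(1) B_push_in[OF x s(2)]] dB_iB[OF x s(2)] by (simp add: cometric_def)
    then show "\<exists>u\<in>tangent_space M x. \<exists>v\<in>tangent_space M x. nabla_flat M (LB X) (LB Y) x = flat M x u \<and>
        nabla_flat M (LB Z) (LB T) x = flat M x v \<and> metric M x u v = G (nabla_flat B X Y) (nabla_flat B Z T) x"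
      using nabla_BB[OF X Y x] nabla_BB[OF Z T x] B_push_in[OF x s(1)] B_push_in[OF x s(2)] by blast
  qed
  then show ?thesis by (simp add: ap_mfd.contraction_cometric[OF apB nd o B_pr_in[OF x]])
qed

section \<open>Contractions involving a single fibre\<close>

context
  fixes j assumes j: "j \<in> {1..m}"
begin

lemma b_pull: "(\<lambda>x. b j (fst x)) \<in> C_inf M"
  by (rule B_pull[OF b_smooth[OF j]])
lemma Xb_pull: "X \<in> \<Gamma> B \<Longrightarrow> (\<lambda>x. X (fst x) (b j)) \<in> C_inf M"
  by (rule B_pull[OF charted.vfield_smooth'[OF B _ b_smooth[OF j]]])
lemma gF_pull: "V \<in> \<Gamma> (F j) \<Longrightarrow> W \<in> \<Gamma> (F j) \<Longrightarrow> (\<lambda>x. gF j V W x) \<in> C_inf M"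
  by (rule F_pull[OF j F_inner_smooth[OF j]])
lemma G_pull: "one \<omega> \<Longrightarrow> one \<tau> \<Longrightarrow> (\<lambda>x. G \<omega> \<tau> x) \<in> C_inf M"
  by (rule B_pull[OF ap_mfd.cometric_smooth[OF apB nd]])
lemma apK_pull: "V \<in> \<Gamma> (F j) \<Longrightarrow> W \<in> \<Gamma> (F j) \<Longrightarrow> U \<in> \<Gamma> (F j) \<Longrightarrow> (\<lambda>x. ap_koszul (F j) V W U (snd x j)) \<in> C_inf M"
  by (rule F_pull[OF j ap_mfd.ap_koszul_smooth[OF apF[OF j]]])

text \<open>The first form is represented by a horizontal vector, so only the horizontal part
  \<open>sFF\<close> of the second matters and the fibre vector \<open>a\<close> drops out.\<close>

lemma contraction_BB_FF:
  assumes X: "X \<in> \<Gamma> B" and Y: "Y \<in> \<Gamma> B" and V: "V \<in> \<Gamma> (F j)" and W: "W \<in> \<Gamma> (F j)" and x: "x \<in> points M"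
  shows "contraction M (nabla_flat M (LB X) (LB Y)) (nabla_flat M (LF j V) (LF j W)) x =
    - 1/2 * b j (fst x) * (gF j V W x * G (nabla_flat B X Y) (db j) x + gF j V (JF j W) x * G (nabla_flat B X Y) (dbJ j) x)"
proof (rule contraction_lift(1)[OF _ _ x])
  note o = one_nabla[OF X Y] one_db[OF j] one_dbJ[OF j]
  show "(\<lambda>x. - 1/2 * b j (fst x) * (gF j V W x * G (nabla_flat B X Y) (db j) x + gF j V (JF j W) x * G (nabla_flat B X Y) (dbJ j) x)) \<in> C_inf M"
    by (intro M.C_inf_mult M.C_inf_add M.C_inf_const b_pull gF_pull G_pull o V W F_endo j)
  fix x assume "x \<in> regular_points M"
  then have x: "x \<in> points M" by (simp add: regular_points_def)
  note s = sB_in[OF o(1) x]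
  obtain a where a: "a \<in> tangent_space (F j) (snd x j)" "nabla_flat (F j) V W (snd x j) = flat (F j) (snd x j) a"
    by (rule F_nabla_flat[OF j V W x])
  note t = mix_in[OF j x sFF_in[OF j x] a(1), of V W]
  have "metric M x (iB x (sB (nabla_flat B X Y) x)) (mix j x (sFF j V W x) a) =
      metric B (fst x) (sFF j V W x) (sB (nabla_flat B X Y) x)"
    using metric_iB_iB[OF x s t] dB_mix[OF j x sFF_in[OF j x] a(1), of V W]
      ap_mfd.metric_sym[OF apB B_pr_in[OF x] s sFF_in[OF j x], of V W] by simp
  also have "\<dots> = - 1/2 * b j (fst x) * (gF j V W x * G (nabla_flat B X Y) (db j) x + gF j V (JF j W) x * G (nabla_flat B X Y) (dbJ j) x)"
    unfolding metric_sFF[OF j x s]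
    using metric_sB[OF o(2) x s] metric_sB[OF o(3) x s]
      ap_mfd.metric_sym[OF apB B_pr_in[OF x] s sB_in[OF o(2) x]] ap_mfd.metric_sym[OF apB B_pr_in[OF x] s sB_in[OF o(3) x]]
    by (simp add: cometric_def algebra_simps)
  finally show "\<exists>u\<in>tangent_space M x. \<exists>v\<in>tangent_space M x. nabla_flat M (LB X) (LB Y) x = flat M x u \<and>
      nabla_flat M (LF j V) (LF j W) x = flat M x v \<and> metric M x u v =
      - 1/2 * b j (fst x) * (gF j V W x * G (nabla_flat B X Y) (db j) x + gF j V (JF j W) x * G (nabla_flat B X Y) (dbJ j) x)"
    using nabla_BB[OF X Y x] nabla_FF[OF j V W x a] B_push_in[OF x s] t by blast
qed

lemma metric_vertical:
  assumes x: "x \<in> points M" and a: "a \<in> tangent_space (F j) (snd x j)" and s: "s \<in> tangent_space B (fst x)" and a': "a' \<in> tangent_space (F j) (snd x j)"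
  shows "metric M x (mix j x (\<lambda>f. 0) a) (mix j x s a') = (b j (fst x))\<^sup>2 * metric (F j) (snd x j) a a'"
  using metric_mix_mix[OF j j x B_zero s a a'] ap_mfd.metric_zero[OF apB B_pr_in[OF x] s] by simp

lemma metric_vBF_right: "V \<in> \<Gamma> (F j) \<Longrightarrow> W \<in> \<Gamma> (F j) \<Longrightarrow> x \<in> points M \<Longrightarrow>
    metric (F j) (snd x j) (W (snd x j)) (vBF X j V x) = (X (fst x) (b j) / b j (fst x)) * gF j W V x"
  unfolding vBF_def inner_vf_def by (rule ap_mfd.metric_scale_right[OF apF[OF j] F_pr_in[OF j] F_vt[OF j] F_vt[OF j]])

lemma metric_vFB_right: "V \<in> \<Gamma> (F j) \<Longrightarrow> W \<in> \<Gamma> (F j) \<Longrightarrow> x \<in> points M \<Longrightarrow>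
    metric (F j) (snd x j) (W (snd x j)) (vFB j V X x) = (X (fst x) (b j) / (2 * b j (fst x))) * gF j W V x +
     (JB X (fst x) (b j) / (2 * b j (fst x))) * gF j W (JF j V) x"
  unfolding vFB_def inner_vf_def by (rule ap_mfd.metric_lin_right[OF apF[OF j] F_pr_in[OF j] F_vt[OF j] F_vt[OF j F_endo[OF j]] F_vt[OF j]])

lemma gF_adj: "V \<in> \<Gamma> (F j) \<Longrightarrow> W \<in> \<Gamma> (F j) \<Longrightarrow> x \<in> points M \<Longrightarrow> gF j (JF j V) W x = gF j V (JF j W) x"
  by (rule ap_mfd.inner_adjoint[OF apF[OF j] _ _ F_pr_in[OF j]])

lemma gF_isom: "V \<in> \<Gamma> (F j) \<Longrightarrow> W \<in> \<Gamma> (F j) \<Longrightarrow> x \<in> points M \<Longrightarrow> gF j (JF j V) (JF j W) x = gF j V W x"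
  by (rule ap_mfd.inner_isom[OF apF[OF j] _ _ F_pr_in[OF j]])

lemma gF_sym: "V \<in> \<Gamma> (F j) \<Longrightarrow> W \<in> \<Gamma> (F j) \<Longrightarrow> x \<in> points M \<Longrightarrow> gF j V W x = gF j W V x"
  by (rule ap_mfd.inner_sym[OF apF[OF j] _ _ F_pr_in[OF j]])

text \<open>The two denominators cancel against \<open>b j ^ 2\<close> of the metric. Where
  \<open>b j = 0\<close> the product of the vectors is \<open>0\<close>, and by
  \<open>regular_cancel\<close> so is the right-hand side.\<close>

lemma contraction_BF_BF:
  assumes X: "X \<in> \<Gamma> B" and Y: "Y \<in> \<Gamma> B" and V: "V \<in> \<Gamma> (F j)" and W: "W \<in> \<Gamma> (F j)" and x: "x \<in> points M"
  shows "contraction M (nabla_flat M (LB X) (LF j V)) (nabla_flat M (LB Y) (LF j W)) x =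
    X (fst x) (b j) * Y (fst x) (b j) * gF j V W x"
proof (rule contraction_lift(1)[OF _ _ x])
  show "(\<lambda>x. X (fst x) (b j) * Y (fst x) (b j) * gF j V W x) \<in> C_inf M"
    by (intro M.C_inf_mult Xb_pull gF_pull X Y V W)
  fix x assume r: "x \<in> regular_points M"
  then have x: "x \<in> points M" by (simp add: regular_points_def)
  have "metric M x (mix j x (\<lambda>f. 0) (vBF X j V x)) (mix j x (\<lambda>f. 0) (vBF Y j W x)) = X (fst x) (b j) * Y (fst x) (b j) * gF j V W x"
    unfolding metric_vertical[OF x vBF_in[OF j V x] B_zero vBF_in[OF j W x]] metric_vBF[OF j V x vBF_in[OF j W x]] metric_vBF_right[OF W V x]
    using regular_cancel[OF j r _ X V W] by (cases "b j (fst x) = 0") (auto simp: power2_eq_square)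
  then show "\<exists>u\<in>tangent_space M x. \<exists>v\<in>tangent_space M x. nabla_flat M (LB X) (LF j V) x = flat M x u \<and>
      nabla_flat M (LB Y) (LF j W) x = flat M x v \<and> metric M x u v = X (fst x) (b j) * Y (fst x) (b j) * gF j V W x"
    using nabla_BF[OF j X V x] nabla_BF[OF j Y W x] mix_in[OF j x B_zero vBF_in[OF j V x]] mix_in[OF j x B_zero vBF_in[OF j W x]] by blast
qed

lemma contraction_FB_BF:
  assumes X: "X \<in> \<Gamma> B" and Y: "Y \<in> \<Gamma> B" and V: "V \<in> \<Gamma> (F j)" and W: "W \<in> \<Gamma> (F j)" and x: "x \<in> points M"
  shows "contraction M (nabla_flat M (LF j V) (LB X)) (nabla_flat M (LB Y) (LF j W)) x =
    1/2 * (X (fst x) (b j) * Y (fst x) (b j) * gF j V W x + JB X (fst x) (b j) * Y (fst x) (b j) * gF j V (JF j W) x)"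
proof (rule contraction_lift(1)[OF _ _ x])
  let ?h = "\<lambda>x. 1/2 * (X (fst x) (b j) * Y (fst x) (b j) * gF j V W x + JB X (fst x) (b j) * Y (fst x) (b j) * gF j V (JF j W) x)"
  show "?h \<in> C_inf M"
    by (intro M.C_inf_mult M.C_inf_add M.C_inf_const Xb_pull gF_pull X Y V W B_endo F_endo j)
  fix x assume r: "x \<in> regular_points M"
  then have x: "x \<in> points M" by (simp add: regular_points_def)
  note JV = F_endo[OF j V] and JW = F_endo[OF j W]
  have "metric M x (mix j x (\<lambda>f. 0) (vFB j V X x)) (mix j x (\<lambda>f. 0) (vBF Y j W x)) = ?h x"
    unfolding metric_vertical[OF x vFB_in[OF j V x] B_zero vBF_in[OF j W x]] metric_vFB[OF j V x vBF_in[OF j W x]]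
      metric_vBF_right[OF W V x] metric_vBF_right[OF W JV x] gF_adj[OF V W x]
    using regular_cancel[OF j r _ Y V W] regular_cancel[OF j r _ Y V JW]
    by (cases "b j (fst x) = 0") (auto simp: power2_eq_square field_simps)
  then show "\<exists>u\<in>tangent_space M x. \<exists>v\<in>tangent_space M x. nabla_flat M (LF j V) (LB X) x = flat M x u \<and>
      nabla_flat M (LB Y) (LF j W) x = flat M x v \<and> metric M x u v = ?h x"
    using nabla_FB[OF j X V x] nabla_BF[OF j Y W x] mix_in[OF j x B_zero vFB_in[OF j V x]] mix_in[OF j x B_zero vBF_in[OF j W x]] by blast
qed

text \<open>Expanding both vectors gives four terms. Self-adjointness moves \<open>J\<close> to the
  second argument, and isometry removes it from the last term.\<close>

lemma contraction_FB_FB: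
  assumes X: "X \<in> \<Gamma> B" and Y: "Y \<in> \<Gamma> B" and V: "V \<in> \<Gamma> (F j)" and W: "W \<in> \<Gamma> (F j)" and x: "x \<in> points M"
  shows "contraction M (nabla_flat M (LF j V) (LB X)) (nabla_flat M (LF j W) (LB Y)) x =
    1/4 * (X (fst x) (b j) * Y (fst x) (b j) * gF j V W x + X (fst x) (b j) * JB Y (fst x) (b j) * gF j V (JF j W) x +
      JB X (fst x) (b j) * Y (fst x) (b j) * gF j V (JF j W) x + JB X (fst x) (b j) * JB Y (fst x) (b j) * gF j V W x)"
proof (rule contraction_lift(1)[OF _ _ x])
  let ?h = "\<lambda>x. 1/4 * (X (fst x) (b j) * Y (fst x) (b j) * gF j V W x + X (fst x) (b j) * JB Y (fst x) (b j) * gF j V (JF j W) x +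
      JB X (fst x) (b j) * Y (fst x) (b j) * gF j V (JF j W) x + JB X (fst x) (b j) * JB Y (fst x) (b j) * gF j V W x)"
  show "?h \<in> C_inf M"
    by (intro M.C_inf_mult M.C_inf_add M.C_inf_const Xb_pull gF_pull X Y V W B_endo F_endo j)
  fix x assume r: "x \<in> regular_points M"
  then have x: "x \<in> points M" by (simp add: regular_points_def)
  note JV = F_endo[OF j V] and JW = F_endo[OF j W]
  have "metric M x (mix j x (\<lambda>f. 0) (vFB j V X x)) (mix j x (\<lambda>f. 0) (vFB j W Y x)) = ?h x"
    unfolding metric_vertical[OF x vFB_in[OF j V x] B_zero vFB_in[OF j W x]] metric_vFB[OF j V x vFB_in[OF j W x]]
      metric_vFB_right[OF W V x] metric_vFB_right[OF W JV x] gF_adj[OF V W x] gF_isom[OF V W x]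
    using regular_cancel[OF j r _ Y V W] regular_cancel[OF j r _ Y V JW]
      regular_cancel[OF j r _ B_endo[OF Y] V W] regular_cancel[OF j r _ B_endo[OF Y] V JW]
    by (cases "b j (fst x) = 0") (auto simp: power2_eq_square field_simps)
  then show "\<exists>u\<in>tangent_space M x. \<exists>v\<in>tangent_space M x. nabla_flat M (LF j V) (LB X) x = flat M x u \<and>
      nabla_flat M (LF j W) (LB Y) x = flat M x v \<and> metric M x u v = ?h x"
    using nabla_FB[OF j X V x] nabla_FB[OF j Y W x] mix_in[OF j x B_zero vFB_in[OF j V x]] mix_in[OF j x B_zero vFB_in[OF j W x]] by blast
qed

lemma metric_nabla:
  assumes V: "V \<in> \<Gamma> (F j)" and W: "W \<in> \<Gamma> (F j)" and U: "U \<in> \<Gamma> (F j)" and x: "x \<in> points M"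
    and a: "a \<in> tangent_space (F j) (snd x j)" "nabla_flat (F j) V W (snd x j) = flat (F j) (snd x j) a"
  shows "metric (F j) (snd x j) (U (snd x j)) a = ap_koszul (F j) V W U (snd x j)"
  using ap_mfd.nabla_flat_eq[OF apF[OF j] V W U F_pr_in[OF j x]] a F_vt[OF j U x]
    ap_mfd.metric_sym[OF apF[OF j] F_pr_in[OF j x] F_vt[OF j U x] a(1)] by (simp add: flat_def)

text \<open>There is only one denominator, so one factor \<open>b j\<close> is left over and both
  sides vanish with it. The product of a fibre field with the representative \<open>a\<close> is a
  value of the Koszul form of the fibre.\<close>

lemma contraction_BF_FF:
  assumes X: "X \<in> \<Gamma> B" and V: "V \<in> \<Gamma> (F j)" and U: "U \<in> \<Gamma> (F j)" and W: "W \<in> \<Gamma> (F j)" and x: "x \<in> points M"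
  shows "contraction M (nabla_flat M (LB X) (LF j V)) (nabla_flat M (LF j U) (LF j W)) x =
    b j (fst x) * X (fst x) (b j) * ap_koszul (F j) U W V (snd x j)" (is ?P)
    and "contraction M (nabla_flat M (LF j U) (LF j W)) (nabla_flat M (LB X) (LF j V)) x =
    b j (fst x) * X (fst x) (b j) * ap_koszul (F j) U W V (snd x j)" (is ?Q)
proof -
  have s: "(\<lambda>x. b j (fst x) * X (fst x) (b j) * ap_koszul (F j) U W V (snd x j)) \<in> C_inf M"
    by (intro M.C_inf_mult b_pull Xb_pull apK_pull X U W V)
  have r: "\<exists>u\<in>tangent_space M x. \<exists>v\<in>tangent_space M x. nabla_flat M (LB X) (LF j V) x = flat M x u \<and>
      nabla_flat M (LF j U) (LF j W) x = flat M x v \<and> metric M x u v = b j (fst x) * X (fst x) (b j) * ap_koszul (F j) U W V (snd x j)"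
    if "x \<in> regular_points M" for x
  proof -
    have x: "x \<in> points M" using that by (simp add: regular_points_def)
    obtain a where a: "a \<in> tangent_space (F j) (snd x j)" "nabla_flat (F j) U W (snd x j) = flat (F j) (snd x j) a"
      by (rule F_nabla_flat[OF j U W x])
    have "metric M x (mix j x (\<lambda>f. 0) (vBF X j V x)) (mix j x (sFF j U W x) a) = b j (fst x) * X (fst x) (b j) * ap_koszul (F j) U W V (snd x j)"
      unfolding metric_vertical[OF x vBF_in[OF j V x] sFF_in[OF j x] a(1)] metric_vBF[OF j V x a(1)] metric_nabla[OF U W V x a]
      by (simp add: power2_eq_square)
    then show ?thesis
      using nabla_BF[OF j X V x] nabla_FF[OF j U W x a] mix_in[OF j x B_zero vBF_in[OF j V x], of X] mix_in[OF j x sFF_in[OF j x] a(1), of U W] by blast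
  qed
  show ?P by (rule contraction_lift(1)[OF s _ x], rule r, assumption)
  show ?Q by (rule contraction_lift(2)[OF s _ x], rule r, assumption)
qed

lemma contraction_FB_FF:
  assumes X: "X \<in> \<Gamma> B" and V: "V \<in> \<Gamma> (F j)" and U: "U \<in> \<Gamma> (F j)" and W: "W \<in> \<Gamma> (F j)" and x: "x \<in> points M"
  shows "contraction M (nabla_flat M (LF j V) (LB X)) (nabla_flat M (LF j U) (LF j W)) x =
    1/2 * b j (fst x) * (X (fst x) (b j) * ap_koszul (F j) U W V (snd x j) + JB X (fst x) (b j) * ap_koszul (F j) U W (JF j V) (snd x j))"
proof (rule contraction_lift(1)[OF _ _ x])
  let ?h = "\<lambda>x. 1/2 * b j (fst x) * (X (fst x) (b j) * ap_koszul (F j) U W V (snd x j) + JB X (fst x) (b j) * ap_koszul (F j) U W (JF j V) (snd x j))"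
  show "?h \<in> C_inf M"
    by (intro M.C_inf_mult M.C_inf_add M.C_inf_const b_pull Xb_pull apK_pull X U W V B_endo F_endo j)
  fix x assume "x \<in> regular_points M"
  then have x: "x \<in> points M" by (simp add: regular_points_def)
  obtain a where a: "a \<in> tangent_space (F j) (snd x j)" "nabla_flat (F j) U W (snd x j) = flat (F j) (snd x j) a"
    by (rule F_nabla_flat[OF j U W x])
  have "metric M x (mix j x (\<lambda>f. 0) (vFB j V X x)) (mix j x (sFF j U W x) a) = ?h x"
    unfolding metric_vertical[OF x vFB_in[OF j V x] sFF_in[OF j x] a(1)] metric_vFB[OF j V x a(1)]
      metric_nabla[OF U W V x a] metric_nabla[OF U W F_endo[OF j V] x a]
    by (simp add: power2_eq_square field_simps)
  then show "\<exists>u\<in>tangent_space M x. \<exists>v\<in>tangent_space M x. nabla_flat M (LF j V) (LB X) x = flat M x u \<and>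
      nabla_flat M (LF j U) (LF j W) x = flat M x v \<and> metric M x u v = ?h x"
    using nabla_FB[OF j X V x] nabla_FF[OF j U W x a] mix_in[OF j x B_zero vFB_in[OF j V x], of X] mix_in[OF j x sFF_in[OF j x] a(1), of U W] by blast
qed

end

text \<open>The product of the horizontal parts of two fibre derivatives, expanded into the inverse
  metric of the differentials of the warping functions and their composites with
  \<open>J\<close>.\<close>

definition GFF :: "nat \<Rightarrow> 'f vfield \<Rightarrow> 'f vfield \<Rightarrow> nat \<Rightarrow> 'f vfield \<Rightarrow> 'f vfield \<Rightarrow> 'b \<times> (nat \<Rightarrow> 'f) \<Rightarrow> real" where
  "GFF i V W j U Q x = 1/4 * b i (fst x) * b j (fst x) *
    (gF i V W x * gF j U Q x * G (db i) (db j) x + gF i V W x * gF j U (JF j Q) x * G (db i) (dbJ j) x +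
     gF i V (JF i W) x * gF j U Q x * G (dbJ i) (db j) x + gF i V (JF i W) x * gF j U (JF j Q) x * G (dbJ i) (dbJ j) x)"

lemma GFF_smooth:
  "i \<in> {1..m} \<Longrightarrow> j \<in> {1..m} \<Longrightarrow> V \<in> \<Gamma> (F i) \<Longrightarrow> W \<in> \<Gamma> (F i) \<Longrightarrow> U \<in> \<Gamma> (F j) \<Longrightarrow> Q \<in> \<Gamma> (F j) \<Longrightarrow> (\<lambda>x. GFF i V W j U Q x) \<in> C_inf M"
  unfolding GFF_def
  by (intro M.C_inf_mult M.C_inf_add M.C_inf_const b_pull gF_pull G_pull one_db one_dbJ F_endo; assumption)

lemma metric_sFF_sFF:
  assumes i: "i \<in> {1..m}" and j: "j \<in> {1..m}" and x: "x \<in> points M"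
  shows "metric B (fst x) (sFF i V W x) (sFF j U Q x) = GFF i V W j U Q x"
proof -
  have s: "metric B (fst x) (sFF j U Q x) (sB \<omega> x) = (- 1/2 * b j (fst x) * gF j U Q x) * G \<omega> (db j) x +
     (- 1/2 * b j (fst x) * gF j U (JF j Q) x) * G \<omega> (dbJ j) x" if o: "one \<omega>" for \<omega>
    unfolding metric_sFF[OF j x sB_in[OF o x]]
    using metric_sB[OF one_db[OF j] x sB_in[OF o x]] metric_sB[OF one_dbJ[OF j] x sB_in[OF o x]]
      ap_mfd.metric_sym[OF apB B_pr_in[OF x] sB_in[OF one_db[OF j] x] sB_in[OF o x]]
      ap_mfd.metric_sym[OF apB B_pr_in[OF x] sB_in[OF one_dbJ[OF j] x] sB_in[OF o x]]
    by (simp add: cometric_def)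
  have "metric B (fst x) (sFF i V W x) (sFF j U Q x) = (- 1/2 * b i (fst x) * gF i V W x) * db i (fst x) (sFF j U Q x) +
     (- 1/2 * b i (fst x) * gF i V (JF i W) x) * dbJ i (fst x) (sFF j U Q x)"
    by (rule metric_sFF[OF i x sFF_in[OF j x]])
  also have "db i (fst x) (sFF j U Q x) = metric B (fst x) (sFF j U Q x) (sB (db i) x)"
    using metric_sB[OF one_db[OF i] x sFF_in[OF j x]] ap_mfd.metric_sym[OF apB B_pr_in[OF x] sB_in[OF one_db[OF i] x] sFF_in[OF j x]] by simp
  also have "dbJ i (fst x) (sFF j U Q x) = metric B (fst x) (sFF j U Q x) (sB (dbJ i) x)"
    using metric_sB[OF one_dbJ[OF i] x sFF_in[OF j x]] ap_mfd.metric_sym[OF apB B_pr_in[OF x] sB_in[OF one_dbJ[OF i] x] sFF_in[OF j x]] by simp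
  finally show ?thesis unfolding s[OF one_db[OF i]] s[OF one_dbJ[OF i]] GFF_def by (simp add: field_simps)
qed

text \<open>The contraction on the fibre has prescribed values only at regular points of the fibre.
  For \<open>b j \<noteq> 0\<close> a regular point of the product lies over such a point, so the
  product of the representatives is that contraction; for \<open>b j = 0\<close> the coefficient
  removes the term.\<close>

lemma contraction_FF_FF:
  assumes i: "i \<in> {1..m}" and j: "j \<in> {1..m}" and V: "V \<in> \<Gamma> (F i)" and W: "W \<in> \<Gamma> (F i)"
    and U: "U \<in> \<Gamma> (F j)" and Q: "Q \<in> \<Gamma> (F j)" and x: "x \<in> points M"
  shows "contraction M (nabla_flat M (LF i V) (LF i W)) (nabla_flat M (LF j U) (LF j Q)) x = GFF i V W j U Q x +
    (if i = j then (b j (fst x))\<^sup>2 * contraction (F j) (nabla_flat (F j) V W) (nabla_flat (F j) U Q) (snd x j) else 0)"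
proof (rule contraction_lift(1)[OF _ _ x])
  let ?c = "contraction (F j) (nabla_flat (F j) V W) (nabla_flat (F j) U Q)"
  let ?h = "\<lambda>x. GFF i V W j U Q x + (if i = j then (b j (fst x))\<^sup>2 * ?c (snd x j) else 0)"
  have c: "is_contraction (F j) (nabla_flat (F j) V W) (nabla_flat (F j) U Q) ?c" if "i = j"
    using F_contraction[OF j _ _ U Q, of V W] V W that by simp
  show "?h \<in> C_inf M"
  proof (cases "i = j")
    case True
    have "(\<lambda>x. (b j (fst x))\<^sup>2 * ?c (snd x j)) \<in> C_inf M"
      by (rule M.C_inf_mult[OF M.C_inf_power[OF b_pull[OF j]] F_pull[OF j]]) (use c[OF True] in \<open>simp add: is_contraction_def\<close>)
    from M.C_inf_add[OF GFF_smooth[OF i j V W U Q] this] show ?thesis using True by simp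
  next
    case False
    then show ?thesis using GFF_smooth[OF i j V W U Q] by simp
  qed
  fix x assume r: "x \<in> regular_points M"
  then have x: "x \<in> points M" by (simp add: regular_points_def)
  obtain a where a: "a \<in> tangent_space (F i) (snd x i)" "nabla_flat (F i) V W (snd x i) = flat (F i) (snd x i) a"
    by (rule F_nabla_flat[OF i V W x])
  obtain a' where a': "a' \<in> tangent_space (F j) (snd x j)" "nabla_flat (F j) U Q (snd x j) = flat (F j) (snd x j) a'"
    by (rule F_nabla_flat[OF j U Q x])
  have "metric M x (mix i x (sFF i V W x) a) (mix j x (sFF j U Q x) a') = GFF i V W j U Q x +
      (if i = j then (b j (fst x))\<^sup>2 * metric (F j) (snd x j) a a' else 0)"
    unfolding metric_mix_mix[OF i j x sFF_in[OF i x] sFF_in[OF j x] a(1) a'(1)] metric_sFF_sFF[OF i j x] ..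
  also have "\<dots> = ?h x"
  proof (cases "i = j \<and> b j (fst x) \<noteq> 0")
    case True
    then have e: "i = j" and nz: "b j (fst x) \<noteq> 0" by simp_all
    have aj: "a \<in> tangent_space (F j) (snd x j)" "nabla_flat (F j) V W (snd x j) = flat (F j) (snd x j) a" using a e by simp_all
    have "?c (snd x j) = bullet_inner (F j) (snd x j) (nabla_flat (F j) V W (snd x j)) (nabla_flat (F j) U Q (snd x j))"
      using c[OF e] regular_fibre(1)[OF r j nz] unfolding is_contraction_def by blast
    also have "\<dots> = metric (F j) (snd x j) a a'"
      unfolding aj(2) a'(2) by (rule ap_mfd.bullet_inner_flat[OF apF[OF j] F_pr_in[OF j x] aj(1) a'(1)])
    finally show ?thesis by simp
  next
    case False
    then show ?thesis by auto
  qed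
  finally show "\<exists>u\<in>tangent_space M x. \<exists>v\<in>tangent_space M x. nabla_flat M (LF i V) (LF i W) x = flat M x u \<and>
      nabla_flat M (LF j U) (LF j Q) x = flat M x v \<and> metric M x u v = ?h x"
    using nabla_FF[OF i V W x a] nabla_FF[OF j U Q x a'] mix_in[OF i x sFF_in[OF i x] a(1), of V W] mix_in[OF j x sFF_in[OF j x] a'(1), of U Q] by blast
qed

end

lemma (in ap_mfd) inner_zero:
  assumes "X \<in> \<Gamma> M" "p \<in> points M"
  shows "inner_vf M (\<lambda>q f. 0) X p = 0" "inner_vf M X (\<lambda>q f. 0) p = 0"
  using metric_zero[OF assms(2) vfield_tangent[OF assms]]
    metric_sym[OF assms(2) tangent_zero vfield_tangent[OF assms]] by (simp_all add: inner_vf_def)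

lemma (in ap_mfd) koszul_zero:
  assumes Y: "Y \<in> \<Gamma> M" and Z: "Z \<in> \<Gamma> M" and p: "p \<in> points M"
  shows "koszul M (\<lambda>q f. 0) Y Z p = 0"
proof -
  have br: "bracket W (\<lambda>q f. 0) p = (\<lambda>f. 0)" "bracket (\<lambda>q f. 0) W p = (\<lambda>f. 0)" if W: "W \<in> \<Gamma> M" for W
    using tangent_const[OF vfield_tangent[OF W p]] by (simp_all add: bracket_def vfield_app_def)
  have d: "W p (inner_vf M (\<lambda>q f. 0) X) = 0" "W p (inner_vf M X (\<lambda>q f. 0)) = 0" if W: "W \<in> \<Gamma> M" and X: "X \<in> \<Gamma> M" for W X
    using tangent_cong[OF vfield_tangent[OF W p] p inner_zero(1)[OF X]] tangent_cong[OF vfield_tangent[OF W p] p inner_zero(2)[OF X]]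
      tangent_const[OF vfield_tangent[OF W p]] by simp_all
  have i: "inner_vf M W (bracket Z (\<lambda>q f. 0)) p = 0" "inner_vf M W (bracket (\<lambda>q f. 0) Y) p = 0" if W: "W \<in> \<Gamma> M" for W
    using inner_zero(2)[OF W p] br(1)[OF Z] br(2)[OF Y] by (simp_all add: inner_vf_def)
  have "inner_vf M (\<lambda>q f. 0) (bracket Y Z) p = 0" by (rule inner_zero(1)[OF bracket_vfield[OF Y Z] p])
  then show ?thesis using d(1)[OF Z Y] d(2)[OF Y Z] i(1)[OF Y] i(2)[OF Z] by (simp add: koszul_def vfield_app_def)
qed

lemma (in ap_mfd) ap_koszul_zero:
  "Y \<in> \<Gamma> M \<Longrightarrow> Z \<in> \<Gamma> M \<Longrightarrow> p \<in> points M \<Longrightarrow> ap_koszul M (\<lambda>q f. 0) Y Z p = 0"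
  unfolding ap_koszul_def using koszul_zero endo_smooth by simp

text \<open>The \<open>J\<close>-twisted half is compatible with the same metric because
  \<open>J\<close> is an isometry. The torsion identity has no such analogue, hence the return to
  \<open>koszul\<close> in \<open>curvature_FFBF\<close>.\<close>

lemma (in ap_mfd) ap_koszul_compat:
  assumes X: "X \<in> \<Gamma> M" and Y: "Y \<in> \<Gamma> M" and Z: "Z \<in> \<Gamma> M" and p: "p \<in> points M"
  shows "ap_koszul M X Y Z p + ap_koszul M X Z Y p = X p (inner_vf M Y Z)"
proof -
  have "X p (inner_vf M (endo_vf M Y) (endo_vf M Z)) = X p (inner_vf M Y Z)"
    by (rule tangent_cong[OF vfield_tangent[OF X p] p inner_isom[OF Y Z]])
  then show ?thesis
    using koszul_compat[OF X Y Z p] koszul_compat[OF X endo_smooth[OF Y] endo_smooth[OF Z] p] by (simp add: ap_koszul_def field_simps)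
qed

context warped_semi_regular
begin

section \<open>Curvature of the warped product\<close>

lemma bXb_smooth: "j \<in> {1..m} \<Longrightarrow> X \<in> \<Gamma> B \<Longrightarrow> (\<lambda>p. b j p * X p (b j)) \<in> C_inf B"
  by (rule charted.C_inf_mult[OF B b_smooth charted.vfield_smooth'[OF B _ b_smooth]])

lemma B_deriv_bXb:
  "j \<in> {1..m} \<Longrightarrow> X \<in> \<Gamma> B \<Longrightarrow> Y \<in> \<Gamma> B \<Longrightarrow> x \<in> points M \<Longrightarrow>
   X (fst x) (\<lambda>p. b j p * Y p (b j)) = b j (fst x) * X (fst x) (\<lambda>p. Y p (b j)) + Y (fst x) (b j) * X (fst x) (b j)"
  by (rule charted.tangent_mult[OF B B_vt b_smooth charted.vfield_smooth'[OF B _ b_smooth]])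

context
  fixes x assumes x: "x \<in> points M"
begin

lemma d_ap_koszul_BBB:
  assumes Y: "Y \<in> \<Gamma> B" and Z: "Z \<in> \<Gamma> B" and T: "T \<in> \<Gamma> B"
  shows "X \<in> \<Gamma> B \<Longrightarrow> LB X x (ap_koszul M (LB Y) (LB Z) (LB T)) = X (fst x) (ap_koszul B Y Z T)"
    and "k \<in> {1..m} \<Longrightarrow> U \<in> \<Gamma> (F k) \<Longrightarrow> LF k U x (ap_koszul M (LB Y) (LB Z) (LB T)) = 0"
proof -
  have *: "v (ap_koszul M (LB Y) (LB Z) (LB T)) = v (\<lambda>x. ap_koszul B Y Z T (fst x))" if "v \<in> tangent_space M x" for v
    by (rule M.tangent_cong[OF that x ap_koszul_BBB]) (rule Y Z T | assumption)+
  note s = ap_mfd.ap_koszul_smooth[OF apB Y Z T]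
  show "LB X x (ap_koszul M (LB Y) (LB Z) (LB T)) = X (fst x) (ap_koszul B Y Z T)" if X: "X \<in> \<Gamma> B"
    unfolding *[OF LB_t[OF X x]] by (rule LB_B[OF X x s])
  show "LF k U x (ap_koszul M (LB Y) (LB Z) (LB T)) = 0" if k: "k \<in> {1..m}" and U: "U \<in> \<Gamma> (F k)"
    unfolding *[OF LF_t[OF k U x]] by (rule LF_B[OF k U x s])
qed

lemma d_ap_koszul_BBF:
  assumes X: "X \<in> \<Gamma> B" and Y: "Y \<in> \<Gamma> B" and j: "j \<in> {1..m}" and W: "W \<in> \<Gamma> (F j)" and v: "v \<in> tangent_space M x"
  shows "v (ap_koszul M (LB X) (LB Y) (LF j W)) = 0" "v (ap_koszul M (LB X) (LF j W) (LB Y)) = 0" "v (ap_koszul M (LF j W) (LB X) (LB Y)) = 0"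
proof -
  show "v (ap_koszul M (LB X) (LB Y) (LF j W)) = 0"
    by (rule M_deriv_zero[OF v x], rule ap_koszul_BBF(1)) (rule X Y j W | assumption)+
  show "v (ap_koszul M (LB X) (LF j W) (LB Y)) = 0"
    by (rule M_deriv_zero[OF v x], rule ap_koszul_BBF(2)) (rule X Y j W | assumption)+
  show "v (ap_koszul M (LF j W) (LB X) (LB Y)) = 0"
    by (rule M_deriv_zero[OF v x], rule ap_koszul_BBF(3)) (rule X Y j W | assumption)+
qed

lemma d_ap_koszul_BFF:
  assumes Y: "Y \<in> \<Gamma> B" and j: "j \<in> {1..m}" and V: "V \<in> \<Gamma> (F j)" and W: "W \<in> \<Gamma> (F j)"
  shows "X \<in> \<Gamma> B \<Longrightarrow> LB X x (ap_koszul M (LB Y) (LF j V) (LF j W)) =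
      gF j V W x * X (fst x) (\<lambda>p. b j p * Y p (b j))" (is "_ \<Longrightarrow> ?BB")
    and "k \<in> {1..m} \<Longrightarrow> U \<in> \<Gamma> (F k) \<Longrightarrow> LF k U x (ap_koszul M (LB Y) (LF j V) (LF j W)) =
      (if j = k then b j (fst x) * Y (fst x) (b j) * U (snd x k) (inner_vf (F j) V W) else 0)" (is "_ \<Longrightarrow> _ \<Longrightarrow> ?BF")
    and "X \<in> \<Gamma> B \<Longrightarrow> LB X x (ap_koszul M (LF j V) (LB Y) (LF j W)) =
      1/2 * gF j V W x * X (fst x) (\<lambda>p. b j p * Y p (b j)) + 1/2 * gF j V (JF j W) x * X (fst x) (\<lambda>p. b j p * JB Y p (b j))" (is "_ \<Longrightarrow> ?FB")
    and "k \<in> {1..m} \<Longrightarrow> U \<in> \<Gamma> (F k) \<Longrightarrow> LF k U x (ap_koszul M (LF j V) (LB Y) (LF j W)) =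
      (if j = k then 1/2 * b j (fst x) * (Y (fst x) (b j) * U (snd x k) (inner_vf (F j) V W)
        + JB Y (fst x) (b j) * U (snd x k) (inner_vf (F j) V (JF j W))) else 0)" (is "_ \<Longrightarrow> _ \<Longrightarrow> ?FF")
proof -
  let ?h = "\<lambda>p. b j p * Y p (b j)" and ?h' = "\<lambda>p. b j p * JB Y p (b j)"
  note h = bXb_smooth[OF j Y] and h' = bXb_smooth[OF j B_endo[OF Y]]
  note g = F_inner_smooth[OF j V W] and g' = F_inner_smooth[OF j V F_endo[OF j W]]
  have 1: "v (ap_koszul M (LB Y) (LF j V) (LF j W)) = v (\<lambda>x. ?h (fst x) * gF j V W x)" if v: "v \<in> tangent_space M x" for v
    by (rule M.tangent_cong[OF v x]) (simp add: ap_koszul_BFF(1)[OF _ Y j V j W])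
  have 2: "v (ap_koszul M (LF j V) (LB Y) (LF j W)) = 1/2 * v (\<lambda>x. ?h (fst x) * gF j V W x) + 1/2 * v (\<lambda>x. ?h' (fst x) * gF j V (JF j W) x)"
    if v: "v \<in> tangent_space M x" for v
  proof -
    have "v (ap_koszul M (LF j V) (LB Y) (LF j W)) = v (\<lambda>x. 1/2 * (?h (fst x) * gF j V W x) + 1/2 * (?h' (fst x) * gF j V (JF j W) x))"
      by (rule M.tangent_cong[OF v x]) (simp add: ap_koszul_BFF(2)[OF _ Y j V j W] algebra_simps)
    also have "\<dots> = 1/2 * v (\<lambda>x. ?h (fst x) * gF j V W x) + 1/2 * v (\<lambda>x. ?h' (fst x) * gF j V (JF j W) x)"
      by (rule M.tangent_lin[OF v M.C_inf_mult[OF B_pull[OF h] F_pull[OF j g]] M.C_inf_mult[OF B_pull[OF h'] F_pull[OF j g']]])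
    finally show ?thesis .
  qed
  show ?BB if X: "X \<in> \<Gamma> B"
    unfolding 1[OF LB_t[OF X x]] LB_prod[OF X x j h g] ..
  show ?BF if k: "k \<in> {1..m}" and U: "U \<in> \<Gamma> (F k)"
    unfolding 1[OF LF_t[OF k U x]] LF_prod[OF k U x j h g] ..
  show ?FB if X: "X \<in> \<Gamma> B"
    unfolding 2[OF LB_t[OF X x]] LB_prod[OF X x j h g] LB_prod[OF X x j h' g'] by simp
  show ?FF if k: "k \<in> {1..m}" and U: "U \<in> \<Gamma> (F k)"
    unfolding 2[OF LF_t[OF k U x]] LF_prod[OF k U x j h g] LF_prod[OF k U x j h' g'] by (simp add: algebra_simps)
qed

lemma d_ap_koszul_BFF_ne:
  assumes Y: "Y \<in> \<Gamma> B" and i: "i \<in> {1..m}" and V: "V \<in> \<Gamma> (F i)" and j: "j \<in> {1..m}" and W: "W \<in> \<Gamma> (F j)" and ne: "i \<noteq> j"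
    and v: "v \<in> tangent_space M x"
  shows "v (ap_koszul M (LB Y) (LF i V) (LF j W)) = 0" "v (ap_koszul M (LF i V) (LB Y) (LF j W)) = 0"
proof -
  show "v (ap_koszul M (LB Y) (LF i V) (LF j W)) = 0"
    by (rule M_deriv_zero[OF v x]) (use ap_koszul_BFF(1)[OF _ Y i V j W] ne in simp)
  show "v (ap_koszul M (LF i V) (LB Y) (LF j W)) = 0"
    by (rule M_deriv_zero[OF v x]) (use ap_koszul_BFF(2)[OF _ Y i V j W] ne in simp)
qed

lemma d_ap_koszul_FFF:
  assumes j: "j \<in> {1..m}" and U: "U \<in> \<Gamma> (F j)" and V: "V \<in> \<Gamma> (F j)" and W: "W \<in> \<Gamma> (F j)"
  shows "X \<in> \<Gamma> B \<Longrightarrow> LB X x (ap_koszul M (LF j U) (LF j V) (LF j W)) =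
      2 * b j (fst x) * X (fst x) (b j) * ap_koszul (F j) U V W (snd x j)" (is "_ \<Longrightarrow> ?B")
    and "k \<in> {1..m} \<Longrightarrow> Q \<in> \<Gamma> (F k) \<Longrightarrow> LF k Q x (ap_koszul M (LF j U) (LF j V) (LF j W)) =
      (if j = k then (b j (fst x))\<^sup>2 * Q (snd x k) (ap_koszul (F j) U V W) else 0)" (is "_ \<Longrightarrow> _ \<Longrightarrow> ?F")
proof -
  note h = b2_smooth[OF j] and g = ap_mfd.ap_koszul_smooth[OF apF[OF j] U V W]
  have *: "v (ap_koszul M (LF j U) (LF j V) (LF j W)) = v (\<lambda>x. (b j (fst x))\<^sup>2 * ap_koszul (F j) U V W (snd x j))"
    if v: "v \<in> tangent_space M x" for v
    by (rule M.tangent_cong[OF v x]) (simp add: ap_koszul_FFF[OF _ j U j V j W])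
  show ?B if X: "X \<in> \<Gamma> B"
    unfolding *[OF LB_t[OF X x]] LB_prod[OF X x j h g] charted.tangent_power2[OF B B_vt[OF X x] b_smooth[OF j]] by simp
  show ?F if k: "k \<in> {1..m}" and Q: "Q \<in> \<Gamma> (F k)"
    unfolding *[OF LF_t[OF k Q x]] LF_prod[OF k Q x j h g] ..
qed

lemma d_ap_koszul_FFF_ne:
  assumes i: "i \<in> {1..m}" and U: "U \<in> \<Gamma> (F i)" and j: "j \<in> {1..m}" and V: "V \<in> \<Gamma> (F j)" and k: "k \<in> {1..m}" and W: "W \<in> \<Gamma> (F k)"
    and ne: "\<not> (i = j \<and> j = k)" and v: "v \<in> tangent_space M x"
  shows "v (ap_koszul M (LF i U) (LF j V) (LF k W)) = 0"
  by (rule M_deriv_zero[OF v x]) (use ap_koszul_FFF[OF _ i U j V k W] ne in auto)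

lemma ap_koszul_bracket_BB:
  "X \<in> \<Gamma> B \<Longrightarrow> Y \<in> \<Gamma> B \<Longrightarrow> C \<in> \<Gamma> M \<Longrightarrow> D \<in> \<Gamma> M \<Longrightarrow>
   ap_koszul M (bracket (LB X) (LB Y)) C D x = ap_koszul M (LB (bracket X Y)) C D x"
  by (rule M.ap_koszul_cong[OF M.bracket_vfield[OF LB_vfield LB_vfield] _ _ bracket_BB refl refl x])

text \<open>The bracket is known to be \<open>0\<close> at points of the manifold only, so it is
  first replaced by the zero field.\<close>

lemma ap_koszul_bracket_zero:
  assumes "A \<in> \<Gamma> M" "A' \<in> \<Gamma> M" "C \<in> \<Gamma> M" "D \<in> \<Gamma> M" "\<And>y. y \<in> points M \<Longrightarrow> bracket A A' y = (\<lambda>f. 0)"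
  shows "ap_koszul M (bracket A A') C D x = 0"
  using M.ap_koszul_cong[OF M.bracket_vfield[OF assms(1,2)] assms(3,4) assms(5) refl refl x]
    M.ap_koszul_zero[OF assms(3,4) x] by simp

lemma ap_koszul_bracket_BF:
  assumes "X \<in> \<Gamma> B" "j \<in> {1..m}" "V \<in> \<Gamma> (F j)" "C \<in> \<Gamma> M" "D \<in> \<Gamma> M"
  shows "ap_koszul M (bracket (LB X) (LF j V)) C D x = 0"
  by (rule ap_koszul_bracket_zero[OF LB_vfield[OF assms(1)] LF_vfield[OF assms(2,3)] assms(4,5) bracket_BF[OF assms(1-3)]])

lemma ap_koszul_bracket_FF:
  assumes j: "j \<in> {1..m}" and V: "V \<in> \<Gamma> (F j)" and W: "W \<in> \<Gamma> (F j)" and C: "C \<in> \<Gamma> M" and D: "D \<in> \<Gamma> M"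
  shows "ap_koszul M (bracket (LF j V) (LF j W)) C D x = ap_koszul M (LF j (bracket V W)) C D x"
  by (rule M.ap_koszul_cong[OF M.bracket_vfield[OF LF_vfield[OF j V] LF_vfield[OF j W]] C D _ refl refl x])
     (simp add: bracket_FF[OF j V j W])

lemma ap_koszul_bracket_FF_ne:
  assumes i: "i \<in> {1..m}" and V: "V \<in> \<Gamma> (F i)" and j: "j \<in> {1..m}" and W: "W \<in> \<Gamma> (F j)" and C: "C \<in> \<Gamma> M" and D: "D \<in> \<Gamma> M" and ne: "i \<noteq> j"
  shows "ap_koszul M (bracket (LF i V) (LF j W)) C D x = 0"
  by (rule ap_koszul_bracket_zero[OF LF_vfield[OF i V] LF_vfield[OF j W] C D]) (simp add: bracket_FF[OF i V j W] ne)

end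

section \<open>Curvature components by the types of their arguments\<close>

abbreviation R where "R \<equiv> ap_curvature M"
abbreviation aK where "aK j U V W x \<equiv> ap_koszul (F j) U V W (snd x j)"
abbreviation K where "K j U V W x \<equiv> koszul (F j) U V W (snd x j)"

lemmas curvature_unfold = ap_curvature_def vfield_app_def

context
  fixes x assumes x: "x \<in> points M"
begin

lemma curvature_BBBB:
  assumes X: "X \<in> \<Gamma> B" and Y: "Y \<in> \<Gamma> B" and Z: "Z \<in> \<Gamma> B" and T: "T \<in> \<Gamma> B"
  shows "R (LB X) (LB Y) (LB Z) (LB T) x = ap_curvature B X Y Z T (fst x)"
  unfolding curvature_unfold d_ap_koszul_BBB(1)[OF x Y Z T X] d_ap_koszul_BBB(1)[OF x X Z T Y]
    ap_koszul_bracket_BB[OF x X Y LB_vfield[OF Z] LB_vfield[OF T]] ap_koszul_BBB[OF x B_bracket[OF X Y] Z T]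
    contraction_BB_BB[OF X Z Y T x] contraction_BB_BB[OF Y Z X T x] ..

lemma curvature_BBBF:
  assumes X: "X \<in> \<Gamma> B" and Y: "Y \<in> \<Gamma> B" and Z: "Z \<in> \<Gamma> B" and j: "j \<in> {1..m}" and W: "W \<in> \<Gamma> (F j)"
  shows "R (LB X) (LB Y) (LB Z) (LF j W) x = 0" "R (LB Z) (LF j W) (LB X) (LB Y) x = 0"
  unfolding curvature_unfold d_ap_koszul_BBF(1)[OF x Y Z j W LB_t[OF X x]] d_ap_koszul_BBF(1)[OF x X Z j W LB_t[OF Y x]]
    ap_koszul_bracket_BB[OF x X Y LB_vfield[OF Z] LF_vfield[OF j W]] ap_koszul_BBF(1)[OF x B_bracket[OF X Y] Z j W]
    contraction_BB_vertical(1)[OF j X Z vertical_BF[OF j Y W] x] contraction_BB_vertical(1)[OF j Y Z vertical_BF[OF j X W] x]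
    d_ap_koszul_BBF(3)[OF x X Y j W LB_t[OF Z x]] d_ap_koszul_BBB(2)[OF x Z X Y j W]
    ap_koszul_bracket_BF[OF x Z j W LB_vfield[OF X] LB_vfield[OF Y]]
    contraction_BB_vertical(1)[OF j Z X vertical_FB[OF j Y W] x] contraction_BB_vertical(2)[OF j Z Y vertical_FB[OF j X W] x]
  by simp_all

text \<open>On one fibre the second derivatives of \<open>b j\<close> cancel against the bracket
  term, the products of its first derivatives against each other, and the two contractions are
  equal.\<close>

lemma curvature_BBFF:
  assumes X: "X \<in> \<Gamma> B" and Y: "Y \<in> \<Gamma> B" and i: "i \<in> {1..m}" and V: "V \<in> \<Gamma> (F i)" and j: "j \<in> {1..m}" and W: "W \<in> \<Gamma> (F j)"
  shows "R (LB X) (LB Y) (LF i V) (LF j W) x = 0"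
proof (cases "i = j")
  case True
  then have V: "V \<in> \<Gamma> (F j)" using V by simp
  have "R (LB X) (LB Y) (LF j V) (LF j W) x = 0"
    unfolding curvature_unfold d_ap_koszul_BFF(1)[OF x Y j V W X] d_ap_koszul_BFF(1)[OF x X j V W Y]
      ap_koszul_bracket_BB[OF x X Y LF_vfield[OF j V] LF_vfield[OF j W]] ap_koszul_BFF(1)[OF x B_bracket[OF X Y] j V j W]
      contraction_BF_BF[OF j X Y V W x] contraction_BF_BF[OF j Y X V W x] B_deriv_bXb[OF j X Y x] B_deriv_bXb[OF j Y X x]
    by (simp add: bracket_def vfield_app_def algebra_simps)
  then show ?thesis using True by simp
next
  case False
  show ?thesis
    unfolding curvature_unfold d_ap_koszul_BFF_ne(1)[OF x Y i V j W False LB_t[OF X x]] d_ap_koszul_BFF_ne(1)[OF x X i V j W False LB_t[OF Y x]]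
      ap_koszul_bracket_BB[OF x X Y LF_vfield[OF i V] LF_vfield[OF j W]] ap_koszul_BFF(1)[OF x B_bracket[OF X Y] i V j W]
      contraction_vertical_mixed(1)[OF i j vertical_BF[OF i X V] vertical_mixed[OF vertical_BF[OF j Y W]] False x]
      contraction_vertical_mixed(1)[OF i j vertical_BF[OF i Y V] vertical_mixed[OF vertical_BF[OF j X W]] False x]
    using False by simp
qed

text \<open>On one fibre only the contractions survive. They agree because the value is symmetric
  under exchange of \<open>V\<close> and \<open>W\<close>, as \<open>J\<close> is self-adjoint for
  the fibre metric.\<close>

lemma curvature_FFBB:
  assumes X: "X \<in> \<Gamma> B" and Y: "Y \<in> \<Gamma> B" and i: "i \<in> {1..m}" and V: "V \<in> \<Gamma> (F i)" and j: "j \<in> {1..m}" and W: "W \<in> \<Gamma> (F j)"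
  shows "R (LF i V) (LF j W) (LB X) (LB Y) x = 0"
proof (cases "i = j")
  case True
  then have V: "V \<in> \<Gamma> (F j)" using V by simp
  have "R (LF j V) (LF j W) (LB X) (LB Y) x = 0"
    unfolding curvature_unfold d_ap_koszul_BBF(3)[OF x X Y j W LF_t[OF j V x]] d_ap_koszul_BBF(3)[OF x X Y j V LF_t[OF j W x]]
      ap_koszul_bracket_FF[OF x j V W LB_vfield[OF X] LB_vfield[OF Y]] ap_koszul_BBF(3)[OF x X Y j F_bracket[OF j V W]]
      contraction_FB_FB[OF j X Y V W x] contraction_FB_FB[OF j X Y W V x] gF_sym[OF j W V x]
      gF_adj[OF j W V x, symmetric] gF_sym[OF j F_endo[OF j W] V x]
    by simp
  then show ?thesis using True by simp
next
  case False
  then have ne: "j \<noteq> i" by simp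
  show ?thesis
    unfolding curvature_unfold d_ap_koszul_BBF(3)[OF x X Y j W LF_t[OF i V x]] d_ap_koszul_BBF(3)[OF x X Y i V LF_t[OF j W x]]
      ap_koszul_bracket_FF_ne[OF x i V j W LB_vfield[OF X] LB_vfield[OF Y] False]
      contraction_vertical_mixed(1)[OF i j vertical_FB[OF i X V] vertical_mixed[OF vertical_FB[OF j Y W]] False x]
      contraction_vertical_mixed(1)[OF j i vertical_FB[OF j X W] vertical_mixed[OF vertical_FB[OF i Y V]] ne x]
    by simp
qed

text \<open>Differentiating \<open>b * Y b\<close> along \<open>X\<close> produces products of first
  derivatives, and exactly these are removed by the contraction of the form of \<open>(V, Y)\<close>
  with that of \<open>(X, W)\<close>. The terms with the inverse metric come from contracting
  \<open>(X, Y)\<close> with the horizontal part of \<open>(V, W)\<close>.\<close>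

lemma curvature_BFBF:
  assumes X: "X \<in> \<Gamma> B" and Y: "Y \<in> \<Gamma> B" and j: "j \<in> {1..m}" and V: "V \<in> \<Gamma> (F j)" and W: "W \<in> \<Gamma> (F j)"
  shows "R (LB X) (LF j V) (LB Y) (LF j W) x =
    1/2 * b j (fst x) * X (fst x) (\<lambda>p. Y p (b j)) * gF j V W x
    - 1/2 * b j (fst x) * G (nabla_flat B X Y) (db j) x * gF j V W x
    + 1/2 * b j (fst x) * X (fst x) (\<lambda>p. JB Y p (b j)) * gF j V (JF j W) x
    - 1/2 * b j (fst x) * G (nabla_flat B X Y) (dbJ j) x * gF j V (JF j W) x"
  unfolding curvature_unfold d_ap_koszul_BFF(3)[OF x Y j V W X] d_ap_koszul_BBF(1)[OF x X Y j W LF_t[OF j V x]]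
    ap_koszul_bracket_BF[OF x X j V LB_vfield[OF Y] LF_vfield[OF j W]]
    contraction_BB_FF[OF j X Y V W x] contraction_FB_BF[OF j Y X V W x] B_deriv_bXb[OF j X Y x] B_deriv_bXb[OF j X B_endo[OF Y] x]
  by (simp add: field_simps)

lemma curvature_BFBF_ne:
  assumes X: "X \<in> \<Gamma> B" and Y: "Y \<in> \<Gamma> B" and i: "i \<in> {1..m}" and V: "V \<in> \<Gamma> (F i)" and j: "j \<in> {1..m}" and W: "W \<in> \<Gamma> (F j)"
    and ne: "i \<noteq> j"
  shows "R (LB X) (LF i V) (LB Y) (LF j W) x = 0"
  unfolding curvature_unfold d_ap_koszul_BFF_ne(2)[OF x Y i V j W ne LB_t[OF X x]] d_ap_koszul_BBF(1)[OF x X Y j W LF_t[OF i V x]]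
    ap_koszul_bracket_BF[OF x X i V LB_vfield[OF Y] LF_vfield[OF j W]]
    contraction_FF_ne(2)[OF i V j W ne j mixed_BB[OF j X Y] x]
    contraction_vertical_mixed(1)[OF i j vertical_FB[OF i Y V] vertical_mixed[OF vertical_BF[OF j X W]] ne x]
  by simp

text \<open>If \<open>i = j\<close>, the directions \<open>k\<close> and \<open>j\<close> are
  orthogonal; otherwise the form of the two fibre fields is itself \<open>0\<close>.\<close>

lemma contraction_vertical_FF_ne:
  assumes k: "k \<in> {1..m}" and \<omega>: "vertical k \<omega>" and i: "i \<in> {1..m}" and V: "V \<in> \<Gamma> (F i)" and j: "j \<in> {1..m}" and W: "W \<in> \<Gamma> (F j)"
    and ne: "\<not> (i = j \<and> j = k)"
  shows "contraction M \<omega> (nabla_flat M (LF i V) (LF j W)) x = 0" "contraction M (nabla_flat M (LF i V) (LF j W)) \<omega> x = 0"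
proof -
  have "contraction M \<omega> (nabla_flat M (LF i V) (LF j W)) x = 0 \<and> contraction M (nabla_flat M (LF i V) (LF j W)) \<omega> x = 0"
  proof (cases "i = j")
    case True
    then have "k \<noteq> j" using ne by blast
    then show ?thesis using contraction_vertical_mixed[OF k j \<omega> mixed_FF[OF i j V W] _ x] by simp
  next
    case False
    show ?thesis using contraction_FF_ne[OF i V j W False k vertical_mixed[OF \<omega>] x] by simp
  qed
  then show "contraction M \<omega> (nabla_flat M (LF i V) (LF j W)) x = 0" "contraction M (nabla_flat M (LF i V) (LF j W)) \<omega> x = 0"
    by simp_all
qed

text \<open>On one fibre, compatibility splits the derivative of \<open>g(W, U)\<close> along
  \<open>V\<close> into two values of the fibre Koszul form. With the coefficient
  \<open>b * X b\<close> they cancel against the derivative of \<open>b^2\<close> along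
  \<open>X\<close> and the two contractions. In the other cases every term is
  \<open>0\<close>.\<close>

lemma curvature_BFFF:
  assumes X: "X \<in> \<Gamma> B" and i: "i \<in> {1..m}" and V: "V \<in> \<Gamma> (F i)" and j: "j \<in> {1..m}" and W: "W \<in> \<Gamma> (F j)"
    and k: "k \<in> {1..m}" and U: "U \<in> \<Gamma> (F k)"
  shows "R (LB X) (LF i V) (LF j W) (LF k U) x = 0"
proof (cases "i = j \<and> j = k")
  case True
  then have VU: "V \<in> \<Gamma> (F j)" "U \<in> \<Gamma> (F j)" using V U by simp_all
  have "V (snd x j) (inner_vf (F j) W U) = aK j V W U x + aK j V U W x"
    by (rule ap_mfd.ap_koszul_compat[OF apF[OF j] VU(1) W VU(2) F_pr_in[OF j x], symmetric])
  moreover have "LF j V x (ap_koszul M (LB X) (LF j W) (LF j U)) = b j (fst x) * X (fst x) (b j) * V (snd x j) (inner_vf (F j) W U)"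
    using d_ap_koszul_BFF(2)[OF x X j W VU(2) j VU(1)] by simp
  ultimately have "R (LB X) (LF j V) (LF j W) (LF j U) x = 0"
    unfolding curvature_unfold d_ap_koszul_FFF(1)[OF x j VU(1) W VU(2) X]
      ap_koszul_bracket_BF[OF x X j VU(1) LF_vfield[OF j W] LF_vfield[OF j VU(2)]]
      contraction_BF_FF(1)[OF j X W VU x] contraction_BF_FF(2)[OF j X VU(2) VU(1) W x]
    by (simp add: algebra_simps)
  then show ?thesis using True by simp
next
  case False
  have "LF i V x (ap_koszul M (LB X) (LF j W) (LF k U)) = 0"
  proof (cases "j = k")
    case True
    then have U': "U \<in> \<Gamma> (F j)" and ij: "j \<noteq> i" using U False by auto
    show ?thesis using d_ap_koszul_BFF(2)[OF x X j W U' i V] ij True by simp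
  next
    case jk: False
    show ?thesis by (rule d_ap_koszul_BFF_ne(1)[OF x X j W k U jk LF_t[OF i V x]])
  qed
  moreover have "\<not> (i = k \<and> k = j)" using False by blast
  ultimately show ?thesis
    unfolding curvature_unfold d_ap_koszul_FFF_ne[OF x i V j W k U False LB_t[OF X x]]
      ap_koszul_bracket_BF[OF x X i V LF_vfield[OF j W] LF_vfield[OF k U]]
      contraction_vertical_FF_ne(2)[OF k vertical_BF[OF k X U] i V j W False]
    using contraction_vertical_FF_ne(1)[OF j vertical_BF[OF j X W] i V k U] by simp
qed

lemma curvature_FFBF:
  assumes X: "X \<in> \<Gamma> B" and j: "j \<in> {1..m}" and U: "U \<in> \<Gamma> (F j)" and V: "V \<in> \<Gamma> (F j)" and W: "W \<in> \<Gamma> (F j)"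
  shows "R (LF j U) (LF j V) (LB X) (LF j W) x =
    1/4 * b j (fst x) * X (fst x) (b j) *
      (- K j V W U x + K j U W V x + K j V (JF j W) (JF j U) x - K j U (JF j W) (JF j V) x)
    - 1/4 * b j (fst x) * JB X (fst x) (b j) *
      (- K j V W (JF j U) x + K j U W (JF j V) x + K j V (JF j W) U x - K j U (JF j W) V x)"
proof -
  note q = F_pr_in[OF j x]
  note kc = ap_mfd.koszul_compat[OF apF[OF j] _ _ _ q] and kt = ap_mfd.koszul_torsion[OF apF[OF j] U V _ q]
  note JW = F_endo[OF j W]
  \<comment> \<open>Compatibility along \<open>U\<close> and \<open>V\<close> together with
    vanishing torsion eliminates derivatives and bracket. It is applied to \<open>W\<close> and to
    \<open>JF j W\<close>, the two fields that occur in the Koszul form of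
    \<open>(V, X, W)\<close>.\<close>
  have 1: "U (snd x j) (inner_vf (F j) V W') - V (snd x j) (inner_vf (F j) U W') - gF j (bracket U V) W' x = K j U W' V x - K j V W' U x"
    if W': "W' \<in> \<Gamma> (F j)" for W'
    using kc[OF U V W'] kc[OF V U W'] kt[OF W'] gF_sym[OF j W' F_bracket[OF j U V] x] by simp
  \<comment> \<open>Since \<open>J (J C) = C\<close>, the twisted half shifts \<open>J\<close> from
    the third argument to the second.\<close>
  have 2: "aK j A W (JF j C) x = 1/2 * (K j A W (JF j C) x + K j A (JF j W) C x)" if A: "A \<in> \<Gamma> (F j)" and C: "C \<in> \<Gamma> (F j)" for A C
  proof -
    note JC = F_endo[OF j C]
    have "K j A (JF j W) (JF j (JF j C)) x = K j A (JF j W) C x"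
      by (rule ap_mfd.koszul_cong[OF apF[OF j] A JW F_endo[OF j JC] refl refl ap_mfd.endo_vf_invol[OF apF[OF j] C] q])
    then show ?thesis by (simp add: ap_koszul_def)
  qed
  have 3: "LF j U x (ap_koszul M (LF j V) (LB X) (LF j W)) = 1/2 * b j (fst x) * (X (fst x) (b j) * U (snd x j) (inner_vf (F j) V W)
        + JB X (fst x) (b j) * U (snd x j) (inner_vf (F j) V (JF j W)))"
    "LF j V x (ap_koszul M (LF j U) (LB X) (LF j W)) = 1/2 * b j (fst x) * (X (fst x) (b j) * V (snd x j) (inner_vf (F j) U W)
        + JB X (fst x) (b j) * V (snd x j) (inner_vf (F j) U (JF j W)))"
    using d_ap_koszul_BFF(4)[OF x X j V W j U] d_ap_koszul_BFF(4)[OF x X j U W j V] by simp_all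
  have 4: "ap_koszul M (bracket (LF j U) (LF j V)) (LB X) (LF j W) x = 1/2 * b j (fst x) *
      (X (fst x) (b j) * gF j (bracket U V) W x + JB X (fst x) (b j) * gF j (bracket U V) (JF j W) x)"
    using ap_koszul_bracket_FF[OF x j U V LB_vfield[OF X] LF_vfield[OF j W]] ap_koszul_BFF(2)[OF x X j F_bracket[OF j U V] j W] by simp
  have "R (LF j U) (LF j V) (LB X) (LF j W) x =
    1/2 * b j (fst x) * X (fst x) (b j) * (U (snd x j) (inner_vf (F j) V W) - V (snd x j) (inner_vf (F j) U W) - gF j (bracket U V) W x) +
    1/2 * b j (fst x) * JB X (fst x) (b j) * (U (snd x j) (inner_vf (F j) V (JF j W)) - V (snd x j) (inner_vf (F j) U (JF j W)) - gF j (bracket U V) (JF j W) x) +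
    1/2 * b j (fst x) * (X (fst x) (b j) * aK j V W U x + JB X (fst x) (b j) * aK j V W (JF j U) x) -
    1/2 * b j (fst x) * (X (fst x) (b j) * aK j U W V x + JB X (fst x) (b j) * aK j U W (JF j V) x)"
    unfolding curvature_unfold 3 4 contraction_FB_FF[OF j X U V W x] contraction_FB_FF[OF j X V U W x] by (simp add: algebra_simps)
  then show ?thesis unfolding 1[OF W] 1[OF JW] 2[OF V U] 2[OF U V] by (simp add: ap_koszul_def field_simps)
qed

lemma curvature_FFBF_ne:
  assumes X: "X \<in> \<Gamma> B" and k: "k \<in> {1..m}" and U: "U \<in> \<Gamma> (F k)" and i: "i \<in> {1..m}" and V: "V \<in> \<Gamma> (F i)"
    and j: "j \<in> {1..m}" and W: "W \<in> \<Gamma> (F j)" and ne: "\<not> (i = j \<and> j = k)"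
  shows "R (LF k U) (LF i V) (LB X) (LF j W) x = 0"
proof -
  \<comment> \<open>Stated for arbitrary \<open>k\<close>, \<open>i\<close>, \<open>U\<close>,
    \<open>V\<close> because the curvature uses it in both orders of the first two fields.\<close>
  have d: "LF k U x (ap_koszul M (LF i V) (LB X) (LF j W)) = 0"
    if k: "k \<in> {1..m}" and U: "U \<in> \<Gamma> (F k)" and i: "i \<in> {1..m}" and V: "V \<in> \<Gamma> (F i)" and ne: "\<not> (i = j \<and> j = k)" for k i U V
  proof (cases "i = j")
    case True
    then have "V \<in> \<Gamma> (F j)" using V by simp
    from d_ap_koszul_BFF(4)[OF x X j this W k U] show ?thesis using ne True by simp
  next
    case False
    show ?thesis by (rule d_ap_koszul_BFF_ne(2)[OF x X i V j W False LF_t[OF k U x]])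
  qed
  have br: "ap_koszul M (bracket (LF k U) (LF i V)) (LB X) (LF j W) x = 0"
  proof (cases "k = i")
    case True
    then have U': "U \<in> \<Gamma> (F i)" and ij: "i \<noteq> j" using U ne by auto
    show ?thesis using ap_koszul_bracket_FF[OF x i U' V LB_vfield[OF X] LF_vfield[OF j W]]
        ap_koszul_BFF(2)[OF x X i F_bracket[OF i U' V] j W] ij True by simp
  next
    case False
    show ?thesis by (rule ap_koszul_bracket_FF_ne[OF x k U i V LB_vfield[OF X] LF_vfield[OF j W] False])
  qed
  have ne': "\<not> (k = j \<and> j = i)" using ne by blast
  show ?thesis unfolding curvature_unfold d[OF k U i V ne] d[OF i V k U ne'] br
      contraction_vertical_FF_ne(1)[OF k vertical_FB[OF k X U] i V j W ne] contraction_vertical_FF_ne(1)[OF i vertical_FB[OF i X V] k U j W ne']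
    by simp
qed

lemma GFF_swap: "i \<in> {1..m} \<Longrightarrow> j \<in> {1..m} \<Longrightarrow> GFF i V W j U Q x = GFF j U Q i V W x"
  using metric_sFF_sFF[of i j x V W U Q] metric_sFF_sFF[of j i x U Q V W] x
    ap_mfd.metric_sym[OF apB B_pr_in[OF x] sFF_in sFF_in, of i j] by simp

lemma cometric_sym: "j \<in> {1..m} \<Longrightarrow> G (db j) (dbJ j) x = G (dbJ j) (db j) x"
  unfolding cometric_def by (rule ap_mfd.metric_sym[OF apB B_pr_in[OF x] sB_in[OF one_db x] sB_in[OF one_dbJ x]])

text \<open>The terms from the fibre all carry \<open>b j ^ 2\<close> and assemble to its curvature;
  the difference of two values of \<open>GFF\<close> remains. Symmetry of the inverse metric merges
  the two products of \<open>db\<close> with \<open>dbJ\<close>.\<close>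

lemma curvature_FFFF:
  assumes j: "j \<in> {1..m}" and U: "U \<in> \<Gamma> (F j)" and V: "V \<in> \<Gamma> (F j)" and W: "W \<in> \<Gamma> (F j)" and Q: "Q \<in> \<Gamma> (F j)"
  shows "R (LF j U) (LF j V) (LF j W) (LF j Q) x =
    (b j (fst x))\<^sup>2 * ap_curvature (F j) U V W Q (snd x j)
    + 1/4 * (b j (fst x))\<^sup>2 *
      (G (db j) (db j) x * (gF j U W x * gF j V Q x - gF j V W x * gF j U Q x)
       + G (dbJ j) (db j) x *
         (gF j U (JF j W) x * gF j V Q x - gF j V (JF j W) x * gF j U Q x
          + gF j U W x * gF j V (JF j Q) x - gF j V W x * gF j U (JF j Q) x)
       + G (dbJ j) (dbJ j) x *
         (gF j U (JF j W) x * gF j V (JF j Q) x - gF j V (JF j W) x * gF j U (JF j Q) x))"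
proof -
  have 1: "LF j U x (ap_koszul M (LF j V) (LF j W) (LF j Q)) = (b j (fst x))\<^sup>2 * U (snd x j) (ap_koszul (F j) V W Q)"
    "LF j V x (ap_koszul M (LF j U) (LF j W) (LF j Q)) = (b j (fst x))\<^sup>2 * V (snd x j) (ap_koszul (F j) U W Q)"
    "ap_koszul M (bracket (LF j U) (LF j V)) (LF j W) (LF j Q) x = (b j (fst x))\<^sup>2 * aK j (bracket U V) W Q x"
    using d_ap_koszul_FFF(2)[OF x j V W Q j U] d_ap_koszul_FFF(2)[OF x j U W Q j V]
      ap_koszul_bracket_FF[OF x j U V LF_vfield[OF j W] LF_vfield[OF j Q]] ap_koszul_FFF[OF x j F_bracket[OF j U V] j W j Q] by simp_all
  have 2: "contraction M (nabla_flat M (LF j U) (LF j W)) (nabla_flat M (LF j V) (LF j Q)) x = GFF j U W j V Q x +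
      (b j (fst x))\<^sup>2 * contraction (F j) (nabla_flat (F j) U W) (nabla_flat (F j) V Q) (snd x j)"
    "contraction M (nabla_flat M (LF j V) (LF j W)) (nabla_flat M (LF j U) (LF j Q)) x = GFF j V W j U Q x +
      (b j (fst x))\<^sup>2 * contraction (F j) (nabla_flat (F j) V W) (nabla_flat (F j) U Q) (snd x j)"
    using contraction_FF_FF[OF j j U W V Q x] contraction_FF_FF[OF j j V W U Q x] by simp_all
  show ?thesis unfolding curvature_unfold 1 2 GFF_def cometric_sym[OF j]
    by (simp add: power2_eq_square field_simps)
qed

text \<open>A derivative or bracket term of fibre fields can be nonzero only if all four fields
  belong to one fibre. The contractions alone decide the remaining patterns.\<close>

lemma curvature_FFFF_not_diagonal:
  assumes k: "k \<in> {1..m}" and U: "U \<in> \<Gamma> (F k)" and i: "i \<in> {1..m}" and V: "V \<in> \<Gamma> (F i)"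
    and j: "j \<in> {1..m}" and W: "W \<in> \<Gamma> (F j)" and s: "s \<in> {1..m}" and Q: "Q \<in> \<Gamma> (F s)"
    and ne: "\<not> (i = j \<and> j = k \<and> k = s)"
  shows "R (LF k U) (LF i V) (LF j W) (LF s Q) x =
    contraction M (nabla_flat M (LF k U) (LF j W)) (nabla_flat M (LF i V) (LF s Q)) x -
    contraction M (nabla_flat M (LF i V) (LF j W)) (nabla_flat M (LF k U) (LF s Q)) x"
proof -
  have d: "LF k U x (ap_koszul M (LF i V) (LF j W) (LF s Q)) = 0"
    if k: "k \<in> {1..m}" and U: "U \<in> \<Gamma> (F k)" and i: "i \<in> {1..m}" and V: "V \<in> \<Gamma> (F i)" and ne: "\<not> (i = j \<and> j = k \<and> k = s)" for k i U V
  proof (cases "i = j \<and> j = s")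
    case True
    then have "V \<in> \<Gamma> (F s)" "W \<in> \<Gamma> (F s)" using V W by simp_all
    from d_ap_koszul_FFF(2)[OF x s this Q k U] show ?thesis using ne True by auto
  next
    case False
    show ?thesis by (rule d_ap_koszul_FFF_ne[OF x i V j W s Q False LF_t[OF k U x]])
  qed
  have br: "ap_koszul M (bracket (LF k U) (LF i V)) (LF j W) (LF s Q) x = 0"
  proof (cases "k = i")
    case True
    then have U': "U \<in> \<Gamma> (F i)" using U by simp
    show ?thesis using ap_koszul_bracket_FF[OF x i U' V LF_vfield[OF j W] LF_vfield[OF s Q]]
        ap_koszul_FFF[OF x i F_bracket[OF i U' V] j W s Q] ne True by auto
  next
    case False
    show ?thesis by (rule ap_koszul_bracket_FF_ne[OF x k U i V LF_vfield[OF j W] LF_vfield[OF s Q] False])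
  qed
  have ne': "\<not> (k = j \<and> j = i \<and> i = s)" using ne by blast
  show ?thesis unfolding curvature_unfold d[OF k U i V ne] d[OF i V k U ne'] br by simp
qed

text \<open>The form of two fields on different fibres is \<open>0\<close>, so a nonzero contraction
  requires equal fibres within each form.\<close>

lemma contraction_FF_FF_mixed:
  assumes k: "k \<in> {1..m}" and U: "U \<in> \<Gamma> (F k)" and i: "i \<in> {1..m}" and V: "V \<in> \<Gamma> (F i)"
    and j: "j \<in> {1..m}" and W: "W \<in> \<Gamma> (F j)" and s: "s \<in> {1..m}" and Q: "Q \<in> \<Gamma> (F s)"
    and ne: "\<not> (k = j \<and> i = s)"
  shows "contraction M (nabla_flat M (LF k U) (LF j W)) (nabla_flat M (LF i V) (LF s Q)) x = 0"
proof (cases "k = j")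
  case True
  then have "i \<noteq> s" using ne by blast
  then show ?thesis by (rule contraction_FF_ne(2)[OF i V s Q _ j mixed_FF[OF k j U W] x])
next
  case False
  then show ?thesis by (rule contraction_FF_ne(1)[OF k U j W _ s mixed_FF[OF i s V Q] x])
qed

text \<open>The second contraction pairs fields of different fibres within a form and vanishes. The
  first is a product of horizontal vectors built from the gradients of \<open>b i\<close> and
  \<open>b j\<close>, which need not be orthogonal: two fibres interact through the base.\<close>

lemma curvature_FFFF_mixed:
  assumes i: "i \<in> {1..m}" and j: "j \<in> {1..m}" and U: "U \<in> \<Gamma> (F j)" and V: "V \<in> \<Gamma> (F i)" and W: "W \<in> \<Gamma> (F j)" and Q: "Q \<in> \<Gamma> (F i)"
    and ne: "j \<noteq> i"
  shows "R (LF j U) (LF i V) (LF j W) (LF i Q) x =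
    1/4 * b i (fst x) * b j (fst x) *
      (G (db i) (db j) x * gF i V Q x * gF j U W x
       + G (dbJ i) (db j) x * gF i V (JF i Q) x * gF j U W x
       + G (db i) (dbJ j) x * gF i V Q x * gF j U (JF j W) x
       + G (dbJ i) (dbJ j) x * gF i V (JF i Q) x * gF j U (JF j W) x)"
proof -
  have n: "\<not> (i = j \<and> j = j \<and> j = i)" "\<not> (i = j \<and> j = i)" using ne by auto
  have c: "contraction M (nabla_flat M (LF j U) (LF j W)) (nabla_flat M (LF i V) (LF i Q)) x = GFF j U W i V Q x"
    using contraction_FF_FF[OF j i U W V Q x] ne by simp
  show ?thesis
    unfolding curvature_FFFF_not_diagonal[OF j U i V j W i Q n(1)] contraction_FF_FF_mixed[OF i V j U j W i Q n(2)] c GFF_swap[OF j i]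
    by (simp add: GFF_def algebra_simps)
qed

lemma curvature_FFFF_zero:
  assumes k: "k \<in> {1..m}" and U: "U \<in> \<Gamma> (F k)" and i: "i \<in> {1..m}" and V: "V \<in> \<Gamma> (F i)"
    and j: "j \<in> {1..m}" and W: "W \<in> \<Gamma> (F j)" and s: "s \<in> {1..m}" and Q: "Q \<in> \<Gamma> (F s)"
    and ne: "\<not> (i = j \<and> j = k \<and> k = s)" "\<not> (j = k \<and> k \<noteq> i \<and> i = s)" "\<not> (k = s \<and> s \<noteq> i \<and> i = j)"
  shows "R (LF k U) (LF i V) (LF j W) (LF s Q) x = 0"
proof -
  have n: "\<not> (k = j \<and> i = s)" "\<not> (i = j \<and> k = s)" using ne by auto
  show ?thesis
    unfolding curvature_FFFF_not_diagonal[OF k U i V j W s Q ne(1)] contraction_FF_FF_mixed[OF k U i V j W s Q n(1)] contraction_FF_FF_mixed[OF i V k U j W s Q n(2)]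
    by simp
qed

end

end

theorem theorem4p8:
  fixes m :: nat
    and B :: "('b, 'i) almost_product"
    and b :: "nat \<Rightarrow> 'b \<Rightarrow> real"
    and F :: "nat \<Rightarrow> ('f, 'j) almost_product"
    and p :: 'b and q :: "nat \<Rightarrow> 'f"
  defines "M \<equiv> multiply_warped_product m B b F"
  defines "R \<equiv> ap_curvature M"
  defines "LB \<equiv> lift_base M"
  defines "LF \<equiv> lift_fibre M"
  defines "JB \<equiv> endo_vf B"
  defines "JF \<equiv> (\<lambda>j. endo_vf (F j))"
  defines "g \<equiv> (\<lambda>j V W. inner_vf (F j) V W (q j))"
  defines "K \<equiv> (\<lambda>j U V W. koszul (F j) U V W (q j))"
  defines "db \<equiv> (\<lambda>j. differential B (b j))"
  defines "dbJ \<equiv> (\<lambda>j. form_endo B (differential B (b j)))"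
  defines "gB' \<equiv> (\<lambda>\<omega> \<tau>. cometric B \<omega> \<tau> p)"
  assumes B: "almost_product_manifold B" "nondegenerate B"
    and F: "\<And>j. j \<in> {1..m} \<Longrightarrow> ap_semi_regular (F j)"
    and b: "\<And>j. j \<in> {1..m} \<Longrightarrow> b j \<in> C_inf B"
    and pq: "(p, q) \<in> points M"
  shows
    \<comment> \<open>(1)\<close>
    "(\<forall>X\<in>\<Gamma> B. \<forall>Y\<in>\<Gamma> B. \<forall>Z\<in>\<Gamma> B. \<forall>T\<in>\<Gamma> B.
        R (LB X) (LB Y) (LB Z) (LB T) (p, q) = ap_curvature B X Y Z T p)
   \<and> \<comment> \<open>(2)\<close>
     (\<forall>X\<in>\<Gamma> B. \<forall>Y\<in>\<Gamma> B. \<forall>Z\<in>\<Gamma> B. \<forall>j\<in>{1..m}. \<forall>W\<in>\<Gamma> (F j).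
        R (LB X) (LB Y) (LB Z) (LF j W) (p, q) = 0 \<and>
        R (LB Z) (LF j W) (LB X) (LB Y) (p, q) = 0)
   \<and> \<comment> \<open>(3)\<close>
     (\<forall>X\<in>\<Gamma> B. \<forall>Y\<in>\<Gamma> B. \<forall>i\<in>{1..m}. \<forall>j\<in>{1..m}. \<forall>V\<in>\<Gamma> (F i). \<forall>W\<in>\<Gamma> (F j).
        R (LB X) (LB Y) (LF i V) (LF j W) (p, q) = 0 \<and>
        R (LF i V) (LF j W) (LB X) (LB Y) (p, q) = 0)
   \<and> \<comment> \<open>(4)\<close>
     (\<forall>X\<in>\<Gamma> B. \<forall>Y\<in>\<Gamma> B. \<forall>j\<in>{1..m}. \<forall>V\<in>\<Gamma> (F j). \<forall>W\<in>\<Gamma> (F j).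
        R (LB X) (LF j V) (LB Y) (LF j W) (p, q) =
          1/2 * b j p * (X \<rhd> Y \<rhd> b j) p * g j V W
          - 1/2 * b j p * gB' (nabla_flat B X Y) (db j) * g j V W
          + 1/2 * b j p * (X \<rhd> JB Y \<rhd> b j) p * g j V (JF j W)
          - 1/2 * b j p * gB' (nabla_flat B X Y) (dbJ j) * g j V (JF j W))
   \<and> \<comment> \<open>(5)\<close>
     (\<forall>X\<in>\<Gamma> B. \<forall>Y\<in>\<Gamma> B. \<forall>i\<in>{1..m}. \<forall>j\<in>{1..m}. \<forall>V\<in>\<Gamma> (F i). \<forall>W\<in>\<Gamma> (F j).
        i \<noteq> j \<longrightarrow> R (LB X) (LF i V) (LB Y) (LF j W) (p, q) = 0)
   \<and> \<comment> \<open>(6)\<close>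
     (\<forall>X\<in>\<Gamma> B. \<forall>i\<in>{1..m}. \<forall>j\<in>{1..m}. \<forall>k\<in>{1..m}. \<forall>V\<in>\<Gamma> (F i). \<forall>W\<in>\<Gamma> (F j). \<forall>U\<in>\<Gamma> (F k).
        R (LB X) (LF i V) (LF j W) (LF k U) (p, q) = 0)
   \<and> \<comment> \<open>(7)\<close>
     (\<forall>X\<in>\<Gamma> B. \<forall>j\<in>{1..m}. \<forall>U\<in>\<Gamma> (F j). \<forall>V\<in>\<Gamma> (F j). \<forall>W\<in>\<Gamma> (F j).
        R (LF j U) (LF j V) (LB X) (LF j W) (p, q) =
          1/4 * b j p * (X \<rhd> b j) p *
            (- K j V W U + K j U W V + K j V (JF j W) (JF j U) - K j U (JF j W) (JF j V))
          - 1/4 * b j p * (JB X \<rhd> b j) p *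
            (- K j V W (JF j U) + K j U W (JF j V) + K j V (JF j W) U - K j U (JF j W) V))
   \<and> \<comment> \<open>(8)\<close>
     (\<forall>X\<in>\<Gamma> B. \<forall>i\<in>{1..m}. \<forall>j\<in>{1..m}. \<forall>k\<in>{1..m}. \<forall>U\<in>\<Gamma> (F k). \<forall>V\<in>\<Gamma> (F i). \<forall>W\<in>\<Gamma> (F j).
        \<not> (i = j \<and> j = k) \<longrightarrow> R (LF k U) (LF i V) (LB X) (LF j W) (p, q) = 0)
   \<and> \<comment> \<open>(9)\<close>
     (\<forall>j\<in>{1..m}. \<forall>U\<in>\<Gamma> (F j). \<forall>V\<in>\<Gamma> (F j). \<forall>W\<in>\<Gamma> (F j). \<forall>Q\<in>\<Gamma> (F j).
        R (LF j U) (LF j V) (LF j W) (LF j Q) (p, q) =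
          (b j p)\<^sup>2 * ap_curvature (F j) U V W Q (q j)
          + 1/4 * (b j p)\<^sup>2 *
            (gB' (db j) (db j) * (g j U W * g j V Q - g j V W * g j U Q)
             + gB' (dbJ j) (db j) *
               (g j U (JF j W) * g j V Q - g j V (JF j W) * g j U Q
                + g j U W * g j V (JF j Q) - g j V W * g j U (JF j Q))
             + gB' (dbJ j) (dbJ j) *
               (g j U (JF j W) * g j V (JF j Q) - g j V (JF j W) * g j U (JF j Q))))
   \<and> \<comment> \<open>(10)\<close>
     (\<forall>i\<in>{1..m}. \<forall>j\<in>{1..m}. \<forall>U\<in>\<Gamma> (F j). \<forall>V\<in>\<Gamma> (F i). \<forall>W\<in>\<Gamma> (F j). \<forall>Q\<in>\<Gamma> (F i).
        j \<noteq> i \<longrightarrow>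
        R (LF j U) (LF i V) (LF j W) (LF i Q) (p, q) =
          1/4 * b i p * b j p *
            (gB' (db i) (db j) * g i V Q * g j U W
             + gB' (dbJ i) (db j) * g i V (JF i Q) * g j U W
             + gB' (db i) (dbJ j) * g i V Q * g j U (JF j W)
             + gB' (dbJ i) (dbJ j) * g i V (JF i Q) * g j U (JF j W)))
   \<and> \<comment> \<open>(11)\<close>
     (\<forall>i\<in>{1..m}. \<forall>j\<in>{1..m}. \<forall>k\<in>{1..m}. \<forall>s\<in>{1..m}.
      \<forall>U\<in>\<Gamma> (F k). \<forall>V\<in>\<Gamma> (F i). \<forall>W\<in>\<Gamma> (F j). \<forall>Q\<in>\<Gamma> (F s).
        \<not> (i = j \<and> j = k \<and> k = s) \<and> \<not> (j = k \<and> k \<noteq> i \<and> i = s) \<and> \<not> (k = s \<and> s \<noteq> i \<and> i = j) \<longrightarrow>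
        R (LF k U) (LF i V) (LF j W) (LF s Q) (p, q) = 0)"
proof -
  have mfd: "ap_mfd (F j)" if "j \<in> {1..m}" for j
    by (rule almost_product_ap_mfd) (use F[OF that] in \<open>simp add: ap_semi_regular_def ap_radical_stationary_def\<close>)
  interpret W: warped_semi_regular m B b F
    by (rule warped_semi_regular.intro[OF warped.intro[OF almost_product_ap_mfd[OF B(1)] mfd b] warped_semi_regular_axioms.intro[OF B(2) F]]; assumption)
  note x = pq[unfolded M_def]
  \<comment> \<open>The component formulas speak of \<open>fst x\<close> and \<open>snd x\<close>;
    these are rewritten to the two parts of the given point.\<close>
  note pt = fst_conv snd_conv
  note B_curvature = W.curvature_BBBB[OF x, unfolded pt]
    and mixed_curvature = W.curvature_BBBF[OF x, unfolded pt] W.curvature_BBFF[OF x, unfolded pt] W.curvature_FFBB[OF x, unfolded pt]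
  show ?thesis
    unfolding R_def LB_def LF_def M_def JB_def JF_def g_def K_def db_def dbJ_def gB'_def vfield_app_def
    apply (intro conjI ballI impI)
    subgoal by (rule B_curvature)
    subgoal by (rule mixed_curvature)
    subgoal by (rule mixed_curvature)
    subgoal by (rule mixed_curvature)
    subgoal by (rule mixed_curvature)
    subgoal by (rule W.curvature_BFBF[OF x, unfolded pt])
    subgoal by (rule W.curvature_BFBF_ne[OF x])
    subgoal by (rule W.curvature_BFFF[OF x])
    subgoal by (rule W.curvature_FFBF[OF x, unfolded pt])
    subgoal by (rule W.curvature_FFBF_ne[OF x])
    subgoal by (rule W.curvature_FFFF[OF x, unfolded pt])
    subgoal by (rule W.curvature_FFFF_mixed[OF x, unfolded pt])
    subgoal by (elim conjE) (rule W.curvature_FFFF_zero[OF x])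
    done
qed

end
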